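(* Let $(W,\mathfrak h)$ be an irreducible complex reflection group with $\dim\mathfrak h>1$, let $c:\mathcal S\to\mathbb C$ be a conjugation-invariant function and let $\zeta\in\mathbb C$. Then the centre of $A_{0,c,\zeta}$ is isomorphic to $Z(H_{0,c})^{\mathrm T}/\langle\mathrm{eu}_c-\zeta\rangle$.
   Context: $\mathfrak h$ is a finite-dimensional complex vector space, $n=\dim\mathfrak h$. A complex reflection is a finite-order $s\in GL(\mathfrak h)$ with $\operatorname{rank}(s-1)=1$. A complex reflection group $(W,\mathfrak h)$ is a finite subgroup $W\subset GL(\mathfrak h)$ generated by complex reflections; it is irreducible if $\mathfrak h$ is an irreducible representation. $\mathcal S$ is the set of complex reflections in $W$. For $s\in\mathcal S$, $\alpha_s\in\mathfrak h^*$ is such that $\ker\alpha_s$ is the hyperplane fixed by $s$, $\lambda_s$ is defined by $s(\alpha_s)=\lambda_s\alpha_s$, and $\alpha_s^\vee\in\mathfrak h$ is an eigenvector of $s$ with eigenvalue $\ne1$. For $t\in\mathbb C$ and conjugation-invariant $c$, the rational Cherednik algebra $H_{t,c}$ is the quotient of $T(\mathfrak h\oplus\mathfrak h^* )\rtimes W$ by $[x,x']=0$, $[y,y']=0$, $[y,x]=t\,x(y)-\sum_{s\in\mathcal S}\frac{2c_s}{\alpha_s(\alpha_s^\vee)}x(\alpha_s^\vee)\alpha_s(y)\,s$ for $x,x'\in\mathfrak h^*$, $y,y'\in\mathfrak h$. Let $y_1,\dots,y_n$ be a basis of $\mathfrak h$ with dual basis $x_1,\dots,x_n$. $H_{t,c}^{\mathfrak{gl}(n)}$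 is the subalgebra of $H_{t,c}$ generated by all $x_iy_j$ and $W$; it equals the subalgebra $H_{t,c}^{\mathrm T}$ of invariants for the action of $\mathrm T=\mathbb C^\times$ by $\lambda\cdot x=\lambda x$, $\lambda\cdot y=\lambda^{-1}y$, $\lambda\cdot w=w$. The Euler element $\mathrm{eu}_c=\sum_ix_iy_i-\sum_{s\in\mathcal S}\frac{2c_s}{1-\lambda_s}s$ is $\mathrm T$-invariant, is central in $H_{t,c}^{\mathfrak{gl}(n)}$, and lies in $Z(H_{0,c})^{\mathrm T}$ when $t=0$. Let $\mathbf a=\frac1{|Z(W)|}\sum_{z\in Z(W)}z$. For $\zeta\in\mathbb C$, $A_{t,c,\zeta}=\mathbf aH_{t,c}^{\mathfrak{gl}(n)}\mathbf a/\langle\mathbf a\,\mathrm{eu}_c-\zeta\rangle$ (here $\zeta$ means $\zeta$ times the unit $\mathbf a$). $Z(-)$ denotes the centre. *)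

theory Defs
  imports
    "HOL-Analysis.Analysis"
    "HOL-Algebra.QuotRing"
    "HOL-Algebra.Module"
    "HOL-Algebra.Generated_Groups"
    "HOL-Algebra.Subrings"
    "HOL-Library.Poly_Mapping"
begin

text \<open>
  An associative unital algebra is a \<^typ>\<open>(complex, 'b) module\<close> record.  The locale of
  algebras in the library forces commutativity, so only the record type is used; ideals,
  generated ideals and quotients are the library's, and ideals are two-sided.
\<close>

text \<open>\<open>A Quot I\<close> forgets the scalar multiplication, which is put back here.\<close>

definition alg_quot :: "(complex, 'b) module \<Rightarrow> 'b set \<Rightarrow> (complex, 'b set) module" where
  "alg_quot A I = ring.extend (A Quot I)
     (module.fields (\<lambda>k X. \<Union>x\<in>X. I +>\<^bsub>A\<^esub> (k \<odot>\<^bsub>A\<^esub> x)))"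

definition alg_centre :: "(complex, 'b) module \<Rightarrow> 'b set" where
  "alg_centre A = {z \<in> carrier A. \<forall>x\<in>carrier A. z \<otimes>\<^bsub>A\<^esub> x = x \<otimes>\<^bsub>A\<^esub> z}"

definition gen_subalgebra :: "(complex, 'b) module \<Rightarrow> 'b set \<Rightarrow> 'b set" where
  "gen_subalgebra A S =
     \<Inter>{B. subring B A \<and> (\<forall>k. \<forall>b\<in>B. k \<odot>\<^bsub>A\<^esub> b \<in> B) \<and> S \<subseteq> B}"

text \<open>The corner algebra \<open>eAe\<close> of an idempotent \<open>e\<close>; its unit is \<open>e\<close>.\<close>

definition corner :: "(complex, 'b) module \<Rightarrow> 'b \<Rightarrow> (complex, 'b) module" where
  "corner A e = A\<lparr>carrier := {e \<otimes>\<^bsub>A\<^esub> x \<otimes>\<^bsub>A\<^esub> e | x. x \<in> carrier A}, one := e\<rparr>"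

definition alg_isomorphic :: "(complex, 'a) module \<Rightarrow> (complex, 'b) module \<Rightarrow> bool" where
  "alg_isomorphic A B \<longleftrightarrow>
     (\<exists>\<phi>\<in>ring_iso A B. \<forall>k. \<forall>x\<in>carrier A. \<phi> (k \<odot>\<^bsub>A\<^esub> x) = k \<odot>\<^bsub>B\<^esub> \<phi> x)"

text \<open>
  \<open>\<hh>\<close> is \<^typ>\<open>complex^'n\<close> with its standard basis \<open>y\<^sub>1, \<dots>, y\<^sub>n\<close>.  A vector of \<open>\<hh>\<^sup>*\<close> is
  given by its coordinates in the dual basis \<open>x\<^sub>1, \<dots>, x\<^sub>n\<close>, hence is again of type
  \<^typ>\<open>complex^'n\<close>.  The evaluation \<open>x(y)\<close> is \<open>pairing x y\<close>, which is bilinear, unlike the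
  library's inner product.
\<close>

type_synonym 'n cmat = "complex^'n^'n"

definition pairing :: "complex^'n \<Rightarrow> complex^'n \<Rightarrow> complex" where
  "pairing x y = (\<Sum>i\<in>UNIV. x $ i * y $ i)"

text \<open>The contragredient action \<open>w(x) = x \<circ> w\<^sup>-\<^sup>1\<close> on \<open>\<hh>\<^sup>*\<close>.\<close>

definition dual_act :: "'n::finite cmat \<Rightarrow> complex^'n \<Rightarrow> complex^'n" where
  "dual_act w x = x v* matrix_inv w"

definition GL :: "('n::finite cmat) monoid" where
  "GL = \<lparr>carrier = {A. invertible A}, mult = (**), one = mat 1\<rparr>"

definition complex_reflection :: "'n::finite cmat \<Rightarrow> bool" where
  "complex_reflection s \<longleftrightarrow>
     s \<in> carrier GL \<and> (\<exists>k::nat. k > 0 \<and> s [^]\<^bsub>GL\<^esub> k = \<one>\<^bsub>GL\<^esub>) \<and> rank (s - mat 1) = 1"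

definition reflections :: "'n::finite cmat set \<Rightarrow> 'n cmat set" where
  "reflections W = {s \<in> W. complex_reflection s}"

definition complex_reflection_group :: "'n::finite cmat set \<Rightarrow> bool" where
  "complex_reflection_group W \<longleftrightarrow>
     subgroup W GL \<and> finite W \<and> generate GL (reflections W) = W"

text \<open>The zero representation, which is not irreducible, cannot occur as index types are nonempty.\<close>

definition irreducible_rep :: "'n::finite cmat set \<Rightarrow> bool" where
  "irreducible_rep W \<longleftrightarrow>
     (\<forall>V. vec.subspace V \<and> (\<forall>w\<in>W. \<forall>v\<in>V. w *v v \<in> V) \<longrightarrow> V = {0} \<or> V = UNIV)"

definition group_centre :: "'n::finite cmat set \<Rightarrow> 'n cmat set" where
  "group_centre W = {z \<in> W. \<forall>w\<in>W. z ** w = w ** z}"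

text \<open>
  \<open>reflection_data W \<alpha> \<alpha>' \<lambda>\<close>: for every reflection \<open>s\<close> a choice of \<open>\<alpha>\<^sub>s \<in> \<hh>\<^sup>*\<close> and of the
  coroot \<open>\<alpha>'\<^sub>s \<in> \<hh>\<close>, and the scalar \<open>\<lambda>\<^sub>s\<close>, which is the eigenvalue of \<open>s\<close> on \<open>\<alpha>\<^sub>s\<close> in \<open>\<hh>\<^sup>*\<close>
  (so the eigenvalue on \<open>\<alpha>'\<^sub>s\<close> is its inverse).
\<close>

definition reflection_data ::
  "'n::finite cmat set \<Rightarrow> ('n cmat \<Rightarrow> complex^'n) \<Rightarrow> ('n cmat \<Rightarrow> complex^'n) \<Rightarrow>
   ('n cmat \<Rightarrow> complex) \<Rightarrow> bool" where
  "reflection_data W \<alpha> \<alpha>' lam \<longleftrightarrow> (\<forall>s\<in>reflections W.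
     {y. pairing (\<alpha> s) y = 0} = {y. s *v y = y} \<and>
     dual_act s (\<alpha> s) = lam s *s \<alpha> s \<and>
     \<alpha>' s \<noteq> 0 \<and> (\<exists>\<mu>. \<mu> \<noteq> 1 \<and> s *v \<alpha>' s = \<mu> *s \<alpha>' s))"

definition conj_invariant :: "'n::finite cmat set \<Rightarrow> ('n cmat \<Rightarrow> complex) \<Rightarrow> bool" where
  "conj_invariant W c \<longleftrightarrow>
     (\<forall>w\<in>W. \<forall>s\<in>reflections W. c (w ** s ** matrix_inv w) = c s)"

datatype 'a word = Word (letters: "'a list")

instantiation word :: (type) monoid_add
begin
definition zero_word :: "'a word" where "0 = Word []"
definition plus_word :: "'a word \<Rightarrow> 'a word \<Rightarrow> 'a word" where
  "u + v = Word (letters u @ letters v)"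
instance
  by standard (simp_all add: zero_word_def plus_word_def)
end

datatype 'n letter = X 'n | Y 'n

text \<open>
  \<open>T(\<hh> \<oplus> \<hh>\<^sup>*)\<close> is the free algebra on \<open>x\<^sub>1, \<dots>, x\<^sub>n, y\<^sub>1, \<dots>, y\<^sub>n\<close>, that is, the monoid algebra
  of the free monoid of words; the product is the convolution product of
  \<^theory>\<open>HOL-Library.Poly_Mapping\<close>.
\<close>

type_synonym 'n tensor = "'n letter word \<Rightarrow>\<^sub>0 complex"

definition const :: "complex \<Rightarrow> 'n tensor" where
  "const k = Poly_Mapping.single 0 k"

definition gen :: "'n letter \<Rightarrow> 'n tensor" where
  "gen l = Poly_Mapping.single (Word [l]) 1"

definition of_h :: "complex^'n \<Rightarrow> 'n::finite tensor" where
  "of_h y = (\<Sum>i\<in>UNIV. const (y $ i) * gen (Y i))"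

definition of_h_dual :: "complex^'n \<Rightarrow> 'n::finite tensor" where
  "of_h_dual x = (\<Sum>i\<in>UNIV. const (x $ i) * gen (X i))"

text \<open>The algebra endomorphism of the tensor algebra with prescribed values on letters.\<close>

definition tensor_lift :: "('n letter \<Rightarrow> 'n tensor) \<Rightarrow> 'n tensor \<Rightarrow> 'n tensor" where
  "tensor_lift \<phi> a = (\<Sum>u\<in>Poly_Mapping.keys a.
     const (Poly_Mapping.lookup a u) * prod_list (map \<phi> (letters u)))"

definition group_act :: "'n::finite cmat \<Rightarrow> 'n tensor \<Rightarrow> 'n tensor" where
  "group_act w = tensor_lift (\<lambda>l. case l of
       X i \<Rightarrow> of_h_dual (dual_act w (axis i 1))
     | Y i \<Rightarrow> of_h (w *v axis i 1))"

definition torus_act :: "complex \<Rightarrow> 'n tensor \<Rightarrow> 'n tensor" where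
  "torus_act k = tensor_lift (\<lambda>l. case l of
       X i \<Rightarrow> const k * gen (X i)
     | Y i \<Rightarrow> const (inverse k) * gen (Y i))"

text \<open>
  An element \<open>\<Sum>\<^sub>w a\<^sub>w w\<close> of the smash product, with coefficients \<open>a\<^sub>w\<close> in the tensor algebra
  written on the left, is the function \<open>w \<mapsto> a\<^sub>w\<close> (zero outside the finite group \<open>W\<close>).
  The product is determined by \<open>(a u) (b v) = a u(b) uv\<close>.
\<close>

type_synonym 'n smash_elt = "'n cmat \<Rightarrow> 'n tensor"

definition smash :: "'n::finite cmat set \<Rightarrow> (complex, 'n smash_elt) module" where
  "smash W =
    \<lparr>carrier = {f. \<forall>w. w \<notin> W \<longrightarrow> f w = 0},
     mult = (\<lambda>f g w. \<Sum>(u, v)\<in>{(u, v). u \<in> W \<and> v \<in> W \<and> u ** v = w}.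
               f u * group_act u (g v)),
     one = (\<lambda>w. if w = mat 1 then 1 else 0),
     zero = (\<lambda>w. 0),
     add = (\<lambda>f g w. f w + g w),
     smult = (\<lambda>k f w. const k * f w)\<rparr>"

definition of_tensor :: "'n::finite tensor \<Rightarrow> 'n smash_elt" where
  "of_tensor a = (\<lambda>w. if w = mat 1 then a else 0)"

text \<open>\<open>group_sum S a\<close> is the element \<open>\<Sum>\<^sub>s\<^sub>\<in>\<^sub>S a\<^sub>s s\<close> of the group algebra.\<close>

definition group_sum :: "'n::finite cmat set \<Rightarrow> ('n cmat \<Rightarrow> complex) \<Rightarrow> 'n smash_elt" where
  "group_sum S a = (\<lambda>w. if w \<in> S then const (a w) else 0)"

definition cherednik_relations ::
  "'n::finite cmat set \<Rightarrow> ('n cmat \<Rightarrow> complex^'n) \<Rightarrow> ('n cmat \<Rightarrow> complex^'n) \<Rightarrow>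
   complex \<Rightarrow> ('n cmat \<Rightarrow> complex) \<Rightarrow> 'n smash_elt set" where
  "cherednik_relations W \<alpha> \<alpha>' t c =
     {of_tensor (of_h_dual x * of_h_dual x' - of_h_dual x' * of_h_dual x) | x x'. True} \<union>
     {of_tensor (of_h y * of_h y' - of_h y' * of_h y) | y y'. True} \<union>
     {of_tensor (of_h y * of_h_dual x - of_h_dual x * of_h y) \<ominus>\<^bsub>smash W\<^esub>
        (of_tensor (const (t * pairing x y)) \<ominus>\<^bsub>smash W\<^esub>
         group_sum (reflections W)
           (\<lambda>s. 2 * c s / pairing (\<alpha> s) (\<alpha>' s) * pairing x (\<alpha>' s) * pairing (\<alpha> s) y))
      | x y. True}"

definition cherednik_ideal ::
  "'n::finite cmat set \<Rightarrow> ('n cmat \<Rightarrow> complex^'n) \<Rightarrow> ('n cmat \<Rightarrow> complex^'n) \<Rightarrow>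
   complex \<Rightarrow> ('n cmat \<Rightarrow> complex) \<Rightarrow> 'n smash_elt set" where
  "cherednik_ideal W \<alpha> \<alpha>' t c = Idl\<^bsub>smash W\<^esub> (cherednik_relations W \<alpha> \<alpha>' t c)"

definition cherednik ::
  "'n::finite cmat set \<Rightarrow> ('n cmat \<Rightarrow> complex^'n) \<Rightarrow> ('n cmat \<Rightarrow> complex^'n) \<Rightarrow>
   complex \<Rightarrow> ('n cmat \<Rightarrow> complex) \<Rightarrow> (complex, 'n smash_elt set) module" where
  "cherednik W \<alpha> \<alpha>' t c = alg_quot (smash W) (cherednik_ideal W \<alpha> \<alpha>' t c)"

definition cherednik_class ::
  "'n::finite cmat set \<Rightarrow> ('n cmat \<Rightarrow> complex^'n) \<Rightarrow> ('n cmat \<Rightarrow> complex^'n) \<Rightarrow>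
   complex \<Rightarrow> ('n cmat \<Rightarrow> complex) \<Rightarrow> 'n smash_elt \<Rightarrow> 'n smash_elt set" where
  "cherednik_class W \<alpha> \<alpha>' t c f = cherednik_ideal W \<alpha> \<alpha>' t c +>\<^bsub>smash W\<^esub> f"

text \<open>
  The torus acts coefficientwise on the smash product; the defining relations are homogeneous,
  so the ideal is stable and the induced action on cosets is the image of sets.
\<close>

definition torus_invariants ::
  "'n::finite cmat set \<Rightarrow> ('n cmat \<Rightarrow> complex^'n) \<Rightarrow> ('n cmat \<Rightarrow> complex^'n) \<Rightarrow>
   complex \<Rightarrow> ('n cmat \<Rightarrow> complex) \<Rightarrow> 'n smash_elt set set" where
  "torus_invariants W \<alpha> \<alpha>' t c =
     {h \<in> carrier (cherednik W \<alpha> \<alpha>' t c).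
        \<forall>k. k \<noteq> 0 \<longrightarrow> (\<lambda>f w. torus_act k (f w)) ` h = h}"

definition cherednik_gl ::
  "'n::finite cmat set \<Rightarrow> ('n cmat \<Rightarrow> complex^'n) \<Rightarrow> ('n cmat \<Rightarrow> complex^'n) \<Rightarrow>
   complex \<Rightarrow> ('n cmat \<Rightarrow> complex) \<Rightarrow> (complex, 'n smash_elt set) module" where
  "cherednik_gl W \<alpha> \<alpha>' t c = (cherednik W \<alpha> \<alpha>' t c)
     \<lparr>carrier := gen_subalgebra (cherednik W \<alpha> \<alpha>' t c)
        (cherednik_class W \<alpha> \<alpha>' t c `
           ({of_tensor (gen (X i) * gen (Y j)) | i j. True} \<union>
            {group_sum {w} (\<lambda>_. 1) | w. w \<in> W}))\<rparr>"

definition euler ::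
  "'n::finite cmat set \<Rightarrow> ('n cmat \<Rightarrow> complex^'n) \<Rightarrow> ('n cmat \<Rightarrow> complex^'n) \<Rightarrow>
   ('n cmat \<Rightarrow> complex) \<Rightarrow> complex \<Rightarrow> ('n cmat \<Rightarrow> complex) \<Rightarrow> 'n smash_elt set" where
  "euler W \<alpha> \<alpha>' lam t c = cherednik_class W \<alpha> \<alpha>' t c
     (of_tensor (\<Sum>i\<in>UNIV. gen (X i) * gen (Y i)) \<ominus>\<^bsub>smash W\<^esub>
      group_sum (reflections W) (\<lambda>s. 2 * c s / (1 - lam s)))"

definition centre_idempotent ::
  "'n::finite cmat set \<Rightarrow> ('n cmat \<Rightarrow> complex^'n) \<Rightarrow> ('n cmat \<Rightarrow> complex^'n) \<Rightarrow>
   complex \<Rightarrow> ('n cmat \<Rightarrow> complex) \<Rightarrow> 'n smash_elt set" where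
  "centre_idempotent W \<alpha> \<alpha>' t c = cherednik_class W \<alpha> \<alpha>' t c
     (group_sum (group_centre W) (\<lambda>_. 1 / of_nat (card (group_centre W))))"

text \<open>
  The algebra \<open>A\<close> with parameters \<open>t, c, \<zeta>\<close>.  The unit of \<open>C\<close> is \<open>a\<close>, so the scalar \<open>\<zeta>\<close> is \<open>\<zeta> a\<close>.
\<close>

definition quot_alg ::
  "'n::finite cmat set \<Rightarrow> ('n cmat \<Rightarrow> complex^'n) \<Rightarrow> ('n cmat \<Rightarrow> complex^'n) \<Rightarrow>
   ('n cmat \<Rightarrow> complex) \<Rightarrow> complex \<Rightarrow> ('n cmat \<Rightarrow> complex) \<Rightarrow> complex \<Rightarrow>
   (complex, 'n smash_elt set set) module" where
  "quot_alg W \<alpha> \<alpha>' lam t c \<zeta> =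
     (let a = centre_idempotent W \<alpha> \<alpha>' t c;
          C = corner (cherednik_gl W \<alpha> \<alpha>' t c) a
      in alg_quot C (Idl\<^bsub>C\<^esub> {(a \<otimes>\<^bsub>C\<^esub> euler W \<alpha> \<alpha>' lam t c) \<ominus>\<^bsub>C\<^esub> (\<zeta> \<odot>\<^bsub>C\<^esub> a)}))"

text \<open>The torus invariants in the centre of \<open>H\<close>, not the centre of the invariants.\<close>

definition centre_invariants ::
  "'n::finite cmat set \<Rightarrow> ('n cmat \<Rightarrow> complex^'n) \<Rightarrow> ('n cmat \<Rightarrow> complex^'n) \<Rightarrow>
   complex \<Rightarrow> ('n cmat \<Rightarrow> complex) \<Rightarrow> (complex, 'n smash_elt set) module" where
  "centre_invariants W \<alpha> \<alpha>' t c = (cherednik W \<alpha> \<alpha>' t c)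
     \<lparr>carrier := alg_centre (cherednik W \<alpha> \<alpha>' t c) \<inter> torus_invariants W \<alpha> \<alpha>' t c\<rparr>"

end

theory Submission
  imports Defs
begin

text \<open>
  At \<open>t = 0\<close> the algebra acts faithfully by Dunkl operators on functions of \<open>(v, p) \<in> \<hh> \<oplus> \<hh>\<^sup>*\<close> with
  \<open>v\<close> regular: \<open>x\<close> acts as multiplication by \<open>x(v)\<close>, and \<open>y\<close> as \<open>p(y) + \<Sum>\<^sub>s k\<^sub>s \<alpha>\<^sub>s(y) / \<alpha>\<^sub>s(v) s\<close> with
  \<open>k\<^sub>s = 2 c\<^sub>s / (1 - \<lambda>\<^sub>s)\<close>.  With this normalisation the Euler element acts exactly as multiplication by
  \<open>q = p(v)\<close>.  Symbols with respect to the degree in \<open>p\<close> give the normal form of the elements and the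
  faithfulness, and they show that \<open>\<Phi> = e h 1\<close>, for \<open>e\<close> the symmetrising idempotent of \<open>W\<close>, acts as a
  central element of the algebra for every element \<open>h\<close>.

  The map \<open>z \<mapsto> a z\<close> from \<open>Z(H)\<^sup>T\<close> to the corner algebra induces the isomorphism.  Let \<open>h\<close> commute with
  the corner modulo \<open>q - \<zeta>\<close>, and put \<open>h\<^sub>0 = h - a \<Phi>\<close> with \<open>\<Phi> = e h 1\<close>.  Then \<open>h\<^sub>0\<close> maps the invariants of
  the polynomial module into their multiples by \<open>q - \<zeta>\<close>.  Since invariant polynomials separate the points
  of a generic orbit modulo \<open>Z(W)\<close>, which by irreducibility consists of scalars, the symbol of \<open>h\<^sub>0\<close> vanishes
  on the quadric \<open>q = 0\<close>.  As \<open>dim \<hh> > 1\<close>, it is then divisible by \<open>q\<close>, and induction on the degree shows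
  that \<open>h\<^sub>0\<close> is divisible by \<open>q - \<zeta>\<close>, so that \<open>h\<close> is congruent to the image of the central element \<open>\<Phi>\<close>.
  Injectivity follows by applying \<open>h \<mapsto> e h 1\<close> to \<open>a z = (q - \<zeta>) d\<close>.
\<close>

section \<open>Associative algebras as records\<close>

text \<open>The operators act on all functions, so an element is known through one coefficient
  function per group element, recovered by testing on indicator functions of points with free orbit.
  Polynomiality is thereby lost and has to be regained; this is the task of the symbols. The
  function \<Phi> = e h 1 is invariant, so multiplication by it commutes with the whole algebra. It
  belongs to the algebra because it preserves the polynomial module: \<Phi> h' 1 = h' \<Phi> = h' e
  h 1. Let h0 be the difference of the overview. The choice of \<Phi> gives e h0 e = 0, hence h0 e =
  (h0 e - e h0) e is a multiple of q - \<zeta>. For b in the corner, h0 b 1 = b h0 1 = b h0 e 1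
  modulo q - \<zeta>, because e 1 = 1. This is why h0 sends invariants to multiples. Scalars in W
  act on v and p by inverse factors, so balanced polynomials cannot see them; the corner at a
  removes exactly this ambiguity. In dimension one the quadric has no point with v and p both
  nonzero, so vanishing on it carries no information.\<close>

locale calg = ring R for R :: "(complex, 'b) module" (structure) +
  assumes smult_closed [simp, intro]: "x \<in> carrier R \<Longrightarrow> k \<odot> x \<in> carrier R"
    and smult_add: "\<lbrakk>x \<in> carrier R; y \<in> carrier R\<rbrakk> \<Longrightarrow> k \<odot> (x \<oplus> y) = k \<odot> x \<oplus> k \<odot> y"
    and smult_left: "\<lbrakk>x \<in> carrier R; y \<in> carrier R\<rbrakk> \<Longrightarrow> (k \<odot> x) \<otimes> y = k \<odot> (x \<otimes> y)"
    and smult_right: "\<lbrakk>x \<in> carrier R; y \<in> carrier R\<rbrakk> \<Longrightarrow> x \<otimes> (k \<odot> y) = k \<odot> (x \<otimes> y)"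
begin

text \<open>Scaling is multiplication by an element of the algebra, so every ideal is stable under
  scalars and its quotient inherits the scalar multiplication.\<close>

lemma smult_eq_mult: "x \<in> carrier R \<Longrightarrow> k \<odot> x = (k \<odot> \<one>) \<otimes> x"
  by (simp add: smult_left)

lemma smult_minus:
  assumes "x \<in> carrier R" "y \<in> carrier R"
  shows "k \<odot> (x \<ominus> y) = k \<odot> x \<ominus> k \<odot> y"
proof -
  have "k \<odot> (x \<ominus> y) = (k \<odot> \<one>) \<otimes> x \<ominus> (k \<odot> \<one>) \<otimes> y"
    using assms by (subst smult_eq_mult) (simp_all add: r_distr a_minus_def r_minus del: smult_left)
  with assms show ?thesis by (simp add: smult_left)
qed

lemma minus_in_ideal_iff_coset:
  assumes "ideal I R" "x \<in> carrier R" "y \<in> carrier R"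
  shows "I +> x = I +> y \<longleftrightarrow> x \<ominus> y \<in> I"
  by (metis assms quotient_eq_iff_same_a_r_cos)

lemma coset_mem:
  assumes I: "ideal I R" and x: "x \<in> carrier R"
  shows "y \<in> I +> x \<longleftrightarrow> y \<in> carrier R \<and> y \<ominus> x \<in> I"
proof -
  interpret I: ideal I R by (rule I)
  have "y \<in> carrier R \<and> I +> y = I +> x" if "y \<in> I +> x"
    using that x a_r_coset_subset_G[OF I.a_subset x] a_repr_independence[OF that x I.a_subgroup] by auto
  moreover have "y \<in> I +> x" if "y \<in> carrier R" "I +> y = I +> x"
    using that I.a_rcos_self[of y] by simp
  ultimately have "y \<in> I +> x \<longleftrightarrow> y \<in> carrier R \<and> I +> y = I +> x" by blast
  thus ?thesis using minus_in_ideal_iff_coset[OF I _ x] by blast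
qed

context
  fixes I assumes I: "ideal I R"
begin

interpretation I: ideal I R by (rule I)

lemma ideal_smult: "x \<in> I \<Longrightarrow> k \<odot> x \<in> I"
  using I.I_l_closed[of x "k \<odot> \<one>"] I.Icarr[of x] by (simp add: smult_left)

lemma quot_carrier: "carrier (alg_quot R I) = {I +> x | x. x \<in> carrier R}"
  by (auto simp: alg_quot_def ring.defs module.defs FactRing_def A_RCOSETS_def RCOSETS_def a_r_coset_def)

lemma quot_class: "x \<in> carrier R \<Longrightarrow> I +> x \<in> carrier (alg_quot R I)"
  by (auto simp: quot_carrier)

lemma quot_mult: "\<lbrakk>x \<in> carrier R; y \<in> carrier R\<rbrakk> \<Longrightarrow>
    (I +> x) \<otimes>\<^bsub>alg_quot R I\<^esub> (I +> y) = I +> (x \<otimes> y)"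
  by (simp add: alg_quot_def ring.defs module.defs FactRing_def I.rcoset_mult_add)

lemma quot_add: "\<lbrakk>x \<in> carrier R; y \<in> carrier R\<rbrakk> \<Longrightarrow>
    (I +> x) \<oplus>\<^bsub>alg_quot R I\<^esub> (I +> y) = I +> (x \<oplus> y)"
  by (simp add: alg_quot_def ring.defs module.defs FactRing_def I.a_rcos_sum)

lemma quot_one: "\<one>\<^bsub>alg_quot R I\<^esub> = I +> \<one>"
  by (simp add: alg_quot_def ring.defs module.defs FactRing_def)

lemma quot_zero: "\<zero>\<^bsub>alg_quot R I\<^esub> = I"
  by (simp add: alg_quot_def ring.defs module.defs FactRing_def)

text \<open>The union in \<open>alg_quot\<close> runs over all representatives. Stability of the
  ideal under scalars makes them contribute the same coset, and the coset is nonempty.\<close>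

lemma quot_smult:
  assumes x: "x \<in> carrier R"
  shows "k \<odot>\<^bsub>alg_quot R I\<^esub> (I +> x) = I +> (k \<odot> x)"
proof -
  have *: "I +> (k \<odot> y) = I +> (k \<odot> x)" if "y \<in> I +> x" for y
  proof -
    have y: "y \<in> carrier R" "y \<ominus> x \<in> I" using that x coset_mem[OF I] by auto
    have "k \<odot> (y \<ominus> x) \<in> I" by (rule ideal_smult[OF y(2)])
    thus ?thesis using x y minus_in_ideal_iff_coset[OF I, of "k \<odot> y" "k \<odot> x"] by (simp add: smult_minus)
  qed
  have "I +> x \<noteq> {}" using I.a_rcos_self[OF x] by blast
  hence "(\<Union>y\<in>I +> x. I +> (k \<odot> y)) = I +> (k \<odot> x)" using * by (intro SUP_eq_const)
  thus ?thesis by (simp add: alg_quot_def ring.defs module.defs)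
qed

lemma quot_ring: "ring (alg_quot R I)"
proof -
  interpret F: ring "R Quot I" by (rule I.quotient_is_ring)
  have eq: "carrier (alg_quot R I) = carrier (R Quot I)" "mult (alg_quot R I) = mult (R Quot I)"
    "add (alg_quot R I) = add (R Quot I)" "one (alg_quot R I) = one (R Quot I)"
    "zero (alg_quot R I) = zero (R Quot I)"
    by (simp_all add: alg_quot_def ring.defs module.defs)
  have "abelian_group (alg_quot R I)"
    by (rule abelian_groupI) (auto simp: eq F.a_ac intro: F.l_neg F.a_inv_closed)
  moreover have "Group.monoid (alg_quot R I)"
    by (rule monoidI) (auto simp: eq F.m_assoc)
  ultimately show ?thesis
    by (intro ringI) (auto simp: eq F.l_distr F.r_distr)
qed

lemma quot_calg: "calg (alg_quot R I)"
proof -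
  interpret Q: ring "alg_quot R I" by (rule quot_ring)
  show ?thesis
    by unfold_locales
      (auto simp: quot_carrier quot_smult quot_add quot_mult smult_add smult_left smult_right)
qed

lemma quot_inv:
  assumes "x \<in> carrier R" shows "\<ominus>\<^bsub>alg_quot R I\<^esub> (I +> x) = I +> (\<ominus> x)"
proof -
  interpret Q: ring "alg_quot R I" by (rule quot_ring)
  have "(I +> x) \<oplus>\<^bsub>alg_quot R I\<^esub> (I +> (\<ominus> x)) = \<zero>\<^bsub>alg_quot R I\<^esub>"
    using assms by (simp add: quot_add r_neg quot_zero I.a_subset)
  hence "(I +> (\<ominus> x)) \<oplus>\<^bsub>alg_quot R I\<^esub> (I +> x) = \<zero>\<^bsub>alg_quot R I\<^esub>"
    using assms by (simp add: quot_class Q.a_comm)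
  thus ?thesis using assms by (intro Q.minus_equality) (auto simp: quot_class)
qed

lemma quot_minus:
  assumes "x \<in> carrier R" "y \<in> carrier R"
  shows "(I +> x) \<ominus>\<^bsub>alg_quot R I\<^esub> (I +> y) = I +> (x \<ominus> y)"
  using assms by (simp add: a_minus_def quot_inv quot_add)

end

text \<open>The unit \<open>e\<close> may differ from that of the ambient algebra, which covers both
  the corner and the torus-invariant centre. Negatives are compared explicitly because in the
  restricted record they are described over the smaller carrier.\<close>

lemma restrict_calg:
  assumes S: "S \<subseteq> carrier R" "\<zero> \<in> S" "e \<in> S"
    and add: "\<And>x y. \<lbrakk>x \<in> S; y \<in> S\<rbrakk> \<Longrightarrow> x \<oplus> y \<in> S"
    and mult: "\<And>x y. \<lbrakk>x \<in> S; y \<in> S\<rbrakk> \<Longrightarrow> x \<otimes> y \<in> S"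
    and smult: "\<And>k x. x \<in> S \<Longrightarrow> k \<odot> x \<in> S"
    and e: "\<And>x. x \<in> S \<Longrightarrow> e \<otimes> x = x" "\<And>x. x \<in> S \<Longrightarrow> x \<otimes> e = x"
    and inv: "\<And>x. x \<in> S \<Longrightarrow> \<ominus> x \<in> S"
  shows "calg (R\<lparr>carrier := S, one := e\<rparr>)"
    and "x \<in> S \<Longrightarrow> \<ominus>\<^bsub>R\<lparr>carrier := S, one := e\<rparr>\<^esub> x = \<ominus> x"
    and "\<lbrakk>x \<in> S; y \<in> S\<rbrakk> \<Longrightarrow> x \<ominus>\<^bsub>R\<lparr>carrier := S, one := e\<rparr>\<^esub> y = x \<ominus> y"
proof -
  let ?R = "R\<lparr>carrier := S, one := e\<rparr>"
  have c: "x \<in> S \<Longrightarrow> x \<in> carrier R" for x using S by auto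
  have "abelian_group ?R"
    by (rule abelian_groupI)
      (auto simp: S add c a_assoc intro: a_comm intro!: bexI[OF _ inv] simp: l_neg)
  moreover have "Group.monoid ?R"
    by (rule monoidI) (auto simp: S mult e c m_assoc)
  ultimately have "ring ?R"
    by (intro ringI) (auto simp: c l_distr r_distr abelian_group.axioms)
  then interpret Q: ring ?R .
  show "calg ?R"
    by unfold_locales (auto simp: smult c smult_add smult_left smult_right)
  show m: "\<ominus>\<^bsub>?R\<^esub> x = \<ominus> x" if "x \<in> S" for x
    using that Q.minus_equality[of "\<ominus> x" x] by (auto simp: inv c l_neg)
  show "x \<ominus>\<^bsub>?R\<^esub> y = x \<ominus> y" if "x \<in> S" "y \<in> S"
    using that by (simp add: a_minus_def m)
qed

text \<open>Membership in the ideals of the theorem becomes divisibility by a central generator, the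
  form in which it is handled from here on.\<close>

lemma Idl_central:
  assumes u: "u \<in> carrier R" and c: "\<And>x. x \<in> carrier R \<Longrightarrow> x \<otimes> u = u \<otimes> x"
  shows "Idl {u} = {u \<otimes> x | x. x \<in> carrier R}"
proof
  have "ideal {u \<otimes> x | x. x \<in> carrier R} R"
  proof (rule idealI)
    show "subgroup {u \<otimes> x |x. x \<in> carrier R} (add_monoid R)"
    proof
      show "{u \<otimes> x |x. x \<in> carrier R} \<subseteq> carrier (add_monoid R)" using u by auto
      show "\<one>\<^bsub>add_monoid R\<^esub> \<in> {u \<otimes> x |x. x \<in> carrier R}" using u by (auto intro: exI[of _ \<zero>])
      fix y z assume "y \<in> {u \<otimes> x |x. x \<in> carrier R}" "z \<in> {u \<otimes> x |x. x \<in> carrier R}"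
      then obtain y' z' where "y = u \<otimes> y'" "z = u \<otimes> z'" "y' \<in> carrier R" "z' \<in> carrier R" by auto
      thus "y \<otimes>\<^bsub>add_monoid R\<^esub> z \<in> {u \<otimes> x |x. x \<in> carrier R}" using u
        by (auto intro!: exI[of _ "y' \<oplus> z'"] simp: r_distr)
    next
      fix y assume "y \<in> {u \<otimes> x |x. x \<in> carrier R}"
      then obtain y' where "y = u \<otimes> y'" "y' \<in> carrier R" by auto
      thus "inv\<^bsub>add_monoid R\<^esub> y \<in> {u \<otimes> x |x. x \<in> carrier R}" using u
        by (auto intro!: exI[of _ "\<ominus> y'"] simp: r_minus a_inv_def[symmetric])
    qed
  next
    fix y z assume "y \<in> {u \<otimes> x |x. x \<in> carrier R}" and z: "z \<in> carrier R"
    then obtain y' where y': "y = u \<otimes> y'" "y' \<in> carrier R" by auto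
    have "z \<otimes> y = u \<otimes> (z \<otimes> y')" using y' z u c[of z] by (simp add: m_assoc[symmetric])
    thus "z \<otimes> y \<in> {u \<otimes> x |x. x \<in> carrier R}" using y' z by auto
    have "y \<otimes> z = u \<otimes> (y' \<otimes> z)" using y' z u by (simp add: m_assoc)
    thus "y \<otimes> z \<in> {u \<otimes> x |x. x \<in> carrier R}" using y' z by auto
  qed (rule ring_axioms)
  thus "Idl {u} \<subseteq> {u \<otimes> x | x. x \<in> carrier R}"
    by (rule genideal_minimal) (use u in \<open>auto intro!: exI[of _ \<one>]\<close>)
  interpret J: ideal "Idl {u}" R by (rule genideal_ideal) (use u in auto)
  show "{u \<otimes> x | x. x \<in> carrier R} \<subseteq> Idl {u}"
    using genideal_self'[OF u] J.I_r_closed by auto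
qed

end

text \<open>
  Elements of the centre of \<open>B/(j u)\<close> are classes of \<open>j z\<close>, and the isomorphism takes a class to
  its preimage under \<open>j\<close>.
\<close>

lemma centre_quotient_iso:
  fixes B :: "(complex, 'a) module" and Z :: "(complex, 'c) module"
  assumes B: "calg B" and Z: "calg Z" and j: "j \<in> ring_hom Z B"
    and js: "\<And>k z. z \<in> carrier Z \<Longrightarrow> j (k \<odot>\<^bsub>Z\<^esub> z) = k \<odot>\<^bsub>B\<^esub> j z"
    and jc: "\<And>z b. \<lbrakk>z \<in> carrier Z; b \<in> carrier B\<rbrakk> \<Longrightarrow> b \<otimes>\<^bsub>B\<^esub> j z = j z \<otimes>\<^bsub>B\<^esub> b"
    and u: "u \<in> carrier Z" and uc: "\<And>z. z \<in> carrier Z \<Longrightarrow> z \<otimes>\<^bsub>Z\<^esub> u = u \<otimes>\<^bsub>Z\<^esub> z"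
    and surj: "\<And>b. \<lbrakk>b \<in> carrier B; \<And>b'. b' \<in> carrier B \<Longrightarrow>
        \<exists>d\<in>carrier B. b \<otimes>\<^bsub>B\<^esub> b' \<ominus>\<^bsub>B\<^esub> b' \<otimes>\<^bsub>B\<^esub> b = j u \<otimes>\<^bsub>B\<^esub> d\<rbrakk> \<Longrightarrow>
        \<exists>z\<in>carrier Z. \<exists>d\<in>carrier B. b \<ominus>\<^bsub>B\<^esub> j z = j u \<otimes>\<^bsub>B\<^esub> d"
    and inj: "\<And>z d. \<lbrakk>z \<in> carrier Z; d \<in> carrier B; j z = j u \<otimes>\<^bsub>B\<^esub> d\<rbrakk> \<Longrightarrow>
        \<exists>z'\<in>carrier Z. z = u \<otimes>\<^bsub>Z\<^esub> z'"
  defines "A \<equiv> alg_quot B (Idl\<^bsub>B\<^esub> {j u})"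
  shows "alg_isomorphic (A\<lparr>carrier := alg_centre A\<rparr>) (alg_quot Z (Idl\<^bsub>Z\<^esub> {u}))"
proof -
  interpret B: calg B by (rule B)
  interpret Z: calg Z by (rule Z)
  interpret j: ring_hom_ring Z B j
    by (rule ring_hom_ringI2) (auto simp: j Z.ring_axioms B.ring_axioms)
  define I where "I = Idl\<^bsub>B\<^esub> {j u}"
  define J where "J = Idl\<^bsub>Z\<^esub> {u}"
  let ?Q = "alg_quot Z J"
  have I: "ideal I B" unfolding I_def by (rule B.genideal_ideal) (use u in auto)
  have J: "ideal J Z" unfolding J_def by (rule Z.genideal_ideal) (use u in auto)
  have Ieq: "I = {j u \<otimes>\<^bsub>B\<^esub> b | b. b \<in> carrier B}" unfolding I_def by (rule B.Idl_central) (use u jc in auto)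
  have Jeq: "J = {u \<otimes>\<^bsub>Z\<^esub> b | b. b \<in> carrier Z}" unfolding J_def by (rule Z.Idl_central) (use u uc in auto)
  have A: "A = alg_quot B I" by (simp add: A_def I_def)
  note qI = B.quot_carrier[OF I] B.quot_mult[OF I] B.quot_add[OF I] B.quot_one[OF I] B.quot_smult[OF I]
  note qJ = Z.quot_carrier[OF J] Z.quot_mult[OF J] Z.quot_add[OF J] Z.quot_one[OF J] Z.quot_smult[OF J]
  note eqI = B.minus_in_ideal_iff_coset[OF I]
  note eqJ = Z.minus_in_ideal_iff_coset[OF J]
  \<comment> \<open>Taking the preimage of a whole coset avoids any choice of
    representatives.\<close>
  define \<psi> where "\<psi> = (\<lambda>C. {z \<in> carrier Z. j z \<in> C})"
  \<comment> \<open>By \<open>inj\<close> the preimage of \<open>I\<close> is no larger than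
    \<open>J\<close>, so distinct classes modulo \<open>J\<close> stay distinct modulo
    \<open>I\<close>.\<close>
  have jI: "j z \<in> I \<longleftrightarrow> z \<in> J" if "z \<in> carrier Z" for z
  proof
    assume "j z \<in> I" thus "z \<in> J" using inj[OF that] by (auto simp: Ieq Jeq)
  next
    assume "z \<in> J" thus "j z \<in> I" using u by (auto simp: Ieq Jeq)
  qed
  have mem: "y \<in> I +>\<^bsub>B\<^esub> x \<longleftrightarrow> I +>\<^bsub>B\<^esub> y = I +>\<^bsub>B\<^esub> x" if "x \<in> carrier B" "y \<in> carrier B" for x y
    using that B.coset_mem[OF I] eqI by simp
  have memJ: "y \<in> J +>\<^bsub>Z\<^esub> x \<longleftrightarrow> J +>\<^bsub>Z\<^esub> y = J +>\<^bsub>Z\<^esub> x" if "x \<in> carrier Z" "y \<in> carrier Z" for x y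
    using that Z.coset_mem[OF J] eqJ by simp
  have Jsub: "J +>\<^bsub>Z\<^esub> x \<subseteq> carrier Z" if "x \<in> carrier Z" for x
    using that Z.coset_mem[OF J] by auto
  have psi: "\<psi> (I +>\<^bsub>B\<^esub> j z) = J +>\<^bsub>Z\<^esub> z" if z: "z \<in> carrier Z" for z
  proof -
    have "j y \<in> I +>\<^bsub>B\<^esub> j z \<longleftrightarrow> y \<in> J +>\<^bsub>Z\<^esub> z" if y: "y \<in> carrier Z" for y
    proof -
      have "j y \<ominus>\<^bsub>B\<^esub> j z = j (y \<ominus>\<^bsub>Z\<^esub> z)" using y z by (simp add: a_minus_def)
      thus ?thesis using y z by (simp add: mem memJ eqI eqJ jI)
    qed
    thus ?thesis using Jsub[OF z] by (auto simp: \<psi>_def)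
  qed
  have cen: "C \<in> alg_centre A \<longleftrightarrow> (\<exists>z\<in>carrier Z. C = I +>\<^bsub>B\<^esub> j z)" for C
  proof
    assume C: "C \<in> alg_centre A"
    then obtain b where b: "b \<in> carrier B" "C = I +>\<^bsub>B\<^esub> b" by (auto simp: alg_centre_def A qI)
    have "\<exists>d\<in>carrier B. b \<otimes>\<^bsub>B\<^esub> b' \<ominus>\<^bsub>B\<^esub> b' \<otimes>\<^bsub>B\<^esub> b = j u \<otimes>\<^bsub>B\<^esub> d" if b': "b' \<in> carrier B" for b'
    proof -
      have "I +>\<^bsub>B\<^esub> b' \<in> carrier A" using b' by (auto simp: A qI)
      hence "I +>\<^bsub>B\<^esub> (b \<otimes>\<^bsub>B\<^esub> b') = I +>\<^bsub>B\<^esub> (b' \<otimes>\<^bsub>B\<^esub> b)" using C b b'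
        by (auto simp: alg_centre_def A qI(2))
      hence "b \<otimes>\<^bsub>B\<^esub> b' \<ominus>\<^bsub>B\<^esub> b' \<otimes>\<^bsub>B\<^esub> b \<in> I" using b b' by (subst eqI[symmetric]) auto
      thus ?thesis by (auto simp: Ieq)
    qed
    from surj[OF b(1) this] obtain z d where z: "z \<in> carrier Z" "d \<in> carrier B"
      "b \<ominus>\<^bsub>B\<^esub> j z = j u \<otimes>\<^bsub>B\<^esub> d" by auto
    hence "b \<ominus>\<^bsub>B\<^esub> j z \<in> I" by (auto simp: Ieq)
    hence "C = I +>\<^bsub>B\<^esub> j z" using b z by (subst b, subst eqI) auto
    thus "\<exists>z\<in>carrier Z. C = I +>\<^bsub>B\<^esub> j z" using z by auto
  next
    assume "\<exists>z\<in>carrier Z. C = I +>\<^bsub>B\<^esub> j z"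
    thus "C \<in> alg_centre A" by (auto simp: alg_centre_def A qI jc)
  qed
  have one: "\<psi> \<one>\<^bsub>A\<^esub> = \<one>\<^bsub>?Q\<^esub>" using psi[of "\<one>\<^bsub>Z\<^esub>"] by (simp add: A qI qJ)
  have "\<psi> \<in> ring_hom (A\<lparr>carrier := alg_centre A\<rparr>) ?Q"
  proof (rule ring_hom_memI)
    fix C assume "C \<in> carrier (A\<lparr>carrier := alg_centre A\<rparr>)"
    then obtain z where z: "z \<in> carrier Z" "C = I +>\<^bsub>B\<^esub> j z" by (auto simp: cen)
    show "\<psi> C \<in> carrier ?Q" using z by (auto simp: psi qJ)
    fix D assume "D \<in> carrier (A\<lparr>carrier := alg_centre A\<rparr>)"
    then obtain y where y: "y \<in> carrier Z" "D = I +>\<^bsub>B\<^esub> j y" by (auto simp: cen)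
    show "\<psi> (C \<otimes>\<^bsub>A\<lparr>carrier := alg_centre A\<rparr>\<^esub> D) = \<psi> C \<otimes>\<^bsub>?Q\<^esub> \<psi> D"
      using y z psi[of "z \<otimes>\<^bsub>Z\<^esub> y"] by (simp add: A qI qJ psi)
    show "\<psi> (C \<oplus>\<^bsub>A\<lparr>carrier := alg_centre A\<rparr>\<^esub> D) = \<psi> C \<oplus>\<^bsub>?Q\<^esub> \<psi> D"
      using y z psi[of "z \<oplus>\<^bsub>Z\<^esub> y"] by (simp add: A qI qJ psi)
  qed (simp add: one)
  moreover have "bij_betw \<psi> (alg_centre A) (carrier ?Q)"
  proof (rule bij_betwI')
    fix C D assume "C \<in> alg_centre A" "D \<in> alg_centre A"
    then obtain z y where zy: "z \<in> carrier Z" "C = I +>\<^bsub>B\<^esub> j z" "y \<in> carrier Z" "D = I +>\<^bsub>B\<^esub> j y" by (auto simp: cen)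
    have "J +>\<^bsub>Z\<^esub> z = J +>\<^bsub>Z\<^esub> y \<longleftrightarrow> I +>\<^bsub>B\<^esub> j z = I +>\<^bsub>B\<^esub> j y"
    proof -
      have "j z \<ominus>\<^bsub>B\<^esub> j y = j (z \<ominus>\<^bsub>Z\<^esub> y)" using zy by (simp add: a_minus_def)
      thus ?thesis using zy by (simp add: eqI eqJ jI)
    qed
    thus "(\<psi> C = \<psi> D) = (C = D)" using zy by (simp add: psi)
  next
    fix C assume "C \<in> alg_centre A"
    thus "\<psi> C \<in> carrier ?Q" by (auto simp: cen psi qJ)
  next
    fix D assume "D \<in> carrier ?Q"
    then obtain y where "y \<in> carrier Z" "D = J +>\<^bsub>Z\<^esub> y" by (auto simp: qJ)
    thus "\<exists>C\<in>alg_centre A. D = \<psi> C" by (auto simp: cen psi intro!: bexI[of _ "I +>\<^bsub>B\<^esub> j y"])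
  qed
  moreover have "\<psi> (k \<odot>\<^bsub>A\<^esub> C) = k \<odot>\<^bsub>?Q\<^esub> \<psi> C" if C: "C \<in> alg_centre A" for k C
  proof -
    obtain z where z: "z \<in> carrier Z" "C = I +>\<^bsub>B\<^esub> j z" using C cen by blast
    have "k \<odot>\<^bsub>A\<^esub> C = I +>\<^bsub>B\<^esub> j (k \<odot>\<^bsub>Z\<^esub> z)" using z by (simp add: A qI(5) js)
    thus ?thesis using z by (simp add: psi qJ(5))
  qed
  ultimately show ?thesis
    unfolding alg_isomorphic_def ring_iso_def J_def[symmetric] by auto
qed

section \<open>Monoid algebras\<close>

lemma poly_mapping_sum_induct [case_names single add]:
  fixes a :: "'m \<Rightarrow>\<^sub>0 'b::comm_monoid_add"
  assumes s: "\<And>u k. P (Poly_Mapping.single u k)" and add: "\<And>a b. \<lbrakk>P a; P b\<rbrakk> \<Longrightarrow> P (a + b)"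
  shows "P a"
proof -
  have "P (\<Sum>u\<in>A. Poly_Mapping.single u (Poly_Mapping.lookup a u))" if "finite A" for A
    using that
  proof induction
    case empty
    show ?case using s[of undefined 0] by simp
  qed (simp add: s add)
  moreover have "(\<Sum>u\<in>Poly_Mapping.keys a. Poly_Mapping.single u (Poly_Mapping.lookup a u)) = a"
    by (rule poly_mapping_eqI)
      (auto simp: lookup_sum lookup_single when_def in_keys_iff)
  ultimately show ?thesis by (metis finite_keys)
qed

text \<open>One construction serves for homomorphisms of the tensor algebra, evaluation of
  polynomials, normal ordering and the selection of components; only \<open>c\<close> and
  \<open>\<eta>\<close> change. The target may be noncommutative.\<close>

definition mlift :: "(complex \<Rightarrow> 'b::ring_1) \<Rightarrow> ('m \<Rightarrow> 'b) \<Rightarrow> ('m \<Rightarrow>\<^sub>0 complex) \<Rightarrow> 'b" where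
  "mlift c \<eta> a = (\<Sum>u\<in>Poly_Mapping.keys a. c (Poly_Mapping.lookup a u) * \<eta> u)"

definition scalar_hom :: "(complex \<Rightarrow> 'b::ring_1) \<Rightarrow> bool" where
  "scalar_hom c \<longleftrightarrow> c 1 = 1 \<and> (\<forall>k l. c (k + l) = c k + c l) \<and> (\<forall>k l. c (k * l) = c k * c l) \<and>
     (\<forall>k x. x * c k = c k * x)"

lemma scalar_homD:
  assumes "scalar_hom c"
  shows "c 1 = 1" "c (k + l) = c k + c l" "c (k * l) = c k * c l"
  using assms unfolding scalar_hom_def by blast+

lemma scalar_hom_commute: "scalar_hom c \<Longrightarrow> x * c k = c k * x"
  unfolding scalar_hom_def by blast

lemma scalar_hom_0: "scalar_hom c \<Longrightarrow> c 0 = 0"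
  using scalar_homD(2)[of c 0 0] by simp

lemma mlift_superset:
  assumes "scalar_hom c" "finite A" "Poly_Mapping.keys a \<subseteq> A"
  shows "mlift c \<eta> a = (\<Sum>u\<in>A. c (Poly_Mapping.lookup a u) * \<eta> u)"
  unfolding mlift_def using assms
  by (intro sum.mono_neutral_left) (auto simp: in_keys_iff scalar_hom_0)

lemma mlift_add:
  assumes c: "scalar_hom c"
  shows "mlift c \<eta> (a + b) = mlift c \<eta> a + mlift c \<eta> b"
proof -
  let ?A = "Poly_Mapping.keys a \<union> Poly_Mapping.keys b"
  have "Poly_Mapping.keys (a + b) \<subseteq> ?A" by (rule Poly_Mapping.keys_add)
  with c have "mlift c \<eta> (a + b) = (\<Sum>u\<in>?A. c (Poly_Mapping.lookup (a + b) u) * \<eta> u)"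
    by (intro mlift_superset) auto
  also have "\<dots> = (\<Sum>u\<in>?A. c (Poly_Mapping.lookup a u) * \<eta> u) + (\<Sum>u\<in>?A. c (Poly_Mapping.lookup b u) * \<eta> u)"
    using c by (simp add: lookup_add scalar_homD distrib_right sum.distrib)
  finally show ?thesis using c by (simp add: mlift_superset[of c ?A])
qed

lemma mlift_0 [simp]: "mlift c \<eta> 0 = 0"
  by (simp add: mlift_def)

lemma mlift_single: "scalar_hom c \<Longrightarrow> mlift c \<eta> (Poly_Mapping.single u k) = c k * \<eta> u"
  by (subst mlift_superset[of c "{u}"]) auto

lemma mlift_uminus: "scalar_hom c \<Longrightarrow> mlift c \<eta> (- a) = - mlift c \<eta> a"
  by (metis mlift_0 mlift_add add.right_inverse add_eq_0_iff)

lemma mlift_diff: "scalar_hom c \<Longrightarrow> mlift c \<eta> (a - b) = mlift c \<eta> a - mlift c \<eta> b"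
  by (metis mlift_add mlift_uminus uminus_add_conv_diff add.commute)

lemma mlift_sum: "scalar_hom c \<Longrightarrow> mlift c \<eta> (\<Sum>i\<in>A. f i) = (\<Sum>i\<in>A. mlift c \<eta> (f i))"
  by (induction A rule: infinite_finite_induct) (auto simp: mlift_add)

lemma mlift_scale:
  fixes a :: "'m::monoid_add \<Rightarrow>\<^sub>0 complex"
  assumes "scalar_hom c"
  shows "mlift c \<eta> (Poly_Mapping.single 0 k * a) = c k * mlift c \<eta> a"
  using assms
  by (induction a rule: poly_mapping_sum_induct)
    (simp_all add: mult_single mlift_single mlift_add distrib_left scalar_homD mult.assoc)

lemma mlift_mult:
  fixes a :: "'m::monoid_add \<Rightarrow>\<^sub>0 complex"
  assumes c: "scalar_hom c" and \<eta>: "\<And>u v. \<eta> (u + v) = \<eta> u * \<eta> v"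
  shows "mlift c \<eta> (a * b) = mlift c \<eta> a * mlift c \<eta> b"
proof (induction a rule: poly_mapping_sum_induct)
  case (single u k)
  show ?case
  proof (induction b rule: poly_mapping_sum_induct)
    case (single v l)
    have "c k * c l * (\<eta> u * \<eta> v) = c k * (c l * \<eta> u) * \<eta> v" by (simp add: mult.assoc)
    also have "c l * \<eta> u = \<eta> u * c l" using c by (rule scalar_hom_commute[symmetric])
    finally show ?case using c \<eta> by (simp add: mult_single mlift_single mult.assoc scalar_homD)
  qed (use c in \<open>simp add: mlift_add distrib_left\<close>)
qed (use c in \<open>simp add: mlift_add distrib_right\<close>)

lemma mlift_1: "scalar_hom c \<Longrightarrow> \<eta> 0 = 1 \<Longrightarrow> mlift c \<eta> 1 = 1"
  by (simp add: single_one[symmetric] mlift_single scalar_homD del: single_one)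

lemma mlift_cong: "(\<And>u. u \<in> Poly_Mapping.keys a \<Longrightarrow> \<eta> u = \<eta>' u) \<Longrightarrow> mlift c \<eta> a = mlift c \<eta>' a"
  unfolding mlift_def by (intro sum.cong) auto

lemma scalar_hom_single: "scalar_hom (Poly_Mapping.single (0::'m::monoid_add))"
  unfolding scalar_hom_def
proof safe
  fix k and x :: "'m \<Rightarrow>\<^sub>0 complex"
  show "x * Poly_Mapping.single 0 k = Poly_Mapping.single 0 k * x"
    by (induction x rule: poly_mapping_sum_induct) (simp_all add: mult_single distrib_left distrib_right mult.commute)
qed (simp_all add: single_add mult_single)

lemma const_hom: "scalar_hom const"
  using scalar_hom_single[where ?'m="'a letter word"] by (simp add: const_def[abs_def])

lemma const_simps [simp]: "const 0 = 0" "const 1 = 1" "const (k + l) = const k + const l"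
    "const (k * l) = const k * const l" "const (- k) = - const k" "const (k - l) = const k - const l"
  by (simp_all add: const_def single_add mult_single single_uminus single_diff)

lemma const_commute: "a * const k = const k * a"
  using const_hom unfolding scalar_hom_def by blast

lemma letters_simps [simp]: "letters 0 = []" "letters (u + v) = letters u @ letters v"
  by (simp_all add: zero_word_def plus_word_def)

definition lword :: "('l \<Rightarrow> 'b::ring_1) \<Rightarrow> 'l word \<Rightarrow> 'b" where
  "lword \<phi> u = prod_list (map \<phi> (letters u))"

lemma lword_simps [simp]: "lword \<phi> 0 = 1" "lword \<phi> (u + v) = lword \<phi> u * lword \<phi> v"
    "lword \<phi> (Word [l]) = \<phi> l"
  by (simp_all add: lword_def)

lemma tensor_lift_mlift: "tensor_lift \<phi> = mlift const (lword \<phi>)"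
  by (simp add: fun_eq_iff tensor_lift_def mlift_def lword_def)

definition talg :: "(complex \<Rightarrow> 'b::ring_1) \<Rightarrow> ('n letter \<Rightarrow> 'b) \<Rightarrow> 'n tensor \<Rightarrow> 'b" where
  "talg c \<phi> = mlift c (lword \<phi>)"

lemma tensor_lift_talg: "tensor_lift \<phi> = talg const \<phi>"
  by (simp add: tensor_lift_mlift talg_def)

lemma single_word: "Poly_Mapping.single u k = const k * lword gen u"
proof -
  have "Poly_Mapping.single (Word us) 1 = lword gen (Word us)" for us :: "'a letter list"
  proof (induction us)
    case Nil
    show ?case by (simp add: lword_def zero_word_def[symmetric])
  next
    case (Cons l us)
    have "Word (l # us) = Word [l] + Word us" by (simp add: plus_word_def)
    hence "Poly_Mapping.single (Word (l # us)) 1 = (gen l * Poly_Mapping.single (Word us) 1 :: 'a tensor)"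
      by (simp add: gen_def mult_single)
    thus ?case using Cons by (simp add: lword_def)
  qed
  from this[of "letters u"] have "lword gen u = Poly_Mapping.single u 1" by simp
  thus ?thesis by (simp add: const_def mult_single)
qed

text \<open>Constants and letters generate the tensor algebra, so compatibilities with
  \<open>W\<close>, with the torus and with \<open>iota\<close> are checked on them alone.\<close>

lemma tensor_induct [case_names const gen add mult]:
  assumes "\<And>k. P (const k)" "\<And>l. P (gen l)" "\<And>a b. \<lbrakk>P a; P b\<rbrakk> \<Longrightarrow> P (a + b)" "\<And>a b. \<lbrakk>P a; P b\<rbrakk> \<Longrightarrow> P (a * b)"
  shows "P (a :: 'n tensor)"
proof (induction a rule: poly_mapping_sum_induct)
  case (single u k)
  have "P (lword gen (Word us))" for us
    by (induction us) (use assms(1)[of 1] assms(2,4) in \<open>auto simp: lword_def\<close>)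
  from this[of "letters u"] show ?case by (simp add: single_word assms)
qed (rule assms)

context
  fixes c :: "complex \<Rightarrow> 'b::ring_1"
  assumes c: "scalar_hom c"
begin

lemma talg_const [simp]: "talg c \<phi> (const k) = c k"
  by (simp add: talg_def const_def mlift_single[OF c])

lemma talg_gen [simp]: "talg c \<phi> (gen l) = \<phi> l"
  using c by (simp add: talg_def gen_def mlift_single scalar_homD)

lemma talg_add [simp]: "talg c \<phi> (a + b) = talg c \<phi> a + talg c \<phi> b"
  by (simp add: talg_def mlift_add[OF c])

lemma talg_0 [simp]: "talg c \<phi> 0 = 0"
  by (simp add: talg_def)

lemma talg_1 [simp]: "talg c \<phi> 1 = 1"
  by (simp add: talg_def mlift_1[OF c])

lemma talg_diff [simp]: "talg c \<phi> (a - b) = talg c \<phi> a - talg c \<phi> b"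
  by (simp add: talg_def mlift_diff[OF c])

lemma talg_sum [simp]: "talg c \<phi> (\<Sum>i\<in>A. f i) = (\<Sum>i\<in>A. talg c \<phi> (f i))"
  by (simp add: talg_def mlift_sum[OF c])

lemma talg_mult [simp]: "talg c \<phi> (a * b) = talg c \<phi> a * talg c \<phi> b"
  by (simp add: talg_def mlift_mult[OF c])

end

section \<open>Linear operators on functions of \<open>\<hh> \<oplus> \<hh>\<^sup>*\<close>\<close>

type_synonym 'n pt = "(complex^'n) \<times> (complex^'n)"

text \<open>Functions without any regularity make room for the poles of the Dunkl operators and for
  indicator functions of single points, which serve as test functions.\<close>

typedef (overloaded) 'n lop =
  "{T :: ('n::finite pt \<Rightarrow> complex) \<Rightarrow> ('n pt \<Rightarrow> complex).
     (\<forall>f g. T (\<lambda>x. f x + g x) = (\<lambda>x. T f x + T g x)) \<and> (\<forall>k f. T (\<lambda>x. k * f x) = (\<lambda>x. k * T f x))}"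
  morphisms ap Lop
  by (rule exI[of _ "\<lambda>f. f"]) auto

setup_lifting type_definition_lop

lemma ap_scale: "ap T (\<lambda>x. k * f x) = (\<lambda>x. k * ap T f x)"
  using ap[of T] by blast

instantiation lop :: (finite) ring_1
begin

lift_definition zero_lop :: "'a lop" is "\<lambda>f x. 0" by auto
lift_definition one_lop :: "'a lop" is "\<lambda>f. f" by auto
lift_definition plus_lop :: "'a lop \<Rightarrow> 'a lop \<Rightarrow> 'a lop" is "\<lambda>S T f x. S f x + T f x"
  by (auto simp: algebra_simps fun_eq_iff)
lift_definition minus_lop :: "'a lop \<Rightarrow> 'a lop \<Rightarrow> 'a lop" is "\<lambda>S T f x. S f x - T f x"
  by (auto simp: algebra_simps fun_eq_iff)
lift_definition uminus_lop :: "'a lop \<Rightarrow> 'a lop" is "\<lambda>S f x. - S f x"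
  by (auto simp: algebra_simps fun_eq_iff)
lift_definition times_lop :: "'a lop \<Rightarrow> 'a lop \<Rightarrow> 'a lop" is "\<lambda>S T f. S (T f)"
  by auto

instance
proof
  show "(0 :: 'a lop) \<noteq> 1"
    by transfer (auto simp: fun_eq_iff intro!: exI[of _ "\<lambda>_. 1"])
qed (transfer; auto simp: algebra_simps fun_eq_iff)+

end

lemma ap_simps [simp]: "ap 0 f = (\<lambda>x. 0)" "ap 1 f = f" "ap (S + T) f = (\<lambda>x. ap S f x + ap T f x)"
   "ap (S - T) f = (\<lambda>x. ap S f x - ap T f x)" "ap (S * T) f = ap S (ap T f)" "ap (- S) f = (\<lambda>x. - ap S f x)"
  by (transfer; simp)+

lemma ap_sum_lop [simp]: "ap (\<Sum>i\<in>A. S i) f = (\<lambda>x. \<Sum>i\<in>A. ap (S i) f x)"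
  by (induction A rule: infinite_finite_induct) auto

lemma lop_eqI: "(\<And>f x. ap S f x = ap T f x) \<Longrightarrow> S = T"
  by (metis ap_inject ext)

lift_definition mulop :: "('n::finite pt \<Rightarrow> complex) \<Rightarrow> 'n lop" is "\<lambda>\<phi> f x. \<phi> x * f x"
  by (auto simp: algebra_simps fun_eq_iff)

lift_definition subop :: "('n::finite pt \<Rightarrow> 'n pt) \<Rightarrow> 'n lop" is "\<lambda>g f x. f (g x)"
  by auto

lemma ap_mulop [simp]: "ap (mulop \<phi>) f = (\<lambda>x. \<phi> x * f x)"
  by transfer simp

lemma ap_subop [simp]: "ap (subop g) f = (\<lambda>x. f (g x))"
  by transfer simp

definition scal :: "complex \<Rightarrow> 'n::finite lop" where
  "scal k = mulop (\<lambda>_. k)"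

lemma ap_scal [simp]: "ap (scal k) f = (\<lambda>x. k * f x)"
  by (simp add: scal_def)

lemma scal_hom: "scalar_hom scal"
  unfolding scalar_hom_def by (auto intro!: lop_eqI simp: algebra_simps ap_scale)

lemma scal_commute: "T * scal k = scal k * T"
  using scal_hom unfolding scalar_hom_def by blast

lemma mulop_mult: "mulop \<phi> * mulop \<psi> = mulop (\<lambda>x. \<phi> x * \<psi> x)"
  by (rule lop_eqI) simp

lemma mulop_commute: "mulop \<phi> * mulop \<psi> = mulop \<psi> * mulop \<phi>"
  by (simp add: mulop_mult mult.commute)

section \<open>The smash product\<close>

lemma matrix_inv_right: "invertible (A::'a::comm_ring_1^'n^'n) \<Longrightarrow> A ** matrix_inv A = mat 1"
  and matrix_inv_left: "invertible (A::'a::comm_ring_1^'n^'n) \<Longrightarrow> matrix_inv A ** A = mat 1"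
proof -
  assume "invertible A"
  hence "\<exists>A'. A ** A' = mat 1 \<and> A' ** A = mat 1" by (simp add: invertible_def)
  from someI_ex[OF this] show "A ** matrix_inv A = mat 1" "matrix_inv A ** A = mat 1"
    by (auto simp: matrix_inv_def)
qed

lemma matrix_inv_unique:
  fixes A :: "'a::comm_ring_1^'n^'n"
  assumes "A ** B = mat 1" "B ** A = mat 1"
  shows "matrix_inv A = B"
proof -
  have i: "invertible A" using assms by (auto simp: invertible_def)
  have "matrix_inv A = matrix_inv A ** (A ** B)" using assms by simp
  also have "\<dots> = B" using i by (simp add: matrix_mul_assoc matrix_inv_left)
  finally show ?thesis .
qed

lemma group_GL: "group (GL :: ('n::finite cmat) monoid)"
proof (rule groupI)
  fix x :: "'n cmat" assume "x \<in> carrier GL"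
  hence x: "invertible x" by (simp add: GL_def)
  hence "invertible (matrix_inv x)" using matrix_inv_right matrix_inv_left by (auto simp: invertible_def)
  thus "\<exists>y\<in>carrier GL. y \<otimes>\<^bsub>GL\<^esub> x = \<one>\<^bsub>GL\<^esub>"
    using x by (auto simp: GL_def matrix_inv_left)
qed (auto simp: GL_def invertible_mult matrix_mul_assoc, auto simp: invertible_def intro: exI[of _ "mat 1"])

lemma inv_GL:
  assumes "invertible A" shows "inv\<^bsub>GL\<^esub> A = matrix_inv A"
proof -
  have "invertible (matrix_inv A)" using assms matrix_inv_right matrix_inv_left by (auto simp: invertible_def)
  thus ?thesis
    using group.inv_equality[OF group_GL, of "matrix_inv A" A] assms
    by (simp add: GL_def matrix_inv_left)
qed

locale matrix_group =
  fixes W :: "'n::finite cmat set"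
  assumes W: "subgroup W GL" and fin: "finite W"
begin

lemma W_inv: "w \<in> W \<Longrightarrow> invertible w"
  using subgroup.subset[OF W] by (auto simp: GL_def)

lemma W_one [simp, intro]: "mat 1 \<in> W"
  using subgroup.one_closed[OF W] by (simp add: GL_def)

lemma W_mult [intro]: "\<lbrakk>u \<in> W; v \<in> W\<rbrakk> \<Longrightarrow> u ** v \<in> W"
  using subgroup.m_closed[OF W, of u v] by (simp add: GL_def)

lemma W_minv [intro]: "w \<in> W \<Longrightarrow> matrix_inv w \<in> W"
  using subgroup.m_inv_closed[OF W, of w] by (simp add: inv_GL W_inv)

lemma W_right [simp]: "w \<in> W \<Longrightarrow> w ** matrix_inv w = mat 1"
  and W_left [simp]: "w \<in> W \<Longrightarrow> matrix_inv w ** w = mat 1"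
  by (simp_all add: matrix_inv_right matrix_inv_left W_inv)

lemma W_assoc1 [simp]: "w \<in> W \<Longrightarrow> w ** (matrix_inv w ** x) = x"
  and W_assoc2 [simp]: "w \<in> W \<Longrightarrow> matrix_inv w ** (w ** x) = x"
  by (simp_all add: matrix_mul_assoc)

lemma W_assoc3 [simp]: "w \<in> W \<Longrightarrow> x ** w ** matrix_inv w = x"
  and W_assoc4 [simp]: "w \<in> W \<Longrightarrow> x ** matrix_inv w ** w = x"
  by (simp_all flip: matrix_mul_assoc)

lemma W_vec1 [simp]: "w \<in> W \<Longrightarrow> w *v (matrix_inv w *v x) = x"
  and W_vec2 [simp]: "w \<in> W \<Longrightarrow> matrix_inv w *v (w *v x) = x"
  by (simp_all add: matrix_vector_mul_assoc)

lemma minv_mult: "\<lbrakk>u \<in> W; v \<in> W\<rbrakk> \<Longrightarrow> matrix_inv (u ** v) = matrix_inv v ** matrix_inv u"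
  by (rule matrix_inv_unique) (simp_all add: matrix_mul_assoc)

lemma minv_minv [simp]: "w \<in> W \<Longrightarrow> matrix_inv (matrix_inv w) = w"
  by (rule matrix_inv_unique) simp_all

lemma minv_one [simp]: "matrix_inv (mat 1 :: 'n cmat) = mat 1"
  by (rule matrix_inv_unique) simp_all

lemma W_mem_left [simp]:
  assumes "u \<in> W" shows "u ** x \<in> W \<longleftrightarrow> x \<in> W"
proof
  assume "u ** x \<in> W"
  hence "matrix_inv u ** (u ** x) \<in> W" using assms by blast
  thus "x \<in> W" using assms by simp
qed (use assms in auto)

lemma W_eq_left: "u \<in> W \<Longrightarrow> u ** x = w \<longleftrightarrow> x = matrix_inv u ** w"
  by auto

lemma sum_W_left: "u \<in> W \<Longrightarrow> (\<Sum>w\<in>W. f (u ** w)) = (\<Sum>w\<in>W. f w)"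
  by (rule sum.reindex_bij_witness[of _ "\<lambda>w. matrix_inv u ** w" "\<lambda>w. u ** w"]) auto

lemma sum_W_right: "u \<in> W \<Longrightarrow> (\<Sum>w\<in>W. f (w ** u)) = (\<Sum>w\<in>W. f w)"
  by (rule sum.reindex_bij_witness[of _ "\<lambda>w. w ** matrix_inv u" "\<lambda>w. w ** u"]) auto

end

section \<open>The pairing and the action of W on tensors\<close>

lemma pairing_add: "pairing (x + x') y = pairing x y + pairing x' y"
    "pairing x (y + y') = pairing x y + pairing x y'"
  and pairing_scale: "pairing (k *s x) y = k * pairing x y" "pairing x (k *s y) = k * pairing x y"
  and pairing_diff: "pairing (x - x') y = pairing x y - pairing x' y"
    "pairing x (y - y') = pairing x y - pairing x y'"
  and pairing_zero [simp]: "pairing 0 y = 0" "pairing x 0 = 0"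
  by (simp_all add: pairing_def algebra_simps sum.distrib sum_subtractf sum_distrib_left)

lemma pairing_axis [simp]: "pairing (axis i 1) y = y $ i" "pairing x (axis i 1) = x $ i"
  by (simp_all add: pairing_def axis_def if_distrib if_distribR cong: if_cong)

lemma pairing_matrix: "pairing (x v* A) y = pairing x (A *v y)"
proof -
  have "pairing (x v* A) y = (\<Sum>i\<in>UNIV. \<Sum>j\<in>UNIV. x $ j * A $ j $ i * y $ i)"
    by (simp add: pairing_def vector_matrix_mult_def sum_distrib_left mult_ac)
  also have "\<dots> = (\<Sum>j\<in>UNIV. \<Sum>i\<in>UNIV. x $ j * A $ j $ i * y $ i)" by (rule sum.swap)
  finally show ?thesis by (simp add: pairing_def matrix_vector_mult_def sum_distrib_left mult.assoc)
qed

lemma pairing_ext: "(\<And>y. pairing x y = pairing x' y) \<Longrightarrow> x = x'"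
  by (metis pairing_axis(2) vec_eq_iff)

lemma pairing_ext2: "(\<And>x. pairing x y = pairing x y') \<Longrightarrow> y = y'"
  by (metis pairing_axis(1) vec_eq_iff)

lemma vec_axis_sum: "(\<Sum>i\<in>UNIV. (y $ i) *s axis i 1) = (y :: complex^'n::finite)"
  by (simp add: vec_eq_iff axis_def if_distrib cong: if_cong)

lemma of_h_add: "of_h (x + y) = of_h x + of_h y"
  and of_h_scale: "of_h (k *s x) = const k * of_h x"
  and of_h_axis [simp]: "of_h (axis i 1) = gen (Y i)"
  by (simp_all add: of_h_def distrib_right sum.distrib sum_distrib_left mult.assoc axis_def
      if_distrib[of const] if_distrib[of "\<lambda>z. z * b" for b] cong: if_cong)

lemma of_h_dual_add: "of_h_dual (x + y) = of_h_dual x + of_h_dual y"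
  and of_h_dual_scale: "of_h_dual (k *s x) = const k * of_h_dual x"
  and of_h_dual_axis [simp]: "of_h_dual (axis i 1) = gen (X i)"
  by (simp_all add: of_h_dual_def distrib_right sum.distrib sum_distrib_left mult.assoc axis_def
      if_distrib[of const] if_distrib[of "\<lambda>z. z * b" for b] cong: if_cong)

lemma of_h_sum: "of_h (\<Sum>i\<in>A. f i) = (\<Sum>i\<in>A. of_h (f i))"
  by (induction A rule: infinite_finite_induct) (simp_all add: of_h_add of_h_def[of 0])

lemma of_h_dual_sum: "of_h_dual (\<Sum>i\<in>A. f i) = (\<Sum>i\<in>A. of_h_dual (f i))"
  by (induction A rule: infinite_finite_induct) (simp_all add: of_h_dual_add of_h_dual_def[of 0])

lemma dual_act_linear: "dual_act w (x + y) = dual_act w x + dual_act w y" "dual_act w (k *s x) = k *s dual_act w x"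
  by (simp_all add: dual_act_def vector_matrix_mult_def vec_eq_iff algebra_simps sum.distrib sum_distrib_left)

lemma dual_act_sum: "dual_act w (\<Sum>i\<in>A. f i) = (\<Sum>i\<in>A. dual_act w (f i))"
proof (induction A rule: infinite_finite_induct)
  case empty
  show ?case using dual_act_linear(2)[of w 0 0] by simp
qed (simp_all add: dual_act_linear dual_act_linear(2)[of w 0 0, simplified])

lemma group_act_hom:
  "group_act w (const k) = const k" "group_act w (a + b) = group_act w a + group_act w b"
  "group_act w (a * b) = group_act w a * group_act w b" "group_act w 0 = 0" "group_act w 1 = 1"
  "group_act w (\<Sum>i\<in>A. f i) = (\<Sum>i\<in>A. group_act w (f i))"
  "group_act w (a - b) = group_act w a - group_act w b"
  by (simp_all add: group_act_def tensor_lift_talg const_hom)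

lemma matrix_vector_mult_sum: "A *v (\<Sum>i\<in>S. f i) = (\<Sum>i\<in>S. A *v f i)"
  for A :: "'a::comm_ring_1^'n^'m"
  by (induction S rule: infinite_finite_induct) (simp_all add: matrix_vector_right_distrib)

lemma group_act_of_h: "group_act w (of_h y) = of_h (w *v y)"
proof -
  have "group_act w (of_h y) = (\<Sum>i\<in>UNIV. const (y $ i) * of_h (w *v axis i 1))"
    unfolding of_h_def[of y] by (simp add: group_act_hom(1,3,6)) (simp add: group_act_def tensor_lift_talg const_hom)
  also have "\<dots> = of_h (w *v (\<Sum>i\<in>UNIV. (y $ i) *s axis i 1))"
    by (simp add: matrix_vector_mult_sum of_h_sum of_h_scale vector_scalar_commute)
  finally show ?thesis by (simp add: vec_axis_sum)
qed

lemma group_act_of_h_dual: "group_act w (of_h_dual y) = of_h_dual (dual_act w y)"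
proof -
  have "group_act w (of_h_dual y) = (\<Sum>i\<in>UNIV. const (y $ i) * of_h_dual (dual_act w (axis i 1)))"
    unfolding of_h_dual_def[of y] by (simp add: group_act_hom(1,3,6)) (simp add: group_act_def tensor_lift_talg const_hom)
  also have "\<dots> = of_h_dual (dual_act w (\<Sum>i\<in>UNIV. (y $ i) *s axis i 1))"
    by (simp add: dual_act_sum of_h_dual_sum of_h_dual_scale dual_act_linear)
  finally show ?thesis by (simp add: vec_axis_sum)
qed

lemma group_act_gen: "group_act w (gen (Y i)) = of_h (w *v axis i 1)"
   "group_act w (gen (X i)) = of_h_dual (dual_act w (axis i 1))"
  using group_act_of_h[of w "axis i 1"] group_act_of_h_dual[of w "axis i 1"] by simp_all

context matrix_group
begin

lemma dual_act_mult: "\<lbrakk>u \<in> W; v \<in> W\<rbrakk> \<Longrightarrow> dual_act u (dual_act v x) = dual_act (u ** v) x"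
  by (simp add: dual_act_def minv_mult vector_matrix_mul_assoc)

lemma dual_act_one [simp]: "dual_act (mat 1) (x :: complex^'n) = x"
  by (simp add: dual_act_def)

lemma group_act_mult:
  assumes "u \<in> W" "v \<in> W"
  shows "group_act u (group_act v a) = group_act (u ** v) (a :: 'n tensor)"
proof (induction a rule: tensor_induct)
  case (gen l)
  show ?case using assms
    by (cases l) (simp_all add: group_act_gen group_act_of_h group_act_of_h_dual matrix_vector_mul_assoc dual_act_mult)
qed (simp_all add: group_act_hom)

lemma group_act_one [simp]: "group_act (mat 1) a = (a :: 'n tensor)"
proof (induction a rule: tensor_induct)
  case (gen l)
  show ?case by (cases l) (simp_all add: group_act_gen)
qed (simp_all add: group_act_hom)

lemma smash_carrier: "f \<in> carrier (smash W) \<longleftrightarrow> (\<forall>w. w \<notin> W \<longrightarrow> f w = 0)"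
  by (simp add: smash_def)

lemma smash_simps: "f \<oplus>\<^bsub>smash W\<^esub> g = (\<lambda>w. f w + g w)" "\<zero>\<^bsub>smash W\<^esub> = (\<lambda>w. 0)"
  "\<one>\<^bsub>smash W\<^esub> = (\<lambda>w. if w = mat 1 then 1 else 0)" "k \<odot>\<^bsub>smash W\<^esub> f = (\<lambda>w. const k * f w)"
  by (simp_all add: smash_def)

lemma smash_mult: "(f \<otimes>\<^bsub>smash W\<^esub> g) w = (if w \<in> W then \<Sum>u\<in>W. f u * group_act u (g (matrix_inv u ** w)) else 0)"
proof -
  have *: "(f \<otimes>\<^bsub>smash W\<^esub> g) w = (\<Sum>(u, v)\<in>{(u, v). u \<in> W \<and> v \<in> W \<and> u ** v = w}. f u * group_act u (g v))"
    by (simp add: smash_def)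
  show ?thesis
  proof (cases "w \<in> W")
    case True
    have "(\<Sum>(u, v)\<in>{(u, v). u \<in> W \<and> v \<in> W \<and> u ** v = w}. f u * group_act u (g v)) =
       (\<Sum>u\<in>W. f u * group_act u (g (matrix_inv u ** w)))"
      using True
      by (intro sum.reindex_bij_witness[of _ "\<lambda>u. (u, matrix_inv u ** w)" fst]) auto
    thus ?thesis using True * by simp
  next
    case False
    hence e: "{(u, v). u \<in> W \<and> v \<in> W \<and> u ** v = w} = {}" by auto
    show ?thesis unfolding * e using False by simp
  qed
qed

lemma smash_assoc: "(f \<otimes>\<^bsub>smash W\<^esub> g) \<otimes>\<^bsub>smash W\<^esub> h = f \<otimes>\<^bsub>smash W\<^esub> (g \<otimes>\<^bsub>smash W\<^esub> h)"
proof
  fix w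
  show "((f \<otimes>\<^bsub>smash W\<^esub> g) \<otimes>\<^bsub>smash W\<^esub> h) w = (f \<otimes>\<^bsub>smash W\<^esub> (g \<otimes>\<^bsub>smash W\<^esub> h)) w"
  proof (cases "w \<in> W")
    case w: True
    have "((f \<otimes>\<^bsub>smash W\<^esub> g) \<otimes>\<^bsub>smash W\<^esub> h) w =
        (\<Sum>a\<in>W. (\<Sum>u\<in>W. f u * group_act u (g (matrix_inv u ** a))) * group_act a (h (matrix_inv a ** w)))"
      using w by (simp add: smash_mult)
    also have "\<dots> = (\<Sum>u\<in>W. \<Sum>a\<in>W. f u * group_act u (g (matrix_inv u ** a)) * group_act a (h (matrix_inv a ** w)))"
      by (subst sum.swap) (simp add: sum_distrib_right)
    also have "\<dots> = (\<Sum>u\<in>W. \<Sum>v\<in>W. f u * group_act u (g v) * group_act (u ** v) (h (matrix_inv (u ** v) ** w)))"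
    proof (rule sum.cong)
      fix u assume "u \<in> W"
      from sum_W_left[OF this, of "\<lambda>a. f u * group_act u (g (matrix_inv u ** a)) * group_act a (h (matrix_inv a ** w))"] this
      show "(\<Sum>a\<in>W. f u * group_act u (g (matrix_inv u ** a)) * group_act a (h (matrix_inv a ** w))) =
        (\<Sum>v\<in>W. f u * group_act u (g v) * group_act (u ** v) (h (matrix_inv (u ** v) ** w)))"
        by simp
    qed simp
    also have "\<dots> = (f \<otimes>\<^bsub>smash W\<^esub> (g \<otimes>\<^bsub>smash W\<^esub> h)) w"
      using w by (simp add: smash_mult group_act_hom group_act_mult minv_mult matrix_mul_assoc sum_distrib_left mult.assoc W_minv cong: sum.cong)
    finally show ?thesis .
  qed (simp add: smash_mult)
qed

lemma smash_calg: "calg (smash W)"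
proof -
  have "abelian_group (smash W)"
  proof (rule abelian_groupI)
    fix f assume "f \<in> carrier (smash W)"
    thus "\<exists>g\<in>carrier (smash W). g \<oplus>\<^bsub>smash W\<^esub> f = \<zero>\<^bsub>smash W\<^esub>"
      by (intro bexI[of _ "\<lambda>w. - f w"]) (auto simp: smash_simps smash_carrier)
  qed (auto simp: smash_simps smash_carrier add_ac)
  moreover have "Group.monoid (smash W)"
  proof (rule monoidI)
    fix f assume f: "f \<in> carrier (smash W)"
    have "(\<one>\<^bsub>smash W\<^esub> \<otimes>\<^bsub>smash W\<^esub> f) w = f w" for w
    proof -
      have "(\<Sum>u\<in>W. (if u = mat 1 then 1 else 0) * group_act u (f (matrix_inv u ** w))) =
        (\<Sum>u\<in>W. if u = mat 1 then f w else 0)" by (rule sum.cong) auto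
      thus ?thesis using f fin by (auto simp: smash_mult smash_simps smash_carrier)
    qed
    thus "\<one>\<^bsub>smash W\<^esub> \<otimes>\<^bsub>smash W\<^esub> f = f" by auto
    have "(f \<otimes>\<^bsub>smash W\<^esub> \<one>\<^bsub>smash W\<^esub>) w = f w" for w
    proof -
      have "(\<Sum>u\<in>W. f u * group_act u (if matrix_inv u ** w = mat 1 then 1 else 0)) =
        (\<Sum>u\<in>W. if u = w then f w else 0)" if "w \<in> W"
      proof (rule sum.cong)
        fix u assume u: "u \<in> W"
        have "matrix_inv u ** w = mat 1 \<longleftrightarrow> u = w"
          using u W_eq_left[of "matrix_inv u" w "mat 1"] by (auto simp: W_minv)
        thus "f u * group_act u (if matrix_inv u ** w = mat 1 then 1 else 0) = (if u = w then f w else 0)"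
          by (auto simp: group_act_hom)
      qed simp
      thus ?thesis using f fin by (auto simp: smash_mult smash_simps smash_carrier)
    qed
    thus "f \<otimes>\<^bsub>smash W\<^esub> \<one>\<^bsub>smash W\<^esub> = f" by auto
  qed (auto simp: smash_assoc, auto simp: smash_carrier smash_mult smash_simps)
  ultimately have "ring (smash W)"
    by (intro ringI)
     (auto simp: fun_eq_iff smash_mult smash_simps sum.distrib distrib_left distrib_right group_act_hom)
  then interpret ring "smash W" .
  show ?thesis
    by unfold_locales
      (auto simp: fun_eq_iff smash_carrier smash_mult smash_simps distrib_left group_act_hom sum_distrib_left mult.assoc
        const_commute intro!: sum.cong, simp flip: mult.assoc add: const_commute)
qed

sublocale S: calg "smash W"
  by (rule smash_calg)

lemma smash_uminus:
  assumes "f \<in> carrier (smash W)" shows "\<ominus>\<^bsub>smash W\<^esub> f = (\<lambda>w. - f w)"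
proof (rule S.minus_equality)
  show "(\<lambda>w. - f w) \<oplus>\<^bsub>smash W\<^esub> f = \<zero>\<^bsub>smash W\<^esub>" by (simp add: smash_simps)
qed (use assms in \<open>auto simp: smash_carrier\<close>)

lemma smash_minus: "g \<in> carrier (smash W) \<Longrightarrow> f \<ominus>\<^bsub>smash W\<^esub> g = (\<lambda>w. f w - g w)"
  by (simp add: a_minus_def smash_uminus smash_simps)

lemma of_tensor_carrier [simp, intro]: "of_tensor a \<in> carrier (smash W)"
  by (auto simp: smash_carrier of_tensor_def)

lemma group_sum_carrier [simp, intro]: "S \<subseteq> W \<Longrightarrow> group_sum S f \<in> carrier (smash W)"
  by (auto simp: smash_carrier group_sum_def)

lemma of_tensor_mult:
  assumes f: "f \<in> carrier (smash W)"
  shows "of_tensor a \<otimes>\<^bsub>smash W\<^esub> f = (\<lambda>w. a * f w)"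
proof
  fix w
  have "(\<Sum>u\<in>W. (if u = mat 1 then a else 0) * group_act u (f (matrix_inv u ** w))) =
    (\<Sum>u\<in>W. if u = mat 1 then a * f w else 0)" by (rule sum.cong) auto
  thus "(of_tensor a \<otimes>\<^bsub>smash W\<^esub> f) w = a * f w"
    using f fin by (auto simp: smash_mult smash_carrier of_tensor_def)
qed

definition grp :: "'n cmat \<Rightarrow> 'n smash_elt" where
  "grp w = group_sum {w} (\<lambda>_. 1)"

lemma grp_carrier [simp, intro]: "w \<in> W \<Longrightarrow> grp w \<in> carrier (smash W)"
  by (auto simp: grp_def)

lemma grp_mult:
  assumes f: "f \<in> carrier (smash W)" and u: "u \<in> W"
  shows "grp u \<otimes>\<^bsub>smash W\<^esub> f = (\<lambda>w. group_act u (f (matrix_inv u ** w)))"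
proof
  fix w
  have "(\<Sum>v\<in>W. (if v \<in> {u} then const 1 else 0) * group_act v (f (matrix_inv v ** w))) =
    (\<Sum>v\<in>W. if v = u then group_act u (f (matrix_inv u ** w)) else 0)" by (rule sum.cong) auto
  thus "(grp u \<otimes>\<^bsub>smash W\<^esub> f) w = group_act u (f (matrix_inv u ** w))"
    using f fin u by (auto simp: smash_mult smash_carrier group_sum_def grp_def group_act_hom W_minv)
qed

end

section \<open>Reflections\<close>

text \<open>A vector \<open>v0\<close> outside the common kernel determines the factor: every
  \<open>v\<close> differs from a multiple of \<open>v0\<close> by an element of the kernel.\<close>

lemma pairing_proportional:
  assumes "\<And>v. pairing a v = 0 \<longleftrightarrow> pairing b v = 0"
  shows "\<exists>k. k \<noteq> 0 \<and> a = k *s b"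
proof (cases "b = 0")
  case True
  have "a = 0" by (rule pairing_ext) (use True assms in simp)
  thus ?thesis using True by (intro exI[of _ 1]) auto
next
  case False
  then obtain v0 where v0: "pairing b v0 \<noteq> 0" by (metis pairing_ext pairing_zero(1))
  hence a0: "pairing a v0 \<noteq> 0" using assms by simp
  have "pairing a v = pairing ((pairing a v0 / pairing b v0) *s b) v" for v
  proof -
    have "pairing b (v - (pairing b v / pairing b v0) *s v0) = 0" using v0 by (simp add: pairing_diff pairing_scale)
    hence "pairing a (v - (pairing b v / pairing b v0) *s v0) = 0" using assms by simp
    thus ?thesis by (simp add: pairing_diff pairing_scale mult.commute)
  qed
  hence "a = (pairing a v0 / pairing b v0) *s b" by (rule pairing_ext)
  thus ?thesis using v0 a0 by (intro exI[of _ "pairing a v0 / pairing b v0"]) auto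
qed

text \<open>The rank is the dimension of the row space. Written as the image of all row vectors,
  this space is visibly transported by invertible factors.\<close>

lemma span_rows: "vec.span (rows A) = range (\<lambda>x. x v* (A :: complex^'n^'m))"
proof
  show "range (\<lambda>x. x v* A) \<subseteq> vec.span (rows A)"
  proof safe
    fix x
    have "x v* A = (\<Sum>i\<in>UNIV. (x $ i) *s row i A)"
      by (simp add: vector_matrix_mult_def vec_eq_iff row_def mult.commute)
    moreover have "(\<Sum>i\<in>UNIV. (x $ i) *s row i A) \<in> vec.span (rows A)"
      by (intro vec.span_sum vec.span_scale vec.span_base) (auto simp: rows_def)
    ultimately show "x v* A \<in> vec.span (rows A)" by simp
  qed
  have "rows A \<subseteq> range (\<lambda>x. x v* A)"
  proof
    fix r assume "r \<in> rows A"
    then obtain i where "r = row i A" by (auto simp: rows_def)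
    hence "r = axis i 1 v* A"
      by (simp add: vector_matrix_mult_def vec_eq_iff row_def axis_def if_distrib if_distribR cong: if_cong)
    thus "r \<in> range (\<lambda>x. x v* A)" by blast
  qed
  moreover have "vec.subspace (range (\<lambda>x. x v* A))"
    unfolding vec.subspace_def
  proof safe
    show "0 \<in> range (\<lambda>x. x v* A)" by (rule image_eqI[of _ _ 0]) auto
    show "x v* A + y v* A \<in> range (\<lambda>x. x v* A)" for x y
      by (rule image_eqI[of _ _ "x + y"]) (auto simp: vector_matrix_left_distrib)
    show "k *s (x v* A) \<in> range (\<lambda>x. x v* A)" for k x
      by (rule image_eqI[of _ _ "k *s x"]) (auto simp: vector_matrix_mult_def vec_eq_iff sum_distrib_left mult_ac)
  qed
  ultimately show "vec.span (rows A) \<subseteq> range (\<lambda>x. x v* A)" by (rule vec.span_minimal)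
qed

lemma rank_conj:
  fixes A P Q :: "complex^'n^'n"
  assumes PQ: "P ** Q = mat 1" "Q ** P = mat 1"
  shows "rank (P ** A ** Q) = rank A"
proof -
  have Pi: "x v* Q v* P = x" "x v* P v* Q = x" for x using PQ by (simp_all add: vector_matrix_mul_assoc)
  have "range (\<lambda>x. x v* (P ** A ** Q)) = (\<lambda>z. z v* Q) ` range (\<lambda>x. x v* A)"
  proof safe
    fix x
    show "x v* (P ** A ** Q) \<in> (\<lambda>z. z v* Q) ` range (\<lambda>x. x v* A)"
      by (rule image_eqI[of _ _ "x v* P v* A"]) (simp_all flip: vector_matrix_mul_assoc)
    show "x v* A v* Q \<in> range (\<lambda>x. x v* (P ** A ** Q))"
      by (rule image_eqI[of _ _ "x v* Q"]) (auto simp: Pi simp flip: vector_matrix_mul_assoc)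
  qed
  moreover have "vec.dim ((\<lambda>z. z v* Q) ` range (\<lambda>x. x v* A)) = vec.dim (range (\<lambda>x. x v* A))"
  proof (rule vec.dim_image_eq)
    show "Vector_Spaces.linear (*s) (*s) (\<lambda>z. z v* Q)"
      by unfold_locales (auto simp: vector_matrix_left_distrib vector_matrix_mult_def vec_eq_iff sum_distrib_left sum.distrib algebra_simps)
    show "inj_on (\<lambda>z. z v* Q) (vec.span (range (\<lambda>x. x v* A)))"
      by (rule inj_onI) (metis Pi(1))
  qed
  ultimately have "vec.dim (vec.span (rows (P ** A ** Q))) = vec.dim (vec.span (rows A))"
    by (simp only: span_rows)
  thus ?thesis by (simp add: row_rank_def_gen)
qed

lemma matrix_diff_distrib:
  fixes A B C :: "'a::comm_ring_1^'n^'n"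
  shows "A ** (B - C) = A ** B - A ** C" "(B - C) ** A = B ** A - C ** A"
  by (simp_all add: matrix_matrix_mult_def vec_eq_iff algebra_simps sum_subtractf)

lemma commute_mult:
  fixes z :: "'a::semigroup_mult"
  assumes "a * z = z * a" "b * z = z * b" shows "a * b * z = z * (a * b)"
proof -
  have "a * b * z = (a * z) * b" using assms(2) by (simp add: mult.assoc)
  thus ?thesis using assms(1) by (simp add: mult.assoc)
qed

text \<open>Intended for \<open>z = iota\<close>: equality after multiplication by \<open>z\<close>
  is a congruence as long as left factors commute with \<open>z\<close>.\<close>

lemma cong_mult_left:
  fixes z :: "'a::semigroup_mult"
  assumes "z * u = z * v" "a * z = z * a" shows "z * (a * u) = z * (a * v)"
proof -
  have "z * (a * u) = a * (z * u)" by (metis assms(2) mult.assoc)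
  also have "\<dots> = z * (a * v)" unfolding assms(1) by (metis assms(2) mult.assoc)
  finally show ?thesis .
qed

lemma cong_mult_right:
  fixes z :: "'a::semigroup_mult"
  assumes "z * u = z * v" shows "z * (u * a) = z * (v * a)"
  using assms by (simp flip: mult.assoc)

locale cherednik_data = matrix_group W for W :: "'n::finite cmat set" +
  fixes \<alpha> \<alpha>' :: "'n cmat \<Rightarrow> complex^'n" and lam c :: "'n cmat \<Rightarrow> complex"
  assumes rdata: "reflection_data W \<alpha> \<alpha>' lam" and conj_inv: "conj_invariant W c"
begin

abbreviation "SS \<equiv> reflections W"

lemma SS_W: "s \<in> SS \<Longrightarrow> s \<in> W"
  by (simp add: reflections_def)

definition rr :: "'n cmat \<Rightarrow> complex" where "rr s = pairing (\<alpha> s) (\<alpha>' s)"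

lemma refl_fix: "s \<in> SS \<Longrightarrow> pairing (\<alpha> s) v = 0 \<longleftrightarrow> s *v v = v"
  using rdata unfolding reflection_data_def by blast

lemma refl_dual: "s \<in> SS \<Longrightarrow> dual_act s (\<alpha> s) = lam s *s \<alpha> s"
  using rdata unfolding reflection_data_def by blast

lemma matrix_scale: "A *v (k *s x) = k *s (A *v (x::complex^'n))"
  by (simp add: vector_scalar_commute)

text \<open>The space is the sum of the fixed hyperplane and the line of the coroot. On that line
  \<open>s\<close> acts by \<open>1 / lam s\<close>, as evaluating the eigenvector equation of the
  form at the coroot shows.\<close>

lemma reflection_inverse:
  assumes s: "s \<in> SS"
  shows "rr s \<noteq> 0" "lam s \<noteq> 0" "lam s \<noteq> 1"
    "matrix_inv s *v v = v + ((lam s - 1) * pairing (\<alpha> s) v / rr s) *s \<alpha>' s"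
    "s *v v = v + ((1 / lam s - 1) * pairing (\<alpha> s) v / rr s) *s \<alpha>' s"
proof -
  obtain \<mu> where \<mu>: "\<alpha>' s \<noteq> 0" "\<mu> \<noteq> 1" "s *v \<alpha>' s = \<mu> *s \<alpha>' s"
    using s rdata unfolding reflection_data_def by blast
  have sW: "s \<in> W" using s by (rule SS_W)
  have "s *v \<alpha>' s \<noteq> \<alpha>' s"
  proof
    assume "s *v \<alpha>' s = \<alpha>' s"
    hence "(\<mu> - 1) *s \<alpha>' s = 0" using \<mu> by (simp add: vec_eq_iff algebra_simps)
    hence "\<mu> - 1 = 0 \<or> \<alpha>' s = 0" by (simp only: vector_mul_eq_0)
    thus False using \<mu> by auto
  qed
  thus rr0: "rr s \<noteq> 0" using refl_fix[OF s] by (simp add: rr_def)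
  have \<mu>0: "\<mu> \<noteq> 0"
  proof
    assume "\<mu> = 0"
    hence "s *v \<alpha>' s = 0" using \<mu> by simp
    hence "\<alpha>' s = 0" using W_vec2[OF sW, of "\<alpha>' s"] by simp
    thus False using \<mu> by simp
  qed
  have inv: "matrix_inv s *v \<alpha>' s = (1 / \<mu>) *s \<alpha>' s"
  proof -
    have "matrix_inv s *v (s *v \<alpha>' s) = \<mu> *s (matrix_inv s *v \<alpha>' s)" by (simp add: \<mu>(3) matrix_scale)
    hence "\<alpha>' s = \<mu> *s (matrix_inv s *v \<alpha>' s)" using sW by simp
    hence "(1 / \<mu>) *s \<alpha>' s = (1 / \<mu>) *s (\<mu> *s (matrix_inv s *v \<alpha>' s))" by simp
    thus ?thesis using \<mu>0 by (simp add: vector_smult_assoc)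
  qed
  have lam: "lam s = 1 / \<mu>"
  proof -
    have "pairing (dual_act s (\<alpha> s)) (\<alpha>' s) = (1 / \<mu>) * rr s"
      by (simp add: dual_act_def pairing_matrix inv pairing_scale rr_def)
    hence "lam s * rr s = (1 / \<mu>) * rr s" using s by (simp only: refl_dual pairing_scale rr_def)
    thus ?thesis using rr0 by (simp only: mult_cancel_right simp_thms)
  qed
  show "lam s \<noteq> 0" "lam s \<noteq> 1" using \<mu> \<mu>0 by (auto simp: lam)
  define t where "t = pairing (\<alpha> s) v / rr s"
  define v' where "v' = v - t *s \<alpha>' s"
  have "pairing (\<alpha> s) v' = 0" using rr0 by (simp add: v'_def pairing_diff pairing_scale t_def rr_def)
  hence v': "s *v v' = v'" using refl_fix[OF s] by simp
  hence v'i: "matrix_inv s *v v' = v'" using sW by (metis W_vec2)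
  have v: "v = v' + t *s \<alpha>' s" by (simp add: v'_def)
  have "matrix_inv s *v v = v' + (lam s * t) *s \<alpha>' s"
    by (subst v) (simp add: matrix_vector_right_distrib v'i matrix_scale inv lam vector_smult_assoc mult.commute)
  also have "\<dots> = v + ((lam s - 1) * t) *s \<alpha>' s" by (simp add: v'_def vec_eq_iff algebra_simps)
  finally show "matrix_inv s *v v = v + ((lam s - 1) * pairing (\<alpha> s) v / rr s) *s \<alpha>' s" by (simp add: t_def)
  have "s *v v = v' + (\<mu> * t) *s \<alpha>' s"
    by (subst v) (simp add: matrix_vector_right_distrib v' matrix_scale \<mu>(3) vector_smult_assoc mult.commute)
  also have "\<dots> = v + ((1 / lam s - 1) * t) *s \<alpha>' s" using \<mu>0 by (simp add: v'_def vec_eq_iff algebra_simps lam)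
  finally show "s *v v = v + ((1 / lam s - 1) * pairing (\<alpha> s) v / rr s) *s \<alpha>' s" by (simp add: t_def)
qed

lemma refl_ne_one: "s \<in> SS \<Longrightarrow> s \<noteq> mat 1"
  using refl_fix[of s "\<alpha>' s"] reflection_inverse(1)[of s] by (auto simp: rr_def)

lemma conj_reflection:
  assumes w: "w \<in> W" and s: "s \<in> SS"
  shows "w ** s ** matrix_inv w \<in> SS"
proof -
  let ?t = "w ** s ** matrix_inv w"
  have sW: "s \<in> W" using s by (rule SS_W)
  have tW: "?t \<in> W" using w sW by blast
  obtain k where k: "k > 0" "s [^]\<^bsub>GL\<^esub> (k::nat) = \<one>\<^bsub>GL\<^esub>" and r: "rank (s - mat 1) = 1"
    using s by (auto simp: reflections_def complex_reflection_def)
  have "?t [^]\<^bsub>GL\<^esub> (j::nat) = w ** (s [^]\<^bsub>GL\<^esub> j) ** matrix_inv w" for j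
  proof (induction j)
    case 0
    show ?case using w by (simp add: GL_def)
  next
    case (Suc j)
    have "?t [^]\<^bsub>GL\<^esub> Suc j = ?t [^]\<^bsub>GL\<^esub> j ** ?t" by (simp add: GL_def)
    thus ?case using w by (simp add: Suc) (simp add: GL_def matrix_mul_assoc)
  qed
  hence "?t [^]\<^bsub>GL\<^esub> k = \<one>\<^bsub>GL\<^esub>" using k w by (simp add: GL_def)
  moreover have "?t - mat 1 = w ** (s - mat 1) ** matrix_inv w"
    using w by (simp add: matrix_diff_distrib)
  hence "rank (?t - mat 1) = 1" using rank_conj[of w "matrix_inv w" "s - mat 1"] w r by simp
  moreover have "?t \<in> carrier GL" using tW subgroup.subset[OF W] by blast
  ultimately show ?thesis using tW k unfolding reflections_def complex_reflection_def by blast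
qed

lemma reflection_same_kernel:
  assumes "s \<in> SS" "t \<in> SS" "\<And>v. s *v v = v \<longleftrightarrow> t *v v = v"
  shows "\<exists>k. k \<noteq> 0 \<and> \<alpha> t = k *s \<alpha> s"
  by (rule pairing_proportional) (use assms in \<open>simp add: refl_fix\<close>)

text \<open>The form of \<open>t\<close> vanishes on the image under \<open>w\<close> of the
  hyperplane of \<open>s\<close>, which fixes it up to a factor. The factor is harmless because
  \<alpha> enters the Dunkl operators through a quotient of degree zero.\<close>

lemma conj_data:
  assumes w: "w \<in> W" and s: "s \<in> SS"
  defines "t \<equiv> w ** s ** matrix_inv w"
  shows "\<exists>k. k \<noteq> 0 \<and> \<alpha> t = k *s dual_act w (\<alpha> s)" "lam t = lam s" "c t = c s"
proof -
  have t: "t \<in> SS" using conj_reflection[OF w s] by (simp add: t_def)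
  have sW: "s \<in> W" "t \<in> W" using s t by (auto simp: SS_W)
  have "pairing (\<alpha> t) v = 0 \<longleftrightarrow> pairing (dual_act w (\<alpha> s)) v = 0" for v
  proof -
    have "t *v v = v \<longleftrightarrow> matrix_inv w *v (t *v v) = matrix_inv w *v v"
      using w by (metis W_vec1)
    also have "matrix_inv w *v (t *v v) = s *v (matrix_inv w *v v)"
      using w by (simp add: t_def matrix_vector_mul_assoc matrix_mul_assoc)
    finally show ?thesis using refl_fix[OF t] refl_fix[OF s] by (simp add: dual_act_def pairing_matrix)
  qed
  then obtain k where k: "k \<noteq> 0" "\<alpha> t = k *s dual_act w (\<alpha> s)" using pairing_proportional by blast
  thus "\<exists>k. k \<noteq> 0 \<and> \<alpha> t = k *s dual_act w (\<alpha> s)" by blast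
  have "dual_act t (dual_act w (\<alpha> s)) = dual_act w (dual_act s (\<alpha> s))"
    using w sW by (simp add: dual_act_mult, simp add: t_def)
  hence "dual_act t (\<alpha> t) = lam s *s \<alpha> t"
    using refl_dual[OF s] by (simp only: k dual_act_linear vector_smult_assoc) (simp add: mult.commute)
  hence "lam t *s \<alpha> t = lam s *s \<alpha> t" by (simp only: refl_dual[OF t])
  hence "(lam t - lam s) *s \<alpha> t = 0" by (simp add: vec_eq_iff algebra_simps)
  hence "lam t - lam s = 0 \<or> \<alpha> t = 0" by (simp only: vector_mul_eq_0)
  moreover have "\<alpha> t \<noteq> 0" using reflection_inverse(1)[OF t] by (auto simp: rr_def)
  ultimately show "lam t = lam s" by auto
  show "c t = c s" using conj_inv w s by (simp add: conj_invariant_def t_def)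
qed

section \<open>Dunkl operators at \<open>t = 0\<close>\<close>

text \<open>This is the diagonal action of the inverse of \<open>w\<close>, so that composing
  functions with it gives a left action of \<open>W\<close>.\<close>

definition act :: "'n cmat \<Rightarrow> 'n pt \<Rightarrow> 'n pt" where
  "act w = (\<lambda>(v, p). (matrix_inv w *v v, p v* w))"

definition Wop :: "'n cmat \<Rightarrow> 'n lop" where "Wop w = subop (act w)"

definition xop :: "complex^'n \<Rightarrow> 'n lop" where "xop x = mulop (\<lambda>(v, p). pairing x v)"

text \<open>In the commutator with \<open>xop\<close>, the difference of the values of
  \<open>x\<close> at the inverse image of \<open>v\<close> under \<open>s\<close> and at
  \<open>v\<close> produces a factor \<open>lam s - 1\<close>; the denominator here cancels it, up
  to the sign in the relation.\<close>

definition kk :: "'n cmat \<Rightarrow> complex" where "kk s = 2 * c s / (1 - lam s)"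

text \<open>The derivative of a usual Dunkl operator is replaced by its symbol \<open>p(y)\<close>.
  The reflection part carries \<open>s\<close> rather than \<open>s - 1\<close>, which keeps an
  additive constant out of the image of the Euler element.\<close>

definition dun :: "complex^'n \<Rightarrow> 'n lop" where
  "dun y = mulop (\<lambda>(v, p). pairing p y) +
     (\<Sum>s\<in>SS. mulop (\<lambda>(v, p). kk s * pairing (\<alpha> s) y / pairing (\<alpha> s) v) * Wop s)"

definition rt :: "'n tensor \<Rightarrow> 'n lop" where
  "rt = talg scal (\<lambda>l. case l of X i \<Rightarrow> xop (axis i 1) | Y i \<Rightarrow> dun (axis i 1))"

definition rho' :: "'n smash_elt \<Rightarrow> 'n lop" where
  "rho' f = (\<Sum>w\<in>W. rt (f w) * Wop w)"

lemma act_act: "\<lbrakk>u \<in> W; w \<in> W\<rbrakk> \<Longrightarrow> act u (act w x) = act (w ** u) x"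
  by (simp add: act_def minv_mult split_beta matrix_vector_mul_assoc vector_matrix_mul_assoc)

lemma act_one [simp]: "act (mat 1) x = x"
  by (simp add: act_def split_beta)

lemma Wop_mult: "\<lbrakk>u \<in> W; w \<in> W\<rbrakk> \<Longrightarrow> Wop u * Wop w = Wop (u ** w)"
  by (rule lop_eqI) (simp add: Wop_def act_act)

lemma Wop_one [simp]: "Wop (mat 1) = 1"
  by (rule lop_eqI) (simp add: Wop_def)

lemma xop_add: "xop (x + x') = xop x + xop x'"
  and xop_scale: "xop (k *s x) = scal k * xop x"
  by (rule lop_eqI; simp add: xop_def split_beta pairing_add pairing_scale algebra_simps)+

lemma ap_dun: "ap (dun y) f x = pairing (snd x) y * f x +
    (\<Sum>s\<in>SS. kk s * pairing (\<alpha> s) y / pairing (\<alpha> s) (fst x) * f (act s x))"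
  by (simp add: dun_def Wop_def split_beta)

lemma dun_add: "dun (y + y') = dun y + dun y'"
  by (rule lop_eqI) (simp add: ap_dun pairing_add ring_distribs add_divide_distrib sum.distrib)

lemma dun_scale: "dun (k *s y) = scal k * dun y"
  by (rule lop_eqI) (simp add: ap_dun pairing_scale ring_distribs sum_distrib_left mult_ac)

lemma dun_diff: "dun (y - y') = dun y - dun y'"
  using dun_add[of "y - y'" y'] by simp

lemma rt_simps [simp]: "rt (const k) = scal k" "rt (a + b) = rt a + rt b" "rt (a * b) = rt a * rt b"
   "rt 0 = 0" "rt 1 = 1" "rt (a - b) = rt a - rt b" "rt (\<Sum>i\<in>A. f i) = (\<Sum>i\<in>A. rt (f i))"
   "rt (gen (X i)) = xop (axis i 1)" "rt (gen (Y i)) = dun (axis i 1)"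
  by (simp_all add: rt_def scal_hom)

lemma rt_of_h [simp]: "rt (of_h y) = dun y"
proof -
  have "rt (of_h y) = (\<Sum>i\<in>UNIV. dun ((y $ i) *s axis i 1))" by (simp add: of_h_def dun_scale)
  also have "\<dots> = dun (\<Sum>i\<in>UNIV. (y $ i) *s axis i 1)"
  proof -
    have "dun 0 = 0" using dun_diff[of 0 0] by simp
    hence "(\<Sum>i\<in>A. dun (f i)) = dun (\<Sum>i\<in>A. f i)" for A and f :: "'n \<Rightarrow> complex^'n"
      by (induction A rule: infinite_finite_induct) (simp_all add: dun_add)
    thus ?thesis .
  qed
  finally show ?thesis by (simp add: vec_axis_sum)
qed

lemma rt_of_h_dual [simp]: "rt (of_h_dual y) = xop y"
proof -
  have "rt (of_h_dual y) = (\<Sum>i\<in>UNIV. xop ((y $ i) *s axis i 1))" by (simp add: of_h_dual_def xop_scale)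
  also have "\<dots> = xop (\<Sum>i\<in>UNIV. (y $ i) *s axis i 1)"
  proof -
    have "xop 0 = 0" using xop_add[of 0 0] by simp
    hence "(\<Sum>i\<in>A. xop (f i)) = xop (\<Sum>i\<in>A. f i)" for A and f :: "'n \<Rightarrow> complex^'n"
      by (induction A rule: infinite_finite_induct) (simp_all add: xop_add)
    thus ?thesis .
  qed
  finally show ?thesis by (simp add: vec_axis_sum)
qed

lemma Wop_xop: "w \<in> W \<Longrightarrow> Wop w * xop x = xop (dual_act w x) * Wop w"
  by (rule lop_eqI) (simp add: Wop_def xop_def act_def split_beta dual_act_def pairing_matrix)

text \<open>Conjugation by \<open>w\<close> permutes the reflections, and each summand is carried to
  the summand of the conjugate. This is valid on the hyperplanes too: corresponding denominators
  vanish together and both quotients are then 0.\<close>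

lemma Wop_dun:
  assumes w: "w \<in> W"
  shows "Wop w * dun y = dun (w *v y) * Wop w"
proof (rule lop_eqI)
  fix f x
  have "(\<Sum>s\<in>SS. kk s * pairing (\<alpha> s) (w *v y) / pairing (\<alpha> s) (fst x) * f (act w (act s x))) =
    (\<Sum>s\<in>SS. kk s * pairing (\<alpha> s) y / pairing (\<alpha> s) (matrix_inv w *v fst x) * f (act s (act w x)))" (is "?l = ?r")
  proof -
    have "?l = (\<Sum>s\<in>SS. let t = w ** s ** matrix_inv w in
       kk t * pairing (\<alpha> t) (w *v y) / pairing (\<alpha> t) (fst x) * f (act w (act t x)))"
      unfolding Let_def
    proof (rule sum.reindex_bij_witness[of _ "\<lambda>s. w ** s ** matrix_inv w" "\<lambda>s. matrix_inv w ** s ** w"])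
      fix s assume "s \<in> SS"
      thus "matrix_inv w ** s ** w \<in> SS" using conj_reflection[of "matrix_inv w" s] w by (simp add: W_minv)
      show "w ** s ** matrix_inv w \<in> SS" using conj_reflection \<open>s \<in> SS\<close> w by blast
    qed (use w in \<open>simp_all add: matrix_mul_assoc\<close>)
    also have "\<dots> = ?r"
    proof (rule sum.cong)
      fix s assume s: "s \<in> SS"
      define t where "t = w ** s ** matrix_inv w"
      from conj_data[OF w s] obtain k where k: "k \<noteq> 0" "\<alpha> t = k *s dual_act w (\<alpha> s)" "lam t = lam s" "c t = c s"
        unfolding t_def by blast
      have "t \<in> W" "s \<in> W" using conj_reflection[OF w s] s SS_W by (auto simp: t_def)
      hence "act w (act t x) = act s (act w x)" using w by (simp add: act_act) (simp add: t_def)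
      thus "(let t = w ** s ** matrix_inv w in kk t * pairing (\<alpha> t) (w *v y) / pairing (\<alpha> t) (fst x) * f (act w (act t x))) =
         kk s * pairing (\<alpha> s) y / pairing (\<alpha> s) (matrix_inv w *v fst x) * f (act s (act w x))"
        unfolding t_def[symmetric] Let_def using w
        by (simp add: k kk_def pairing_scale dual_act_def pairing_matrix)
    qed simp
    finally show ?thesis .
  qed
  thus "ap (Wop w * dun y) f x = ap (dun (w *v y) * Wop w) f x"
    by (simp add: ap_dun Wop_def) (simp add: act_def split_beta pairing_matrix)
qed

lemma Wop_rt: "w \<in> W \<Longrightarrow> Wop w * rt a = rt (group_act w a) * Wop w"
proof (induction a rule: tensor_induct)
  case (const k)
  show ?case by (simp add: group_act_hom scal_commute)
next
  case (gen l)
  thus ?case by (cases l) (simp_all add: group_act_gen Wop_xop Wop_dun)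
next
  case (add a b)
  thus ?case by (simp add: group_act_hom distrib_left distrib_right)
next
  case (mult a b)
  have "Wop w * rt (a * b) = (Wop w * rt a) * rt b" by (simp add: mult.assoc)
  also have "\<dots> = rt (group_act w a) * (Wop w * rt b)" using mult by (simp add: mult.assoc)
  finally show ?case using mult by (simp add: group_act_hom mult.assoc)
qed

lemma rho'_add: "rho' (\<lambda>w. f w + g w) = rho' f + rho' g"
  by (simp add: rho'_def distrib_right sum.distrib)

lemma rho'_diff: "rho' (\<lambda>w. f w - g w) = rho' f - rho' g"
  by (simp add: rho'_def left_diff_distrib sum_subtractf)

lemma rho'_tensor_left: "rho' (\<lambda>w. a * f w) = rt a * rho' f"
  by (simp add: rho'_def sum_distrib_left mult.assoc)

lemma rho'_of_tensor [simp]: "rho' (of_tensor a) = rt a"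
proof -
  have "rho' (of_tensor a) = (\<Sum>w\<in>W. if w = mat 1 then rt a else 0)"
    unfolding rho'_def by (rule sum.cong) (auto simp: of_tensor_def)
  thus ?thesis using fin by simp
qed

lemma rho'_group_sum: "S \<subseteq> W \<Longrightarrow> rho' (group_sum S a) = (\<Sum>w\<in>S. scal (a w) * Wop w)"
proof -
  assume S: "S \<subseteq> W"
  have "rho' (group_sum S a) = (\<Sum>w\<in>W. if w \<in> S then scal (a w) * Wop w else 0)"
    unfolding rho'_def by (rule sum.cong) (auto simp: group_sum_def)
  also have "\<dots> = (\<Sum>w\<in>W \<inter> S. scal (a w) * Wop w)" using fin by (simp add: sum.inter_restrict)
  finally show ?thesis using S by (simp add: Int_absorb1)
qed

lemma rho'_mult:
  "rho' (f \<otimes>\<^bsub>smash W\<^esub> g) = rho' f * rho' g"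
proof -
  have "rho' (f \<otimes>\<^bsub>smash W\<^esub> g) = (\<Sum>w\<in>W. \<Sum>u\<in>W. rt (f u) * (rt (group_act u (g (matrix_inv u ** w))) * Wop w))"
    unfolding rho'_def by (rule sum.cong) (auto simp: smash_mult sum_distrib_right mult.assoc)
  also have "\<dots> = (\<Sum>u\<in>W. \<Sum>w\<in>W. rt (f u) * (rt (group_act u (g (matrix_inv u ** w))) * Wop w))"
    by (rule sum.swap)
  also have "\<dots> = (\<Sum>u\<in>W. \<Sum>v\<in>W. rt (f u) * (rt (group_act u (g v)) * Wop (u ** v)))"
  proof (rule sum.cong)
    fix u assume "u \<in> W"
    from sum_W_left[OF this, of "\<lambda>w. rt (f u) * (rt (group_act u (g (matrix_inv u ** w))) * Wop w)"] this
    show "(\<Sum>w\<in>W. rt (f u) * (rt (group_act u (g (matrix_inv u ** w))) * Wop w)) =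
      (\<Sum>v\<in>W. rt (f u) * (rt (group_act u (g v)) * Wop (u ** v)))" by simp
  qed simp
  also have "\<dots> = (\<Sum>u\<in>W. \<Sum>v\<in>W. (rt (f u) * Wop u) * (rt (g v) * Wop v))"
  proof (intro sum.cong refl)
    fix u v assume uv: "u \<in> W" "v \<in> W"
    have "(rt (f u) * Wop u) * (rt (g v) * Wop v) = rt (f u) * (Wop u * rt (g v)) * Wop v" by (simp add: mult.assoc)
    also have "\<dots> = rt (f u) * (rt (group_act u (g v)) * (Wop u * Wop v))" using uv by (simp add: Wop_rt mult.assoc)
    finally show "rt (f u) * (rt (group_act u (g v)) * Wop (u ** v)) = (rt (f u) * Wop u) * (rt (g v) * Wop v)"
      using uv by (simp add: Wop_mult)
  qed
  finally show ?thesis by (simp add: rho'_def sum_product)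
qed

lemma rho'_one: "rho' \<one>\<^bsub>smash W\<^esub> = 1"
  using rho'_of_tensor[of 1] by (simp add: smash_simps of_tensor_def)

lemma rho'_smult: "rho' (k \<odot>\<^bsub>smash W\<^esub> f) = scal k * rho' f"
  by (simp add: smash_simps rho'_tensor_left)

text \<open>Trivial stabilisers are required, not merely nonvanishing of the forms: free orbits make
  the coefficients of an operator unique. Nonvanishing follows in \<open>reg_alpha\<close>.\<close>

definition reg :: "(complex^'n) set" where
  "reg = {v. \<forall>w\<in>W. w \<noteq> mat 1 \<longrightarrow> w *v v \<noteq> v}"

text \<open>
  Cutting down to \<open>v \<in> reg\<close> discards the junk values of the Dunkl operators on the hyperplanes;
  the relations of the algebra hold only after multiplication by this idempotent.
\<close>

definition iota :: "'n lop" where "iota = mulop (\<lambda>(v, p). of_bool (v \<in> reg))"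

lemma reg_stable [simp]: "w \<in> W \<Longrightarrow> w *v v \<in> reg \<longleftrightarrow> v \<in> reg"
proof -
  have *: "w *v v \<in> reg" if w: "w \<in> W" and v: "v \<in> reg" for w v
    unfolding reg_def
  proof safe
    fix u assume u: "u \<in> W" "u \<noteq> mat 1" "u *v (w *v v) = w *v v"
    have "(matrix_inv w ** u ** w) *v v = matrix_inv w *v (u *v (w *v v))"
      using w by (simp add: matrix_vector_mul_assoc matrix_mul_assoc)
    hence "(matrix_inv w ** u ** w) *v v = v" using w u by simp
    moreover have "matrix_inv w ** u ** w \<in> W" using w u by blast
    ultimately have e: "matrix_inv w ** u ** w = mat 1" using v by (auto simp: reg_def)
    have "u = w ** (matrix_inv w ** u ** w) ** matrix_inv w"
      using w by (simp add: matrix_mul_assoc)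
    hence "u = mat 1" using w by (simp add: e)
    thus False using u by simp
  qed
  assume w: "w \<in> W"
  show ?thesis using *[OF w, of v] *[OF W_minv[OF w], of "w *v v"] w by auto
qed

lemma reg_act [simp]: "w \<in> W \<Longrightarrow> fst (act w x) \<in> reg \<longleftrightarrow> fst x \<in> reg"
  by (simp add: act_def split_beta W_minv)

lemma reg_alpha: "\<lbrakk>v \<in> reg; s \<in> SS\<rbrakk> \<Longrightarrow> pairing (\<alpha> s) v \<noteq> 0"
  using refl_fix[of s v] refl_ne_one SS_W by (auto simp: reg_def)

lemma act_inj:
  assumes "fst x \<in> reg" "u \<in> W" "w \<in> W"
  shows "act u x = act w x \<longleftrightarrow> u = w"
proof
  assume "act u x = act w x"
  hence "matrix_inv u *v fst x = matrix_inv w *v fst x" by (auto simp: act_def split_beta)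
  hence "(w ** matrix_inv u) *v fst x = fst x" using assms by (simp flip: matrix_vector_mul_assoc)
  moreover have "w ** matrix_inv u \<in> W" using assms by blast
  ultimately have "w ** matrix_inv u = mat 1" using assms(1) by (auto simp: reg_def)
  hence "w ** matrix_inv u ** u = u" by simp
  thus "u = w" using assms by simp
qed simp

lemma ap_iota: "ap iota f x = (if fst x \<in> reg then f x else 0)"
  by (simp add: iota_def split_beta)

lemma iota_idem [simp]: "iota * iota = iota"
  by (rule lop_eqI) (simp add: ap_iota)

lemma iota_mulop: "mulop \<phi> * iota = iota * mulop \<phi>"
  by (simp add: iota_def mulop_commute)

lemma iota_Wop: "w \<in> W \<Longrightarrow> Wop w * iota = iota * Wop w"
  by (rule lop_eqI) (simp add: ap_iota Wop_def)

lemma iota_dun: "dun y * iota = iota * dun y"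
proof -
  have *: "mulop \<phi> * Wop s * iota = iota * (mulop \<phi> * Wop s)" if "s \<in> SS" for s \<phi>
    using iota_mulop[of \<phi>] iota_Wop[OF SS_W[OF that]] by (rule commute_mult)
  show ?thesis
    unfolding dun_def by (simp add: distrib_left distrib_right sum_distrib_left sum_distrib_right * iota_mulop)
qed

lemma iota_rt: "rt a * iota = iota * rt a"
proof (induction a rule: tensor_induct)
  case (gen l)
  show ?case by (cases l) (simp_all add: iota_dun xop_def iota_mulop)
next
  case (mult a b)
  thus ?case by (simp add: commute_mult)
qed (simp_all add: scal_commute distrib_left distrib_right)

lemma iota_rho': "rho' f * iota = iota * rho' f"
proof -
  have "rt a * Wop w * iota = iota * (rt a * Wop w)" if "w \<in> W" for a w
    using iota_rt[of a] iota_Wop[OF that] by (rule commute_mult)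
  thus ?thesis by (simp add: rho'_def sum_distrib_left sum_distrib_right)
qed

definition rho :: "'n smash_elt \<Rightarrow> 'n lop" where "rho f = iota * rho' f"

lemma rho_mult: "rho (f \<otimes>\<^bsub>smash W\<^esub> g) = rho f * rho g"
proof -
  have "rho f * rho g = iota * (rho' f * iota) * rho' g" by (simp add: rho_def mult.assoc)
  also have "\<dots> = rho (f \<otimes>\<^bsub>smash W\<^esub> g)" by (simp add: iota_rho' rho_def rho'_mult flip: mult.assoc)
  finally show ?thesis by simp
qed

lemma rho_add: "rho (f \<oplus>\<^bsub>smash W\<^esub> g) = rho f + rho g"
  by (simp add: rho_def smash_simps rho'_add distrib_left)

lemma rho_minus: "g \<in> carrier (smash W) \<Longrightarrow> rho (f \<ominus>\<^bsub>smash W\<^esub> g) = rho f - rho g"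
  by (simp add: rho_def smash_minus rho'_diff right_diff_distrib)

lemma rho_smult: "rho (k \<odot>\<^bsub>smash W\<^esub> f) = scal k * rho f"
  by (simp add: rho_def rho'_smult scal_commute[of iota] flip: mult.assoc)

lemma rho_one: "rho \<one>\<^bsub>smash W\<^esub> = iota"
  by (simp add: rho_def rho'_one)

lemma rho_zero: "rho (\<lambda>w. 0) = 0"
  by (simp add: rho_def rho'_def)

definition kap :: "'n cmat \<Rightarrow> complex^'n \<Rightarrow> complex^'n \<Rightarrow> complex" where
  "kap s x y = 2 * c s / pairing (\<alpha> s) (\<alpha>' s) * pairing x (\<alpha>' s) * pairing (\<alpha> s) y"

text \<open>Multiplications commute with each other, so only the reflection terms survive. The
  change of \<open>x\<close> under a reflection is proportional to the value of the form at
  \<open>v\<close> and cancels the pole.\<close>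

lemma dun_xop: "iota * (dun y * xop x - xop x * dun y) = iota * - (\<Sum>s\<in>SS. scal (kap s x y) * Wop s)"
proof (rule lop_eqI)
  fix f and z :: "'n pt"
  show "ap (iota * (dun y * xop x - xop x * dun y)) f z = ap (iota * - (\<Sum>s\<in>SS. scal (kap s x y) * Wop s)) f z"
  proof (cases "fst z \<in> reg")
    case True
    have "ap (dun y * xop x - xop x * dun y) f z =
      (\<Sum>s\<in>SS. kk s * pairing (\<alpha> s) y / pairing (\<alpha> s) (fst z) * (pairing x (matrix_inv s *v fst z) - pairing x (fst z)) * f (act s z))"
      by (simp add: ap_dun xop_def split_beta sum_distrib_left algebra_simps sum_subtractf diff_divide_distrib)
        (simp add: act_def split_beta)
    also have "\<dots> = (\<Sum>s\<in>SS. - (kap s x y * f (act s z)))"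
    proof (rule sum.cong)
      fix s assume s: "s \<in> SS"
      have "kk s * pairing (\<alpha> s) y / pairing (\<alpha> s) (fst z) * (pairing x (matrix_inv s *v fst z) - pairing x (fst z)) = - kap s x y"
        using reg_alpha[OF True s] reflection_inverse(1,3)[OF s]
        by (simp add: reflection_inverse(4)[OF s] pairing_add pairing_scale kk_def kap_def flip: rr_def) (simp add: field_simps)
      thus "kk s * pairing (\<alpha> s) y / pairing (\<alpha> s) (fst z) * (pairing x (matrix_inv s *v fst z) - pairing x (fst z)) * f (act s z)
        = - (kap s x y * f (act s z))" by simp
    qed simp
    finally show ?thesis using True by (simp add: ap_iota Wop_def sum_negf)
  qed (simp add: ap_iota)
qed

text \<open>Over regular points the operator lies in the smash product of all functions with
  \<open>W\<close>. The behaviour elsewhere is left open, and multiplication by \<open>iota\<close>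
  removes it.\<close>

definition coeffs :: "'n lop \<Rightarrow> ('n cmat \<Rightarrow> 'n pt \<Rightarrow> complex) \<Rightarrow> bool" where
  "coeffs T g \<longleftrightarrow> (\<forall>f x. fst x \<in> reg \<longrightarrow> ap T f x = (\<Sum>w\<in>W. g w x * f (act w x)))"

lemma coeffsD: "coeffs T g \<Longrightarrow> fst x \<in> reg \<Longrightarrow> ap T f x = (\<Sum>w\<in>W. g w x * f (act w x))"
  unfolding coeffs_def by blast

lemma coeffs_mulop: "coeffs (mulop \<phi>) (\<lambda>w x. of_bool (w = mat 1) * \<phi> x)"
  using fin by (simp add: coeffs_def mult.assoc)

lemma coeffs_Wop: "u \<in> W \<Longrightarrow> coeffs (Wop u) (\<lambda>w x. of_bool (w = u))"
  using fin by (simp add: coeffs_def Wop_def)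

lemma coeffs_add: "\<lbrakk>coeffs S g; coeffs T h\<rbrakk> \<Longrightarrow> coeffs (S + T) (\<lambda>w x. g w x + h w x)"
  by (auto simp: coeffs_def distrib_right sum.distrib)

lemma coeffs_diff: "\<lbrakk>coeffs S g; coeffs T h\<rbrakk> \<Longrightarrow> coeffs (S - T) (\<lambda>w x. g w x - h w x)"
  by (auto simp: coeffs_def left_diff_distrib sum_subtractf)

lemma coeffs_mult:
  assumes "coeffs S g" "coeffs T h"
  shows "coeffs (S * T) (\<lambda>w x. \<Sum>u\<in>W. g u x * h (matrix_inv u ** w) (act u x))"
  unfolding coeffs_def
proof safe
  fix f :: "'n pt \<Rightarrow> complex" and v p :: "complex^'n" assume v: "fst (v, p) \<in> reg"
  let ?x = "(v, p)"
  have "ap (S * T) f ?x = (\<Sum>u\<in>W. \<Sum>w\<in>W. g u ?x * h w (act u ?x) * f (act (u ** w) ?x))"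
    using v by (simp add: coeffsD[OF assms(1)] coeffsD[OF assms(2)] sum_distrib_left act_act mult.assoc cong: sum.cong)
  also have "\<dots> = (\<Sum>u\<in>W. \<Sum>w\<in>W. g u ?x * h (matrix_inv u ** w) (act u ?x) * f (act w ?x))"
  proof (rule sum.cong)
    fix u assume "u \<in> W"
    from sum_W_left[OF this, of "\<lambda>w. g u ?x * h (matrix_inv u ** w) (act u ?x) * f (act w ?x)"] this
    show "(\<Sum>w\<in>W. g u ?x * h w (act u ?x) * f (act (u ** w) ?x)) =
      (\<Sum>w\<in>W. g u ?x * h (matrix_inv u ** w) (act u ?x) * f (act w ?x))" by simp
  qed simp
  also have "\<dots> = (\<Sum>w\<in>W. (\<Sum>u\<in>W. g u ?x * h (matrix_inv u ** w) (act u ?x)) * f (act w ?x))"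
    by (subst sum.swap) (simp add: sum_distrib_right)
  finally show "ap (S * T) f ?x = (\<Sum>w\<in>W. (\<Sum>u\<in>W. g u ?x * h (matrix_inv u ** w) (act u ?x)) * f (act w ?x))" .
qed

text \<open>The orbit of a regular point is free, so the indicator function of
  \<open>act w x\<close> sees a single coefficient.\<close>

lemma coeffs_unique:
  assumes "coeffs T g" "fst x \<in> reg" "w \<in> W"
  shows "g w x = ap T (\<lambda>z. of_bool (z = act w x)) x"
proof -
  have "ap T (\<lambda>z. of_bool (z = act w x)) x = (\<Sum>u\<in>W. g u x * of_bool (act u x = act w x))"
    using assms by (simp add: coeffsD)
  also have "\<dots> = (\<Sum>u\<in>W. if u = w then g u x else 0)"
    by (rule sum.cong) (use assms act_inj in auto)
  finally show ?thesis using fin assms by simp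
qed

lemma coeffs_sum: "(\<And>i. i \<in> A \<Longrightarrow> \<exists>g. coeffs (T i) g) \<Longrightarrow> \<exists>g. coeffs (\<Sum>i\<in>A. T i) g"
proof (induction A rule: infinite_finite_induct)
  case (insert i A)
  have "\<exists>g. coeffs (T i) g" using insert.prems by blast
  then obtain g where g: "coeffs (T i) g" by blast
  have "\<exists>g. coeffs (\<Sum>i\<in>A. T i) g" by (rule insert.IH) (use insert.prems in blast)
  then obtain h where h: "coeffs (\<Sum>i\<in>A. T i) h" by blast
  from coeffs_add[OF g h] show ?case using insert by auto
qed (auto simp: coeffs_def intro!: exI[of _ "\<lambda>w x. 0"])

lemma coeffs_dun: "\<exists>g. coeffs (dun y) g"
  unfolding dun_def using coeffs_sum coeffs_mulop coeffs_Wop SS_W coeffs_mult coeffs_add by meson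

lemma coeffs_rt: "\<exists>g. coeffs (rt a) g"
proof (induction a rule: tensor_induct)
  case (const k)
  show ?case using coeffs_mulop by (auto simp: scal_def)
next
  case (gen l)
  show ?case using coeffs_mulop coeffs_dun by (cases l) (auto simp: xop_def)
next
  case (add a b)
  thus ?case using coeffs_add by fastforce
next
  case (mult a b)
  thus ?case using coeffs_mult by fastforce
qed

lemma coeffs_rho: "\<exists>g. coeffs (rho f) g"
  unfolding rho_def rho'_def iota_def using coeffs_sum coeffs_mulop coeffs_Wop coeffs_mult coeffs_rt by meson

text \<open>
  By the Jacobi identity the commutator of two Dunkl operators commutes with all \<open>x\<close>, so only
  its coefficient at the identity can be nonzero, and that one is symmetric.
\<close>

lemma dun_commute: "iota * (dun y * dun y' - dun y' * dun y) = 0"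
proof -
  define a b E where "a = dun y" and "b = dun y'" and "E = a * b - b * a"
  obtain g where g: "coeffs E g" unfolding E_def a_def b_def using coeffs_dun coeffs_mult coeffs_diff by meson
  \<comment> \<open>The Jacobi identity expresses this through the commutators of \<open>a\<close>
    and \<open>b\<close> with \<open>x\<close>, which \<open>dun_xop\<close> turns into the group
    algebra elements \<open>- K\<close> and \<open>- K'\<close>.\<close>
  have comm: "iota * (E * xop x - xop x * E) = 0" for x
  proof -
    define K K' where "K = (\<Sum>s\<in>SS. scal (kap s x y) * Wop s)" and "K' = (\<Sum>s\<in>SS. scal (kap s x y') * Wop s)"
    have ia: "a * iota = iota * a" "b * iota = iota * b" by (simp_all add: a_def b_def iota_dun)
    have 1: "iota * (a * xop x - xop x * a) = iota * - K" "iota * (b * xop x - xop x * b) = iota * - K'"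
      by (simp_all only: a_def b_def K_def K'_def dun_xop)
    have A: "iota * (a * (b * xop x - xop x * b)) = iota * (a * - K')"
      by (rule cong_mult_left[OF 1(2) ia(1)])
    have B: "iota * ((b * xop x - xop x * b) * a) = iota * (- K' * a)"
      by (rule cong_mult_right[OF 1(2)])
    have C: "iota * (b * (a * xop x - xop x * a)) = iota * (b * - K)"
      by (rule cong_mult_left[OF 1(1) ia(2)])
    have D: "iota * ((a * xop x - xop x * a) * b) = iota * (- K * b)"
      by (rule cong_mult_right[OF 1(1)])
    have "iota * (E * xop x - xop x * E) = iota * (a * (b * xop x - xop x * b)) - iota * ((b * xop x - xop x * b) * a)
       - iota * (b * (a * xop x - xop x * a)) + iota * ((a * xop x - xop x * a) * b)"
      by (simp add: E_def algebra_simps)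
    also have "\<dots> = iota * (- (a * K' - K' * a) + (b * K - K * b))"
      unfolding A B C D by (simp add: algebra_simps)
    also have "a * K' - K' * a = b * K - K * b"
    proof -
      have *: "dun y * (scal k * Wop s) - scal k * Wop s * dun y =
          scal (k * ((1 - 1 / lam s) * pairing (\<alpha> s) y / rr s)) * dun (\<alpha>' s) * Wop s"
        if s: "s \<in> SS" for s k y
      proof -
        have "dun y * (scal k * Wop s) = scal k * (dun y * Wop s)" by (simp add: scal_commute[of "dun y"] flip: mult.assoc)
        moreover have "scal k * Wop s * dun y = scal k * (dun (s *v y) * Wop s)"
          using Wop_dun[OF SS_W[OF s], of y] by (simp add: mult.assoc)
        ultimately have "dun y * (scal k * Wop s) - scal k * Wop s * dun y = scal k * (dun (y - s *v y) * Wop s)"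
          by (simp only: dun_diff right_diff_distrib left_diff_distrib)
        also have "y - s *v y = ((1 - 1 / lam s) * pairing (\<alpha> s) y / rr s) *s \<alpha>' s"
          unfolding reflection_inverse(5)[OF s] by (simp add: vec_eq_iff algebra_simps diff_divide_distrib)
        finally have "dun y * (scal k * Wop s) - scal k * Wop s * dun y = scal k * (dun (((1 - 1 / lam s) * pairing (\<alpha> s) y / rr s) *s \<alpha>' s) * Wop s)" .
        thus ?thesis by (simp only: dun_scale scalar_homD[OF scal_hom] mult.assoc)
      qed
      have "a * K' - K' * a = (\<Sum>s\<in>SS. dun y * (scal (kap s x y') * Wop s) - scal (kap s x y') * Wop s * dun y)"
        by (simp add: a_def K'_def sum_distrib_left sum_distrib_right sum_subtractf)
      also have "\<dots> = (\<Sum>s\<in>SS. dun y' * (scal (kap s x y) * Wop s) - scal (kap s x y) * Wop s * dun y')"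
      proof (rule sum.cong)
        fix s assume s: "s \<in> SS"
        \<comment> \<open>The product is symmetric in \<open>y\<close> and \<open>y'\<close>, each
          of which occurs only through its pairing with the form of \<open>s\<close>.\<close>
        have "kap s x y' * ((1 - 1 / lam s) * pairing (\<alpha> s) y / rr s) = kap s x y * ((1 - 1 / lam s) * pairing (\<alpha> s) y' / rr s)"
          by (simp add: kap_def)
        thus "dun y * (scal (kap s x y') * Wop s) - scal (kap s x y') * Wop s * dun y =
          dun y' * (scal (kap s x y) * Wop s) - scal (kap s x y) * Wop s * dun y'"
          by (simp only: *[OF s])
      qed simp
      also have "\<dots> = b * K - K * b"
        by (simp add: b_def K_def sum_distrib_left sum_distrib_right sum_subtractf)
      finally show ?thesis .
    qed
    finally show ?thesis by simp
  qed
  \<comment> \<open>A linear form \<open>x\<close> that distinguishes the two base points has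
    different eigenvalues on the left and on the right of the commutator, which forces the
    coefficient to vanish.\<close>
  have off: "g w z = 0" if z: "fst z \<in> reg" and w: "w \<in> W" "w \<noteq> mat 1" for w z
  proof -
    let ?d = "\<lambda>u. of_bool (u = act w z)"
    have "matrix_inv w *v fst z \<noteq> fst z"
    proof
      assume "matrix_inv w *v fst z = fst z"
      hence "w *v fst z = fst z" using W_vec1[OF w(1), of "fst z"] by simp
      thus False using z w by (auto simp: reg_def)
    qed
    then obtain x where x: "pairing x (matrix_inv w *v fst z) \<noteq> pairing x (fst z)" using pairing_ext2 by blast
    have xd: "ap (xop x) ?d = (\<lambda>u. pairing x (matrix_inv w *v fst z) * ?d u)"
      by (auto simp: xop_def fun_eq_iff act_def split_beta)
    have "0 = ap (iota * (E * xop x - xop x * E)) ?d z" by (simp add: comm)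
    also have "\<dots> = (pairing x (matrix_inv w *v fst z) - pairing x (fst z)) * ap E ?d z"
    proof -
      have "ap (iota * (E * xop x - xop x * E)) ?d z = ap E (ap (xop x) ?d) z - ap (xop x) (ap E ?d) z"
        using z by (simp add: ap_iota)
      also have "ap E (ap (xop x) ?d) = (\<lambda>u. pairing x (matrix_inv w *v fst z) * ap E ?d u)"
        unfolding xd by (rule ap_scale)
      finally show ?thesis by (simp add: xop_def split_beta left_diff_distrib)
    qed
    also have "ap E ?d z = g w z" using coeffs_unique[OF g z w(1)] by simp
    finally show ?thesis using x by simp
  qed
  have one: "g (mat 1) z = 0" if z: "fst z \<in> reg" for z
  proof -
    let ?d = "\<lambda>u. of_bool (u = z)"
    have dd: "ap (dun y * dun y') ?d z = pairing (snd z) y * pairing (snd z) y' +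
       (\<Sum>s\<in>SS. \<Sum>t\<in>SS. of_bool (s ** t = mat 1) * (kk s * pairing (\<alpha> s) y / pairing (\<alpha> s) (fst z) * (kk t * pairing (\<alpha> t) y' / pairing (\<alpha> t) (matrix_inv s *v fst z))))" for y y'
    proof -
      have ne: "act s z \<noteq> z" if "s \<in> SS" for s
        using act_inj[OF z SS_W[OF that] W_one] refl_ne_one[OF that] by simp
      have "act t (act s z) = z \<longleftrightarrow> s ** t = mat 1" if "s \<in> SS" "t \<in> SS" for s t
        using act_inj[OF z _ W_one, of "s ** t"] that SS_W by (simp add: act_act W_mult)
      hence "ap (dun y') ?d (act s z) = (\<Sum>t\<in>SS. of_bool (s ** t = mat 1) * (kk t * pairing (\<alpha> t) y' / pairing (\<alpha> t) (matrix_inv s *v fst z)))"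
        if "s \<in> SS" for s using that ne[OF that] unfolding ap_dun by (simp add: mult.commute) (simp add: act_def split_beta)
      moreover have "ap (dun y') ?d z = pairing (snd z) y'" using ne by (simp add: ap_dun)
      ultimately show ?thesis
        by (simp add: ap_dun[of y] sum_distrib_left mult_ac cong: sum.cong)
    qed
    \<comment> \<open>Only pairs of mutually inverse reflections contribute at the identity. Their
      forms have the same kernel, hence are proportional, so exchanging \<open>y\<close> and
      \<open>y'\<close> changes nothing.\<close>
    have sw: "of_bool (s ** t = mat 1) * (kk s * pairing (\<alpha> s) y / pairing (\<alpha> s) (fst z) * (kk t * pairing (\<alpha> t) y' / pairing (\<alpha> t) (matrix_inv s *v fst z)))
      = of_bool (s ** t = mat 1) * (kk s * pairing (\<alpha> s) y' / pairing (\<alpha> s) (fst z) * (kk t * pairing (\<alpha> t) y / pairing (\<alpha> t) (matrix_inv s *v fst z)))"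
      if s: "s \<in> SS" and t: "t \<in> SS" for s t
    proof (cases "s ** t = mat 1")
      case True
      have "t = matrix_inv s" using True SS_W[OF s] W_assoc2[of s t] by simp
      hence "s *v v = v \<longleftrightarrow> t *v v = v" for v using SS_W[OF s] by (metis W_vec1 W_vec2)
      then obtain k where "\<alpha> t = k *s \<alpha> s" using reflection_same_kernel[OF s t] by blast
      thus ?thesis by (simp add: pairing_scale)
    qed simp
    have "ap (dun y * dun y') ?d z = ap (dun y' * dun y) ?d z" unfolding dd
      by (intro arg_cong2[where f = "(+)"] sum.cong refl sw mult.commute)
    hence "ap E ?d z = 0" by (simp add: E_def a_def b_def)
    thus ?thesis using coeffs_unique[OF g z W_one] by simp
  qed
  have "ap (iota * E) f z = ap 0 f z" for f z
  proof (cases "fst z \<in> reg")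
    case True
    hence "g w z = 0" if "w \<in> W" for w using off one that by metis
    thus ?thesis using True coeffsD[OF g True] by (simp add: ap_iota)
  qed (simp add: ap_iota)
  hence "iota * E = 0" by (rule lop_eqI)
  thus ?thesis by (simp add: E_def a_def b_def)
qed

lemma rho_relations:
  assumes "r \<in> cherednik_relations W \<alpha> \<alpha>' 0 c"
  shows "rho r = 0" "r \<in> carrier (smash W)"
proof -
  consider (xx) x x' where "r = of_tensor (of_h_dual x * of_h_dual x' - of_h_dual x' * of_h_dual x)"
    | (yy) y y' where "r = of_tensor (of_h y * of_h y' - of_h y' * of_h y)"
    | (yx) x y where "r = of_tensor (of_h y * of_h_dual x - of_h_dual x * of_h y) \<ominus>\<^bsub>smash W\<^esub>
        (of_tensor (const (0 * pairing x y)) \<ominus>\<^bsub>smash W\<^esub> group_sum SS (\<lambda>s. kap s x y))"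
    using assms unfolding cherednik_relations_def kap_def by blast
  hence "rho r = 0 \<and> r \<in> carrier (smash W)"
  proof cases
    case xx
    thus ?thesis by (simp add: rho_def xop_def mulop_commute)
  next
    case yy
    thus ?thesis by (simp add: rho_def dun_commute)
  next
    case yx
    have S: "SS \<subseteq> W" by (auto simp: reflections_def)
    have gs: "group_sum SS f \<in> carrier (smash W)" for f using S by blast
    have m: "of_tensor (const (0 * pairing x y)) \<ominus>\<^bsub>smash W\<^esub> group_sum SS (\<lambda>s. kap s x y) \<in> carrier (smash W)"
      using gs by (intro S.minus_closed) auto
    have "rho r = rho (of_tensor (of_h y * of_h_dual x - of_h_dual x * of_h y)) - (rho (of_tensor (const (0 * pairing x y))) - rho (group_sum SS (\<lambda>s. kap s x y)))"
      unfolding yx using m gs by (simp add: rho_minus)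
    also have "\<dots> = 0"
      using dun_xop[of y x] by (simp add: rho_def rho'_group_sum[OF S] scalar_hom_0[OF scal_hom])
    finally show ?thesis unfolding yx using m by (simp add: S.minus_closed)
  qed
  thus "rho r = 0" "r \<in> carrier (smash W)" by auto
qed

definition CI :: "'n smash_elt set" where "CI = cherednik_ideal W \<alpha> \<alpha>' 0 c"

lemma CI_ideal: "ideal CI (smash W)"
  unfolding CI_def cherednik_ideal_def by (rule S.genideal_ideal) (use rho_relations in blast)

lemma relations_CI: "r \<in> cherednik_relations W \<alpha> \<alpha>' 0 c \<Longrightarrow> r \<in> CI"
  unfolding CI_def cherednik_ideal_def by (meson S.genideal_self rho_relations(2) subsetD subsetI)

lemma rho_CI:
  assumes "r \<in> CI" shows "rho r = 0"
proof -
  have "ideal {f \<in> carrier (smash W). rho f = 0} (smash W)"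
  proof (rule idealI)
    show "subgroup {f \<in> carrier (smash W). rho f = 0} (add_monoid (smash W))"
    proof
      fix f assume f: "f \<in> {f \<in> carrier (smash W). rho f = 0}"
      hence "rho (\<zero>\<^bsub>smash W\<^esub> \<ominus>\<^bsub>smash W\<^esub> f) = 0" by (simp add: rho_minus) (simp add: smash_simps rho_zero)
      thus "inv\<^bsub>add_monoid (smash W)\<^esub> f \<in> {f \<in> carrier (smash W). rho f = 0}"
        using f by (simp add: a_minus_def flip: a_inv_def)
    qed (auto simp: rho_add, simp add: smash_simps rho_zero)
  qed (auto simp: rho_mult S.ring_axioms)
  hence "CI \<subseteq> {f \<in> carrier (smash W). rho f = 0}"
    unfolding CI_def cherednik_ideal_def by (rule S.genideal_minimal) (use rho_relations in blast)
  thus ?thesis using assms by blast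
qed

end

section \<open>Polynomials and avoidance of subspaces\<close>

type_synonym 'n mpoly = "'n letter multiset \<Rightarrow>\<^sub>0 complex"

fun val :: "'n::finite letter \<Rightarrow> 'n pt \<Rightarrow> complex" where
  "val (X i) z = fst z $ i"
| "val (Y i) z = snd z $ i"

definition mev :: "'n::finite pt \<Rightarrow> 'n letter multiset \<Rightarrow> complex" where
  "mev z m = (\<Prod>l\<in>#m. val l z)"

definition ev :: "'n::finite mpoly \<Rightarrow> 'n pt \<Rightarrow> complex" where
  "ev f z = mlift (\<lambda>k. k) (mev z) f"

lemma scalar_hom_id: "scalar_hom (\<lambda>k. k)"
  by (simp add: scalar_hom_def)

lemma mev_simps [simp]: "mev z 0 = 1" "mev z {#} = 1" "mev z (m + m') = mev z m * mev z m'"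
    "mev z {#l#} = val l z" "mev z (add_mset l m) = val l z * mev z m"
  by (simp_all add: mev_def)

lemma ev_simps [simp]: "ev 0 z = 0" "ev 1 z = 1" "ev (f + g) z = ev f z + ev g z"
    "ev (f - g) z = ev f z - ev g z" "ev (f * g) z = ev f z * ev g z" "ev (- f) z = - ev f z"
    "ev (Poly_Mapping.single m k) z = k * mev z m"
    "ev (\<Sum>i\<in>A. F i) z = (\<Sum>i\<in>A. ev (F i) z)"
  by (simp_all add: ev_def mlift_add mlift_diff mlift_mult mlift_1 mlift_single mlift_sum mlift_uminus scalar_hom_id)

lemma continuous_mev [continuous_intros]:
  "continuous_on A g \<Longrightarrow> continuous_on A h \<Longrightarrow> continuous_on A (\<lambda>t. mev (g t, h t) m)"
proof (induction m)
  case (add l m)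
  thus ?case by (cases l) (auto intro!: continuous_intros)
qed simp

lemma continuous_ev:
  "continuous_on A g \<Longrightarrow> continuous_on A h \<Longrightarrow> continuous_on A (\<lambda>t. ev f (g t, h t))"
  unfolding ev_def mlift_def by (intro continuous_intros)

text \<open>Under componentwise multiplication of points the monomials become characters, as
  \<open>mev_zmul\<close> records.\<close>

definition zmul :: "'n::finite pt \<Rightarrow> 'n pt \<Rightarrow> 'n pt" where
  "zmul z z' = (\<chi> i. fst z $ i * fst z' $ i, \<chi> i. snd z $ i * snd z' $ i)"

lemma mev_zmul: "mev (zmul z z') m = mev z m * mev z' m"
proof (induction m)
  case (add l m)
  thus ?case by (cases l) (simp_all add: zmul_def)
qed simp

lemma mev_separate:
  assumes "m \<noteq> m'" shows "\<exists>z. mev z m \<noteq> mev (z::'n::finite pt) m'"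
proof -
  obtain l where l: "count m l \<noteq> count m' l" using assms multiset_eqI by metis
  \<comment> \<open>With the value 2 at the coordinate of \<open>l\<close> and 1 elsewhere, a
    monomial evaluates to 2 raised to the multiplicity of \<open>l\<close>.\<close>
  define z :: "'n pt" where "z = (\<chi> i. if l = X i then 2 else 1, \<chi> i. if l = Y i then 2 else 1)"
  have "mev z m = 2 ^ count m l" for m
  proof (induction m)
    case (add a m)
    have "val a z = (if a = l then 2 else 1)" by (cases a) (auto simp: z_def)
    thus ?case using add by simp
  qed simp
  moreover have "(2::complex) ^ a = 2 ^ b \<Longrightarrow> a = b" for a b
    by (drule arg_cong[of _ _ norm]) (simp add: norm_power)
  ultimately have "mev z m \<noteq> mev z m'" using l by metis
  thus ?thesis ..
qed

text \<open>Dedekind's independence of characters, for the monomials as characters of the torus.\<close>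

lemma monomials_independent:
  assumes "finite A" "\<And>z::'n::finite pt. (\<Sum>m\<in>A. b m * mev z m) = 0" "m \<in> A"
  shows "b m = 0"
  using assms
proof (induction A arbitrary: b m rule: finite_induct)
  case (insert m0 A)
  have *: "b m = 0" if m: "m \<in> A" for m
  proof -
    have "m \<noteq> m0" using m insert by auto
    from mev_separate[OF this] obtain z0 :: "'n pt" where z0: "mev z0 m \<noteq> mev z0 m0" by blast
    have "(\<Sum>m\<in>A. (b m * (mev z0 m - mev z0 m0)) * mev z m) = 0" for z :: "'n pt"
    proof -
      have "(\<Sum>m\<in>A. (b m * (mev z0 m - mev z0 m0)) * mev z m) =
        (\<Sum>m\<in>insert m0 A. b m * mev (zmul z z0) m) - mev z0 m0 * (\<Sum>m\<in>insert m0 A. b m * mev z m)"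
        using insert.hyps by (simp add: mev_zmul sum_distrib_left sum_subtractf[symmetric] algebra_simps)
      thus ?thesis using insert.prems(1) by simp
    qed
    from insert.IH[OF this m] show ?thesis using z0 by simp
  qed
  hence "(\<Sum>m\<in>A. b m * mev (z::'n pt) m) = 0" for z by (intro sum.neutral) simp
  hence "b m0 * mev (\<chi> i. 1, \<chi> i. 1 :: complex^'n) m0 = 0"
    using insert.prems(1)[of "(\<chi> i. 1, \<chi> i. 1)"] insert.hyps by simp
  moreover have "mev (\<chi> i. 1, \<chi> i. 1 :: complex^'n) m = 1" for m
  proof (induction m)
    case (add a m)
    thus ?case by (cases a) simp_all
  qed simp
  ultimately show ?case using * insert.prems(2) by auto
qed simp

lemma ev_eq_0:
  assumes "\<And>z::'n::finite pt. ev f z = 0" shows "f = 0"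
proof (rule poly_mapping_eqI)
  fix m
  have "Poly_Mapping.lookup f m = 0" if "m \<in> Poly_Mapping.keys f"
    using monomials_independent[of "Poly_Mapping.keys f" "Poly_Mapping.lookup f" m] assms that
    by (simp add: ev_def mlift_def)
  thus "Poly_Mapping.lookup f m = Poly_Mapping.lookup 0 m" by (cases "m \<in> Poly_Mapping.keys f") (auto simp: in_keys_iff)
qed

section \<open>Avoiding finitely many proper subspaces\<close>

lemma eventually_notin_finite: "finite F \<Longrightarrow> eventually (\<lambda>t. t \<notin> F) (at (a::'a::t1_space))"
proof -
  assume "finite F"
  hence "open (- (F - {a}))" by (intro open_Compl finite_imp_closed) simp
  thus ?thesis unfolding eventually_at_topological by (intro exI[of _ "- (F - {a})"]) auto
qed

lemma line_meets_subspace_once: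
  assumes V: "vec.subspace V" and u: "u \<notin> V" and t: "v + t *s u \<in> V" "v + s *s u \<in> V"
  shows "t = (s::'a::field)"
proof (rule ccontr)
  assume ne: "t \<noteq> s"
  have "(v + t *s u) - (v + s *s u) \<in> V" using V t by (rule vec.subspace_diff)
  hence "(t - s) *s u \<in> V" by (simp add: vector_sub_rdistrib)
  hence "(1 / (t - s)) *s ((t - s) *s u) \<in> V" by (rule vec.subspace_scale[OF V])
  moreover have "(1 / (t - s)) *s ((t - s) *s u) = u" using ne by (simp only: vector_smult_assoc) simp
  ultimately show False using u by simp
qed

lemma finite_line_bad:
  assumes "finite \<V>" "\<And>V. V \<in> \<V> \<Longrightarrow> vec.subspace V" "\<And>V. V \<in> \<V> \<Longrightarrow> u \<notin> V"
  shows "finite {t::complex. \<exists>V\<in>\<V>. v + t *s u \<in> V}"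
proof -
  have "finite {t. v + t *s u \<in> V}" if "V \<in> \<V>" for V
  proof (cases "\<exists>s. v + s *s u \<in> V")
    case True
    then obtain s where "v + s *s u \<in> V" by blast
    hence "{t. v + t *s u \<in> V} \<subseteq> {s}"
      using line_meets_subspace_once[OF assms(2)[OF that] assms(3)[OF that]] by blast
    thus ?thesis by (rule finite_subset) simp
  qed simp
  moreover have "{t. \<exists>V\<in>\<V>. v + t *s u \<in> V} = (\<Union>V\<in>\<V>. {t. v + t *s u \<in> V})" by auto
  ultimately show ?thesis using assms(1) by simp
qed

text \<open>If the vector \<open>u\<close> found so far lies in the new subspace \<open>V0\<close>,
  take \<open>x\<close> outside it. All of \<open>x + t u\<close> stay outside \<open>V0\<close>,
  and each old subspace excludes at most one \<open>t\<close>, so an infinite field leaves a good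
  one.\<close>

lemma avoid_subspaces:
  fixes \<V> :: "(complex^'n::finite) set set"
  assumes "finite \<V>" "\<And>V. V \<in> \<V> \<Longrightarrow> vec.subspace V \<and> V \<noteq> UNIV"
  shows "\<exists>u. \<forall>V\<in>\<V>. u \<notin> V"
  using assms
proof (induction \<V> rule: finite_induct)
  case (insert V0 \<V>)
  then obtain u where u: "\<forall>V\<in>\<V>. u \<notin> V" by auto
  obtain x where x: "x \<notin> V0" using insert.prems by blast
  have fin: "finite {t::complex. \<exists>V\<in>\<V>. x + t *s u \<in> V}"
    using insert u by (intro finite_line_bad) auto
  show ?case
  proof (cases "u \<in> V0")
    case False
    thus ?thesis using u by auto
  next
    case True
    have "infinite (UNIV :: complex set)" by (rule infinite_UNIV_char_0)
    from ex_new_if_finite[OF this fin] obtain t where t: "t \<notin> {t::complex. \<exists>V\<in>\<V>. x + t *s u \<in> V}"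
      by blast
    have "x + t *s u \<notin> V0"
    proof
      assume "x + t *s u \<in> V0"
      hence "(x + t *s u) - t *s u \<in> V0"
        using True insert.prems by (intro vec.subspace_diff vec.subspace_scale) auto
      thus False using x by simp
    qed
    thus ?thesis using t by auto
  qed
qed simp

text \<open>With \<open>u\<close> outside all the subspaces, the line \<open>v + t u\<close> meets
  them for finitely many \<open>t\<close> only. Hence \<open>v\<close> is a limit of points where
  the function is zero.\<close>

lemma continuous_avoid_zero:
  fixes f :: "complex^'n::finite \<Rightarrow> complex"
  assumes V: "finite \<V>" "\<And>V. V \<in> \<V> \<Longrightarrow> vec.subspace V \<and> V \<noteq> UNIV"
    and f: "continuous_on UNIV f" and 0: "\<And>v. \<forall>V\<in>\<V>. v \<notin> V \<Longrightarrow> f v = 0"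
  shows "f v = 0"
proof -
  obtain u where u: "\<forall>V\<in>\<V>. u \<notin> V" using avoid_subspaces[OF V] by blast
  have "finite {t. \<exists>V\<in>\<V>. v + t *s u \<in> V}" using V u by (intro finite_line_bad) auto
  hence "eventually (\<lambda>t. t \<notin> {t. \<exists>V\<in>\<V>. v + t *s u \<in> V}) (at (0::complex))" by (rule eventually_notin_finite)
  hence ev: "eventually (\<lambda>t. f (v + t *s u) = 0) (at (0::complex))"
    by eventually_elim (auto intro: 0)
  have "continuous_on UNIV (\<lambda>t::complex. v + t *s u)"
    unfolding vector_scalar_mult_def by (intro continuous_intros)
  hence "continuous_on UNIV (\<lambda>t::complex. f (v + t *s u))"
    using f by (metis continuous_on_compose2 subset_UNIV)
  hence "((\<lambda>t. f (v + t *s u)) \<longlongrightarrow> f (v + 0 *s u)) (at (0::complex))"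
    using continuous_on_eq_continuous_at[of UNIV] isCont_def by blast
  moreover have "((\<lambda>t. f (v + t *s u)) \<longlongrightarrow> 0) (at (0::complex))"
    using ev by (rule tendsto_eventually)
  ultimately have "f (v + 0 *s u) = 0" by (intro tendsto_unique[of "at (0::complex)"]) auto
  thus ?thesis by simp
qed

lemma subspace_eigen: "vec.subspace {v. A *v v = k *s (v :: complex^'n)}"
  unfolding vec.subspace_def
  by (auto simp: matrix_vector_right_distrib vector_scalar_commute vector_add_ldistrib vector_smult_assoc mult.commute)

section \<open>Normal ordering spans\<close>

fun isX :: "'n letter \<Rightarrow> bool" where "isX (X i) = True" | "isX (Y i) = False"

text \<open>Any ordering will do: two orderings of commuting letters give congruent tensors by
  \<open>TI_perm\<close>.\<close>

definition xlist :: "'n letter multiset \<Rightarrow> 'n letter list" where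
  "xlist m = (SOME l. mset l = filter_mset isX m)"

definition ylist :: "'n letter multiset \<Rightarrow> 'n letter list" where
  "ylist m = (SOME l. mset l = filter_mset (\<lambda>l. \<not> isX l) m)"

lemma mset_xlist [simp]: "mset (xlist m) = filter_mset isX m"
  unfolding xlist_def by (rule someI_ex) (rule ex_mset)

lemma mset_ylist [simp]: "mset (ylist m) = filter_mset (\<lambda>l. \<not> isX l) m"
  unfolding ylist_def by (rule someI_ex) (rule ex_mset)

definition lw :: "'n letter list \<Rightarrow> 'n tensor" where "lw us = prod_list (map gen us)"

lemma lw_simps [simp]: "lw [] = 1" "lw (l # us) = gen l * lw us" "lw (us @ vs) = lw us * lw vs"
  by (simp_all add: lw_def)

definition nfT :: "'n mpoly \<Rightarrow> 'n tensor" where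
  "nfT = mlift const (\<lambda>m. lw (xlist m) * lw (ylist m))"

lemma nfT_simps [simp]: "nfT 0 = 0" "nfT (f + g) = nfT f + nfT g" "nfT (f - g) = nfT f - nfT g"
   "nfT (Poly_Mapping.single m k) = const k * (lw (xlist m) * lw (ylist m))"
   "nfT (Poly_Mapping.single 0 k * f) = const k * nfT f"
   "nfT (\<Sum>i\<in>A. F i) = (\<Sum>i\<in>A. nfT (F i))"
  by (simp_all add: nfT_def mlift_add mlift_diff mlift_single mlift_sum mlift_scale const_hom)

definition atw :: "'n cmat \<Rightarrow> 'n::finite tensor \<Rightarrow> 'n smash_elt" where
  "atw u a = (\<lambda>w. if w = u then a else 0)"

context cherednik_data
begin

text \<open>
  Congruence of tensors modulo the relations; \<open>nfT f\<close> is the normally ordered tensor with commutative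
  symbol \<open>f\<close>.
\<close>

definition TI :: "'n tensor set" where "TI = {a. of_tensor a \<in> CI}"

lemma CI_carrier: "f \<in> CI \<Longrightarrow> f \<in> carrier (smash W)"
  using CI_ideal by (meson additive_subgroup.a_Hcarr ideal.axioms(1))

lemma CI_add: "f \<in> CI \<Longrightarrow> g \<in> CI \<Longrightarrow> (\<lambda>w. f w + g w) \<in> CI"
  using additive_subgroup.a_closed[OF ideal.axioms(1)[OF CI_ideal], of f g] by (simp add: smash_simps)

lemma CI_cong: "f \<in> CI \<Longrightarrow> (\<And>w. f w = g w) \<Longrightarrow> g \<in> CI"
  using ext[of f g] by simp

lemma CI_tensor: "f \<in> CI \<Longrightarrow> (\<lambda>w. a * f w) \<in> CI"
  using ideal.I_l_closed[OF CI_ideal, of f "of_tensor a"] by (simp add: of_tensor_mult CI_carrier)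

lemma CI_grp: "f \<in> CI \<Longrightarrow> u \<in> W \<Longrightarrow> (\<lambda>w. group_act u (f (matrix_inv u ** w))) \<in> CI"
  using ideal.I_l_closed[OF CI_ideal, of f "grp u"] by (simp add: grp_mult CI_carrier)

lemma CI_right: "f \<in> CI \<Longrightarrow> g \<in> carrier (smash W) \<Longrightarrow> f \<otimes>\<^bsub>smash W\<^esub> g \<in> CI"
  by (rule ideal.I_r_closed[OF CI_ideal])

lemma CI_zero: "(\<lambda>w. 0) \<in> CI"
  using additive_subgroup.zero_closed[OF ideal.axioms(1)[OF CI_ideal]] by (simp add: smash_simps)

lemma TI_add: "a \<in> TI \<Longrightarrow> b \<in> TI \<Longrightarrow> a + b \<in> TI"
  unfolding TI_def using CI_add[of "of_tensor a" "of_tensor b"] by (simp add: of_tensor_def if_distrib if_distribR cong: if_cong)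

lemma TI_left: "a \<in> TI \<Longrightarrow> b * a \<in> TI"
  unfolding TI_def using CI_tensor[of "of_tensor a" b] by (simp add: of_tensor_def if_distrib cong: if_cong)

lemma TI_right: "a \<in> TI \<Longrightarrow> a * b \<in> TI"
  unfolding TI_def using CI_right[of "of_tensor a" "of_tensor b"]
  by (simp add: of_tensor_mult) (simp add: of_tensor_def if_distrib cong: if_cong)

lemma TI_zero: "0 \<in> TI"
  unfolding TI_def using CI_zero by (simp add: of_tensor_def)

lemma TI_atw: "a \<in> TI \<Longrightarrow> u \<in> W \<Longrightarrow> atw u a \<in> CI"
  unfolding TI_def using CI_right[of "of_tensor a" "grp u"]
  by (simp add: of_tensor_mult) (simp add: atw_def grp_def group_sum_def if_distrib cong: if_cong)

lemma TI_comm: "isX l = isX l' \<Longrightarrow> gen l * gen l' - gen l' * gen l \<in> TI"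
proof -
  assume "isX l = isX l'"
  hence "of_tensor (gen l * gen l' - gen l' * gen l) \<in> cherednik_relations W \<alpha> \<alpha>' 0 c"
  proof (cases l; cases l')
    fix i j assume l: "l = X i" "l' = X j"
    show ?thesis unfolding cherednik_relations_def
      by (intro UnI1, rule CollectI, rule exI[of _ "axis i 1"], rule exI[of _ "axis j 1"]) (simp add: l)
  next
    fix i j assume l: "l = Y i" "l' = Y j"
    show ?thesis unfolding cherednik_relations_def
      by (rule UnI1, rule UnI2, rule CollectI, rule exI[of _ "axis i 1"], rule exI[of _ "axis j 1"]) (simp add: l)
  qed auto
  thus ?thesis using relations_CI by (simp add: TI_def)
qed

lemma TI_move:
  assumes "\<And>x. x \<in> set xs \<Longrightarrow> isX x = isX l"
  shows "lw xs * gen l - gen l * lw xs \<in> TI"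
  using assms
proof (induction xs)
  case Nil
  show ?case by (simp add: TI_zero)
next
  case (Cons x xs)
  have "lw (x # xs) * gen l - gen l * lw (x # xs) =
    gen x * (lw xs * gen l - gen l * lw xs) + (gen x * gen l - gen l * gen x) * lw xs"
    by (simp add: algebra_simps)
  moreover have "gen x * (lw xs * gen l - gen l * lw xs) \<in> TI" using Cons by (intro TI_left) auto
  moreover have "(gen x * gen l - gen l * gen x) * lw xs \<in> TI" using Cons by (intro TI_right TI_comm) auto
  ultimately show ?case by (simp add: TI_add)
qed

lemma TI_perm:
  assumes "mset xs = mset ys" "\<And>x y. x \<in> set xs \<Longrightarrow> y \<in> set xs \<Longrightarrow> isX x = isX y"
  shows "lw xs - lw ys \<in> TI"
  using assms
proof (induction xs arbitrary: ys)
  case Nil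
  thus ?case by (simp add: TI_zero)
next
  case (Cons x xs)
  have "x \<in> set ys" using Cons.prems(1) by (metis list.set_intros(1) set_mset_mset)
  then obtain y1 y2 where ys: "ys = y1 @ x # y2" by (auto simp: in_set_conv_decomp)
  have s: "set ys = set (x # xs)" using Cons.prems(1) by (metis set_mset_mset)
  have "mset xs = mset (y1 @ y2)" using Cons.prems(1) by (simp add: ys)
  hence "lw xs - lw (y1 @ y2) \<in> TI" by (rule Cons.IH) (use Cons.prems in auto)
  hence "gen x * (lw xs - lw (y1 @ y2)) \<in> TI" by (rule TI_left)
  moreover have "(lw y1 * gen x - gen x * lw y1) * lw y2 \<in> TI"
    by (intro TI_right TI_move) (use Cons.prems s ys in auto)
  hence "- 1 * ((lw y1 * gen x - gen x * lw y1) * lw y2) \<in> TI" by (rule TI_left)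
  moreover have "lw (x # xs) - lw ys = gen x * (lw xs - lw (y1 @ y2)) + - 1 * ((lw y1 * gen x - gen x * lw y1) * lw y2)"
    by (simp add: ys algebra_simps)
  ultimately show ?case by (metis TI_add)
qed

lemma TI_nfT_list:
  assumes "\<forall>x\<in>set xs. isX x" "\<forall>y\<in>set ys. \<not> isX y"
  shows "lw xs * lw ys - nfT (Poly_Mapping.single (mset xs + mset ys) 1) \<in> TI"
proof -
  let ?m = "mset xs + mset ys"
  have "filter_mset isX ?m = mset xs" "filter_mset (\<lambda>l. \<not> isX l) ?m = mset ys"
    using assms by (simp_all add: filter_id_conv filter_empty_conv flip: mset_filter)
  hence 1: "lw xs - lw (xlist ?m) \<in> TI" "lw ys - lw (ylist ?m) \<in> TI"
    using assms by (auto intro!: TI_perm)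
  have "(lw xs - lw (xlist ?m)) * lw ys + lw (xlist ?m) * (lw ys - lw (ylist ?m)) \<in> TI"
    using 1 by (intro TI_add TI_left TI_right)
  thus ?thesis by (simp add: algebra_simps)
qed

section \<open>Elements congruent to a normal form\<close>

definition nf :: "('n cmat \<Rightarrow> 'n mpoly) \<Rightarrow> 'n smash_elt" where
  "nf \<phi> = (\<lambda>w. if w \<in> W then nfT (\<phi> w) else 0)"

lemma nf_carrier [simp]: "nf \<phi> \<in> carrier (smash W)"
  by (auto simp: nf_def smash_carrier)

text \<open>Words times group elements span the smash product, so showing that this set is
  everything amounts to its stability under left multiplication by letters.\<close>

definition Sp :: "'n smash_elt set" where
  "Sp = {f \<in> carrier (smash W). \<exists>\<phi>. (\<lambda>w. f w - nf \<phi> w) \<in> CI}"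

lemma Sp_I: "f \<in> carrier (smash W) \<Longrightarrow> (\<lambda>w. f w - nf \<phi> w) \<in> CI \<Longrightarrow> f \<in> Sp"
  by (auto simp: Sp_def)

lemma Sp_zero: "(\<lambda>w. 0) \<in> Sp"
  by (rule Sp_I[of _ "\<lambda>_. 0"]) (auto simp: smash_carrier nf_def intro!: CI_cong[OF CI_zero])

lemma Sp_add: "f \<in> Sp \<Longrightarrow> g \<in> Sp \<Longrightarrow> (\<lambda>w. f w + g w) \<in> Sp"
proof -
  assume fg: "f \<in> Sp" "g \<in> Sp"
  then obtain \<phi> \<psi> where "(\<lambda>w. f w - nf \<phi> w) \<in> CI" "(\<lambda>w. g w - nf \<psi> w) \<in> CI" by (auto simp: Sp_def)
  from CI_add[OF this] have "(\<lambda>w. (f w + g w) - nf (\<lambda>w. \<phi> w + \<psi> w) w) \<in> CI"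
    by (rule CI_cong) (auto simp: nf_def)
  thus ?thesis by (rule Sp_I[rotated]) (use fg in \<open>auto simp: Sp_def smash_carrier\<close>)
qed

lemma Sp_const: "f \<in> Sp \<Longrightarrow> (\<lambda>w. const k * f w) \<in> Sp"
proof -
  assume f: "f \<in> Sp"
  then obtain \<phi> where "(\<lambda>w. f w - nf \<phi> w) \<in> CI" by (auto simp: Sp_def)
  from CI_tensor[OF this, of "const k"] have "(\<lambda>w. const k * f w - nf (\<lambda>w. Poly_Mapping.single 0 k * \<phi> w) w) \<in> CI"
    by (rule CI_cong) (auto simp: nf_def right_diff_distrib)
  thus ?thesis by (rule Sp_I[rotated]) (use f in \<open>auto simp: Sp_def smash_carrier\<close>)
qed

lemma Sp_sum: "(\<And>i. i \<in> A \<Longrightarrow> F i \<in> Sp) \<Longrightarrow> (\<lambda>w. \<Sum>i\<in>A. F i w) \<in> Sp"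
  by (induction A rule: infinite_finite_induct) (auto intro: Sp_add simp: Sp_zero)

lemma Sp_cong: "g \<in> Sp \<Longrightarrow> f \<in> carrier (smash W) \<Longrightarrow> (\<lambda>w. f w - g w) \<in> CI \<Longrightarrow> f \<in> Sp"
proof -
  assume f: "g \<in> Sp" "f \<in> carrier (smash W)" "(\<lambda>w. f w - g w) \<in> CI"
  then obtain \<phi> where "(\<lambda>w. g w - nf \<phi> w) \<in> CI" by (auto simp: Sp_def)
  from CI_add[OF f(3) this] have "(\<lambda>w. f w - nf \<phi> w) \<in> CI" by (rule CI_cong) auto
  thus ?thesis using f by (intro Sp_I)
qed

lemma atw_carrier [simp]: "u \<in> W \<Longrightarrow> atw u a \<in> carrier (smash W)"
  by (auto simp: atw_def smash_carrier)

lemma Sp_list: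
  assumes "\<forall>x\<in>set xs. isX x" "\<forall>y\<in>set ys. \<not> isX y" "u \<in> W"
  shows "atw u (lw xs * lw ys) \<in> Sp"
proof (rule Sp_I)
  let ?f = "Poly_Mapping.single (mset xs + mset ys) 1"
  show "(\<lambda>w. atw u (lw xs * lw ys) w - nf (\<lambda>w. if w = u then ?f else 0) w) \<in> CI"
    by (rule CI_cong[OF TI_atw[OF TI_nfT_list[OF assms(1,2)] assms(3)]]) (use assms in \<open>auto simp: atw_def nf_def fun_eq_iff\<close>)
qed (use assms in simp)

text \<open>A linear map that respects the ideal need only be tested on normally ordered words times
  a group element, because modulo the ideal these span \<open>Sp\<close>.\<close>

lemma Sp_linear:
  assumes add: "\<And>f g. L (\<lambda>w. f w + g w) = (\<lambda>w. L f w + L g w)"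
    and con: "\<And>k f. L (\<lambda>w. const k * f w) = (\<lambda>w. const k * L f w)"
    and CI: "\<And>f. f \<in> CI \<Longrightarrow> L f \<in> CI"
    and car: "\<And>f. f \<in> carrier (smash W) \<Longrightarrow> L f \<in> carrier (smash W)"
    and base: "\<And>xs ys u. \<forall>x\<in>set xs. isX x \<Longrightarrow> \<forall>y\<in>set ys. \<not> isX y \<Longrightarrow> u \<in> W \<Longrightarrow> L (atw u (lw xs * lw ys)) \<in> Sp"
    and f: "f \<in> Sp"
  shows "L f \<in> Sp"
proof -
  have L0: "L (\<lambda>w. 0) = (\<lambda>w. 0)" using con[of 0 "\<lambda>w. 0"] by simp
  have Ldiff: "L (\<lambda>w. f w - g w) = (\<lambda>w. L f w - L g w)" for f g
    using add[of "\<lambda>w. f w - g w" g] by (auto simp: fun_eq_iff eq_diff_eq)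
  have *: "L (atw u (nfT \<phi>)) \<in> Sp" if u: "u \<in> W" for u \<phi>
  proof (induction \<phi> rule: poly_mapping_sum_induct)
    case (single m k)
    have "\<forall>x\<in>set (xlist m). isX x" "\<forall>y\<in>set (ylist m). \<not> isX y"
      by (simp_all add: set_mset_mset[symmetric] del: set_mset_mset)
    from base[OF this u] have "(\<lambda>w. const k * L (atw u (lw (xlist m) * lw (ylist m))) w) \<in> Sp" by (rule Sp_const)
    moreover have "atw u (nfT (Poly_Mapping.single m k)) = (\<lambda>w. const k * atw u (lw (xlist m) * lw (ylist m)) w)"
      by (auto simp: atw_def fun_eq_iff)
    ultimately show ?case by (simp only: con)
  next
    case (add f g)
    have "atw u (nfT (f + g)) = (\<lambda>w. atw u (nfT f) w + atw u (nfT g) w)" by (auto simp: atw_def)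
    thus ?case using add Sp_add assms(1) by simp
  qed
  have sub: "L (\<lambda>w. \<Sum>u\<in>A. atw u (nfT (\<phi> u)) w) \<in> Sp" if "A \<subseteq> W" for \<phi> A
    using finite_subset[OF that fin] that
  proof (induction A rule: finite_induct)
    case (insert u A)
    thus ?case using * by (simp add: add Sp_add)
  qed (simp add: L0 Sp_zero)
  hence nf: "L (nf \<phi>) \<in> Sp" for \<phi>
  proof -
    have "nf \<phi> = (\<lambda>w. \<Sum>u\<in>W. atw u (nfT (\<phi> u)) w)" using fin by (auto simp: nf_def atw_def fun_eq_iff)
    thus ?thesis using sub[of W \<phi>] by simp
  qed
  obtain \<phi> where "(\<lambda>w. f w - nf \<phi> w) \<in> CI" using f by (auto simp: Sp_def)
  from CI[OF this] have "(\<lambda>w. L f w - L (nf \<phi>) w) \<in> CI" by (simp add: Ldiff)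
  moreover have "L f \<in> carrier (smash W)" using f car by (simp add: Sp_def)
  ultimately show ?thesis using Sp_cong[OF nf] by blast
qed

lemma Sp_X: "f \<in> Sp \<Longrightarrow> (\<lambda>w. gen (X i) * f w) \<in> Sp"
proof (rule Sp_linear[where L = "\<lambda>f w. gen (X i) * f w"])
  fix xs ys :: "'n letter list" and u assume *: "\<forall>x\<in>set xs. isX x" "\<forall>y\<in>set ys. \<not> isX y" "u \<in> W"
  have "(\<lambda>w. gen (X i) * atw u (lw xs * lw ys) w) = atw u (lw (X i # xs) * lw ys)"
    by (auto simp: atw_def fun_eq_iff mult.assoc)
  thus "(\<lambda>w. gen (X i) * atw u (lw xs * lw ys) w) \<in> Sp" using * by (simp only:) (rule Sp_list, auto)
qed (auto simp: distrib_left const_commute CI_tensor smash_carrier simp flip: mult.assoc)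

text \<open>A group element sends a word in the \<open>y\<close> letters to a combination of such
  words; this span absorbs it.\<close>

inductive_set SY :: "'n tensor set" where
  SY_word: "\<forall>y\<in>set ys. \<not> isX y \<Longrightarrow> lw ys \<in> SY"
| SY_add: "\<lbrakk>a \<in> SY; b \<in> SY\<rbrakk> \<Longrightarrow> a + b \<in> SY"
| SY_const: "a \<in> SY \<Longrightarrow> const k * a \<in> SY"

lemma SY_Y: "a \<in> SY \<Longrightarrow> gen (Y i) * a \<in> SY"
proof (induction rule: SY.induct)
  case (SY_word ys)
  thus ?case using SY.SY_word[of "Y i # ys"] by simp
next
  case (SY_const a k)
  have "gen (Y i) * (const k * a) = const k * (gen (Y i) * a)" by (simp add: const_commute flip: mult.assoc)
  thus ?case using SY_const SY.SY_const by simp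
qed (auto intro: SY.intros simp: distrib_left)

lemma SY_sum: "(\<And>i. i \<in> A \<Longrightarrow> F i \<in> SY) \<Longrightarrow> (\<Sum>i\<in>A. F i) \<in> SY"
  using SY_const[OF SY_word[of "[]"], of 0]
  by (induction A rule: infinite_finite_induct) (auto intro: SY_add)

lemma SY_of_h: "a \<in> SY \<Longrightarrow> of_h y * a \<in> SY"
  unfolding of_h_def sum_distrib_right by (intro SY_sum) (simp add: mult.assoc SY_Y SY_const)

lemma SY_act: "\<forall>y\<in>set ys. \<not> isX y \<Longrightarrow> group_act u (lw ys) \<in> SY"
proof (induction ys)
  case Nil
  show ?case using SY_word[of "[]"] by (simp add: group_act_hom)
next
  case (Cons y ys)
  then obtain i where "y = Y i" by (cases y) auto
  thus ?case using Cons by (simp add: group_act_hom group_act_gen SY_of_h)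
qed

lemma SY_Sp: "a \<in> SY \<Longrightarrow> u \<in> W \<Longrightarrow> atw u a \<in> Sp"
proof (induction rule: SY.induct)
  case (SY_word ys)
  thus ?case using Sp_list[of "[]" ys u] by simp
next
  case (SY_add a b)
  have "atw u (a + b) = (\<lambda>w. atw u a w + atw u b w)" by (auto simp: atw_def)
  thus ?case using SY_add Sp_add by simp
next
  case (SY_const a k)
  have "atw u (const k * a) = (\<lambda>w. const k * atw u a w)" by (auto simp: atw_def)
  thus ?case using SY_const Sp_const by simp
qed

lemma Sp_grp:
  assumes u: "u \<in> W" and f: "f \<in> Sp" shows "(\<lambda>w. group_act u (f (matrix_inv u ** w))) \<in> Sp"
  using _ _ _ _ _ f
proof (rule Sp_linear[where L = "\<lambda>f w. group_act u (f (matrix_inv u ** w))"])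
  fix xs ys :: "'n letter list" and v assume *: "\<forall>x\<in>set xs. isX x" "\<forall>y\<in>set ys. \<not> isX y" "v \<in> W"
  have e: "(\<lambda>w. group_act u (atw v a (matrix_inv u ** w))) = atw (u ** v) (group_act u a)" for a
  proof
    fix w
    have "matrix_inv u ** w = v \<longleftrightarrow> w = u ** v" using u by auto
    thus "group_act u (atw v a (matrix_inv u ** w)) = atw (u ** v) (group_act u a) w"
      by (auto simp: atw_def group_act_hom)
  qed
  show "(\<lambda>w. group_act u (atw v (lw xs * lw ys) (matrix_inv u ** w))) \<in> Sp" unfolding e using *(1)
  proof (induction xs)
    case Nil
    show ?case using SY_Sp[OF SY_act[OF *(2), of u], of "u ** v"] * u by auto
  next
    case (Cons x xs)
    then obtain i where x: "x = X i" by (cases x) auto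
    let ?a = "group_act u (lw xs * lw ys)" and ?d = "dual_act u (axis i 1)"
    have "atw (u ** v) (group_act u (lw (x # xs) * lw ys)) =
       (\<lambda>w. \<Sum>j\<in>UNIV. const (?d $ j) * (gen (X j) * atw (u ** v) ?a w))"
      by (auto simp: fun_eq_iff atw_def x group_act_hom group_act_gen mult.assoc of_h_dual_def sum_distrib_right)
    moreover have "\<dots> \<in> Sp" using Cons by (intro Sp_sum Sp_const Sp_X) auto
    ultimately show ?case by simp
  qed
next
  show "f \<in> CI \<Longrightarrow> (\<lambda>w. group_act u (f (matrix_inv u ** w))) \<in> CI" for f using u by (rule CI_grp[rotated])
qed (use u in \<open>auto simp: group_act_hom smash_carrier W_minv\<close>)

text \<open>Moving \<open>y\<close> past the first \<open>x\<close> leaves that \<open>x\<close> in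
  front of a shorter problem, plus reflections applied to the remaining word. Induction handles the
  former and \<open>Sp_grp\<close> the latter.\<close>

lemma Sp_Y: "f \<in> Sp \<Longrightarrow> (\<lambda>w. gen (Y i) * f w) \<in> Sp"
proof (rule Sp_linear[where L = "\<lambda>f w. gen (Y i) * f w"])
  fix xs ys :: "'n letter list" and u assume *: "\<forall>x\<in>set xs. isX x" "\<forall>y\<in>set ys. \<not> isX y" "u \<in> W"
  show "(\<lambda>w. gen (Y i) * atw u (lw xs * lw ys) w) \<in> Sp" using *(1)
  proof (induction xs)
    case Nil
    have "(\<lambda>w. gen (Y i) * atw u (lw [] * lw ys) w) = atw u (lw [] * lw (Y i # ys))"
      by (auto simp: atw_def fun_eq_iff)
    thus ?case using * by (simp only:) (rule Sp_list, auto)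
  next
    case (Cons x xs)
    then obtain j where x: "x = X j" by (cases x) auto
    define r where "r = atw u (lw xs * lw ys)"
    have r: "r \<in> Sp" "r \<in> carrier (smash W)" unfolding r_def using Cons * by (auto intro: Sp_list)
    have S: "SS \<subseteq> W" by (auto simp: reflections_def)
    let ?x = "axis j 1" and ?y = "axis i 1"
    let ?k = "\<lambda>s. 2 * c s / pairing (\<alpha> s) (\<alpha>' s) * pairing ?x (\<alpha>' s) * pairing (\<alpha> s) ?y"
    define rel where "rel = of_tensor (of_h ?y * of_h_dual ?x - of_h_dual ?x * of_h ?y) \<ominus>\<^bsub>smash W\<^esub>
        (of_tensor (const (0 * pairing ?x ?y)) \<ominus>\<^bsub>smash W\<^esub> group_sum SS ?k)"
    have relw: "rel w = of_tensor (gen (Y i) * gen (X j) - gen (X j) * gen (Y i)) w + group_sum SS ?k w" for w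
    proof -
      have "group_sum SS ?k \<in> carrier (smash W)" using S by blast
      moreover from this have "of_tensor (const (0 * pairing ?x ?y)) \<ominus>\<^bsub>smash W\<^esub> group_sum SS ?k \<in> carrier (smash W)"
        by (intro S.minus_closed) auto
      ultimately show ?thesis unfolding rel_def
        by (simp add: smash_minus) (simp add: of_tensor_def)
    qed
    have "rel \<in> CI"
      unfolding rel_def cherednik_relations_def
      by (rule relations_CI, unfold cherednik_relations_def, rule UnI2, rule CollectI, rule exI[of _ ?x], rule exI[of _ ?y]) simp
    hence relr: "rel \<otimes>\<^bsub>smash W\<^esub> r \<in> CI" using r by (intro CI_right)
    \<comment> \<open>The defining relation rewrites \<open>y x r\<close> as this element, all of
      whose summands are known to have a normal form.\<close>
    define q where "q = (\<lambda>w. gen (X j) * (gen (Y i) * r w) + (\<Sum>s\<in>SS. const (- ?k s) * group_act s (r (matrix_inv s ** w))))"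
    have q: "q \<in> Sp" unfolding q_def using Cons r S
      by (intro Sp_add Sp_X Sp_sum Sp_const Sp_grp) (auto simp: r_def)
    have "(rel \<otimes>\<^bsub>smash W\<^esub> r) w = gen (Y i) * (gen (X j) * r w) - q w" for w
    proof -
      have "rel = of_tensor (gen (Y i) * gen (X j) - gen (X j) * gen (Y i)) \<oplus>\<^bsub>smash W\<^esub> group_sum SS ?k"
        by (auto simp: relw smash_simps)
      hence "rel \<otimes>\<^bsub>smash W\<^esub> r = of_tensor (gen (Y i) * gen (X j) - gen (X j) * gen (Y i)) \<otimes>\<^bsub>smash W\<^esub> r \<oplus>\<^bsub>smash W\<^esub> group_sum SS ?k \<otimes>\<^bsub>smash W\<^esub> r"
        using S r by (simp add: S.l_distr group_sum_carrier)
      moreover have "(group_sum SS ?k \<otimes>\<^bsub>smash W\<^esub> r) w = (\<Sum>s\<in>SS. const (?k s) * group_act s (r (matrix_inv s ** w)))"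
      proof (cases "w \<in> W")
        case True
        have "(group_sum SS ?k \<otimes>\<^bsub>smash W\<^esub> r) w = (\<Sum>s\<in>W. if s \<in> SS then const (?k s) * group_act s (r (matrix_inv s ** w)) else 0)"
          using True by (simp add: smash_mult group_sum_def if_distrib[of "\<lambda>x. x * b" for b] cong: if_cong)
        also have "\<dots> = (\<Sum>s\<in>W \<inter> SS. const (?k s) * group_act s (r (matrix_inv s ** w)))"
          by (rule sum.inter_restrict[OF fin, symmetric])
        finally show ?thesis using S by (simp add: Int_absorb1)
      next
        case False
        have "r (matrix_inv s ** w) = 0" if "s \<in> SS" for s
          using False that S r(2) W_mem_left[of "matrix_inv s" w] by (auto simp: smash_carrier W_minv)
        thus ?thesis using False by (simp add: smash_mult group_act_hom)
      qed
      ultimately show ?thesis using r(2)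
        by (simp add: q_def smash_simps of_tensor_mult sum_negf algebra_simps)
    qed
    hence "(\<lambda>w. gen (Y i) * (gen (X j) * r w) - q w) \<in> CI" using CI_cong[OF relr] by simp
    hence "(\<lambda>w. gen (Y i) * (gen (X j) * r w)) \<in> Sp"
      by (rule Sp_cong[OF q, rotated]) (use r(2) in \<open>auto simp: smash_carrier\<close>)
    moreover have "(\<lambda>w. gen (Y i) * atw u (lw (x # xs) * lw ys) w) = (\<lambda>w. gen (Y i) * (gen (X j) * r w))"
      by (auto simp: atw_def fun_eq_iff r_def x mult.assoc)
    ultimately show ?case by simp
  qed
qed (auto simp: distrib_left const_commute CI_tensor smash_carrier simp flip: mult.assoc)

lemma Sp_all: "f \<in> carrier (smash W) \<Longrightarrow> f \<in> Sp"
proof -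
  have lw: "atw u (lw us) \<in> Sp" if "u \<in> W" for u us
  proof (induction us)
    case Nil
    show ?case using Sp_list[of "[]" "[]" u] that by simp
  next
    case (Cons l us)
    have "atw u (lw (l # us)) = (\<lambda>w. gen l * atw u (lw us) w)" by (auto simp: atw_def fun_eq_iff)
    thus ?case using Cons Sp_X Sp_Y by (cases l) simp_all
  qed
  have *: "atw u a \<in> Sp" if "u \<in> W" for u a
  proof (induction a rule: poly_mapping_sum_induct)
    case (single v k)
    have "atw u (Poly_Mapping.single v k) = (\<lambda>w. const k * atw u (lw (letters v)) w)"
      by (auto simp: atw_def fun_eq_iff single_word lword_def lw_def)
    thus ?case using lw[OF that] Sp_const by simp
  next
    case (add a b)
    have "atw u (a + b) = (\<lambda>w. atw u a w + atw u b w)" by (auto simp: atw_def)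
    thus ?case using add Sp_add by simp
  qed
  assume f: "f \<in> carrier (smash W)"
  have "f = (\<lambda>w. \<Sum>u\<in>W. atw u (f u) w)" using fin f by (auto simp: atw_def fun_eq_iff smash_carrier)
  moreover have "\<dots> \<in> Sp" by (intro Sp_sum *)
  ultimately show ?thesis by simp
qed

lemma normal_form: "f \<in> carrier (smash W) \<Longrightarrow> \<exists>\<phi>. (\<lambda>w. f w - nf \<phi> w) \<in> CI"
  using Sp_all by (auto simp: Sp_def)

end

section \<open>Filtration by degree in \<open>p\<close>\<close>

text \<open>Applied for fixed \<open>v\<close>, so that the coefficients may depend on
  \<open>v\<close> in an arbitrary way. The inductive form turns substitution, scaling and products
  into inductions.\<close>

inductive homp :: "nat \<Rightarrow> (complex^'n::finite \<Rightarrow> complex) \<Rightarrow> bool" where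
  homp_const: "homp 0 (\<lambda>p. k)"
| homp_var: "homp d g \<Longrightarrow> homp (Suc d) (\<lambda>p. p $ i * g p)"
| homp_add: "\<lbrakk>homp d g; homp d h\<rbrakk> \<Longrightarrow> homp d (\<lambda>p. g p + h p)"

lemma homp_zero: "homp d (\<lambda>p. 0)"
proof (induction d)
  case (Suc d)
  from homp_var[OF this] show ?case by simp
qed (rule homp_const)

lemma homp_scale: "homp d g \<Longrightarrow> homp d (\<lambda>p. k * g p)"
proof (induction rule: homp.induct)
  case (homp_const l)
  show ?case by (rule homp.homp_const)
next
  case (homp_var d g i)
  from homp.homp_var[OF homp_var.IH, of i] show ?case by (simp add: mult_ac)
next
  case (homp_add d g h)
  from homp.homp_add[OF homp_add.IH] show ?case by (simp add: distrib_left)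
qed

lemma homp_sum: "(\<And>i. i \<in> A \<Longrightarrow> homp d (F i)) \<Longrightarrow> homp d (\<lambda>p. \<Sum>i\<in>A. F i p)"
  by (induction A rule: infinite_finite_induct) (auto intro: homp_add simp: homp_zero)

lemma homp_linear: "homp d g \<Longrightarrow> homp (Suc d) (\<lambda>p. pairing p y * g p)"
proof -
  assume "homp d g"
  hence "homp (Suc d) (\<lambda>p. \<Sum>i\<in>UNIV. y $ i * (p $ i * g p))" by (intro homp_sum homp_scale homp_var)
  thus ?thesis by (simp add: pairing_def sum_distrib_left mult_ac)
qed

lemma homp_subst: "homp d g \<Longrightarrow> homp d (\<lambda>p. g (p v* A))"
proof (induction rule: homp.induct)
  case (homp_var d g i)
  from homp_linear[OF homp_var.IH, of "A *v axis i 1"] show ?case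
    by (simp flip: pairing_matrix)
qed (auto intro: homp.intros)

lemma homp_scaling: "homp d g \<Longrightarrow> g (s *s p) = s ^ d * g p"
  by (induction rule: homp.induct) (auto simp: algebra_simps)

lemma homp_mult: "homp d g \<Longrightarrow> homp e h \<Longrightarrow> homp (d + e) (\<lambda>p. g p * h p)"
proof (induction rule: homp.induct)
  case (homp_var d g i)
  from homp.homp_var[OF homp_var.IH[OF homp_var.prems], of i] show ?case by (simp add: mult.assoc)
next
  case (homp_add d g g')
  from homp.homp_add[OF homp_add.IH(1)[OF homp_add.prems] homp_add.IH(2)[OF homp_add.prems]]
  show ?case by (simp add: distrib_right)
qed (auto intro: homp_scale)

text \<open>The bound is strict: the degree is below \<open>d\<close>, so that \<open>lowp 0\<close>
  means the zero function and each recursion step splits off the component of degree exactly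
  \<open>d\<close>.\<close>

fun lowp :: "nat \<Rightarrow> (complex^'n::finite \<Rightarrow> complex) \<Rightarrow> bool" where
  "lowp 0 g \<longleftrightarrow> (\<forall>p. g p = 0)"
| "lowp (Suc d) g \<longleftrightarrow> (\<exists>h k. lowp d h \<and> homp d k \<and> (\<forall>p. g p = h p + k p))"

lemma lowp_cong: "lowp d g \<Longrightarrow> (\<And>p. g p = h p) \<Longrightarrow> lowp d h"
  using ext[of g h] by simp

lemma lowp_SucI: "\<lbrakk>lowp d h; homp d k; \<And>p. g p = h p + k p\<rbrakk> \<Longrightarrow> lowp (Suc d) g"
  by auto

lemma lowp_zero [simp]: "lowp d (\<lambda>p. 0)"
  by (induction d) (auto intro!: exI[of _ "\<lambda>p. 0"] simp: homp_zero)

lemma lowp_add: "lowp d g \<Longrightarrow> lowp d h \<Longrightarrow> lowp d (\<lambda>p. g p + h p)"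
proof (induction d arbitrary: g h)
  case (Suc d)
  then obtain g1 g2 h1 h2 where "lowp d g1" "lowp d h1" "homp d g2" "homp d h2"
    "\<And>p. g p = g1 p + g2 p" "\<And>p. h p = h1 p + h2 p" by auto
  thus ?case using Suc.IH[of g1 h1]
    by (intro lowp_SucI[of d "\<lambda>p. g1 p + h1 p" "\<lambda>p. g2 p + h2 p"] homp_add) auto
qed simp

lemma lowp_scale: "lowp d g \<Longrightarrow> lowp d (\<lambda>p. k * g p)"
proof (induction d arbitrary: g)
  case (Suc d)
  then obtain g1 g2 where "lowp d g1" "homp d g2" "\<And>p. g p = g1 p + g2 p" by auto
  thus ?case using Suc.IH[of g1]
    by (intro lowp_SucI[of d "\<lambda>p. k * g1 p" "\<lambda>p. k * g2 p"] homp_scale) (auto simp: distrib_left)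
qed simp

lemma lowp_diff: "lowp d g \<Longrightarrow> lowp d h \<Longrightarrow> lowp d (\<lambda>p. g p - h p)"
  using lowp_add[of d g "\<lambda>p. -1 * h p"] lowp_scale[of d h "-1"] by simp

lemma lowp_sum: "(\<And>i. i \<in> A \<Longrightarrow> lowp d (F i)) \<Longrightarrow> lowp d (\<lambda>p. \<Sum>i\<in>A. F i p)"
  by (induction A rule: infinite_finite_induct) (auto intro: lowp_add)

lemma lowp_Suc: "lowp d g \<Longrightarrow> lowp (Suc d) g"
  using homp_zero[of d] by (intro lowp_SucI[of d g "\<lambda>p. 0"]) auto

lemma lowp_mono: "lowp d g \<Longrightarrow> d \<le> e \<Longrightarrow> lowp e g"
  by (induction e rule: nat_induct) (auto simp: le_Suc_eq intro: lowp_Suc simp del: lowp.simps(2))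

lemma homp_lowp: "homp d g \<Longrightarrow> lowp (Suc d) g"
  by (rule lowp_SucI[of d "\<lambda>p. 0" g]) auto

lemma lowp_subst: "lowp d g \<Longrightarrow> lowp d (\<lambda>p. g (p v* A))"
proof (induction d arbitrary: g)
  case (Suc d)
  then obtain g1 g2 where "lowp d g1" "homp d g2" "\<And>p. g p = g1 p + g2 p" by auto
  thus ?case using Suc.IH[of g1] homp_subst[of d g2 A]
    by (intro lowp_SucI[of d "\<lambda>p. g1 (p v* A)" "\<lambda>p. g2 (p v* A)"]) auto
qed simp

lemma lowp_mult_homp: "homp e k \<Longrightarrow> lowp d g \<Longrightarrow> lowp (e + d) (\<lambda>p. k p * g p)"
proof (induction d arbitrary: g)
  case (Suc d)
  then obtain g1 g2 where "lowp d g1" "homp d g2" "\<And>p. g p = g1 p + g2 p" by auto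
  thus ?case using Suc.IH[of g1] homp_mult[of e k d g2] Suc.prems(1)
    unfolding add_Suc_right
    by (intro lowp_SucI[of "e + d" "\<lambda>p. k p * g1 p" "\<lambda>p. k p * g2 p"]) (auto simp: distrib_left)
qed simp

text \<open>Degree at most \<open>e\<close> times degree below \<open>d\<close> has degree below
  \<open>e + d\<close>; this is the reason for the successor on one factor only.\<close>

lemma lowp_mult: "lowp (Suc e) k \<Longrightarrow> lowp d g \<Longrightarrow> lowp (e + d) (\<lambda>p. k p * g p)"
proof (induction e arbitrary: k)
  case 0
  then obtain k2 where "homp 0 k2" "\<And>p. k p = k2 p" by auto
  thus ?case using lowp_mult_homp[of 0 k2 d g] 0 by simp
next
  case (Suc e)
  then obtain k1 k2 where k: "lowp (Suc e) k1" "homp (Suc e) k2" "\<And>p. k p = k1 p + k2 p" by auto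
  have "lowp (Suc e + d) (\<lambda>p. k1 p * g p)" using Suc.IH[OF k(1) Suc.prems(2)] by (simp add: lowp_Suc del: lowp.simps)
  from lowp_add[OF this lowp_mult_homp[OF k(2) Suc.prems(2)]] show ?case
    by (rule lowp_cong) (simp add: k(3) distrib_right)
qed

text \<open>Divide the value at \<open>n p\<close> by the \<open>d\<close>-th power of
  \<open>n\<close>. Homogeneity makes the quotient constantly \<open>g p\<close>, while a lower
  degree makes it tend to 0.\<close>

lemma homp_lowp_zero:
  assumes "homp d g" "lowp d g" shows "g p = 0"
proof -
  have lim: "lowp d h \<Longrightarrow> (\<lambda>n. h (of_nat n *s p) / of_nat n ^ d) \<longlonglongrightarrow> 0" for h
  proof (induction d arbitrary: h)
    case (Suc d)
    then obtain h1 h2 where h: "lowp d h1" "homp d h2" "\<And>p. h p = h1 p + h2 p" by auto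
    have "(\<lambda>n. (h1 (of_nat n *s p) / of_nat n ^ d) * (1 / of_nat n) + h2 p * (1 / of_nat n)) \<longlonglongrightarrow> 0 * 0 + h2 p * 0"
      by (intro tendsto_intros Suc.IH h lim_1_over_n)
    moreover have "eventually (\<lambda>n. (h1 (of_nat n *s p) / of_nat n ^ d) * (1 / of_nat n) + h2 p * (1 / of_nat n)
       = h (of_nat n *s p) / of_nat n ^ Suc d) sequentially"
      using eventually_gt_at_top[of 0] by eventually_elim (simp add: h homp_scaling[OF h(2)] field_simps)
    ultimately show ?case by (simp add: tendsto_cong)
  qed simp
  have "eventually (\<lambda>n. g (of_nat n *s p) / of_nat n ^ d = g p) sequentially"
    using eventually_gt_at_top[of 0] by eventually_elim (simp add: homp_scaling[OF assms(1)])
  hence "(\<lambda>n. g (of_nat n *s p) / of_nat n ^ d) \<longlonglongrightarrow> g p" by (rule tendsto_eventually)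
  thus ?thesis using lim[OF assms(2)] LIMSEQ_unique by blast
qed

section \<open>Components of polynomials\<close>

definition pcomp :: "('n letter multiset \<Rightarrow> bool) \<Rightarrow> 'n mpoly \<Rightarrow> 'n mpoly" where
  "pcomp P = mlift (Poly_Mapping.single 0) (\<lambda>m. if P m then Poly_Mapping.single m 1 else 0)"

lemma pcomp_simps [simp]: "pcomp P 0 = 0" "pcomp P (f + g) = pcomp P f + pcomp P g"
   "pcomp P (f - g) = pcomp P f - pcomp P g"
   "pcomp P (Poly_Mapping.single m k) = (if P m then Poly_Mapping.single m k else 0)"
  by (simp_all add: pcomp_def mlift_add mlift_diff mlift_single mult_single scalar_hom_single)

lemma lookup_pcomp: "Poly_Mapping.lookup (pcomp P f) m = (if P m then Poly_Mapping.lookup f m else 0)"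
  by (induction f rule: poly_mapping_sum_induct) (auto simp: lookup_add lookup_single when_def)

lemma keys_pcomp: "Poly_Mapping.keys (pcomp P f) = {m \<in> Poly_Mapping.keys f. P m}"
  by (auto simp: in_keys_iff lookup_pcomp split: if_splits)

lemma pcomp_id: "(\<And>m. m \<in> Poly_Mapping.keys f \<Longrightarrow> P m) \<Longrightarrow> pcomp P f = f"
  by (rule poly_mapping_eqI) (auto simp: lookup_pcomp in_keys_iff)

definition xdeg :: "'n letter multiset \<Rightarrow> nat" where "xdeg m = size (filter_mset isX m)"
definition ydeg :: "'n letter multiset \<Rightarrow> nat" where "ydeg m = size (filter_mset (\<lambda>l. \<not> isX l) m)"

lemma deg_simps [simp]: "xdeg 0 = 0" "ydeg 0 = 0" "xdeg {#} = 0" "ydeg {#} = 0" "xdeg (m + m') = xdeg m + xdeg m'" "ydeg (m + m') = ydeg m + ydeg m'"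
  "xdeg (add_mset l m) = (if isX l then Suc (xdeg m) else xdeg m)"
  "ydeg (add_mset l m) = (if isX l then ydeg m else Suc (ydeg m))"
  by (simp_all add: xdeg_def ydeg_def)

definition ylt :: "nat \<Rightarrow> 'n mpoly \<Rightarrow> bool" where "ylt d f \<longleftrightarrow> (\<forall>m\<in>Poly_Mapping.keys f. ydeg m < d)"

abbreviation "ycomp d \<equiv> pcomp (\<lambda>m. ydeg m = d)"

lemma homp_mev: "homp (ydeg m) (\<lambda>p. mev (v, p) m)"
proof (induction m)
  case empty
  show ?case using homp_const by simp
next
  case (add l m)
  thus ?case by (cases l) (simp_all add: homp_scale homp_var)
qed

lemma homp_ev:
  assumes "\<And>m. m \<in> Poly_Mapping.keys f \<Longrightarrow> ydeg m = d" shows "homp d (\<lambda>p. ev f (v, p))"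
  unfolding ev_def mlift_def by (intro homp_sum homp_scale) (use assms homp_mev in metis)

lemma homp_ycomp: "homp d (\<lambda>p. ev (ycomp d f) (v, p))"
  by (rule homp_ev) (auto simp: keys_pcomp)

lemma ylt_ex: "\<exists>N. ylt N f"
proof -
  have "finite (ydeg ` Poly_Mapping.keys f)" by simp
  then obtain N where "\<forall>n\<in>ydeg ` Poly_Mapping.keys f. n < N" by (metis finite_nat_set_iff_bounded)
  thus ?thesis by (auto simp: ylt_def)
qed

lemma ylt_mono: "ylt d f \<Longrightarrow> d \<le> e \<Longrightarrow> ylt e f"
  by (auto simp: ylt_def)

lemma ylt_ycomp_zero: "ylt (Suc d) f \<Longrightarrow> ycomp d f = 0 \<Longrightarrow> ylt d f"
  unfolding ylt_def by (metis (mono_tags, lifting) empty_iff keys_pcomp keys_zero less_SucE mem_Collect_eq)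

lemma ylt_zero: "ylt 0 f \<Longrightarrow> f = 0"
  by (simp add: ylt_def)

context cherednik_data
begin

lemma reg_avoid:
  "\<exists>\<V>. finite \<V> \<and> (\<forall>V\<in>\<V>. vec.subspace V \<and> V \<noteq> (UNIV :: (complex^'n) set)) \<and>
     reg = {v. \<forall>V\<in>\<V>. v \<notin> V}"
proof (intro exI conjI ballI)
  let ?V = "(\<lambda>w. {v. w *v v = 1 *s v}) ` (W - {mat 1})"
  show "finite ?V" using fin by simp
  show "reg = {v. \<forall>V\<in>?V. v \<notin> V}" by (auto simp: reg_def)
  fix V assume "V \<in> ?V"
  then obtain w where w: "w \<in> W" "w \<noteq> mat 1" "V = {v. w *v v = 1 *s v}" by auto
    have "V \<noteq> UNIV"
    proof
      assume "V = UNIV"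
      hence "w *v v = mat 1 *v v" for v using w(3) by auto
      hence "w = mat 1" by (simp add: matrix_eq)
      thus False using w by simp
    qed
    thus "V \<noteq> UNIV" "vec.subspace V" using subspace_eigen[of w 1] w by simp_all
qed

lemma ev_reg_zero:
  assumes "\<And>v p. v \<in> reg \<Longrightarrow> ev f (v, p) = 0" shows "f = 0"
proof (rule ev_eq_0)
  fix z :: "'n pt"
  obtain \<V> where V: "finite \<V>" "\<And>V. V \<in> \<V> \<Longrightarrow> vec.subspace V \<and> V \<noteq> (UNIV :: (complex^'n) set)"
     "reg = {v. \<forall>V\<in>\<V>. v \<notin> V}" using reg_avoid by blast
  have "ev f (fst z, snd z) = 0"
    by (rule continuous_avoid_zero[OF V(1,2), of "\<lambda>v. ev f (v, snd z)"])
      (use assms V in \<open>auto intro!: continuous_ev continuous_intros\<close>)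
  thus "ev f z = 0" by simp
qed

text \<open>
  The filtration is by degree in \<open>p\<close> alone; \<open>G\<close> is the symbol of \<open>T\<close> in degree \<open>d\<close>, which may be zero.
\<close>

definition lowop :: "nat \<Rightarrow> 'n lop \<Rightarrow> bool" where
  "lowop d T \<longleftrightarrow> (\<exists>g. coeffs T g \<and> (\<forall>w\<in>W. \<forall>v\<in>reg. lowp d (\<lambda>p. g w (v, p))))"

definition sym :: "nat \<Rightarrow> 'n lop \<Rightarrow> ('n cmat \<Rightarrow> 'n pt \<Rightarrow> complex) \<Rightarrow> bool" where
  "sym d T G \<longleftrightarrow> (\<exists>g. coeffs T g \<and> (\<forall>w\<in>W. \<forall>v\<in>reg. homp d (\<lambda>p. G w (v, p)) \<and> lowp d (\<lambda>p. g w (v, p) - G w (v, p))))"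

text \<open>The leading parts are chosen separately for every \<open>w\<close> and \<open>v\<close>.
  Regularity in \<open>v\<close> is not claimed at this stage; \<open>symbol_polynomial\<close>
  supplies it later.\<close>

lemma lowop_sym: "lowop (Suc d) T \<longleftrightarrow> (\<exists>G. sym d T G)"
proof
  assume "lowop (Suc d) T"
  then obtain g where g: "coeffs T g" "\<forall>w\<in>W. \<forall>v\<in>reg. lowp (Suc d) (\<lambda>p. g w (v, p))" by (auto simp: lowop_def simp del: lowp.simps)
  have "\<exists>k. w \<in> W \<longrightarrow> v \<in> reg \<longrightarrow> homp d k \<and> lowp d (\<lambda>p. g w (v, p) - k p)" for w v
  proof (cases "w \<in> W \<and> v \<in> reg")
    case True
    with g obtain h k where "lowp d h" "homp d k" "\<forall>p. g w (v, p) = h p + k p" by fastforce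
    thus ?thesis by (intro exI[of _ k]) (auto elim: lowp_cong)
  qed auto
  then obtain k where k: "\<And>w v. w \<in> W \<longrightarrow> v \<in> reg \<longrightarrow> homp d (k w v) \<and> lowp d (\<lambda>p. g w (v, p) - k w v p)" by metis
  show "\<exists>G. sym d T G" unfolding sym_def
    by (rule exI[of _ "\<lambda>w (v, p). k w v p"], rule exI[of _ g]) (use g k in simp)
next
  assume "\<exists>G. sym d T G"
  then obtain G g where g: "coeffs T g" "\<forall>w\<in>W. \<forall>v\<in>reg. homp d (\<lambda>p. G w (v, p)) \<and> lowp d (\<lambda>p. g w (v, p) - G w (v, p))"
    by (auto simp: sym_def)
  have "lowp (Suc d) (\<lambda>p. g w (v, p))" if "w \<in> W" "v \<in> reg" for w v
    by (rule lowp_SucI[of d "\<lambda>p. g w (v, p) - G w (v, p)" "\<lambda>p. G w (v, p)"]) (use g that in auto)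
  thus "lowop (Suc d) T" using g(1) by (auto simp: lowop_def)
qed

lemma sym_lowop: "sym d T G \<Longrightarrow> lowop (Suc d) T"
  using lowop_sym by blast

lemma lowop_mono: "lowop d T \<Longrightarrow> d \<le> e \<Longrightarrow> lowop e T"
  unfolding lowop_def using lowp_mono by blast

lemma lowop_coeffs: "lowop d T \<Longrightarrow> coeffs T g \<Longrightarrow> w \<in> W \<Longrightarrow> v \<in> reg \<Longrightarrow> lowp d (\<lambda>p. g w (v, p))"
proof -
  assume "lowop d T" "coeffs T g" and w: "w \<in> W" "v \<in> reg"
  then obtain h where h: "coeffs T h" "lowp d (\<lambda>p. h w (v, p))" by (auto simp: lowop_def)
  have "h w (v, p) = g w (v, p)" for p
    using coeffs_unique[OF h(1), of "(v, p)" w] coeffs_unique[OF \<open>coeffs T g\<close>, of "(v, p)" w] w by simp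
  with h(2) show ?thesis by (rule lowp_cong)
qed

lemma sym_zero:
  assumes "sym d T G" "lowop d T" "w \<in> W" "fst z \<in> reg" shows "G w z = 0"
proof -
  obtain g where g: "coeffs T g" "homp d (\<lambda>p. G w (fst z, p))" "lowp d (\<lambda>p. g w (fst z, p) - G w (fst z, p))"
    using assms unfolding sym_def by blast
  have "lowp d (\<lambda>p. g w (fst z, p))" using lowop_coeffs assms g by blast
  from lowp_diff[OF this g(3)] have "lowp d (\<lambda>p. G w (fst z, p))" by simp
  from homp_lowp_zero[OF g(2) this, of "snd z"] show ?thesis by simp
qed

lemma sym_add: "sym d S G \<Longrightarrow> sym d T H \<Longrightarrow> sym d (S + T) (\<lambda>w z. G w z + H w z)"
proof -
  assume "sym d S G" "sym d T H"
  then obtain g h where g: "coeffs S g" "\<forall>w\<in>W. \<forall>v\<in>reg. homp d (\<lambda>p. G w (v, p)) \<and> lowp d (\<lambda>p. g w (v, p) - G w (v, p))"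
    and h: "coeffs T h" "\<forall>w\<in>W. \<forall>v\<in>reg. homp d (\<lambda>p. H w (v, p)) \<and> lowp d (\<lambda>p. h w (v, p) - H w (v, p))"
    unfolding sym_def by blast
  show ?thesis unfolding sym_def
  proof (intro exI[of _ "\<lambda>w x. g w x + h w x"] conjI ballI)
    fix w v assume "w \<in> W" "v \<in> reg"
    thus "homp d (\<lambda>p. G w (v, p) + H w (v, p))" using g h by (intro homp_add) auto
    have "lowp d (\<lambda>p. (g w (v, p) - G w (v, p)) + (h w (v, p) - H w (v, p)))"
      using g h \<open>w \<in> W\<close> \<open>v \<in> reg\<close> by (intro lowp_add) auto
    thus "lowp d (\<lambda>p. g w (v, p) + h w (v, p) - (G w (v, p) + H w (v, p)))" by (rule lowp_cong) simp
  qed (intro coeffs_add g h)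
qed

lemma lowop_add: "lowop d S \<Longrightarrow> lowop d T \<Longrightarrow> lowop d (S + T)"
  unfolding lowop_def
  by (elim exE conjE) (rule exI, rule conjI, erule (1) coeffs_add, simp add: lowp_add)

lemma coeffs_mulop_left: "coeffs T g \<Longrightarrow> coeffs (mulop \<phi> * T) (\<lambda>w x. \<phi> x * g w x)"
  by (auto simp: coeffs_def sum_distrib_left mult.assoc)

lemma coeffs_Wop_left:
  assumes "coeffs T g" "u \<in> W"
  shows "coeffs (Wop u * T) (\<lambda>w x. g (matrix_inv u ** w) (act u x))"
  using coeffs_mult[OF coeffs_Wop[OF assms(2)] assms(1)] fin assms(2)
  by simp

lemma coeffs_Wop_right:
  assumes "coeffs T g" "u \<in> W"
  shows "coeffs (T * Wop u) (\<lambda>w x. g (w ** matrix_inv u) x)"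
  unfolding coeffs_def
proof (intro allI impI)
  fix f and x :: "'n pt" assume x: "fst x \<in> reg"
  have "ap (T * Wop u) f x = (\<Sum>w\<in>W. g w x * f (act (w ** u) x))"
    using x assms by (simp add: coeffsD[OF assms(1)] Wop_def act_act cong: sum.cong)
  also have "\<dots> = (\<Sum>w\<in>W. g (w ** u ** matrix_inv u) x * f (act (w ** u) x))" using assms by simp
  also have "\<dots> = (\<Sum>w\<in>W. g (w ** matrix_inv u) x * f (act w x))"
    by (rule sum_W_right[OF assms(2), of "\<lambda>w. g (w ** matrix_inv u) x * f (act w x)"])
  finally show "ap (T * Wop u) f x = (\<Sum>w\<in>W. g (w ** matrix_inv u) x * f (act w x))" .
qed

lemma coeffs_iota: "coeffs (iota * T) g \<longleftrightarrow> coeffs T g"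
  by (simp add: coeffs_def ap_iota)

lemma lowop_iota [simp]: "lowop d (iota * T) = lowop d T"
  by (simp add: lowop_def coeffs_iota)

lemma sym_iota [simp]: "sym d (iota * T) G = sym d T G"
  by (simp add: sym_def coeffs_iota)

lemma sym_scale:
  assumes "sym d T G" and \<phi>: "\<And>v p. \<phi> (v, p) = k v"
  shows "sym d (mulop \<phi> * T) (\<lambda>w z. \<phi> z * G w z)"
proof -
  obtain g where g: "coeffs T g" "\<forall>w\<in>W. \<forall>v\<in>reg. homp d (\<lambda>p. G w (v, p)) \<and> lowp d (\<lambda>p. g w (v, p) - G w (v, p))"
    using assms unfolding sym_def by blast
  show ?thesis unfolding sym_def
    by (rule exI[of _ "\<lambda>w x. \<phi> x * g w x"])
      (use g in \<open>auto simp: \<phi> homp_scale intro!: coeffs_mulop_left simp flip: right_diff_distrib intro!: lowp_scale\<close>)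
qed

lemma lowop_scale:
  assumes "lowop d T" and \<phi>: "\<And>v p. \<phi> (v, p) = k v"
  shows "lowop d (mulop \<phi> * T)"
proof -
  obtain g where g: "coeffs T g" "\<forall>w\<in>W. \<forall>v\<in>reg. lowp d (\<lambda>p. g w (v, p))"
    using assms unfolding lowop_def by blast
  show ?thesis unfolding lowop_def
    by (rule exI[of _ "\<lambda>w x. \<phi> x * g w x"]) (use g in \<open>auto simp: \<phi> intro: coeffs_mulop_left lowp_scale\<close>)
qed

lemma sym_xop: "sym d T G \<Longrightarrow> sym d (xop x * T) (\<lambda>w z. pairing x (fst z) * G w z)"
  using sym_scale[of d T G "\<lambda>(v, p). pairing x v" "pairing x"] by (simp add: xop_def split_beta)

lemma sym_scal: "sym d T G \<Longrightarrow> sym d (scal k * T) (\<lambda>w z. k * G w z)"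
  using sym_scale[of d T G "\<lambda>_. k" "\<lambda>_. k"] by (simp add: scal_def)

lemma lowop_Wop_left:
  assumes "lowop d T" "u \<in> W" shows "lowop d (Wop u * T)"
proof -
  obtain g where g: "coeffs T g" "\<forall>w\<in>W. \<forall>v\<in>reg. lowp d (\<lambda>p. g w (v, p))"
    using assms unfolding lowop_def by blast
  show ?thesis unfolding lowop_def
  proof (intro exI[of _ "\<lambda>w x. g (matrix_inv u ** w) (act u x)"] conjI ballI)
    fix w v assume "w \<in> W" "v \<in> reg"
    hence "lowp d (\<lambda>p. g (matrix_inv u ** w) (matrix_inv u *v v, p))" using g assms by (auto simp: W_minv)
    from lowp_subst[OF this, of u] show "lowp d (\<lambda>p. g (matrix_inv u ** w) (act u (v, p)))" by (simp add: act_def)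
  qed (intro coeffs_Wop_left g assms)
qed

lemma sym_Wop_right:
  assumes "sym d T G" "u \<in> W"
  shows "sym d (T * Wop u) (\<lambda>w z. G (w ** matrix_inv u) z)"
proof -
  obtain g where g: "coeffs T g" "\<forall>w\<in>W. \<forall>v\<in>reg. homp d (\<lambda>p. G w (v, p)) \<and> lowp d (\<lambda>p. g w (v, p) - G w (v, p))"
    using assms unfolding sym_def by blast
  show ?thesis unfolding sym_def
    by (rule exI[of _ "\<lambda>w x. g (w ** matrix_inv u) x"]) (use g assms in \<open>auto simp: coeffs_Wop_right W_mult W_minv\<close>)
qed

lemma sym_lowop_add:
  assumes "sym d S G" "lowop d T" shows "sym d (S + T) G"
proof -
  have "sym d T (\<lambda>w z. 0)" using assms(2) unfolding sym_def lowop_def by (auto simp: homp_zero)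
  from sym_add[OF assms(1) this] show ?thesis by simp
qed

lemma lowop_sum: "(\<And>i. i \<in> A \<Longrightarrow> lowop d (T i)) \<Longrightarrow> lowop d (\<Sum>i\<in>A. T i)"
proof (induction A rule: infinite_finite_induct)
  case (insert i A)
  thus ?case by (simp add: lowop_add)
qed (auto simp: lowop_def coeffs_def intro!: exI[of _ "\<lambda>w x. 0"])

text \<open>Reflections act linearly on \<open>p\<close> and do not raise the degree, so the leading
  part of a Dunkl operator is multiplication by \<open>p(y)\<close>.\<close>

lemma sym_dun:
  assumes "sym d T G" shows "sym (Suc d) (dun y * T) (\<lambda>w z. pairing (snd z) y * G w z)"
proof -
  obtain g where g: "coeffs T g" "\<forall>w\<in>W. \<forall>v\<in>reg. homp d (\<lambda>p. G w (v, p)) \<and> lowp d (\<lambda>p. g w (v, p) - G w (v, p))"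
    using assms unfolding sym_def by blast
  have "sym (Suc d) (mulop (\<lambda>(v, p). pairing p y) * T) (\<lambda>w z. pairing (snd z) y * G w z)"
    unfolding sym_def
  proof (intro exI[of _ "\<lambda>w x. (case x of (v, p) \<Rightarrow> pairing p y) * g w x"] conjI ballI)
    fix w v assume wv: "w \<in> W" "v \<in> reg"
    thus "homp (Suc d) (\<lambda>p. pairing (snd (v, p)) y * G w (v, p))" using g by (simp add: homp_linear)
    have "homp 1 (\<lambda>p. pairing p y)" using homp_linear[OF homp_const[of 1], of y] by simp
    from lowp_mult_homp[OF this] have "lowp (1 + d) (\<lambda>p. pairing p y * (g w (v, p) - G w (v, p)))" using g wv by simp
    thus "lowp (Suc d) (\<lambda>p. (case (v, p) of (v, p) \<Rightarrow> pairing p y) * g w (v, p) - pairing (snd (v, p)) y * G w (v, p))"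
      by (simp only: plus_1_eq_Suc) (rule lowp_cong, simp_all add: right_diff_distrib)
  qed (intro coeffs_mulop_left g)
  moreover have "lowop (Suc d) (\<Sum>s\<in>SS. mulop (\<lambda>(v, p). kk s * pairing (\<alpha> s) y / pairing (\<alpha> s) v) * Wop s * T)"
  proof (rule lowop_sum)
    fix s assume "s \<in> SS"
    hence "lowop (Suc d) (Wop s * T)" using lowop_Wop_left[OF sym_lowop[OF assms]] SS_W by blast
    from lowop_scale[OF this, of "\<lambda>(v, p). kk s * pairing (\<alpha> s) y / pairing (\<alpha> s) v"]
    show "lowop (Suc d) (mulop (\<lambda>(v, p). kk s * pairing (\<alpha> s) y / pairing (\<alpha> s) v) * Wop s * T)"
      by (simp add: mult.assoc)
  qed
  ultimately show ?thesis
    unfolding dun_def distrib_right sum_distrib_right by (rule sym_lowop_add)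
qed

lemma scal_one [simp]: "scal 1 = 1"
  by (rule lop_eqI) simp

lemma sym_one: "sym 0 1 (\<lambda>w z. of_bool (w = mat 1))"
  unfolding sym_def using coeffs_mulop[of "\<lambda>_. 1"] scal_one
  by (intro exI[of _ "\<lambda>w z. of_bool (w = mat 1)"]) (simp add: scal_def[symmetric] homp_const)

lemma sym_lw: "sym (ydeg (mset us)) (rt (lw us)) (\<lambda>w z. of_bool (w = mat 1) * mev z (mset us))"
proof (induction us)
  case Nil
  show ?case using sym_one by simp
next
  case (Cons l us)
  show ?case
  proof (cases l)
    case (X i)
    thus ?thesis using sym_xop[OF Cons, of "axis i 1"] by (simp add: mult_ac)
  next
    case (Y i)
    thus ?thesis using sym_dun[OF Cons, of "axis i 1"] by (simp add: mult_ac)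
  qed
qed

section \<open>Uniqueness of normal forms and faithfulness\<close>

definition NF :: "('n cmat \<Rightarrow> 'n mpoly) \<Rightarrow> 'n lop" where
  "NF \<phi> = (\<Sum>w\<in>W. rt (nfT (\<phi> w)) * Wop w)"

lemma rho_nf: "rho (nf \<phi>) = iota * NF \<phi>"
  unfolding rho_def rho'_def NF_def nf_def by simp

lemma NF_diff: "NF (\<lambda>w. \<phi> w - \<psi> w) = NF \<phi> - NF \<psi>"
  by (simp add: NF_def left_diff_distrib sum_subtractf)

lemma sym_nfT_lt: "ylt (Suc d) f \<Longrightarrow> sym d (rt (nfT f)) (\<lambda>w z. of_bool (w = mat 1) * ev (ycomp d f) z)"
proof -
  assume f: "ylt (Suc d) f"
  have mono: "sym d (rt (nfT (Poly_Mapping.single m k))) (\<lambda>w z. of_bool (w = mat 1) * ev (ycomp d (Poly_Mapping.single m k)) z)"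
    if "ydeg m < Suc d" for m k
  proof -
    have e: "mset (xlist m @ ylist m) = m" by (simp flip: multiset_partition)
    have s: "sym (ydeg m) (rt (lw (xlist m @ ylist m))) (\<lambda>w z. of_bool (w = mat 1) * mev z m)"
      using sym_lw[of "xlist m @ ylist m"] by (simp only: e)
    show ?thesis
    proof (cases "ydeg m = d")
      case True
      thus ?thesis using sym_scal[OF s, of k] by (simp add: mult_ac)
    next
      case False
      hence l: "lowop d (rt (lw (xlist m @ ylist m)))" using sym_lowop[OF s] lowop_mono that by (metis Suc_leI less_SucE)
      have "lowop d (scal k * rt (lw (xlist m @ ylist m)))" using lowop_scale[OF l, of "\<lambda>_. k"] by (simp add: scal_def)
      thus ?thesis using False unfolding sym_def lowop_def by (auto simp: homp_zero)
    qed
  qed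
  have all: "sym d (rt (nfT (\<Sum>m\<in>A. Poly_Mapping.single m (Poly_Mapping.lookup f m))))
     (\<lambda>w z. of_bool (w = mat 1) * ev (ycomp d (\<Sum>m\<in>A. Poly_Mapping.single m (Poly_Mapping.lookup f m))) z)"
    if "finite A" "A \<subseteq> Poly_Mapping.keys f" for A
    using that
  proof (induction A rule: finite_induct)
    case empty
    have "sym d 0 (\<lambda>w z. 0)" unfolding sym_def by (rule exI[of _ "\<lambda>w x. 0"]) (simp add: coeffs_def homp_zero)
    thus ?case by simp
  next
    case (insert m A)
    have "ydeg m < Suc d" using f insert by (auto simp: ylt_def)
    from sym_add[OF mono[OF this] insert.IH] show ?case using insert by (simp add: distrib_left)
  qed
  have "(\<Sum>u\<in>Poly_Mapping.keys f. Poly_Mapping.single u (Poly_Mapping.lookup f u)) = f"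
    by (rule poly_mapping_eqI) (auto simp: lookup_sum lookup_single when_def in_keys_iff)
  with all[OF finite_keys order_refl] show ?thesis by (simp only:)
qed

lemma sym_sum:
  assumes "finite A" "\<And>i. i \<in> A \<Longrightarrow> sym d (T i) (G i)"
  shows "sym d (\<Sum>i\<in>A. T i) (\<lambda>w z. \<Sum>i\<in>A. G i w z)"
  using assms
proof (induction A rule: finite_induct)
  case empty
  show ?case unfolding sym_def by (rule exI[of _ "\<lambda>w x. 0"]) (simp add: coeffs_def homp_zero)
qed (simp add: sym_add)

lemma sym_cong: "sym d T G \<Longrightarrow> (\<And>w z. w \<in> W \<Longrightarrow> fst z \<in> reg \<Longrightarrow> G w z = H w z) \<Longrightarrow> sym d T H"
  unfolding sym_def by simp

lemma sym_NF:
  assumes "\<And>w. w \<in> W \<Longrightarrow> ylt (Suc d) (\<phi> w)"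
  shows "sym d (NF \<phi>) (\<lambda>w z. ev (ycomp d (\<phi> w)) z)"
proof -
  have "sym d (NF \<phi>) (\<lambda>w z. \<Sum>u\<in>W. of_bool (w ** matrix_inv u = mat 1) * ev (ycomp d (\<phi> u)) z)"
    unfolding NF_def using assms by (intro sym_sum fin sym_Wop_right sym_nfT_lt)
  thus ?thesis
  proof (rule sym_cong)
    fix w z assume w: "w \<in> W"
    have "(\<Sum>u\<in>W. of_bool (w ** matrix_inv u = mat 1) * ev (ycomp d (\<phi> u)) z) = (\<Sum>u\<in>W. of_bool (u = w) * ev (ycomp d (\<phi> u)) z)"
    proof (rule sum.cong)
      fix u assume u: "u \<in> W"
      have "w ** matrix_inv u = mat 1 \<longleftrightarrow> u = w"
        using u w W_assoc4[OF u, of w] by (metis W_right matrix_mul_lid)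
      thus "of_bool (w ** matrix_inv u = mat 1) * ev (ycomp d (\<phi> u)) z = of_bool (u = w) * ev (ycomp d (\<phi> u)) z" by simp
    qed simp
    thus "(\<Sum>u\<in>W. of_bool (w ** matrix_inv u = mat 1) * ev (ycomp d (\<phi> u)) z) = ev (ycomp d (\<phi> w)) z"
      using fin w by simp
  qed
qed

lemma ylt_all_ex: "\<exists>N. \<forall>w\<in>W. ylt N (\<phi> w)"
proof -
  have "\<forall>w. \<exists>N. ylt N (\<phi> w)" using ylt_ex by blast
  from choice[OF this] obtain N where N: "\<And>w. ylt (N w) (\<phi> w)" by blast
  have "\<forall>w\<in>W. ylt (Max (N ` W)) (\<phi> w)" using N fin by (auto intro!: ylt_mono[OF N])
  thus ?thesis ..
qed

text \<open>As long as the coefficients exceed the degree of the operator, their top components form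
  a vanishing symbol. They are then zero at regular points, hence zero as polynomials, and the bound
  drops by one.\<close>

lemma NF_ylt:
  assumes "lowop d (NF \<phi>)" "w \<in> W" shows "ylt d (\<phi> w)"
proof -
  obtain N where N: "\<forall>w\<in>W. ylt N (\<phi> w)" using ylt_all_ex by blast
  have "\<forall>w\<in>W. ylt N (\<phi> w) \<Longrightarrow> \<forall>w\<in>W. ylt d (\<phi> w)"
  proof (induction N)
    case 0
    thus ?case by (auto simp: ylt_def)
  next
    case (Suc N)
    show ?case
    proof (cases "Suc N \<le> d")
      case True
      thus ?thesis using Suc.prems ylt_mono by blast
    next
      case False
      hence l: "lowop N (NF \<phi>)" using assms(1) lowop_mono by simp
      have s: "sym N (NF \<phi>) (\<lambda>w z. ev (ycomp N (\<phi> w)) z)" using Suc.prems by (intro sym_NF) auto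
      have "ycomp N (\<phi> w) = 0" if "w \<in> W" for w
        by (rule ev_reg_zero) (use sym_zero[OF s l that] in auto)
      thus ?thesis using Suc ylt_ycomp_zero by blast
    qed
  qed
  thus ?thesis using N assms by blast
qed

lemma lowop_zero: "lowop d 0"
  unfolding lowop_def by (rule exI[of _ "\<lambda>w x. 0"]) (simp add: coeffs_def)

text \<open>This is the independence half of the Poincare-Birkhoff-Witt property, the case of degree
  bound 0 in \<open>NF_ylt\<close>.\<close>

lemma NF_zero:
  assumes "iota * NF \<phi> = 0" "w \<in> W" shows "\<phi> w = 0"
proof -
  have "lowop 0 (NF \<phi>)" using lowop_zero[of 0] lowop_iota[of 0 "NF \<phi>"] assms(1) by simp
  from NF_ylt[OF this assms(2)] show ?thesis by (rule ylt_zero)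
qed

text \<open>An element of the kernel is congruent to a normal form, which is also killed and
  therefore has zero coefficients.\<close>

theorem rho_kernel: "f \<in> carrier (smash W) \<Longrightarrow> rho f = 0 \<longleftrightarrow> f \<in> CI"
proof
  assume f: "f \<in> carrier (smash W)" "rho f = 0"
  obtain \<phi> where \<phi>: "(\<lambda>w. f w - nf \<phi> w) \<in> CI" using normal_form f by blast
  have "(\<lambda>w. f w - nf \<phi> w) = f \<ominus>\<^bsub>smash W\<^esub> nf \<phi>" by (simp add: smash_minus)
  hence "rho f - rho (nf \<phi>) = 0" using rho_CI[OF \<phi>] by (simp add: rho_minus)
  hence "iota * NF \<phi> = 0" using f by (simp add: rho_nf)
  hence "\<phi> w = 0" if "w \<in> W" for w using NF_zero that by blast
  hence "nf \<phi> = (\<lambda>w. 0)" by (auto simp: nf_def)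
  thus "f \<in> CI" using \<phi> by simp
qed (rule rho_CI)

text \<open>By \<open>rho_kernel\<close> this is a copy of the Cherednik algebra; its unit is
  \<open>iota\<close> and not the identity operator.\<close>

definition HH :: "'n lop set" where "HH = rho ` carrier (smash W)"

lemma HH_NF: "h \<in> HH \<longleftrightarrow> (\<exists>\<phi>. h = iota * NF \<phi>)"
proof
  assume "h \<in> HH"
  then obtain f where f: "f \<in> carrier (smash W)" "h = rho f" by (auto simp: HH_def)
  obtain \<phi> where \<phi>: "(\<lambda>w. f w - nf \<phi> w) \<in> CI" using normal_form f by blast
  have "(\<lambda>w. f w - nf \<phi> w) = f \<ominus>\<^bsub>smash W\<^esub> nf \<phi>" by (simp add: smash_minus)
  hence "rho f - rho (nf \<phi>) = 0" using rho_CI[OF \<phi>] by (simp add: rho_minus)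
  thus "\<exists>\<phi>. h = iota * NF \<phi>" using f by (auto simp: rho_nf)
next
  assume "\<exists>\<phi>. h = iota * NF \<phi>"
  thus "h \<in> HH" unfolding HH_def by (auto simp flip: rho_nf)
qed

end

section \<open>The image of the algebra and its torus invariants\<close>

context cherednik_data
begin

lemma iota_left: "iota * (iota * h) = iota * h"
  by (simp flip: mult.assoc)

lemma HH_iota [simp]: "h \<in> HH \<Longrightarrow> iota * h = h" "h \<in> HH \<Longrightarrow> h * iota = h"
proof -
  have "iota * rho f = rho f" "rho f * iota = rho f" for f
    unfolding rho_def mult.assoc[of iota "rho' f"] iota_rho' by (rule iota_left)+
  thus "h \<in> HH \<Longrightarrow> iota * h = h" "h \<in> HH \<Longrightarrow> h * iota = h" by (auto simp: HH_def)
qed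

lemma HH_add: "a \<in> HH \<Longrightarrow> b \<in> HH \<Longrightarrow> a + b \<in> HH"
  unfolding HH_def by (auto simp flip: rho_add)

lemma HH_diff: "a \<in> HH \<Longrightarrow> b \<in> HH \<Longrightarrow> a - b \<in> HH"
  unfolding HH_def by (auto simp flip: rho_minus)

lemma HH_mult: "a \<in> HH \<Longrightarrow> b \<in> HH \<Longrightarrow> a * b \<in> HH"
  unfolding HH_def by (auto simp flip: rho_mult)

lemma HH_scal: "a \<in> HH \<Longrightarrow> scal k * a \<in> HH"
  unfolding HH_def by (auto simp flip: rho_smult)

lemma HH_rt: "iota * rt a \<in> HH"
  unfolding HH_def by (rule image_eqI[of _ _ "of_tensor a"]) (auto simp: rho_def)

lemma HH_one: "iota \<in> HH"
  using HH_rt[of 1] by simp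

lemma HH_zero: "0 \<in> HH"
  using HH_rt[of 0] by simp

lemma HH_Wop: "w \<in> W \<Longrightarrow> iota * Wop w \<in> HH"
  unfolding HH_def by (rule image_eqI[of _ _ "grp w"]) (auto simp: rho_def grp_def rho'_group_sum)

lemma HH_sum: "(\<And>i. i \<in> A \<Longrightarrow> T i \<in> HH) \<Longrightarrow> (\<Sum>i\<in>A. T i) \<in> HH"
  by (induction A rule: infinite_finite_induct) (auto intro: HH_add simp: HH_zero)

lemma HH_coeffs: "h \<in> HH \<Longrightarrow> \<exists>g. coeffs h g"
  unfolding HH_def using coeffs_rho by blast

lemma HH_off_reg: "h \<in> HH \<Longrightarrow> fst z \<notin> reg \<Longrightarrow> ap h f z = 0"
  using ap_iota[of "ap h f" z] HH_iota(1)[of h] ap_simps(5)[of iota h f] by simp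

section \<open>Invariant functions and the torus\<close>

definition winv :: "('n pt \<Rightarrow> complex) \<Rightarrow> bool" where
  "winv \<Phi> \<longleftrightarrow> (\<forall>w\<in>W. \<forall>z. \<Phi> (act w z) = \<Phi> z)"

lemma coeffs_winv:
  assumes "coeffs h g" "winv \<Phi>" "fst z \<in> reg"
  shows "ap h (\<lambda>z. \<Phi> z * F z) z = \<Phi> z * ap h F z"
proof -
  have "\<Phi> (act w z) = \<Phi> z" if "w \<in> W" for w using assms(2) that unfolding winv_def by blast
  thus ?thesis by (simp add: coeffsD[OF assms(1,3)] sum_distrib_left mult.left_commute)
qed

text \<open>Coefficient functions commute with multiplication and group elements fix an invariant
  function. No polynomiality of the function enters, so this is available before membership in the
  algebra is known.\<close>

lemma HH_winv_commute:
  assumes h: "h \<in> HH" and \<Phi>: "winv \<Phi>"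
  shows "h * mulop \<Phi> = mulop \<Phi> * h"
proof (rule lop_eqI)
  fix f z
  obtain g where g: "coeffs h g" using HH_coeffs h by blast
  show "ap (h * mulop \<Phi>) f z = ap (mulop \<Phi> * h) f z"
  proof (cases "fst z \<in> reg")
    case True
    thus ?thesis using coeffs_winv[OF g \<Phi> True, of f] by simp
  next
    case False
    thus ?thesis using HH_off_reg[OF h False] by simp
  qed
qed

text \<open>Conjugation by it multiplies \<open>xop\<close> by \<open>k\<close> and
  \<open>dun\<close> by the inverse of \<open>k\<close>, so invariance under the torus becomes a
  commutation of operators.\<close>

definition tau :: "complex \<Rightarrow> 'n lop" where
  "tau k = subop (\<lambda>(v, p). (k *s v, inverse k *s p))"

lemma tau_mult: "tau k * tau l = tau (k * l)"
  by (rule lop_eqI) (simp add: tau_def split_beta vector_smult_assoc mult.commute)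

lemma tau_one [simp]: "tau 1 = 1"
  by (rule lop_eqI) (simp add: tau_def)

lemma tau_cancel: "k \<noteq> 0 \<Longrightarrow> a * tau k = b * tau k \<longleftrightarrow> a = b"
proof
  assume k: "k \<noteq> 0" and "a * tau k = b * tau k"
  hence "a * tau k * tau (inverse k) = b * tau k * tau (inverse k)" by simp
  thus "a = b" using k by (simp add: mult.assoc tau_mult)
qed simp

lemma tau_xop: "tau k * xop x = scal k * xop x * tau k"
  by (rule lop_eqI) (simp add: tau_def xop_def split_beta pairing_scale)

lemma act_scale: "act w (a *s v, b *s p) = (a *s fst (act w (v, p)), b *s snd (act w (v, p)))"
  by (simp add: act_def vector_scalar_commute)
    (simp add: vector_matrix_mult_def vec_eq_iff sum_distrib_left mult_ac)

lemma tau_Wop: "tau k * Wop w = Wop w * tau k"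
  by (rule lop_eqI) (simp add: tau_def Wop_def split_beta act_scale)

lemma tau_dun:
  assumes k: "k \<noteq> 0"
  shows "tau k * dun y = scal (inverse k) * dun y * tau k"
proof (rule lop_eqI)
  fix f and z :: "'n pt"
  have 1: "ap (tau k * dun y) f z = pairing (inverse k *s snd z) y * f (k *s fst z, inverse k *s snd z) +
     (\<Sum>s\<in>SS. kk s * pairing (\<alpha> s) y / pairing (\<alpha> s) (k *s fst z) * f (act s (k *s fst z, inverse k *s snd z)))"
    by (simp add: tau_def ap_dun split_beta)
  have 2: "ap (scal (inverse k) * dun y * tau k) f z = inverse k * (pairing (snd z) y * f (k *s fst z, inverse k *s snd z) +
     (\<Sum>s\<in>SS. kk s * pairing (\<alpha> s) y / pairing (\<alpha> s) (fst z) * f (k *s fst (act s z), inverse k *s snd (act s z))))"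
    by (simp add: tau_def ap_dun split_beta)
  show "ap (tau k * dun y) f z = ap (scal (inverse k) * dun y * tau k) f z"
    unfolding 1 2 using k by (simp add: act_scale pairing_scale distrib_left sum_distrib_left field_simps)
qed

lemma reg_scale: "k \<noteq> 0 \<Longrightarrow> k *s v \<in> reg \<longleftrightarrow> v \<in> reg"
  by (auto simp: reg_def vector_scalar_commute)

lemma tau_iota: "k \<noteq> 0 \<Longrightarrow> tau k * iota = iota * tau k"
  by (rule lop_eqI) (simp add: tau_def ap_iota split_beta reg_scale)

lemma torus_hom:
  "torus_act k (const l) = const l" "torus_act k (a + b) = torus_act k a + torus_act k b"
  "torus_act k (a * b) = torus_act k a * torus_act k b" "torus_act k 0 = 0" "torus_act k 1 = 1"
  "torus_act k (gen (X i)) = const k * gen (X i)" "torus_act k (gen (Y i)) = const (inverse k) * gen (Y i)"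
  by (simp_all add: torus_act_def tensor_lift_talg const_hom)

lemma tau_rt: "k \<noteq> 0 \<Longrightarrow> tau k * rt a = rt (torus_act k a) * tau k"
proof (induction a rule: tensor_induct)
  case (gen l)
  thus ?case by (cases l) (simp_all add: torus_hom tau_xop tau_dun)
next
  case (add a b)
  thus ?case by (simp add: torus_hom distrib_left distrib_right)
next
  case (mult a b)
  have "tau k * rt (a * b) = (tau k * rt a) * rt b" by (simp add: mult.assoc)
  also have "\<dots> = rt (torus_act k a) * (tau k * rt b)" using mult by (simp add: mult.assoc)
  finally show ?case using mult by (simp add: torus_hom mult.assoc)
qed (simp add: torus_hom scal_commute)

lemma tau_rho:
  assumes k: "k \<noteq> 0" shows "tau k * rho f = rho (\<lambda>w. torus_act k (f w)) * tau k"
proof -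
  have *: "tau k * (rt a * Wop w) = rt (torus_act k a) * Wop w * tau k" for a w
  proof -
    have "tau k * (rt a * Wop w) = (tau k * rt a) * Wop w" by (simp add: mult.assoc)
    also have "\<dots> = rt (torus_act k a) * (tau k * Wop w)" by (simp add: tau_rt[OF k] mult.assoc)
    finally show ?thesis by (simp add: tau_Wop mult.assoc)
  qed
  have "tau k * rho' f = rho' (\<lambda>w. torus_act k (f w)) * tau k"
    by (simp add: rho'_def sum_distrib_left sum_distrib_right *)
  moreover have "tau k * rho f = iota * (tau k * rho' f)"
    by (simp add: rho_def tau_iota[OF k] flip: mult.assoc)
  ultimately show ?thesis by (simp add: rho_def mult.assoc)
qed

definition HT :: "'n lop set" where
  "HT = {h \<in> HH. \<forall>k. k \<noteq> 0 \<longrightarrow> tau k * h = h * tau k}"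

definition bal :: "'n mpoly \<Rightarrow> bool" where "bal f \<longleftrightarrow> (\<forall>m\<in>Poly_Mapping.keys f. xdeg m = ydeg m)"

definition ptorus :: "complex \<Rightarrow> 'n mpoly \<Rightarrow> 'n mpoly" where
  "ptorus k = mlift (Poly_Mapping.single 0) (\<lambda>m. Poly_Mapping.single m (k ^ xdeg m * inverse k ^ ydeg m))"

lemma ptorus_simps [simp]: "ptorus k (f + g) = ptorus k f + ptorus k g" "ptorus k 0 = 0"
   "ptorus k (Poly_Mapping.single m a) = Poly_Mapping.single m (a * (k ^ xdeg m * inverse k ^ ydeg m))"
  by (simp_all add: ptorus_def mlift_add mlift_single mult_single scalar_hom_single)

lemma lookup_ptorus: "Poly_Mapping.lookup (ptorus k f) m = Poly_Mapping.lookup f m * (k ^ xdeg m * inverse k ^ ydeg m)"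
  by (induction f rule: poly_mapping_sum_induct) (auto simp: lookup_add lookup_single when_def distrib_right)

lemma torus_lw: "torus_act k (lw us) = const (k ^ xdeg (mset us) * inverse k ^ ydeg (mset us)) * lw (us :: 'n letter list)"
proof (induction us)
  case (Cons l us)
  have c: "gen l * (const a * b) = const a * (gen l * b)" "const a * (const a' * b) = const (a * a') * b" for a a' b and l :: "'n letter"
    by (metis const_commute mult.assoc) (simp add: mult.assoc)
  show ?case
    by (cases l) (simp_all only: torus_hom lw_simps Cons mult.assoc c, simp_all add: mult_ac del: const_simps)
qed (simp add: torus_hom)

lemma torus_nfT: "torus_act k (nfT f) = nfT (ptorus k f)"
proof (induction f rule: poly_mapping_sum_induct)
  case (single m a)
  have "torus_act k (lw (xlist m @ ylist m)) = const (k ^ xdeg m * inverse k ^ ydeg m) * lw (xlist m @ ylist m)"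
    unfolding torus_lw by (simp flip: multiset_partition)
  thus ?case by (simp add: torus_hom mult.assoc)
qed (simp add: torus_hom)

text \<open>The single torus element 2 suffices: it scales a monomial by 2 to the difference of its
  two degrees, which is 1 only for balanced monomials. Uniqueness of normal forms permits comparing
  coefficients.\<close>

lemma HT_NF:
  assumes "h \<in> HT" shows "\<exists>\<phi>. h = iota * NF \<phi> \<and> (\<forall>w\<in>W. bal (\<phi> w))"
proof -
  obtain \<phi> where \<phi>: "h = iota * NF \<phi>" using assms HH_NF by (auto simp: HT_def)
  have "(\<lambda>w. torus_act 2 (nf \<phi> w)) = nf (\<lambda>w. ptorus 2 (\<phi> w))"
    by (auto simp: nf_def torus_nfT torus_hom)
  hence "tau 2 * h = iota * NF (\<lambda>w. ptorus 2 (\<phi> w)) * tau 2"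
    using tau_rho[of 2 "nf \<phi>"] by (simp add: \<phi> rho_nf)
  hence "iota * NF (\<lambda>w. ptorus 2 (\<phi> w)) * tau 2 = h * tau 2" using assms by (simp add: HT_def)
  hence "iota * NF (\<lambda>w. ptorus 2 (\<phi> w)) = iota * NF \<phi>" by (simp add: tau_cancel \<phi>)
  hence "iota * NF (\<lambda>w. ptorus 2 (\<phi> w) - \<phi> w) = 0" by (simp add: NF_diff right_diff_distrib)
  hence z: "ptorus 2 (\<phi> w) - \<phi> w = 0" if "w \<in> W" for w using NF_zero that by blast
  have "bal (\<phi> w)" if w: "w \<in> W" for w
    unfolding bal_def
  proof
    fix m assume m: "m \<in> Poly_Mapping.keys (\<phi> w)"
    have "Poly_Mapping.lookup (ptorus 2 (\<phi> w)) m = Poly_Mapping.lookup (\<phi> w) m" using z[OF w] by simp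
    hence "(2::complex) ^ xdeg m * inverse 2 ^ ydeg m = 1"
      using m by (simp add: lookup_ptorus in_keys_iff)
    hence "(2::complex) ^ xdeg m = 2 ^ ydeg m" by (simp add: field_simps power_inverse)
    hence "norm ((2::complex) ^ xdeg m) = norm ((2::complex) ^ ydeg m)" by simp
    thus "xdeg m = ydeg m" by (simp add: norm_power)
  qed
  thus ?thesis using \<phi> by blast
qed

lemma ptorus_bal: "bal f \<Longrightarrow> k \<noteq> 0 \<Longrightarrow> ptorus k f = f"
proof (rule poly_mapping_eqI)
  fix m assume f: "bal f" "k \<noteq> 0"
  show "Poly_Mapping.lookup (ptorus k f) m = Poly_Mapping.lookup f m"
  proof (cases "m \<in> Poly_Mapping.keys f")
    case True
    hence "xdeg m = ydeg m" using f by (simp add: bal_def)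
    thus ?thesis using f by (simp add: lookup_ptorus flip: power_mult_distrib)
  qed (simp add: lookup_ptorus in_keys_iff)
qed

lemma NF_HT:
  assumes "\<And>w. w \<in> W \<Longrightarrow> bal (\<phi> w)" shows "iota * NF \<phi> \<in> HT"
proof -
  have "tau k * (iota * NF \<phi>) = iota * NF \<phi> * tau k" if k: "k \<noteq> 0" for k
  proof -
    have "(\<lambda>w. torus_act k (nf \<phi> w)) = nf \<phi>"
      using assms k by (auto simp: nf_def torus_nfT torus_hom ptorus_bal)
    thus ?thesis using tau_rho[OF k, of "nf \<phi>"] by (simp add: rho_nf)
  qed
  thus ?thesis using HH_NF by (auto simp: HT_def)
qed

lemma HT_HH: "h \<in> HT \<Longrightarrow> h \<in> HH"
  by (simp add: HT_def)

lemma HT_add: "a \<in> HT \<Longrightarrow> b \<in> HT \<Longrightarrow> a + b \<in> HT"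
  and HT_diff: "a \<in> HT \<Longrightarrow> b \<in> HT \<Longrightarrow> a - b \<in> HT"
  by (auto simp: HT_def HH_add HH_diff algebra_simps)

lemma HT_mult: "a \<in> HT \<Longrightarrow> b \<in> HT \<Longrightarrow> a * b \<in> HT"
  by (auto simp: HT_def HH_mult mult.assoc) (metis mult.assoc)

lemma HT_scal: "a \<in> HT \<Longrightarrow> scal k * a \<in> HT"
  by (auto simp: HT_def HH_scal mult.assoc scal_commute[of "tau _"]) (metis mult.assoc scal_commute)

lemma HT_one: "iota \<in> HT"
  by (simp add: HT_def HH_one tau_iota)

lemma HT_Wop: "w \<in> W \<Longrightarrow> iota * Wop w \<in> HT"
  by (simp add: HT_def HH_Wop tau_iota mult.assoc tau_Wop[symmetric]) (simp add: tau_iota flip: mult.assoc)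

lemma HT_zero: "0 \<in> HT"
  using HT_scal[OF HT_one, of 0] by (simp add: scalar_hom_0[OF scal_hom])

lemma HT_sum: "(\<And>i. i \<in> A \<Longrightarrow> T i \<in> HT) \<Longrightarrow> (\<Sum>i\<in>A. T i) \<in> HT"
  by (induction A rule: infinite_finite_induct) (auto intro: HT_add simp: HT_zero)

section \<open>The spherical subalgebra\<close>

text \<open>The counterpart of \<open>sym\<close> for functions, in particular for the result of
  applying an operator to the constant 1.\<close>

definition fsym :: "nat \<Rightarrow> ('n pt \<Rightarrow> complex) \<Rightarrow> ('n pt \<Rightarrow> complex) \<Rightarrow> bool" where
  "fsym d F g \<longleftrightarrow> (\<forall>v\<in>reg. homp d (\<lambda>p. g (v, p)) \<and> lowp d (\<lambda>p. F (v, p) - g (v, p)))"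

lemma fsym_unique:
  assumes "fsym d F g" "fsym d F h" "fst z \<in> reg" shows "g z = h z"
proof -
  let ?v = "fst z"
  have "homp d (\<lambda>p. g (?v, p) + -1 * h (?v, p))"
    using assms by (intro homp_add homp_scale) (auto simp: fsym_def)
  moreover have "lowp d (\<lambda>p. (F (?v, p) - h (?v, p)) - (F (?v, p) - g (?v, p)))"
    using assms by (intro lowp_diff[of d "\<lambda>p. F (?v, p) - h (?v, p)" "\<lambda>p. F (?v, p) - g (?v, p)"]) (auto simp: fsym_def)
  hence "lowp d (\<lambda>p. g (?v, p) + -1 * h (?v, p))" by simp
  ultimately have "g (?v, snd z) + -1 * h (?v, snd z) = 0" by (rule homp_lowp_zero)
  thus ?thesis by simp
qed

lemma fsym_low_zero: "fsym d F g \<Longrightarrow> \<forall>v\<in>reg. lowp d (\<lambda>p. F (v, p)) \<Longrightarrow> fst z \<in> reg \<Longrightarrow> g z = 0"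
  using fsym_unique[of d F g "\<lambda>_. 0" z] by (simp add: fsym_def homp_zero)

lemma fsym_lowp: "fsym d F g \<Longrightarrow> v \<in> reg \<Longrightarrow> lowp (Suc d) (\<lambda>p. F (v, p))"
  unfolding fsym_def by (rule lowp_SucI[of d "\<lambda>p. F (v, p) - g (v, p)" "\<lambda>p. g (v, p)"]) auto

lemma fsym_apply:
  assumes T: "sym d T G" and F: "fsym e F g"
  shows "fsym (d + e) (ap T F) (\<lambda>z. \<Sum>w\<in>W. G w z * g (act w z))"
  unfolding fsym_def
proof (intro ballI conjI)
  fix v assume v: "v \<in> reg"
  obtain t where t: "coeffs T t" "\<forall>w\<in>W. \<forall>v\<in>reg. homp d (\<lambda>p. G w (v, p)) \<and> lowp d (\<lambda>p. t w (v, p) - G w (v, p))"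
    using T unfolding sym_def by blast
  have g: "homp e (\<lambda>p. g (act w (v, p)))" "lowp e (\<lambda>p. F (act w (v, p)) - g (act w (v, p)))" if "w \<in> W" for w
  proof -
    have "matrix_inv w *v v \<in> reg" using v that by (simp add: W_minv)
    hence "homp e (\<lambda>p. g (matrix_inv w *v v, p))" "lowp e (\<lambda>p. F (matrix_inv w *v v, p) - g (matrix_inv w *v v, p))"
      using F by (auto simp: fsym_def)
    from homp_subst[OF this(1), of w] lowp_subst[OF this(2), of w]
    show "homp e (\<lambda>p. g (act w (v, p)))" "lowp e (\<lambda>p. F (act w (v, p)) - g (act w (v, p)))" by (simp_all add: act_def)
  qed
  show "homp (d + e) (\<lambda>p. \<Sum>w\<in>W. G w (v, p) * g (act w (v, p)))"
    using t v g by (intro homp_sum homp_mult) auto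
  \<comment> \<open>For each \<open>w\<close> the error is split as
    \<open>(t - G) F + G (F - g)\<close>, where each product has one factor of lower degree.\<close>
  have "lowp (d + e) (\<lambda>p. \<Sum>w\<in>W. (t w (v, p) - G w (v, p)) * F (act w (v, p)) + G w (v, p) * (F (act w (v, p)) - g (act w (v, p))))"
  proof (intro lowp_sum lowp_add)
    fix w assume w: "w \<in> W"
    have F': "lowp (Suc e) (\<lambda>p. F (act w (v, p)))"
      by (rule lowp_SucI[OF g(2)[OF w] g(1)[OF w]]) simp
    have "lowp d (\<lambda>p. t w (v, p) - G w (v, p))" using t w v by blast
    from lowp_mult[OF F' this] show "lowp (d + e) (\<lambda>p. (t w (v, p) - G w (v, p)) * F (act w (v, p)))"
      by (simp add: mult.commute add.commute)
    show "lowp (d + e) (\<lambda>p. G w (v, p) * (F (act w (v, p)) - g (act w (v, p))))"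
      using t w v g by (intro lowp_mult_homp) auto
  qed
  thus "lowp (d + e) (\<lambda>p. ap T F (v, p) - (\<Sum>w\<in>W. G w (v, p) * g (act w (v, p))))"
    by (rule lowp_cong) (use v in \<open>simp add: coeffsD[OF t(1)] sum_subtractf[symmetric] algebra_simps\<close>)
qed

abbreviation "one1 \<equiv> (\<lambda>_::'n pt. 1::complex)"

lemma fsym_one: "fsym 0 one1 one1"
  by (simp add: fsym_def homp_const)

lemma fsym_nfT: "ylt (Suc d) f \<Longrightarrow> fsym d (ap (rt (nfT f)) one1) (ev (ycomp d f))"
proof -
  assume "ylt (Suc d) f"
  from fsym_apply[OF sym_nfT_lt[OF this] fsym_one] show ?thesis
    using fin by simp
qed

lemma fsym_ev:
  assumes "ylt (Suc d) f" shows "fsym d (ev f) (ev (ycomp d f))"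
proof -
  have low: "ylt d f \<Longrightarrow> lowp d (\<lambda>p. ev f (v, p))" for f d v
  proof (unfold ev_def mlift_def, intro lowp_sum lowp_scale)
    fix m assume "ylt d f" "m \<in> Poly_Mapping.keys f"
    hence "Suc (ydeg m) \<le> d" by (auto simp: ylt_def)
    thus "lowp d (\<lambda>p. mev (v, p) m)" using lowp_mono homp_lowp homp_mev by blast
  qed
  have "ylt d (f - ycomp d f)"
    unfolding ylt_def
  proof
    fix m assume "m \<in> Poly_Mapping.keys (f - ycomp d f)"
    hence "Poly_Mapping.lookup f m - (if ydeg m = d then Poly_Mapping.lookup f m else 0) \<noteq> 0"
      by (simp only: in_keys_iff lookup_minus lookup_pcomp) simp
    hence "m \<in> Poly_Mapping.keys f \<and> ydeg m \<noteq> d" by (cases "ydeg m = d") (simp_all add: in_keys_iff)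
    thus "ydeg m < d" using assms by (auto simp: ylt_def)
  qed
  from low[OF this] show ?thesis by (simp add: fsym_def homp_ycomp)
qed

text \<open>\<open>E\<close> stands for evaluation of polynomials or for their normal ordering
  applied to 1. Descending induction works for both, since the top component is determined by the
  values at regular points.\<close>

lemma ylt_of_fsym:
  assumes key: "\<And>M f. ylt (Suc M) f \<Longrightarrow> fsym M (E f) (ev (ycomp M f))"
    and low: "\<forall>v\<in>reg. lowp d (\<lambda>p. E f (v, p))"
  shows "ylt d f"
proof -
  obtain N where N: "ylt N f" using ylt_ex by blast
  thus ?thesis
  proof (induction N)
    case 0
    thus ?case by (auto simp: ylt_def)
  next
    case (Suc N)
    show ?case
    proof (cases "Suc N \<le> d")
      case True
      thus ?thesis using Suc.prems ylt_mono by blast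
    next
      case False
      hence "\<forall>v\<in>reg. lowp N (\<lambda>p. E f (v, p))" using low lowp_mono by (metis not_less_eq_eq)
      from fsym_low_zero[OF key[OF Suc.prems] this] have "ycomp N f = 0" by (intro ev_reg_zero) simp
      thus ?thesis using Suc ylt_ycomp_zero by blast
    qed
  qed
qed

lemma fsym_symbol:
  assumes key: "\<And>M f. ylt (Suc M) f \<Longrightarrow> fsym M (E f) (ev (ycomp M f))"
    and F: "fsym N (E f) g" and z: "fst z \<in> reg"
  shows "g z = ev (ycomp N f) z"
proof -
  have "ylt (Suc N) f" using ylt_of_fsym[of E, OF key] fsym_lowp[OF F] by blast
  from fsym_unique[OF F key[OF this] z] show ?thesis .
qed

lemma ap_NF_one: "ap (NF \<phi>) one1 = ap (rt (nfT (\<Sum>w\<in>W. \<phi> w))) one1"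
proof -
  have "ap (rt a * Wop w) one1 = ap (rt a) one1" for a w by (simp add: Wop_def)
  thus ?thesis by (simp add: NF_def del: ap_simps(5))
qed

lemma ycomp_idem: "ycomp d (ycomp d f) = ycomp d f"
  by (rule pcomp_id) (simp add: keys_pcomp)

lemma ylt_ycomp: "ylt (Suc d) (ycomp d f)"
  by (auto simp: ylt_def keys_pcomp)

end

section \<open>Homogeneous polynomials in p and interpolation\<close>

lemma homp_poly: "homp d g \<Longrightarrow> \<exists>f. \<forall>v p. ev f (v, p) = g p"
proof (induction rule: homp.induct)
  case (homp_const k)
  show ?case by (intro exI[of _ "Poly_Mapping.single 0 k"]) simp
next
  case (homp_var d g i)
  then obtain f where "\<forall>v p. ev f (v, p) = g p" by blast
  thus ?case by (intro exI[of _ "Poly_Mapping.single {#Y i#} 1 * f"]) simp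
next
  case (homp_add d g h)
  then obtain f f' where "\<forall>v p. ev f (v, p) = g p" "\<forall>v p. ev f' (v, p) = h p" by blast
  thus ?case by (intro exI[of _ "f + f'"]) simp
qed

lemma continuous_homp: "homp d g \<Longrightarrow> continuous_on UNIV g"
proof -
  assume "homp d g"
  then obtain f where f: "\<forall>v p. ev f (v, p) = g p" using homp_poly by blast
  have "continuous_on UNIV (\<lambda>p. ev f (0, p))" by (intro continuous_ev continuous_intros)
  thus ?thesis by (simp add: f)
qed

lemma ev_fix_p: "\<exists>f'. \<forall>v p. ev f' (v, p) = ev f (v, p0)"
proof (induction f rule: poly_mapping_sum_induct)
  case (single m k)
  have "\<exists>f'. \<forall>v p. ev f' (v, p) = mev (v, p0) m"
  proof (induction m)
    case empty
    show ?case by (intro exI[of _ 1]) simp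
  next
    case (add l m)
    then obtain f' where f': "\<forall>v p. ev f' (v, p) = mev (v, p0) m" by blast
    show ?case
    proof (cases l)
      case (X i)
      thus ?thesis using f' by (intro exI[of _ "Poly_Mapping.single {#X i#} 1 * f'"]) simp
    next
      case (Y i)
      thus ?thesis using f' by (intro exI[of _ "Poly_Mapping.single 0 (p0 $ i) * f'"]) simp
    qed
  qed
  then obtain f' where "\<forall>v p. ev f' (v, p) = mev (v, p0) m" by blast
  thus ?case by (intro exI[of _ "Poly_Mapping.single 0 k * f'"]) simp
next
  case (add a b)
  then obtain f f' where "\<forall>v p. ev f (v, p) = ev a (v, p0)" "\<forall>v p. ev f' (v, p) = ev b (v, p0)" by blast
  thus ?case by (intro exI[of _ "f + f'"]) simp
qed

lemma homp_finite_span: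
  "\<exists>B. finite B \<and> (\<forall>b\<in>B. homp d b) \<and> (\<forall>g. homp d g \<longrightarrow> (\<exists>k. \<forall>p. g p = (\<Sum>b\<in>B. k b * b p)))"
proof (induction d)
  case 0
  have "homp d g \<Longrightarrow> d = 0 \<Longrightarrow> \<exists>k. \<forall>p. g p = k" for d and g :: "complex^'a \<Rightarrow> complex"
    by (induction rule: homp.induct) auto
  hence *: "\<exists>k. \<forall>p. g p = k" if "homp 0 g" for g :: "complex^'a \<Rightarrow> complex" using that by blast
  show ?case
  proof (intro exI[of _ "{\<lambda>p. 1}"] conjI allI impI)
    fix g :: "complex^'a \<Rightarrow> complex" assume "homp 0 g"
    then obtain k where "\<forall>p. g p = k" using * by blast
    thus "\<exists>k. \<forall>p. g p = (\<Sum>b\<in>{\<lambda>p. 1}. k b * b p)" by (intro exI[of _ "\<lambda>_. k"]) simp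
  qed (auto intro: homp_const)
next
  case (Suc d)
  then obtain B where B: "finite B" "\<forall>b\<in>B. homp d b"
    "\<forall>g. homp d g \<longrightarrow> (\<exists>k. \<forall>p::complex^'a. g p = (\<Sum>b\<in>B. k b * b p))" by (elim exE conjE)
  define B' where "B' = (\<lambda>(i, b) p. p $ i * b p) ` (UNIV \<times> B)"
  have fin: "finite B'" using B by (simp add: B'_def)
  have "homp e g \<Longrightarrow> e = Suc d \<Longrightarrow> \<exists>k. \<forall>p. g p = (\<Sum>b\<in>B'. k b * b p)" for e g
  proof (induction rule: homp.induct)
    case (homp_var e g i)
    then obtain k where k: "\<And>p. g p = (\<Sum>b\<in>B. k b * b p)" using B by blast
    let ?f = "\<lambda>b p. p $ i * b p"
    have mem: "?f b \<in> B'" if "b \<in> B" for b using that by (auto simp: B'_def intro!: image_eqI[of _ _ "(i, b)"])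
    have "p $ i * g p = (\<Sum>b'\<in>B'. (\<Sum>b\<in>{b\<in>B. ?f b = b'}. k b) * b' p)" for p
    proof -
      have "p $ i * g p = (\<Sum>b\<in>B. k b * ?f b p)" by (simp add: k sum_distrib_left mult.left_commute)
      also have "\<dots> = (\<Sum>b'\<in>B'. \<Sum>b\<in>{b\<in>B. ?f b = b'}. k b * ?f b p)"
        using mem by (intro sum.group[symmetric] B fin) auto
      also have "\<dots> = (\<Sum>b'\<in>B'. (\<Sum>b\<in>{b\<in>B. ?f b = b'}. k b) * b' p)"
        by (intro sum.cong refl) (auto simp: sum_distrib_right intro!: sum.cong)
      finally show ?thesis .
    qed
    thus ?case by (intro exI[of _ "\<lambda>b'. \<Sum>b\<in>{b\<in>B. ?f b = b'}. k b"]) simp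
  next
    case (homp_add e g h)
    then obtain k l where "\<And>p. g p = (\<Sum>b\<in>B'. k b * b p)" "\<And>p. h p = (\<Sum>b\<in>B'. l b * b p)" by blast
    thus ?case by (intro exI[of _ "\<lambda>b. k b + l b"]) (simp add: distrib_right sum.distrib)
  qed simp
  moreover have "homp (Suc d) b" if "b \<in> B'" for b using that B by (auto simp: B'_def intro!: homp_var)
  ultimately show ?case using fin by blast
qed

text \<open>Gaussian elimination with pivots chosen in \<open>D\<close>.\<close>

lemma interpolation:
  fixes B :: "('a \<Rightarrow> complex) set"
  assumes "finite B" and P: "\<And>b. b \<in> B \<Longrightarrow> P b"
    and lin: "\<And>k f g. P f \<Longrightarrow> P g \<Longrightarrow> P (\<lambda>x. f x + k * g x)" and P0: "P (\<lambda>x. 0)"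
  shows "\<exists>K L. finite K \<and> K \<subseteq> D \<and> (\<forall>k\<in>K. P (L k)) \<and> (\<forall>k\<in>K. \<forall>l\<in>K. L k l = of_bool (k = l)) \<and>
     (\<forall>b\<in>B. \<forall>x\<in>D. b x = (\<Sum>k\<in>K. b k * L k x))"
  using assms(1) P
proof (induction B rule: finite_induct)
  case empty
  show ?case by (intro exI[of _ "{}"]) auto
next
  case (insert b B)
  then obtain K L where K: "finite K" "K \<subseteq> D" "\<forall>k\<in>K. P (L k)" "\<forall>k\<in>K. \<forall>l\<in>K. L k l = of_bool (k = l)"
    "\<forall>b\<in>B. \<forall>x\<in>D. b x = (\<Sum>k\<in>K. b k * L k x)" by auto
  define b' where "b' = (\<lambda>x. b x - (\<Sum>k\<in>K. b k * L k x))"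
  have Psum: "P (\<lambda>x. f x + (\<Sum>k\<in>A. a k * L k x))" if "finite A" "A \<subseteq> K" "P f" for A a f
    using that
  proof (induction A rule: finite_induct)
    case (insert k A)
    hence "P (\<lambda>x. (f x + (\<Sum>k\<in>A. a k * L k x)) + a k * L k x)" using K by (intro lin) auto
    thus ?case using insert by (simp add: add_ac)
  qed simp
  have Pb': "P b'" using Psum[OF K(1) order_refl, of b "\<lambda>k. - b k"] insert.prems
    by (simp add: b'_def sum_negf)
  have b'K: "b' l = 0" if "l \<in> K" for l
  proof -
    have "(\<Sum>k\<in>K. b k * L k l) = (\<Sum>k\<in>K. of_bool (k = l) * b k)"
      using K that by (intro sum.cong) auto
    thus ?thesis using K(1) that by (simp add: b'_def)
  qed
  show ?case
  proof (cases "\<forall>x\<in>D. b' x = 0")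
    case True
    thus ?thesis using K by (intro exI[of _ K] exI[of _ L]) (auto simp: b'_def)
  next
    case False
    then obtain x0 where x0: "x0 \<in> D" "b' x0 \<noteq> 0" by blast
    have x0K: "x0 \<notin> K" using x0 b'K by auto
    \<comment> \<open>The residual \<open>b'\<close> vanishes at the old pivots. Normalised at the
      new pivot it joins the dual family, and multiples of it are subtracted from the old members to
      make them vanish there.\<close>
    define L0 where "L0 = (\<lambda>x. b' x / b' x0)"
    define L' where "L' = (\<lambda>k. if k = x0 then L0 else (\<lambda>x. L k x - L k x0 * L0 x))"
    have PL0: "P L0" using lin[OF P0 Pb', of "1 / b' x0"] by (simp add: L0_def)
    have L0: "L0 x0 = 1" "\<And>k. k \<in> K \<Longrightarrow> L0 k = 0" using x0 b'K by (auto simp: L0_def)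
    have sum: "(\<Sum>k\<in>insert x0 K. g k * L' k x) = (\<Sum>k\<in>K. g k * L k x) + (g x0 - (\<Sum>k\<in>K. g k * L k x0)) * L0 x" for g x
    proof -
      have "(\<Sum>k\<in>K. g k * L' k x) = (\<Sum>k\<in>K. g k * L k x - g k * L k x0 * L0 x)"
        using x0K by (intro sum.cong) (auto simp: L'_def algebra_simps)
      moreover have "L' x0 = L0" by (simp add: L'_def)
      ultimately show ?thesis using K(1) x0K by (simp add: sum_subtractf sum_distrib_left algebra_simps)
    qed
    show ?thesis
    proof (intro exI[of _ "insert x0 K"] exI[of _ L'] conjI ballI)
      fix k assume k: "k \<in> insert x0 K"
      show "P (L' k)"
        using k PL0 K lin[of "L k" L0 "- L k x0"] by (auto simp: L'_def)
      fix l assume "l \<in> insert x0 K"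
      thus "L' k l = of_bool (k = l)" using k L0 x0K K(4) by (cases "k = x0"; cases "l = x0") (simp_all add: L'_def)
    next
      fix a x assume a: "a \<in> insert b B" "x \<in> D"
      show "a x = (\<Sum>k\<in>insert x0 K. a k * L' k x)"
      proof (cases "a = b")
        case True
        have "b x0 - (\<Sum>k\<in>K. b k * L k x0) = b' x0" by (simp add: b'_def)
        hence "(b x0 - (\<Sum>k\<in>K. b k * L k x0)) * L0 x = b' x" using x0 by (simp add: L0_def)
        thus ?thesis using True unfolding sum by (simp add: b'_def)
      next
        case False
        hence "a x = (\<Sum>k\<in>K. a k * L k x)" "a x0 = (\<Sum>k\<in>K. a k * L k x0)" using a K x0 by auto
        thus ?thesis unfolding sum by simp
      qed
    qed (use K x0 in auto)
  qed
qed

text \<open>For each point to be excluded one factor, affine in a coordinate that distinguishes it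
  from \<open>a\<close>, suffices. Only \<open>p\<close> occurs, so the values are the same for all
  \<open>v\<close>.\<close>

lemma separating_poly:
  fixes A :: "(complex^'n::finite) set"
  assumes "finite A"
  shows "\<exists>r. \<forall>v. ev r (v, a) = 1 \<and> (\<forall>b\<in>A. b \<noteq> a \<longrightarrow> ev r (v, b) = 0)"
  using assms
proof (induction A rule: finite_induct)
  case empty
  show ?case by (intro exI[of _ 1]) simp
next
  case (insert b A)
  then obtain r where r: "\<And>v. ev r (v, a) = 1" "\<And>v b. b \<in> A \<Longrightarrow> b \<noteq> a \<Longrightarrow> ev r (v, b) = 0" by blast
  show ?case
  proof (cases "b = a")
    case True
    thus ?thesis using r by (intro exI[of _ r]) auto
  next
    case False
    then obtain i where i: "b $ i \<noteq> a $ i" by (auto simp: vec_eq_iff)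
    let ?l = "(Poly_Mapping.single {#Y i#} 1 - Poly_Mapping.single 0 (b $ i)) * Poly_Mapping.single 0 (1 / (a $ i - b $ i))"
    show ?thesis using r i by (intro exI[of _ "?l * r"]) auto
  qed
qed

context cherednik_data
begin

definition regd :: "(complex^'n) set" where
  "regd = {p. \<forall>w\<in>W. w \<noteq> mat 1 \<longrightarrow> p v* w \<noteq> p}"

lemma regd_avoid:
  "\<exists>\<V>. finite \<V> \<and> (\<forall>V\<in>\<V>. vec.subspace V \<and> V \<noteq> (UNIV :: (complex^'n) set)) \<and>
     regd = {v. \<forall>V\<in>\<V>. v \<notin> V}"
proof (intro exI conjI ballI)
  let ?V = "(\<lambda>w. {v. transpose w *v v = 1 *s v}) ` (W - {mat 1})"
  show "finite ?V" using fin by simp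
  show "regd = {v. \<forall>V\<in>?V. v \<notin> V}" by (auto simp: regd_def)
  fix V assume "V \<in> ?V"
  then obtain w where w: "w \<in> W" "w \<noteq> mat 1" "V = {v. transpose w *v v = 1 *s v}" by auto
  show "V \<noteq> UNIV"
  proof
    assume "V = UNIV"
    hence "transpose w *v v = mat 1 *v v" for v using w(3) by auto
    hence "transpose w = mat 1" by (simp add: matrix_eq)
    hence "w = mat 1" by (metis transpose_mat transpose_transpose)
    thus False using w by simp
  qed
  show "vec.subspace V" using subspace_eigen[of "transpose w" 1] w by simp
qed

lemma regd_distinct: "p \<in> regd \<Longrightarrow> u \<in> W \<Longrightarrow> w \<in> W \<Longrightarrow> p v* u = p v* w \<Longrightarrow> u = w"
proof -
  assume p: "p \<in> regd" "u \<in> W" "w \<in> W" "p v* u = p v* w"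
  have "p v* (u ** matrix_inv w) = p v* w v* matrix_inv w" by (simp add: p(4) flip: vector_matrix_mul_assoc)
  also have "\<dots> = p" using p by (simp add: vector_matrix_mul_assoc)
  finally have "p v* (u ** matrix_inv w) = p" .
  moreover have "u ** matrix_inv w \<in> W" using p by blast
  ultimately have "u ** matrix_inv w = mat 1" using p by (auto simp: regd_def)
  hence "u ** matrix_inv w ** w = w" by simp
  thus "u = w" using p by simp
qed

text \<open>
  An operator with arbitrary function coefficients that preserves the polynomial module
  \<open>H 1\<close> has polynomial symbol: testing on \<open>r(D) 1\<close> shows that its coefficients are polynomial in \<open>v\<close>
  at every \<open>p\<close> with trivial stabiliser.
\<close>

lemma symbol_polynomial:
  assumes T: "sym d T G" and M: "\<And>h. h \<in> HH \<Longrightarrow> \<exists>h'\<in>HH. ap (T * h) one1 = ap h' one1" and u: "u \<in> W"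
  shows "\<exists>F. \<forall>v\<in>reg. \<forall>p. G u (v, p) = ev F (v, p)"
proof -
  \<comment> \<open>The sum is the symbol of \<open>T r(D) 1\<close>, which is an element of the
    polynomial module. Evaluation of \<open>r\<close> at \<open>v = 0\<close> discards monomials
    that contain an \<open>x\<close>.\<close>
  have test: "\<exists>f. \<forall>v\<in>reg. \<forall>p. (\<Sum>w\<in>W. G w (v, p) * ev r (0, p v* w)) = ev f (v, p)" for r
  proof (induction r rule: poly_mapping_sum_induct)
    case (single m k)
    show ?case
    proof (cases "xdeg m = 0")
      case True
      let ?r = "Poly_Mapping.single m k"
      have ev0: "mev (v, p) m = mev (0, p) m" for v p
        using True
      proof (induction m)
        case (add l m)
        thus ?case by (cases l) (auto split: if_splits)
      qed simp
      have r: "ylt (Suc (ydeg m)) ?r" by (simp add: ylt_def)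
      have rc: "ycomp (ydeg m) ?r = ?r" by simp
      obtain h' where h': "h' \<in> HH" "ap (T * (iota * rt (nfT ?r))) one1 = ap h' one1"
        using M[OF HH_rt] by blast
      obtain \<phi> where \<phi>: "h' = iota * NF \<phi>" using h' HH_NF by blast
      define f where "f = (\<Sum>w\<in>W. \<phi> w)"
      have "fsym (ydeg m) (ap (iota * rt (nfT ?r)) one1) (ev ?r)"
        using fsym_nfT[OF r] unfolding rc by (simp add: fsym_def ap_iota)
      from fsym_apply[OF T this]
      have "fsym (d + ydeg m) (ap h' one1) (\<lambda>z. \<Sum>w\<in>W. G w z * ev ?r (act w z))" using h'(2) by simp
      hence "fsym (d + ydeg m) (ap (rt (nfT f)) one1) (\<lambda>z. \<Sum>w\<in>W. G w z * ev ?r (act w z))"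
        by (simp add: fsym_def \<phi> ap_iota ap_NF_one f_def)
      from fsym_symbol[of "\<lambda>f. ap (rt (nfT f)) one1", OF fsym_nfT this]
      have "(\<Sum>w\<in>W. G w (v, p) * ev ?r (act w (v, p))) = ev (ycomp (d + ydeg m) f) (v, p)" if "v \<in> reg" for v p
        using that by simp
      moreover have "ev ?r (act w (v, p)) = ev ?r (0, p v* w)" for w v p
        using ev0 by (simp add: act_def)
      ultimately have "(\<Sum>w\<in>W. G w (v, p) * ev ?r (0, p v* w)) = ev (ycomp (d + ydeg m) f) (v, p)" if "v \<in> reg" for v p
        using that by (simp only:)
      thus ?thesis by (intro exI[of _ "ycomp (d + ydeg m) f"]) blast
    next
      case False
      have "mev (0, p) m = 0" for p :: "complex^'n" using False
      proof (induction m)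
        case (add l m)
        thus ?case by (cases l) (auto split: if_splits)
      qed simp
      thus ?thesis by (intro exI[of _ 0]) simp
    qed
  next
    case (add a b)
    then obtain f f' where "\<forall>v\<in>reg. \<forall>p. (\<Sum>w\<in>W. G w (v, p) * ev a (0, p v* w)) = ev f (v, p)"
      "\<forall>v\<in>reg. \<forall>p. (\<Sum>w\<in>W. G w (v, p) * ev b (0, p v* w)) = ev f' (v, p)" by blast
    thus ?case by (intro exI[of _ "f + f'"]) (simp add: distrib_left sum.distrib)
  qed
  \<comment> \<open>The orbit of \<open>p0\<close> is free, so a polynomial that is 1 at one of its
    points and 0 at the others isolates the coefficient of \<open>u\<close>.\<close>
  have pt: "\<exists>f. \<forall>v\<in>reg. \<forall>p. G u (v, p0) = ev f (v, p)" if p0: "p0 \<in> regd" for p0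
  proof -
    obtain r where r: "\<And>v. ev r (v, p0 v* u) = 1" "\<And>v b. b \<in> (\<lambda>w. p0 v* w) ` W \<Longrightarrow> b \<noteq> p0 v* u \<Longrightarrow> ev r (v, b) = 0"
      using separating_poly[of "(\<lambda>w. p0 v* w) ` W" "p0 v* u"] fin by auto
    obtain f where "\<forall>v\<in>reg. \<forall>p. (\<Sum>w\<in>W. G w (v, p) * ev r (0, p v* w)) = ev f (v, p)" using test[of r] ..
    hence f: "\<And>v p. v \<in> reg \<Longrightarrow> (\<Sum>w\<in>W. G w (v, p) * ev r (0, p v* w)) = ev f (v, p)" by simp
    have "(\<Sum>w\<in>W. G w (v, p0) * ev r (0, p0 v* w)) = (\<Sum>w\<in>W. of_bool (w = u) * G w (v, p0))" for v
    proof (rule sum.cong)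
      fix w assume w: "w \<in> W"
      show "G w (v, p0) * ev r (0, p0 v* w) = of_bool (w = u) * G w (v, p0)"
        using r(1) r(2)[of "p0 v* w"] regd_distinct[OF p0 w u] w by (cases "w = u") auto
    qed simp
    hence "G u (v, p0) = ev f (v, p0)" if "v \<in> reg" for v using f[OF that, of p0] fin u by simp
    thus ?thesis using ev_fix_p[of f p0] by metis
  qed
  \<comment> \<open>Homogeneous polynomials of degree \<open>d\<close> form a finite-dimensional
    space, so finitely many values at points of \<open>regd\<close> determine the symbol. Their
    polynomial dependence on \<open>v\<close> then carries over to all \<open>p\<close>.\<close>
  obtain B :: "(complex^'n \<Rightarrow> complex) set" where B0: "finite B \<and> (\<forall>b\<in>B. homp d b) \<and>
    (\<forall>g. homp d g \<longrightarrow> (\<exists>k. \<forall>p. g p = (\<Sum>b\<in>B. k b * b p)))" using homp_finite_span[of d] ..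
  have B: "finite B" "\<And>b. b \<in> B \<Longrightarrow> homp d b"
    "\<And>g. homp d g \<Longrightarrow> \<exists>k. \<forall>p. g p = (\<Sum>b\<in>B. k b * b p)" using B0 by simp_all
  obtain K L where K: "finite K" "K \<subseteq> regd" "\<And>k. k \<in> K \<Longrightarrow> homp d (L k)"
    "\<And>b p. b \<in> B \<Longrightarrow> p \<in> regd \<Longrightarrow> b p = (\<Sum>k\<in>K. b k * L k p)"
  proof -
    have "\<exists>K L. finite K \<and> K \<subseteq> regd \<and> (\<forall>k\<in>K. homp d (L k)) \<and> (\<forall>k\<in>K. \<forall>l\<in>K. L k l = of_bool (k = l)) \<and>
        (\<forall>b\<in>B. \<forall>x\<in>regd. b x = (\<Sum>k\<in>K. b k * L k x))"
      by (rule interpolation[OF B(1,2)]) (simp_all add: homp_add homp_scale homp_zero)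
    then obtain K L where "finite K \<and> K \<subseteq> regd \<and> (\<forall>k\<in>K. homp d (L k)) \<and> (\<forall>k\<in>K. \<forall>l\<in>K. L k l = of_bool (k = l)) \<and>
        (\<forall>b\<in>B. \<forall>x\<in>regd. b x = (\<Sum>k\<in>K. b k * L k x))" by (elim exE)
    thus ?thesis by (intro that[of K L]) simp_all
  qed
  have "\<exists>f. \<forall>v\<in>reg. \<forall>p. G u (v, k) = ev f (v, p)" if "k \<in> K" for k using pt that K by blast
  then obtain f where f: "\<And>k v p. k \<in> K \<Longrightarrow> v \<in> reg \<Longrightarrow> G u (v, k) = ev (f k) (v, p)" by metis
  have "\<exists>l. \<forall>v p. ev l (v, p) = L k p" if "k \<in> K" for k using homp_poly K that by blast
  then obtain l where l: "\<And>k v p. k \<in> K \<Longrightarrow> ev (l k) (v, p) = L k p" by metis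
  define F where "F = (\<Sum>k\<in>K. f k * l k)"
  have gK: "g p = (\<Sum>k\<in>K. g k * L k p)" if "homp d g" "p \<in> regd" for g p
  proof -
    from B(3)[OF that(1)] obtain a where "\<forall>p. g p = (\<Sum>b\<in>B. a b * b p)" ..
    hence a: "\<And>p. g p = (\<Sum>b\<in>B. a b * b p)" by simp
    have "(\<Sum>k\<in>K. g k * L k p) = (\<Sum>k\<in>K. \<Sum>b\<in>B. a b * (b k * L k p))"
      unfolding a by (simp add: sum_distrib_right mult.assoc)
    also have "\<dots> = (\<Sum>b\<in>B. a b * (\<Sum>k\<in>K. b k * L k p))" by (subst sum.swap) (simp add: sum_distrib_left)
    also have "\<dots> = g p" unfolding a using K(4) that by (intro sum.cong) auto
    finally show ?thesis by simp
  qed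
  have "G u (v, p) = ev F (v, p)" if v: "v \<in> reg" for v p
  proof -
    have h: "homp d (\<lambda>p. G u (v, p))" using T u v unfolding sym_def by blast
    obtain \<V> where V: "finite \<V>" "\<And>V. V \<in> \<V> \<Longrightarrow> vec.subspace V \<and> V \<noteq> (UNIV :: (complex^'n) set)"
     "regd = {v. \<forall>V\<in>\<V>. v \<notin> V}" using regd_avoid by blast
    have "G u (v, p) - ev F (v, p) = 0"
    proof (rule continuous_avoid_zero[OF V(1,2), of "\<lambda>p. G u (v, p) - ev F (v, p)"])
      show "continuous_on UNIV (\<lambda>p. G u (v, p) - ev F (v, p))"
        using continuous_homp[OF h] by (intro continuous_intros continuous_ev)
      fix p assume "\<forall>V\<in>\<V>. p \<notin> V"
      hence "p \<in> regd" using V by simp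
      from gK[OF h this] show "G u (v, p) - ev F (v, p) = 0" using f[OF _ v] l by (simp add: F_def)
    qed
    thus ?thesis by simp
  qed
  thus ?thesis by blast
qed

text \<open>The symbol is polynomial, so a normal form with the same symbol can be subtracted. The
  difference still preserves the module, because elements of the algebra do, and its degree has
  dropped.\<close>

lemma HH_of_preserves:
  assumes "lowop d T" "iota * T = T" "\<And>h. h \<in> HH \<Longrightarrow> \<exists>h'\<in>HH. ap (T * h) one1 = ap h' one1"
  shows "T \<in> HH"
  using assms
proof (induction d arbitrary: T)
  case 0
  then obtain g where g: "coeffs T g" "\<forall>w\<in>W. \<forall>v\<in>reg. \<forall>p. g w (v, p) = 0" by (auto simp: lowop_def)
  have "ap (iota * T) f z = 0" for f z
    using coeffsD[OF g(1), of z] g(2) by (cases z) (auto simp: ap_iota)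
  hence "T = 0" using 0 by (intro lop_eqI) simp
  thus ?case by (simp add: HH_zero)
next
  case (Suc d)
  obtain G where G: "sym d T G" using Suc.prems lowop_sym by blast
  have "\<forall>w. \<exists>F. w \<in> W \<longrightarrow> (\<forall>v\<in>reg. \<forall>p. G w (v, p) = ev F (v, p))"
  proof
    fix w
    show "\<exists>F. w \<in> W \<longrightarrow> (\<forall>v\<in>reg. \<forall>p. G w (v, p) = ev F (v, p))"
    proof (cases "w \<in> W")
      case True
      from symbol_polynomial[OF G Suc.prems(3) True] obtain F where "\<forall>v\<in>reg. \<forall>p. G w (v, p) = ev F (v, p)" ..
      thus ?thesis by (intro exI impI)
    qed simp
  qed
  from choice[OF this] obtain F where "\<forall>w. w \<in> W \<longrightarrow> (\<forall>v\<in>reg. \<forall>p. G w (v, p) = ev (F w) (v, p))" ..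
  hence F: "\<And>w v p. w \<in> W \<Longrightarrow> v \<in> reg \<Longrightarrow> G w (v, p) = ev (F w) (v, p)" by simp
  \<comment> \<open>\<open>F\<close> may contain further degrees in \<open>p\<close>; homogeneity of
    the symbol at regular points singles out the component of degree \<open>d\<close>.\<close>
  have Gc: "G w z = ev (ycomp d (F w)) z" if w: "w \<in> W" and z: "fst z \<in> reg" for w z
  proof -
    have "fsym d (ev (F w)) (G w)"
      unfolding fsym_def
    proof (intro ballI conjI)
      fix v assume v: "v \<in> reg"
      show "homp d (\<lambda>p. G w (v, p))" using G w v unfolding sym_def by blast
      show "lowp d (\<lambda>p. ev (F w) (v, p) - G w (v, p))" by (simp add: F w v)
    qed
    from fsym_symbol[of ev, OF fsym_ev this z] show ?thesis .
  qed
  define h0 where "h0 = iota * NF (\<lambda>w. ycomp d (F w))"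
  have h0: "h0 \<in> HH" using HH_NF by (auto simp: h0_def)
  have s0: "sym d h0 (\<lambda>w z. ev (ycomp d (F w)) z)"
    unfolding h0_def sym_iota using sym_NF[of d "\<lambda>w. ycomp d (F w)"] by (simp add: ylt_ycomp ycomp_idem)
  obtain t where t: "coeffs T t" "\<forall>w\<in>W. \<forall>v\<in>reg. homp d (\<lambda>p. G w (v, p)) \<and> lowp d (\<lambda>p. t w (v, p) - G w (v, p))"
    using G unfolding sym_def by blast
  obtain t0 where t0: "coeffs h0 t0" "\<forall>w\<in>W. \<forall>v\<in>reg. lowp d (\<lambda>p. t0 w (v, p) - ev (ycomp d (F w)) (v, p))"
    using s0 unfolding sym_def by blast
  have "lowop d (T - h0)" unfolding lowop_def
  proof (intro exI[of _ "\<lambda>w x. t w x - t0 w x"] conjI ballI coeffs_diff t t0)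
    fix w v assume wv: "w \<in> W" "v \<in> reg"
    hence "lowp d (\<lambda>p. t w (v, p) - G w (v, p))" "lowp d (\<lambda>p. t0 w (v, p) - ev (ycomp d (F w)) (v, p))"
      using t t0 by auto
    from lowp_diff[OF this] show "lowp d (\<lambda>p. t w (v, p) - t0 w (v, p))" by (rule lowp_cong) (simp add: Gc wv)
  qed
  moreover have "iota * (T - h0) = T - h0" using Suc.prems h0 by (simp add: right_diff_distrib)
  moreover have "\<exists>h'\<in>HH. ap ((T - h0) * h) one1 = ap h' one1" if h: "h \<in> HH" for h
  proof -
    obtain h' where "h' \<in> HH" "ap (T * h) one1 = ap h' one1" using Suc.prems h by blast
    thus ?thesis using h0 h by (intro bexI[of _ "h' - h0 * h"]) (auto simp: HH_diff HH_mult)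
  qed
  ultimately have "T - h0 \<in> HH" by (rule Suc.IH)
  from HH_add[OF this h0] show ?case by simp
qed

section \<open>The symmetrising idempotent\<close>

definition ee :: "'n lop" where "ee = (\<Sum>w\<in>W. scal (1 / of_nat (card W)) * Wop w)"

lemma card_W: "of_nat (card W) \<noteq> (0::complex)"
  using fin W_one by auto

lemma ee_winv: "winv (ap ee f)"
  unfolding winv_def
proof (intro ballI allI)
  fix w z assume w: "w \<in> W"
  have "(\<Sum>u\<in>W. f (act u (act w z))) = (\<Sum>u\<in>W. f (act u z))"
    using sum_W_left[OF w, of "\<lambda>u. f (act u z)"] w by (simp add: act_act)
  thus "ap ee f (act w z) = ap ee f z" by (simp add: ee_def Wop_def flip: sum_divide_distrib)
qed

lemma ee_one: "ap ee one1 = one1"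
  using card_W by (simp add: ee_def Wop_def)

lemma ee_HT: "iota * ee \<in> HT"
proof -
  have "iota * ee = (\<Sum>w\<in>W. scal (1 / of_nat (card W)) * (iota * Wop w))"
    unfolding ee_def sum_distrib_left
    by (intro sum.cong refl) (simp add: scal_commute[of iota] flip: mult.assoc)
  thus ?thesis by (simp add: HT_sum HT_scal HT_Wop)
qed

lemma ee_iota: "ee * iota = iota * ee"
  unfolding ee_def sum_distrib_left sum_distrib_right
  by (intro sum.cong refl commute_mult iota_Wop) (simp add: scal_commute)

text \<open>Besides preservation of the module, \<open>HH_of_preserves\<close> asks for a degree
  bound in \<open>p\<close>. It comes from the normal form of \<open>e h\<close> applied to the
  constant 1.\<close>

lemma spherical_in_HH:
  assumes h: "h \<in> HH"
  defines "\<Phi> \<equiv> ap (ee * h) one1"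
  shows "winv \<Phi>" "iota * mulop \<Phi> \<in> HH"
proof -
  show winv: "winv \<Phi>" unfolding \<Phi>_def using ee_winv by simp
  have eh: "iota * ee * h \<in> HH" using HH_mult[OF HT_HH[OF ee_HT] h] .
  obtain \<phi> where \<phi>: "iota * ee * h = iota * NF \<phi>" using eh HH_NF by blast
  obtain N where N: "\<forall>w\<in>W. ylt N (\<phi> w)" using ylt_all_ex by blast
  have "\<forall>w\<in>W. ylt (Suc N) (\<phi> w)" using N ylt_mono by (meson le_SucI order_refl)
  hence "sym N (iota * ee * h) (\<lambda>w z. ev (ycomp N (\<phi> w)) z)" using sym_NF[of N \<phi>] by (simp add: \<phi>)
  from fsym_apply[OF this fsym_one] obtain g where "fsym N (ap (iota * ee * h) one1) g"
    unfolding add_0_right by blast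
  hence "fsym N \<Phi> g" by (simp add: fsym_def ap_iota \<Phi>_def)
  hence lowp: "\<forall>v\<in>reg. lowp (Suc N) (\<lambda>p. \<Phi> (v, p))" using fsym_lowp by blast
  show "iota * mulop \<Phi> \<in> HH"
  proof (rule HH_of_preserves)
    have "lowp (Suc N) (\<lambda>p. of_bool (w = mat 1) * \<Phi> (v, p))" if "v \<in> reg" for w v
      using lowp that by (intro lowp_scale) auto
    thus "lowop (Suc N) (iota * mulop \<Phi>)"
      by (subst lowop_iota, unfold lowop_def) (intro exI[of _ "\<lambda>w x. of_bool (w = mat 1) * \<Phi> x"] conjI ballI coeffs_mulop)
    show "iota * (iota * mulop \<Phi>) = iota * mulop \<Phi>" by (simp flip: mult.assoc)
    fix h' assume h': "h' \<in> HH"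
    have "iota * mulop \<Phi> * h' = h' * mulop \<Phi>"
      unfolding HH_winv_commute[OF h' winv] iota_mulop[symmetric] using h' by (simp add: mult.assoc)
    hence "ap (iota * mulop \<Phi> * h') one1 = ap (h' * mulop \<Phi>) one1" by (simp only:)
    also have "\<dots> = ap (h' * (iota * ee * h)) one1"
    proof -
      have "h' * (iota * ee * h) = (h' * iota) * (ee * h)" by (simp add: mult.assoc)
      hence "h' * (iota * ee * h) = h' * (ee * h)" using h' by simp
      thus ?thesis by (simp add: \<Phi>_def)
    qed
    finally show "\<exists>h''\<in>HH. ap (iota * mulop \<Phi> * h') one1 = ap h'' one1" using HH_mult[OF h' eh] by blast
  qed
qed

end

section \<open>The quadric \<open>\<Sum>\<^sub>i x\<^sub>i y\<^sub>i = 0\<close>\<close>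

definition qhat :: "'n::finite mpoly" where
  "qhat = (\<Sum>i\<in>UNIV. Poly_Mapping.single {#X i, Y i#} 1)"

lemma ev_qhat: "ev qhat (v, p) = pairing p v"
  by (simp add: qhat_def pairing_def mult.commute)

lemma subspace_coord: "vec.subspace {v::complex^'n. v $ i = 0}" "{v::complex^'n. v $ i = 0} \<noteq> UNIV"
proof -
  show "vec.subspace {v::complex^'n. v $ i = 0}" by (auto simp: vec.subspace_def)
  have "axis i 1 \<notin> {v::complex^'n. v $ i = 0}" by simp
  thus "{v::complex^'n. v $ i = 0} \<noteq> UNIV" by blast
qed

lemma ev_dense_zero:
  fixes f :: "'n::finite mpoly"
  assumes V: "finite \<V>" "\<And>V. V \<in> \<V> \<Longrightarrow> vec.subspace V \<and> V \<noteq> UNIV"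
    and U: "finite \<U>" "\<And>V. V \<in> \<U> \<Longrightarrow> vec.subspace V \<and> V \<noteq> UNIV"
    and 0: "\<And>v p. \<lbrakk>\<forall>V\<in>\<V>. v \<notin> V; \<forall>V\<in>\<U>. p \<notin> V\<rbrakk> \<Longrightarrow> ev f (v, p) = 0"
  shows "f = 0"
proof (rule ev_eq_0)
  fix z :: "'n pt"
  have "ev f (v, p) = 0" if "\<forall>V\<in>\<V>. v \<notin> V" for v p
    by (rule continuous_avoid_zero[OF U, of "\<lambda>p. ev f (v, p)"])
      (use 0 that in \<open>auto intro!: continuous_ev continuous_intros\<close>)
  note dense = this
  have "ev f (v, p) = 0" for v p
    by (rule continuous_avoid_zero[OF V, of "\<lambda>v. ev f (v, p)"])
      (use dense in \<open>auto intro!: continuous_ev continuous_intros\<close>)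
  thus "ev f z = 0" by (cases z) simp
qed

lemma qhat_cancel:
  assumes "qhat * f = 0" shows "f = (0 :: 'n::finite mpoly)"
proof -
  fix i :: 'n
  have *: "ev f (v, p) = 0" if v: "v $ i \<noteq> 0" for v p
  proof -
    have sub: "vec.subspace {p. pairing p v = 0}" by (auto simp: vec.subspace_def pairing_add pairing_scale)
    have "axis i 1 \<notin> {p. pairing p v = 0}" using v by simp
    hence ne: "{p. pairing p v = 0} \<noteq> UNIV" by blast
    have off: "ev f (v, p) = 0" if "pairing p v \<noteq> 0" for p
      using arg_cong[OF assms, of "\<lambda>f. ev f (v, p)"] that by (simp add: ev_qhat)
    show ?thesis
    proof (rule continuous_avoid_zero[of "{{p. pairing p v = 0}}" "\<lambda>p. ev f (v, p)"])
      show "continuous_on UNIV (\<lambda>p. ev f (v, p))" by (intro continuous_ev continuous_intros)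
    qed (use sub off ne in simp_all)
  qed
  show ?thesis
    by (rule ev_dense_zero[of "{{v. v $ i = 0}}" "{}"]) (use * in \<open>auto simp: subspace_coord\<close>)
qed

context
  fixes i0 :: "'n::finite"
begin

abbreviation "xi \<equiv> (Poly_Mapping.single {#X i0#} 1 :: 'n mpoly)"

text \<open>The polynomial \<open>qhat\<close> is linear in the letter \<open>Y i0\<close> with
  leading coefficient \<open>xi\<close>. A power of \<open>xi\<close> pays for eliminating that
  letter; freeness of the remainder from it is expressed by its values.\<close>

lemma pseudo_division:
  "\<exists>N g r. xi ^ N * f = qhat * g + r \<and> (\<forall>v p p'. (\<forall>j. j \<noteq> i0 \<longrightarrow> p $ j = p' $ j) \<longrightarrow> ev r (v, p) = ev r (v, p'))"
proof (induction f rule: poly_mapping_sum_induct)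
  case (single m k)
  let ?P = "\<lambda>f. \<exists>N g r. xi ^ N * f = qhat * g + r \<and> (\<forall>v p p'. (\<forall>j. j \<noteq> i0 \<longrightarrow> p $ j = p' $ j) \<longrightarrow> ev r (v, p) = ev r (v, p'))"
  have "?P (Poly_Mapping.single m 1)"
  proof (induction m)
    case empty
    have "xi ^ 0 * Poly_Mapping.single {#} 1 = qhat * 0 + 1" by (simp flip: zero_multiset_def)
    thus ?case by (metis ev_simps(2))
  next
    case (add l m)
    then obtain N g r where *: "xi ^ N * Poly_Mapping.single m 1 = qhat * g + r"
      "\<And>v p p'. (\<forall>j. j \<noteq> i0 \<longrightarrow> p $ j = p' $ j) \<Longrightarrow> ev r (v, p) = ev r (v, p')" by blast
    let ?l = "Poly_Mapping.single {#l#} 1 :: 'n mpoly"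
    have lm: "Poly_Mapping.single (add_mset l m) 1 = ?l * Poly_Mapping.single m 1" by (simp add: mult_single)
    show ?case
    proof (cases "l = Y i0")
      case True
      \<comment> \<open>The part of \<open>qhat\<close> without index \<open>i0\<close>: modulo
        \<open>qhat\<close>, the product of \<open>xi\<close> and the letter may be replaced by
        \<open>- q'\<close>.\<close>
      define q' :: "'n mpoly" where "q' = (\<Sum>i\<in>UNIV - {i0}. Poly_Mapping.single {#X i, Y i#} 1)"
      have "qhat = xi * ?l + q'" unfolding qhat_def q'_def True
        by (subst sum.remove[of _ i0]) (simp_all add: mult_single add_mset_commute)
      from this[symmetric] have "xi * ?l = qhat - q'" by (rule add_implies_diff)
      moreover have "xi ^ Suc N * (?l * Poly_Mapping.single m 1) = (xi * ?l) * (xi ^ N * Poly_Mapping.single m 1)"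
        by (simp add: mult_ac)
      ultimately have "xi ^ Suc N * (?l * Poly_Mapping.single m 1) = (qhat - q') * (qhat * g + r)"
        by (simp only: *(1))
      also have "\<dots> = qhat * ((qhat - q') * g + r) + - q' * r" by (simp add: algebra_simps)
      finally have "xi ^ Suc N * Poly_Mapping.single (add_mset l m) 1 = qhat * ((qhat - q') * g + r) + - q' * r"
        by (simp only: lm)
      moreover have "ev (- q' * r) (v, p) = ev (- q' * r) (v, p')" if "\<forall>j. j \<noteq> i0 \<longrightarrow> p $ j = p' $ j" for v p p'
        using *(2)[OF that] that by (simp add: q'_def)
      ultimately show ?thesis by blast
    next
      case False
      have "xi ^ N * Poly_Mapping.single (add_mset l m) 1 = ?l * (xi ^ N * Poly_Mapping.single m 1)"
        by (simp only: lm mult_ac)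
      also have "\<dots> = qhat * (?l * g) + ?l * r" unfolding *(1) by (simp add: algebra_simps)
      finally have "xi ^ N * Poly_Mapping.single (add_mset l m) 1 = qhat * (?l * g) + ?l * r" .
      moreover have "ev (?l * r) (v, p) = ev (?l * r) (v, p')" if "\<forall>j. j \<noteq> i0 \<longrightarrow> p $ j = p' $ j" for v p p'
        using *(2)[OF that] that False by (cases l) auto
      ultimately show ?thesis by blast
    qed
  qed
  then obtain N g r where *: "xi ^ N * Poly_Mapping.single m 1 = qhat * g + r"
      "\<And>v p p'. (\<forall>j. j \<noteq> i0 \<longrightarrow> p $ j = p' $ j) \<Longrightarrow> ev r (v, p) = ev r (v, p')" by blast
  let ?k = "Poly_Mapping.single 0 k :: 'n mpoly"
  have km: "Poly_Mapping.single m k = ?k * Poly_Mapping.single m 1" by (simp add: mult_single)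
  have "xi ^ N * Poly_Mapping.single m k = ?k * (xi ^ N * Poly_Mapping.single m 1)"
    unfolding km by (simp only: mult_ac)
  also have "\<dots> = qhat * (?k * g) + ?k * r" unfolding *(1) by (simp add: algebra_simps)
  finally have "xi ^ N * Poly_Mapping.single m k = qhat * (?k * g) + ?k * r" .
  moreover have "ev (?k * r) (v, p) = ev (?k * r) (v, p')" if "\<forall>j. j \<noteq> i0 \<longrightarrow> p $ j = p' $ j" for v p p'
    using *(2)[OF that] by simp
  ultimately show ?case by blast
next
  case (add a b)
  then obtain N g r N' g' r' where *: "xi ^ N * a = qhat * g + r" "xi ^ N' * b = qhat * g' + r'"
      "\<And>v p p'. (\<forall>j. j \<noteq> i0 \<longrightarrow> p $ j = p' $ j) \<Longrightarrow> ev r (v, p) = ev r (v, p')"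
      "\<And>v p p'. (\<forall>j. j \<noteq> i0 \<longrightarrow> p $ j = p' $ j) \<Longrightarrow> ev r' (v, p) = ev r' (v, p')" by blast
  have "xi ^ (N + N') * (a + b) = xi ^ N' * (xi ^ N * a) + xi ^ N * (xi ^ N' * b)"
    by (simp add: power_add algebra_simps)
  also have "\<dots> = qhat * (xi ^ N' * g + xi ^ N * g') + (xi ^ N' * r + xi ^ N * r')" unfolding *(1,2) by (simp add: algebra_simps)
  finally have "xi ^ (N + N') * (a + b) = qhat * (xi ^ N' * g + xi ^ N * g') + (xi ^ N' * r + xi ^ N * r')" .
  moreover have pow: "ev (xi ^ M) (v, p) = (v $ i0) ^ M" for M v and p :: "complex^'n"
    by (induction M) simp_all
  have "ev (xi ^ N' * r + xi ^ N * r') (v, p) = ev (xi ^ N' * r + xi ^ N * r') (v, p')"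
    if "\<forall>j. j \<noteq> i0 \<longrightarrow> p $ j = p' $ j" for v p p'
    using *(3,4)[OF that] by (simp add: pow)
  ultimately show ?case by blast
qed

lemma split_variable:
  "\<exists>g' g0. g = xi * g' + g0 \<and> (\<forall>v p. ev g0 (v, p) = ev g (\<chi> i. if i = i0 then 0 else v $ i, p))"
proof (induction g rule: poly_mapping_sum_induct)
  case (single m k)
  let ?P = "\<lambda>g. \<exists>g' g0. g = xi * g' + g0 \<and> (\<forall>v p. ev g0 (v, p) = ev g (\<chi> i. if i = i0 then 0 else v $ i, p))"
  have "?P (Poly_Mapping.single m 1)"
  proof (induction m)
    case empty
    have "Poly_Mapping.single {#} 1 = xi * 0 + 1" by (simp flip: zero_multiset_def)
    thus ?case by (metis (no_types, lifting) ev_simps(2) mult_zero_right add_0)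
  next
    case (add l m)
    then obtain g' g0 where *: "Poly_Mapping.single m 1 = xi * g' + g0"
      "\<And>v p. ev g0 (v, p) = mev (\<chi> i. if i = i0 then 0 else v $ i, p) m" by auto
    let ?l = "Poly_Mapping.single {#l#} 1 :: 'n mpoly"
    have lm: "Poly_Mapping.single (add_mset l m) 1 = ?l * Poly_Mapping.single m 1" by (simp add: mult_single)
    show ?case
    proof (cases "l = X i0")
      case True
      have "Poly_Mapping.single (add_mset l m) 1 = xi * Poly_Mapping.single m 1 + 0" using lm True by simp
      thus ?thesis by (intro exI conjI) (assumption, simp add: True)
    next
      case False
      have "Poly_Mapping.single (add_mset l m) 1 = xi * (?l * g') + ?l * g0" unfolding lm *(1) by (simp add: algebra_simps)
      moreover have "ev (?l * g0) (v, p) = ev (Poly_Mapping.single (add_mset l m) 1) (\<chi> i. if i = i0 then 0 else v $ i, p)" for v p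
        using *(2)[of v p] False by (cases l) auto
      ultimately show ?thesis by blast
    qed
  qed
  then obtain g' g0 where *: "Poly_Mapping.single m 1 = xi * g' + g0"
    "\<And>v p. ev g0 (v, p) = mev (\<chi> i. if i = i0 then 0 else v $ i, p) m" by auto
  let ?k = "Poly_Mapping.single 0 k :: 'n mpoly"
  have "Poly_Mapping.single m k = ?k * Poly_Mapping.single m 1" by (simp add: mult_single)
  also have "\<dots> = xi * (?k * g') + ?k * g0" unfolding *(1) by (simp add: algebra_simps)
  finally have "Poly_Mapping.single m k = xi * (?k * g') + ?k * g0" .
  moreover have "ev (?k * g0) (v, p) = ev (Poly_Mapping.single m k) (\<chi> i. if i = i0 then 0 else v $ i, p)" for v p
    by (simp add: *(2))
  ultimately show ?case by blast
next
  case (add a b)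
  then obtain g' g0 h' h0 where "a = xi * g' + g0" "b = xi * h' + h0"
    "\<And>v p. ev g0 (v, p) = ev a (\<chi> i. if i = i0 then 0 else v $ i, p)"
    "\<And>v p. ev h0 (v, p) = ev b (\<chi> i. if i = i0 then 0 else v $ i, p)" by blast
  thus ?case by (intro exI[of _ "g' + h'"] exI[of _ "g0 + h0"]) (simp add: algebra_simps)
qed

lemma xi_cancel: "xi * f = 0 \<Longrightarrow> f = 0"
proof -
  assume "xi * f = 0"
  hence *: "v $ i0 * ev f (v, p) = 0" for v p
    by (drule_tac arg_cong[of _ _ "\<lambda>f. ev f (v, p)"]) simp
  show ?thesis
    by (rule ev_dense_zero[of "{{v. v $ i0 = 0}}" "{}"]) (use * in \<open>auto simp: subspace_coord\<close>)
qed

text \<open>A second index keeps \<open>qhat\<close> from vanishing identically on the hyperplane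
  \<open>xi = 0\<close>. The factor \<open>g\<close> must therefore vanish there, and is divisible
  by \<open>xi\<close>.\<close>

lemma xi_power_cancel:
  assumes j0: "j0 \<noteq> i0" and "xi ^ N * f = qhat * g"
  shows "\<exists>g'. f = qhat * g'"
  using assms(2)
proof (induction N arbitrary: g)
  case 0
  thus ?case by auto
next
  case (Suc N)
  have z: "ev g (v, p) = 0" if v: "v $ i0 = 0" for v p
  proof -
    \<comment> \<open>Moving \<open>v\<close> and \<open>p\<close> together in direction
      \<open>j0\<close> stays on the hyperplane and makes \<open>qhat\<close> the monic quadratic
      \<open>Q\<close> in \<open>t\<close>. It is nonzero for small nonzero \<open>t\<close>, so the
      value of \<open>g\<close> at \<open>t = 0\<close> is a limit of zeros.\<close>
    let ?v = "\<lambda>t. v + t *s axis j0 1" and ?p = "\<lambda>t. p + t *s axis j0 1"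
    define Q where "Q = [:pairing p v, p $ j0 + v $ j0, 1:]"
    have "finite {t. poly Q t = 0}" by (rule poly_roots_finite) (simp add: Q_def)
    hence "eventually (\<lambda>t. t \<notin> {t. poly Q t = 0}) (at 0)" by (rule eventually_notin_finite)
    hence "eventually (\<lambda>t. ev g (?v t, ?p t) = 0) (at 0)"
    proof eventually_elim
      case (elim t)
      have q: "pairing (?p t) (?v t) = poly Q t"
        by (simp add: pairing_add pairing_scale Q_def algebra_simps)
      have "?v t $ i0 = 0" using v j0 by (simp add: axis_def)
      moreover have "ev (xi ^ Suc N * f) (?v t, ?p t) = ev (qhat * g) (?v t, ?p t)" by (simp only: Suc.prems)
      ultimately have "0 = pairing (?p t) (?v t) * ev g (?v t, ?p t)" by (simp add: ev_qhat)
      thus ?case using elim q by simp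
    qed
    hence "((\<lambda>t. ev g (?v t, ?p t)) \<longlongrightarrow> 0) (at 0)" by (rule tendsto_eventually)
    moreover have "continuous_on UNIV (\<lambda>t. ev g (?v t, ?p t))"
      by (intro continuous_ev, unfold vector_scalar_mult_def) (intro continuous_intros)+
    hence "((\<lambda>t. ev g (?v t, ?p t)) \<longlongrightarrow> ev g (?v 0, ?p 0)) (at 0)"
      using continuous_on_eq_continuous_at[of UNIV] isCont_def by blast
    ultimately have "ev g (?v 0, ?p 0) = 0" by (intro tendsto_unique[of "at (0::complex)"]) auto
    thus ?thesis by simp
  qed
  obtain g' g0 where g: "g = xi * g' + g0" "\<And>v p. ev g0 (v, p) = ev g (\<chi> i. if i = i0 then 0 else v $ i, p)"
    using split_variable by blast
  have "ev g0 (v, p) = 0" for v p unfolding g(2) by (rule z) simp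
  hence "g0 = 0" by (intro ev_eq_0) (metis surj_pair)
  hence "xi * (xi ^ N * f - qhat * g') = 0" using Suc.prems g(1) by (simp add: algebra_simps)
  hence "xi ^ N * f - qhat * g' = 0" by (rule xi_cancel)
  thus ?case using Suc.IH[of g'] by simp
qed

end

text \<open>After pseudo-division the remainder does not depend on coordinate \<open>i0\<close> of
  \<open>p\<close>. It can be tested at a point of the quadric, where it vanishes, and the powers of
  the leading coefficient are cancelled afterwards.\<close>

lemma quadric_division:
  fixes f :: "'n::finite mpoly"
  assumes n: "CARD('n) > 1" and V: "finite \<V>" "\<And>V. V \<in> \<V> \<Longrightarrow> vec.subspace V \<and> V \<noteq> UNIV"
    and 0: "\<And>v p. \<lbrakk>\<forall>V\<in>\<V>. v \<notin> V; p \<noteq> 0; pairing p v = 0\<rbrakk> \<Longrightarrow> ev f (v, p) = 0"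
  shows "\<exists>g. f = qhat * g"
proof -
  obtain i0 j0 :: 'n where ij: "j0 \<noteq> i0"
    using n by (metis UNIV_I card_1_singleton_iff One_nat_def card_le_Suc0_iff_eq finite not_less)
  obtain N g r where d: "Poly_Mapping.single {#X i0#} 1 ^ N * f = qhat * g + r"
    and r: "\<And>v p p'. (\<forall>j. j \<noteq> i0 \<longrightarrow> p $ j = p' $ j) \<Longrightarrow> ev r (v, p) = ev r (v, p')"
    using pseudo_division[of i0 f] by blast
  have "r = 0"
  proof (rule ev_dense_zero[of "insert {v. v $ i0 = 0} \<V>" "{{p. p $ j0 = 0}}"])
    fix v p :: "complex^'n"
    assume v: "\<forall>V\<in>insert {v. v $ i0 = 0} \<V>. v \<notin> V" and p: "\<forall>V\<in>{{p. p $ j0 = 0}}. p \<notin> V"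
    \<comment> \<open>Correcting one coordinate puts \<open>p\<close> on the quadric; the untouched
      coordinate \<open>j0\<close> keeps it nonzero.\<close>
    define p' where "p' = p - (pairing p v / v $ i0) *s axis i0 1"
    have "pairing p' v = 0" using v by (simp add: p'_def pairing_diff pairing_scale)
    moreover have "p' $ j0 = p $ j0" using ij by (simp add: p'_def axis_def)
    hence "p' \<noteq> 0" using p by auto
    ultimately have "ev f (v, p') = 0" using 0 v by auto
    moreover have "ev (Poly_Mapping.single {#X i0#} 1 ^ N * f) (v, p') = ev (qhat * g + r) (v, p')" by (simp only: d)
    ultimately have "ev r (v, p') = 0" using \<open>pairing p' v = 0\<close> by (simp add: ev_qhat)
    moreover have "ev r (v, p) = ev r (v, p')" by (rule r) (simp add: p'_def axis_def)
    ultimately show "ev r (v, p) = 0" by simp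
  qed (use V subspace_coord in auto)
  thus ?thesis using xi_power_cancel[OF ij, of N f g] d by simp
qed

abbreviation "bcomp a b \<equiv> pcomp (\<lambda>m. xdeg m = a \<and> ydeg m = b)"

text \<open>Since \<open>qhat\<close> has bidegree (1, 1), a quotient of a bihomogeneous polynomial
  by it can be replaced by a single bihomogeneous component.\<close>

lemma bcomp_qhat: "bcomp (Suc a) (Suc b) (qhat * g) = qhat * bcomp a b g"
proof (induction g rule: poly_mapping_sum_induct)
  case (single m k)
  have s: "pcomp P (\<Sum>i\<in>A. F i) = (\<Sum>i\<in>A. pcomp P (F i))" for P A and F :: "'a \<Rightarrow> 'a mpoly"
    by (induction A rule: infinite_finite_induct) simp_all
  show ?case by (auto simp: qhat_def sum_distrib_right s mult_single)
qed (simp add: distrib_left)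

lemma bcomp_qhat_0: "bcomp 0 b (qhat * g) = 0"
proof (induction g rule: poly_mapping_sum_induct)
  case (single m k)
  have s: "pcomp P (\<Sum>i\<in>A. F i) = (\<Sum>i\<in>A. pcomp P (F i))" for P A and F :: "'a \<Rightarrow> 'a mpoly"
    by (induction A rule: infinite_finite_induct) simp_all
  show ?case by (simp add: qhat_def sum_distrib_right s mult_single)
qed (simp add: distrib_left)

section \<open>Central elements of an irreducible group are scalar\<close>

locale cherednik_irreducible = cherednik_data +
  assumes irr: "irreducible_rep W" and card: "CARD('a) > 1"
begin

abbreviation "ZW \<equiv> group_centre W"

lemma ZW_W: "z \<in> ZW \<Longrightarrow> z \<in> W"
  by (simp add: group_centre_def)

lemma finite_order:
  assumes "w \<in> W"
  shows "\<exists>N. N > 0 \<and> ((*v) w ^^ N) = id"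
proof -
  define P where "P = (\<lambda>j. ((**) w ^^ j) (mat 1))"
  have PW: "P j \<in> W" for j unfolding P_def by (induction j) (use assms in auto)
  have "\<not> inj P" using finite_imageD[of P UNIV] finite_subset[OF _ fin] PW by (metis image_subsetI infinite_UNIV_nat)
  then obtain i j where ij: "P i = P j" "i < j" unfolding inj_on_def by (metis linorder_neqE_nat)
  have Pv: "P j *v v = ((*v) w ^^ j) v" for j v
    unfolding P_def by (induction j) (simp_all flip: matrix_vector_mul_assoc)
  have "((*v) w ^^ (j - i)) v = v" for v
  proof -
    have "P i *v (((*v) w ^^ (j - i)) v) = ((*v) w ^^ (i + (j - i))) v" by (simp only: Pv funpow_add comp_apply)
    also have "\<dots> = P i *v v" using ij by (simp add: ij(1) Pv)
    finally have "matrix_inv (P i) *v (P i *v (((*v) w ^^ (j - i)) v)) = matrix_inv (P i) *v (P i *v v)" by simp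
    thus ?thesis using PW by simp
  qed
  thus ?thesis using ij by (intro exI[of _ "j - i"]) (auto simp: fun_eq_iff)
qed

lemma eigenvalue_root:
  assumes "w *v v = k *s v" "v \<noteq> 0" "((*v) w ^^ N) = id" shows "k ^ N = (1::complex)"
proof -
  have "((*v) w ^^ j) v = k ^ j *s v" for j
    by (induction j) (simp_all add: assms(1) vector_scalar_commute vector_smult_assoc mult.commute)
  from this[of N] have "(k ^ N - 1) *s v = 0" using assms(3) by (simp add: vec_eq_iff algebra_simps)
  thus ?thesis using assms(2) vector_mul_eq_0[of "k ^ N - 1" v] by simp
qed

text \<open>An element of finite order has explicit spectral projections: averages of its powers
  weighted by roots of unity. They add up to a nonzero multiple of \<open>v\<close>, so one of them
  is an eigenvector.\<close>

lemma eigenvector_exists: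
  assumes "w \<in> W" shows "\<exists>k v. v \<noteq> 0 \<and> w *v v = k *s v"
proof -
  obtain N where N: "N > 0" "((*v) w ^^ N) = id" using finite_order[OF assms] by blast
  define om where "om = (\<lambda>k j::nat. exp (2 * of_real pi * \<i> * of_nat (k * j) / of_nat N) :: complex)"
  fix v :: "complex^'a"
  define v where "v = (axis undefined 1 :: complex^'a)"
  have v: "v \<noteq> 0" by (simp add: v_def axis_eq_0_iff)
  \<comment> \<open>These are the discrete Fourier components of the orbit of \<open>v\<close>;
    summing them over \<open>k\<close> keeps only the term \<open>j = 0\<close>, by
    \<open>sum0\<close>.\<close>
  define u where "u = (\<lambda>k. \<Sum>j<N. om k j *s ((*v) w ^^ j) v)"
  have sum0: "(\<Sum>k<N. om k j) = 0" if "j < N" "j \<noteq> 0" for j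
  proof -
    define r where "r = exp (2 * of_real pi * \<i> * of_nat j / of_nat N)"
    have "om k j = r ^ k" for k unfolding om_def r_def by (simp flip: exp_of_nat_mult) (simp add: mult_ac)
    moreover have "r \<noteq> 1" unfolding r_def
      using complex_root_unity_eq_1[of N j] N that by (auto dest: dvd_imp_le)
    moreover have "r ^ N = 1" unfolding r_def using N
      by (simp flip: exp_of_nat_mult) (use exp_integer_2pi[of "of_nat j"] in \<open>simp add: mult_ac\<close>)
    ultimately show ?thesis by (simp add: geometric_sum)
  qed
  have "(\<Sum>k<N. u k) = (\<Sum>j<N. (\<Sum>k<N. om k j) *s ((*v) w ^^ j) v)"
    unfolding u_def by (subst sum.swap) (simp add: vec_eq_iff sum_distrib_right)
  also have "\<dots> = (\<Sum>j<N. if j = 0 then of_nat N *s v else 0)"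
    by (rule sum.cong) (auto simp: sum0, simp add: om_def)
  also have "\<dots> = of_nat N *s v" using N by simp
  finally have "(\<Sum>k<N. u k) \<noteq> 0" using N v by simp
  then obtain k where k: "u k \<noteq> 0" by (metis sum.neutral)
  have om: "om k (Suc j) = om k 1 * om k j" for j
    unfolding om_def by (simp add: exp_add[symmetric] algebra_simps add_divide_distrib)
  have wu: "om k 1 *s (w *v u k) = u k"
  proof -
    let ?g = "\<lambda>j. om k j *s ((*v) w ^^ j) v"
    have "w *v u k = (\<Sum>j<N. om k j *s ((*v) w ^^ Suc j) v)"
      unfolding u_def by (simp add: matrix_vector_mult_sum vector_scalar_commute)
    hence "om k 1 *s (w *v u k) = (\<Sum>j<N. ?g (Suc j))"
      by (simp only: vec.scale_sum_right vector_smult_assoc om[symmetric])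
    also have "\<dots> = u k - om k 0 *s v + om k N *s v"
      using sum.lessThan_Suc_shift[of ?g N] N by (simp add: u_def algebra_simps)
    also have "om k N = 1" using N exp_integer_2pi[of "of_nat k"] by (simp add: om_def mult_ac)
    also have "om k 0 = 1" by (simp add: om_def)
    finally show ?thesis by simp
  qed
  have "om k 1 \<noteq> 0" by (simp add: om_def)
  hence "w *v u k = (1 / om k 1) *s u k" using wu by (metis (no_types, lifting) divide_self_if times_divide_eq_left vector_smult_assoc vector_smult_lid mult_1)
  thus ?thesis using k by blast
qed

text \<open>Schur's argument: an eigenspace of a central element is stable under \<open>W\<close>,
  and irreducibility makes it everything.\<close>

lemma centre_scalar:
  assumes z: "z \<in> ZW" shows "\<exists>k. k \<noteq> 0 \<and> (\<forall>v. z *v v = k *s v)"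
proof -
  have zW: "z \<in> W" using z by (rule ZW_W)
  obtain k v where kv: "v \<noteq> 0" "z *v v = k *s v" using eigenvector_exists[OF zW] by blast
  let ?V = "{v. z *v v = k *s v}"
  have "w *v v \<in> ?V" if "w \<in> W" "v \<in> ?V" for w v
  proof -
    have "z ** w = w ** z" using z that by (simp add: group_centre_def)
    hence "z *v (w *v v) = w *v (z *v v)" by (simp only: matrix_vector_mul_assoc)
    thus ?thesis using that by (simp add: vector_scalar_commute)
  qed
  hence "?V = {0} \<or> ?V = UNIV" using irr subspace_eigen[of z k] unfolding irreducible_rep_def by blast
  hence all: "z *v v = k *s v" for v using kv by blast
  have "k \<noteq> 0"
  proof
    assume "k = 0"
    hence "z *v v = 0" using all by simp
    hence "v = 0" using W_vec2[OF zW, of v] by simp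
    thus False using kv by simp
  qed
  thus ?thesis using all by blast
qed

lemma scalar_in_centre: "w \<in> W \<Longrightarrow> (\<And>v. w *v v = k *s v) \<Longrightarrow> w \<in> ZW"
proof -
  assume w: "w \<in> W" "\<And>v. w *v v = k *s v"
  have "w ** u = u ** w" for u
    unfolding matrix_eq by (simp add: w vector_scalar_commute flip: matrix_vector_mul_assoc)
  thus ?thesis using w by (simp add: group_centre_def)
qed

lemma ZW_subgroup: "subgroup ZW GL"
proof (rule group.subgroupI[OF group_GL])
    show "ZW \<subseteq> carrier GL" using ZW_W W_inv by (auto simp: GL_def)
    show "ZW \<noteq> {}" using W_one by (auto simp: group_centre_def)
  next
    fix a assume a: "a \<in> ZW"
    have "matrix_inv a ** w = w ** matrix_inv a" if w: "w \<in> W" for w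
    proof -
      have "a ** w = w ** a" using a w by (simp add: group_centre_def)
      hence "matrix_inv a ** (a ** w) ** matrix_inv a = matrix_inv a ** (w ** a) ** matrix_inv a" by simp
      thus ?thesis using ZW_W[OF a] by (simp add: matrix_mul_assoc)
    qed
    hence "matrix_inv a \<in> ZW" using ZW_W[OF a] by (auto simp: group_centre_def)
    thus "inv\<^bsub>GL\<^esub> a \<in> ZW" using ZW_W[OF a] by (simp add: inv_GL W_inv)
  next
    fix a b assume ab: "a \<in> ZW" "b \<in> ZW"
    have "a ** b ** w = w ** (a ** b)" if w: "w \<in> W" for w
    proof -
      have c: "a ** w = w ** a" "b ** w = w ** b" using ab w by (simp_all add: group_centre_def)
      have "a ** b ** w = a ** (w ** b)" by (simp only: c matrix_mul_assoc[symmetric])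
      also have "\<dots> = w ** a ** b" by (simp only: c matrix_mul_assoc)
      finally show ?thesis by (simp only: matrix_mul_assoc)
    qed
    moreover have "a ** b \<in> W" using ab ZW_W by blast
    ultimately show "a \<otimes>\<^bsub>GL\<^esub> b \<in> ZW" by (simp add: group_centre_def GL_def)
qed

lemma ZW_group: "matrix_group ZW"
  using ZW_subgroup fin by (simp add: matrix_group_def group_centre_def)

sublocale Zg: matrix_group ZW by (rule ZW_group)

lemma mev_scale: "mev (a *s v, b *s p) m = a ^ xdeg m * b ^ ydeg m * mev (v, p) m"
proof (induction m)
  case (add l m)
  thus ?case by (cases l) (simp_all add: mult_ac)
qed simp

text \<open>A scalar acts on \<open>v\<close> and on \<open>p\<close> by inverse factors, which
  cancel in a balanced monomial. Balanced polynomials thus separate orbits at best modulo the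
  centre.\<close>

lemma act_centre:
  assumes z: "z \<in> ZW" and f: "bal f"
  shows "ev f (act z x) = ev f x"
proof -
  obtain k where k: "k \<noteq> 0" "\<And>v. z *v v = k *s v" using centre_scalar[OF z] by blast
  have 1: "matrix_inv z *v v = inverse k *s v" for v
  proof -
    have "k *s (matrix_inv z *v v) = v" using k(2)[of "matrix_inv z *v v"] ZW_W[OF z] by simp
    hence "inverse k *s (k *s (matrix_inv z *v v)) = inverse k *s v" by simp
    thus ?thesis using k by (simp add: vector_smult_assoc)
  qed
  have 2: "p v* z = k *s p" for p
    by (rule pairing_ext) (simp add: pairing_matrix k pairing_scale)
  have "act z x = (inverse k *s fst x, k *s snd x)" by (simp add: act_def split_beta 1 2)
  moreover have "mev (inverse k *s fst x, k *s snd x) m = mev x m" if "m \<in> Poly_Mapping.keys f" for m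
    using f that k by (simp add: mev_scale bal_def flip: power_mult_distrib)
  ultimately show ?thesis unfolding ev_def by (intro mlift_cong) simp
qed

section \<open>The idempotent of the centre\<close>

definition aa :: "'a lop" where "aa = (\<Sum>z\<in>ZW. scal (1 / of_nat (card ZW)) * Wop z)"

lemma ZW_card: "of_nat (card ZW) \<noteq> (0::complex)"
  using Zg.fin Zg.W_one by auto

lemma aa_one: "ap aa one1 = one1"
  using ZW_card by (simp add: aa_def Wop_def)

lemma aa_HT: "iota * aa \<in> HT"
proof -
  have "iota * aa = (\<Sum>w\<in>ZW. scal (1 / of_nat (card ZW)) * (iota * Wop w))"
    unfolding aa_def sum_distrib_left
    by (intro sum.cong refl) (simp add: scal_commute[of iota] flip: mult.assoc)
  thus ?thesis by (simp add: HT_sum HT_scal HT_Wop ZW_W)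
qed

lemma aa_iota: "aa * iota = iota * aa"
  unfolding aa_def sum_distrib_left sum_distrib_right
  by (intro sum.cong refl commute_mult iota_Wop) (simp_all add: scal_commute ZW_W)

lemma aa_Wop: "z \<in> ZW \<Longrightarrow> aa * Wop z = aa"
proof -
  assume z: "z \<in> ZW"
  have "aa * Wop z = (\<Sum>w\<in>ZW. scal (1 / of_nat (card ZW)) * Wop (w ** z))"
    unfolding aa_def sum_distrib_right using z by (intro sum.cong) (simp_all add: mult.assoc Wop_mult ZW_W)
  also have "\<dots> = aa" unfolding aa_def by (rule Zg.sum_W_right[OF z])
  finally show ?thesis .
qed

lemma sum_scal: "(\<Sum>i\<in>A. scal k * T) = scal (of_nat (card A) * k) * T"
  by (rule lop_eqI) (simp del: sum_constant, simp)

lemma ee_Wop: "w \<in> W \<Longrightarrow> ee * Wop w = ee" "w \<in> W \<Longrightarrow> Wop w * ee = ee"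
proof -
  assume w: "w \<in> W"
  have "ee * Wop w = (\<Sum>u\<in>W. scal (1 / of_nat (card W)) * Wop (u ** w))"
    unfolding ee_def sum_distrib_right using w by (intro sum.cong) (simp_all add: mult.assoc Wop_mult)
  also have "\<dots> = ee" unfolding ee_def by (rule sum_W_right[OF w])
  finally show "ee * Wop w = ee" .
  have "Wop w * ee = (\<Sum>u\<in>W. scal (1 / of_nat (card W)) * Wop (w ** u))"
    unfolding ee_def sum_distrib_left using w
    by (intro sum.cong) (simp_all add: scal_commute[of "Wop _"] mult.assoc[symmetric], simp add: mult.assoc Wop_mult)
  also have "\<dots> = ee" unfolding ee_def by (rule sum_W_left[OF w])
  finally show "Wop w * ee = ee" .
qed

lemma aa_idem: "aa * aa = aa"
proof -
  have "aa * aa = (\<Sum>z\<in>ZW. scal (1 / of_nat (card ZW)) * (aa * Wop z))"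
    by (subst (2) aa_def, unfold sum_distrib_left, intro sum.cong refl)
      (simp add: scal_commute[of aa] flip: mult.assoc)
  also have "\<dots> = (\<Sum>z\<in>ZW. scal (1 / of_nat (card ZW)) * aa)" by (rule sum.cong) (simp_all add: aa_Wop)
  also have "\<dots> = aa" unfolding sum_scal using ZW_card by simp
  finally show ?thesis .
qed

lemma ee_aa: "ee * aa = ee" "aa * ee = ee" "ee * ee = ee"
proof -
  have "ee * aa = (\<Sum>z\<in>ZW. scal (1 / of_nat (card ZW)) * (ee * Wop z))"
    unfolding aa_def sum_distrib_left by (intro sum.cong refl) (simp add: scal_commute[of ee] flip: mult.assoc)
  also have "\<dots> = (\<Sum>z\<in>ZW. scal (1 / of_nat (card ZW)) * ee)" by (rule sum.cong) (simp_all add: ee_Wop ZW_W)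
  also have "\<dots> = ee" unfolding sum_scal using ZW_card by simp
  finally show "ee * aa = ee" .
  have "aa * ee = (\<Sum>z\<in>ZW. scal (1 / of_nat (card ZW)) * ee)"
    unfolding aa_def sum_distrib_right by (rule sum.cong) (simp_all add: ee_Wop ZW_W mult.assoc)
  also have "\<dots> = ee" unfolding sum_scal using ZW_card by simp
  finally show "aa * ee = ee" .
  have "ee * ee = (\<Sum>w\<in>W. scal (1 / of_nat (card W)) * ee)"
    by (subst (1) ee_def, unfold sum_distrib_right, rule sum.cong) (simp_all add: ee_Wop mult.assoc)
  also have "\<dots> = ee" unfolding sum_scal using card_W by simp
  finally show "ee * ee = ee" .
qed

end

section \<open>Reduction modulo the Euler element\<close>

context cherednik_irreducible
begin

definition Qop :: "complex \<Rightarrow> 'a lop" where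
  "Qop \<zeta> = iota * mulop (\<lambda>(v, p). pairing p v - \<zeta>)"

definition qf :: "'a pt \<Rightarrow> complex" where "qf = (\<lambda>(v, p). pairing p v)"

lemma ap_Qop: "ap (Qop \<zeta>) f z = (if fst z \<in> reg then (qf z - \<zeta>) * f z else 0)"
  by (simp add: Qop_def ap_iota qf_def split_beta)

lemma ev_qhat': "ev qhat z = qf z"
  by (cases z) (simp add: ev_qhat qf_def)

lemma qf_act: "w \<in> W \<Longrightarrow> qf (act w z) = qf z"
  by (simp add: qf_def act_def split_beta pairing_matrix)

lemma winv_q: "winv (\<lambda>(v, p). pairing p v - \<zeta>)"
  using qf_act by (simp add: winv_def qf_def split_beta)

text \<open>Summing over the basis turns each reflection term into the form of \<open>s\<close>
  evaluated at \<open>v\<close>, which cancels the denominator. What remains is exactly the group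
  part subtracted in the Euler element.\<close>

lemma euler_op:
  "iota * ((\<Sum>i\<in>UNIV. xop (axis i 1) * dun (axis i 1)) - (\<Sum>s\<in>SS. scal (kk s) * Wop s)) = iota * mulop qf"
proof (rule lop_eqI)
  fix f and z :: "'a pt"
  show "ap (iota * ((\<Sum>i\<in>UNIV. xop (axis i 1) * dun (axis i 1)) - (\<Sum>s\<in>SS. scal (kk s) * Wop s))) f z = ap (iota * mulop qf) f z"
  proof (cases "fst z \<in> reg")
    case True
    have "(\<Sum>i\<in>UNIV. fst z $ i * (\<Sum>s\<in>SS. kk s * \<alpha> s $ i / pairing (\<alpha> s) (fst z) * f (act s z)))
       = (\<Sum>s\<in>SS. \<Sum>i\<in>UNIV. fst z $ i * (kk s * \<alpha> s $ i / pairing (\<alpha> s) (fst z) * f (act s z)))"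
      by (subst sum.swap) (simp add: sum_distrib_left)
    also have "\<dots> = (\<Sum>s\<in>SS. kk s * f (act s z))"
    proof (rule sum.cong)
      fix s assume s: "s \<in> SS"
      have "(\<Sum>i\<in>UNIV. fst z $ i * (kk s * \<alpha> s $ i / pairing (\<alpha> s) (fst z) * f (act s z)))
         = kk s / pairing (\<alpha> s) (fst z) * f (act s z) * (\<Sum>i\<in>UNIV. \<alpha> s $ i * fst z $ i)"
        by (simp add: sum_distrib_left sum_divide_distrib mult_ac)
      thus "(\<Sum>i\<in>UNIV. fst z $ i * (kk s * \<alpha> s $ i / pairing (\<alpha> s) (fst z) * f (act s z))) = kk s * f (act s z)"
        using reg_alpha[OF True s] by (simp flip: pairing_def)
    qed simp
    finally have "(\<Sum>i\<in>UNIV. fst z $ i * (\<Sum>s\<in>SS. kk s * \<alpha> s $ i / pairing (\<alpha> s) (fst z) * f (act s z))) = (\<Sum>s\<in>SS. kk s * f (act s z))" .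
    moreover have "(\<Sum>i\<in>UNIV. fst z $ i * (snd z $ i * f z)) = qf z * f z"
      by (simp add: qf_def split_beta pairing_def sum_distrib_left mult_ac)
    ultimately show ?thesis
      using True by (simp add: ap_iota xop_def split_beta ap_dun Wop_def distrib_left sum.distrib)
  qed (simp add: ap_iota)
qed

lemma q_HH: "iota * mulop qf \<in> HH"
proof -
  have "iota * (xop (axis i 1) * dun (axis i 1)) \<in> HH" for i
    using HH_rt[of "gen (X i) * gen (Y i)"] by simp
  hence 1: "(\<Sum>i\<in>UNIV. iota * (xop (axis i 1) * dun (axis i 1))) \<in> HH" by (rule HH_sum)
  have "scal (kk s) * (iota * Wop s) \<in> HH" if "s \<in> SS" for s
    using that by (intro HH_scal HH_Wop SS_W)
  hence "iota * (scal (kk s) * Wop s) \<in> HH" if "s \<in> SS" for s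
    using that by (simp add: scal_commute[of iota] flip: mult.assoc)
  hence "(\<Sum>s\<in>SS. iota * (scal (kk s) * Wop s)) \<in> HH" by (rule HH_sum)
  from HH_diff[OF 1 this] show ?thesis
    by (simp add: euler_op[symmetric] right_diff_distrib sum_distrib_left)
qed

lemma Qop_eq: "Qop \<zeta> = iota * mulop qf - scal \<zeta> * iota"
  by (rule lop_eqI) (simp add: ap_Qop ap_iota algebra_simps)

lemma Qop_HT: "Qop \<zeta> \<in> HT"
proof -
  have "tau k * mulop qf = mulop qf * tau k" if "k \<noteq> 0" for k
    using that by (intro lop_eqI) (simp add: tau_def qf_def split_beta pairing_scale)
  hence "tau k * (iota * mulop qf) = iota * mulop qf * tau k" if "k \<noteq> 0" for k
    using that tau_iota by (metis mult.assoc)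
  hence "iota * mulop qf \<in> HT" using q_HH by (simp add: HT_def)
  thus ?thesis unfolding Qop_eq by (intro HT_diff HT_scal HT_one)
qed

lemma Qop_central: "h \<in> HH \<Longrightarrow> h * Qop \<zeta> = Qop \<zeta> * h"
proof -
  assume h: "h \<in> HH"
  have "h * (iota * mulop (\<lambda>(v, p). pairing p v - \<zeta>)) = (h * iota) * mulop (\<lambda>(v, p). pairing p v - \<zeta>)"
    by (simp add: mult.assoc)
  also have "\<dots> = mulop (\<lambda>(v, p). pairing p v - \<zeta>) * (iota * h)"
    using HH_winv_commute[OF h winv_q] h by simp
  also have "\<dots> = iota * mulop (\<lambda>(v, p). pairing p v - \<zeta>) * h" by (simp add: iota_mulop flip: mult.assoc)
  finally show ?thesis by (simp add: Qop_def)
qed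

lemma lowp_pairing_shift: "lowp d (\<lambda>p. G p) \<Longrightarrow> lowp (Suc d) (\<lambda>p. (pairing p v - \<zeta>) * G p)"
proof -
  assume G: "lowp d (\<lambda>p. G p)"
  have "homp 1 (\<lambda>p. pairing p v)" using homp_linear[OF homp_const[of 1], of v] by simp
  from lowp_mult_homp[OF this G] have "lowp (Suc d) (\<lambda>p. pairing p v * G p)" by simp
  from lowp_diff[OF this lowp_scale[OF lowp_Suc[OF G], of \<zeta>]] show ?thesis
    by (rule lowp_cong) (simp add: left_diff_distrib)
qed

lemma fsym_Q:
  assumes "fsym d F g" shows "fsym (Suc d) (\<lambda>z. (qf z - \<zeta>) * F z) (\<lambda>z. qf z * g z)"
  unfolding fsym_def
proof (intro ballI conjI)
  fix v assume v: "v \<in> reg"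
  have g: "homp d (\<lambda>p. g (v, p))" "lowp d (\<lambda>p. F (v, p) - g (v, p))" using assms v by (auto simp: fsym_def)
  show "homp (Suc d) (\<lambda>p. qf (v, p) * g (v, p))" using homp_linear[OF g(1), of v] by (simp add: qf_def)
  from lowp_add[OF lowp_pairing_shift[OF g(2), of v \<zeta>] homp_lowp[OF homp_scale[OF g(1), of "- \<zeta>"]]]
  show "lowp (Suc d) (\<lambda>p. (qf (v, p) - \<zeta>) * F (v, p) - qf (v, p) * g (v, p))"
    by (rule lowp_cong) (simp add: qf_def algebra_simps)
qed

lemma sym_Q:
  assumes "sym d T G" shows "sym (Suc d) (Qop \<zeta> * T) (\<lambda>w z. qf z * G w z)"
proof -
  obtain t where t: "coeffs T t" "\<forall>w\<in>W. \<forall>v\<in>reg. homp d (\<lambda>p. G w (v, p)) \<and> lowp d (\<lambda>p. t w (v, p) - G w (v, p))"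
    using assms unfolding sym_def by blast
  have "sym (Suc d) (mulop (\<lambda>(v, p). pairing p v - \<zeta>) * T) (\<lambda>w z. qf z * G w z)"
    unfolding sym_def
  proof (intro exI[of _ "\<lambda>w z. (case z of (v, p) \<Rightarrow> pairing p v - \<zeta>) * t w z"] conjI ballI coeffs_mulop_left t)
    fix w v assume wv: "w \<in> W" "v \<in> reg"
    hence "fsym d (\<lambda>z. t w (v, snd z)) (\<lambda>z. G w (v, snd z))" using t by (simp add: fsym_def)
    from fsym_Q[OF this, of \<zeta>] wv(2)
    show "homp (Suc d) (\<lambda>p. qf (v, p) * G w (v, p))"
      "lowp (Suc d) (\<lambda>p. (case (v, p) of (v, p) \<Rightarrow> pairing p v - \<zeta>) * t w (v, p) - qf (v, p) * G w (v, p))"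
      by (auto simp: fsym_def qf_def)
  qed
  thus ?thesis by (simp add: Qop_def mult.assoc)
qed

lemma qf_cancel: "(\<And>z. fst z \<in> reg \<Longrightarrow> qf z * ev f z = 0) \<Longrightarrow> f = 0"
  by (rule qhat_cancel, rule ev_reg_zero) (simp add: ev_qhat')

text \<open>Multiplication by \<open>q - \<zeta>\<close> raises the degree by exactly one, as
  \<open>qhat\<close> is not a zero divisor. Hence no cancellation can hide the top part, and the
  symbol of a multiple is a multiple of \<open>q\<close>.\<close>

lemma fsym_Q_nfT:
  assumes F: "fsym N (\<lambda>z. (qf z - \<zeta>) * ap (rt (nfT f)) one1 z) g" and z: "fst z \<in> reg" and q: "qf z = 0"
  shows "g z = 0"
proof -
  let ?E = "\<lambda>f z. (qf z - \<zeta>) * ap (rt (nfT f)) one1 z"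
  have key: "fsym (Suc M) (?E f) (\<lambda>z. qf z * ev (ycomp M f) z)" if "ylt (Suc M) f" for M f
    using fsym_Q[OF fsym_nfT[OF that]] .
  obtain M where M: "ylt M f" using ylt_ex by blast
  have "ylt N f" using M
  proof (induction M)
    case 0
    thus ?case by (auto simp: ylt_def)
  next
    case (Suc M)
    show ?case
    proof (cases "Suc M \<le> N")
      case True
      thus ?thesis using Suc.prems ylt_mono by blast
    next
      case False
      have "\<forall>v\<in>reg. lowp (Suc M) (\<lambda>p. ?E f (v, p))"
      proof
        fix v assume "v \<in> reg"
        from fsym_lowp[OF F this] show "lowp (Suc M) (\<lambda>p. ?E f (v, p))"
          by (rule lowp_mono) (use False in simp)
      qed
      from fsym_low_zero[OF key[OF Suc.prems] this] have "ycomp M f = 0" by (intro qf_cancel)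
      thus ?thesis using Suc ylt_ycomp_zero by blast
    qed
  qed
  show ?thesis
  proof (cases N)
    case 0
    hence "f = 0" using \<open>ylt N f\<close> ylt_zero by simp
    thus ?thesis using fsym_low_zero[OF F _ z] by simp
  next
    case (Suc M)
    hence "ylt (Suc M) f" using \<open>ylt N f\<close> by simp
    from fsym_unique[OF F[unfolded Suc] key[OF this] z] show ?thesis using q by simp
  qed
qed

section \<open>Balanced polynomials and generic orbits\<close>

lemma bal_simps: "bal f \<Longrightarrow> bal g \<Longrightarrow> bal (f * g)" "bal (Poly_Mapping.single 0 k)"
   "bal f \<Longrightarrow> bal g \<Longrightarrow> bal (f - g)" "bal f \<Longrightarrow> bal g \<Longrightarrow> bal (f + g)" "bal 0" "bal 1"
   "bal (Poly_Mapping.single {#X i, Y j#} k)"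
proof -
  show "bal f \<Longrightarrow> bal g \<Longrightarrow> bal (f * g)" unfolding bal_def using keys_mult[of f g] by fastforce
  show "bal f \<Longrightarrow> bal g \<Longrightarrow> bal (f - g)"
  proof -
    assume b: "bal f" "bal g"
    have "m \<in> Poly_Mapping.keys f \<or> m \<in> Poly_Mapping.keys g" if "m \<in> Poly_Mapping.keys (f - g)" for m
      using that by (auto simp: in_keys_iff lookup_minus)
    thus ?thesis using b unfolding bal_def by blast
  qed
  show "bal f \<Longrightarrow> bal g \<Longrightarrow> bal (f + g)"
  proof -
    assume b: "bal f" "bal g"
    have "m \<in> Poly_Mapping.keys f \<or> m \<in> Poly_Mapping.keys g" if "m \<in> Poly_Mapping.keys (f + g)" for m
      using that by (auto simp: in_keys_iff lookup_add)
    thus ?thesis using b unfolding bal_def by blast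
  qed
  have s: "bal (Poly_Mapping.single m k)" if "xdeg m = ydeg m" for m k
    using that by (cases "k = 0") (simp_all add: bal_def)
  show "bal (Poly_Mapping.single 0 k)" "bal (Poly_Mapping.single {#X i, Y j#} k)" by (rule s; simp)+
  show "bal 0" "bal 1" using s[of 0 0] s[of 0 1] by (simp_all only: single_zero single_one deg_simps simp_thms)
qed

lemma separating_bal_poly:
  assumes "finite A" "\<And>b. b \<in> A \<Longrightarrow> \<exists>i j. fst b $ i * snd b $ j \<noteq> fst a $ i * snd a $ j"
  shows "\<exists>r. bal r \<and> ev r a = 1 \<and> (\<forall>b\<in>A. ev r b = 0)"
  using assms
proof (induction A rule: finite_induct)
  case empty
  show ?case by (intro exI[of _ 1]) (simp add: bal_simps)
next
  case (insert b A)
  then obtain r where r: "bal r" "ev r a = 1" "\<forall>b\<in>A. ev r b = 0" by auto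
  obtain i j where ij: "fst b $ i * snd b $ j \<noteq> fst a $ i * snd a $ j" using insert.prems by blast
  let ?m = "Poly_Mapping.single {#X i, Y j#} 1"
  let ?l = "(?m - Poly_Mapping.single 0 (fst b $ i * snd b $ j)) * Poly_Mapping.single 0 (1 / (fst a $ i * snd a $ j - fst b $ i * snd b $ j))"
  have "bal (?l * r)" by (intro bal_simps r)
  moreover have "ev (?l * r) a = 1" "\<forall>c\<in>insert b A. ev (?l * r) c = 0" using r ij by auto
  ultimately show ?case by blast
qed

lemma NF_delta: "NF (\<lambda>w. if w = mat 1 then f else 0) = rt (nfT f)"
proof -
  have "NF (\<lambda>w. if w = mat 1 then f else 0) = (\<Sum>w\<in>W. if w = mat 1 then rt (nfT f) else 0)"
    unfolding NF_def by (rule sum.cong) auto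
  thus ?thesis using fin by simp
qed

lemma NF_Wop:
  assumes y: "y \<in> W" shows "NF \<phi> * Wop y = NF (\<lambda>w. \<phi> (w ** matrix_inv y))"
proof -
  have "NF \<phi> * Wop y = (\<Sum>w\<in>W. rt (nfT (\<phi> w)) * Wop (w ** y))"
    unfolding NF_def sum_distrib_right using y by (intro sum.cong) (simp_all add: mult.assoc Wop_mult)
  also have "\<dots> = (\<Sum>w\<in>W. rt (nfT (\<phi> (w ** y ** matrix_inv y))) * Wop (w ** y))" using y by simp
  also have "\<dots> = NF (\<lambda>w. \<phi> (w ** matrix_inv y))" unfolding NF_def
    by (rule sum_W_right[OF y, of "\<lambda>w. rt (nfT (\<phi> (w ** matrix_inv y))) * Wop w"])
  finally show ?thesis .
qed

lemma NF_unique: "iota * NF \<phi> = iota * NF \<psi> \<Longrightarrow> w \<in> W \<Longrightarrow> \<phi> w = \<psi> w"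
  using NF_zero[of "\<lambda>w. \<phi> w - \<psi> w" w] by (simp add: NF_diff right_diff_distrib)

text \<open>Eigenvalues of elements of finite order are roots of unity, so only finitely many
  eigenspaces are to be avoided. Those of a noncentral element are proper, since a scalar element
  would be central.\<close>

lemma generic_avoid:
  "\<exists>\<V>. finite \<V> \<and> (\<forall>V\<in>\<V>. vec.subspace V \<and> V \<noteq> (UNIV :: (complex^'a) set)) \<and>
     (\<forall>v. (\<forall>V\<in>\<V>. v \<notin> V) \<longrightarrow> v \<in> reg \<and> (\<forall>g\<in>W - ZW. \<forall>k. g *v v \<noteq> k *s v))"
proof -
  obtain \<V> where V: "finite \<V>" "\<forall>V\<in>\<V>. vec.subspace V \<and> V \<noteq> (UNIV :: (complex^'a) set)" "reg = {v. \<forall>V\<in>\<V>. v \<notin> V}"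
    using reg_avoid by blast
  have "\<forall>w. \<exists>N. w \<in> W \<longrightarrow> N > 0 \<and> ((*v) w ^^ N) = id" using finite_order by blast
  from choice[OF this] obtain N where N: "\<forall>w. w \<in> W \<longrightarrow> N w > 0 \<and> ((*v) w ^^ N w) = id" ..
  define \<U> where "\<U> = (\<Union>g\<in>W - ZW. (\<lambda>k. {v. g *v v = k *s v}) ` {k. k ^ N g = 1})"
  have fU: "finite \<U>" unfolding \<U>_def
    using fin N by (intro finite_UN_I finite_imageI) (auto simp: finite_roots_unity Suc_le_eq)
  have "V \<noteq> UNIV \<and> vec.subspace V" if "V \<in> \<U>" for V
  proof -
    from that obtain g k where gk: "g \<in> W" "g \<notin> ZW" "V = {v. g *v v = k *s v}" unfolding \<U>_def by blast
    have "V \<noteq> UNIV"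
    proof
      assume "V = UNIV"
      hence "v \<in> {v. g *v v = k *s v}" for v unfolding gk(3) by simp
      hence "g *v v = k *s v" for v by blast
      from scalar_in_centre[OF gk(1) this] show False using gk(2) by simp
    qed
    thus ?thesis using gk subspace_eigen by simp
  qed
  \<comment> \<open>The zero subspace is added to the list because a nonzero \<open>v\<close> is
    required to read off the order of its eigenvalue.\<close>
  moreover have "v \<in> reg \<and> (\<forall>g\<in>W - ZW. \<forall>k. g *v v \<noteq> k *s v)" if v: "\<forall>V\<in>insert {0} (\<V> \<union> \<U>). v \<notin> V" for v
  proof (intro conjI ballI allI notI)
    show "v \<in> reg" using v V by simp
    fix g k assume g: "g \<in> W - ZW" and k: "g *v v = k *s v"
    have "v \<noteq> 0" using v by simp
    hence "k ^ N g = 1" using eigenvalue_root[OF k, of "N g"] N g by simp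
    hence "{v. g *v v = k *s v} \<in> \<U>" unfolding \<U>_def using g by (intro UN_I[of g] imageI) simp_all
    hence "{v. g *v v = k *s v} \<in> insert {0} (\<V> \<union> \<U>)" by simp
    hence "v \<notin> {v. g *v v = k *s v}" using v by (rule bspec[rotated])
    thus False using k by simp
  qed
  moreover have "vec.subspace {0::complex^'a} \<and> {0::complex^'a} \<noteq> UNIV"
  proof -
    have "axis undefined 1 \<notin> {0::complex^'a}" by (simp add: axis_eq_0_iff)
    thus ?thesis by (auto simp: vec.subspace_def)
  qed
  ultimately show ?thesis using V fU
    by (intro exI[of _ "insert {0} (\<V> \<union> \<U>)"]) auto
qed

text \<open>The products of coordinates form a rank one tensor, which determines its first factor up
  to scale. Equality therefore makes \<open>v\<close> an eigenvector of a group element, and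
  genericity makes that element central.\<close>

lemma orbit_separated:
  assumes gen: "\<forall>g\<in>W - ZW. \<forall>k. g *v v \<noteq> k *s v" and p: "p \<noteq> 0" and u: "u \<in> W" and w: "w \<in> W"
    and eq: "\<And>i j. fst (act w (v, p)) $ i * snd (act w (v, p)) $ j = fst (act u (v, p)) $ i * snd (act u (v, p)) $ j"
  shows "matrix_inv u ** w \<in> ZW"
proof (rule ccontr)
  assume n: "matrix_inv u ** w \<notin> ZW"
  have "p v* u \<noteq> 0"
  proof
    assume "p v* u = 0"
    hence "p v* u v* matrix_inv u = 0" by simp
    thus False using p u by (simp add: vector_matrix_mul_assoc)
  qed
  then obtain j where j: "(p v* u) $ j \<noteq> 0" by (auto simp: vec_eq_iff)
  define k where "k = (p v* w) $ j / (p v* u) $ j"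
  have "matrix_inv u *v v = k *s (matrix_inv w *v v)"
    using eq[of _ j] j by (auto simp: vec_eq_iff act_def k_def field_simps)
  hence "w *v (matrix_inv u *v v) = k *s v" using w by (simp add: vector_scalar_commute)
  hence e: "(w ** matrix_inv u) *v v = k *s v" by (simp add: matrix_vector_mul_assoc)
  have "w ** matrix_inv u \<in> W" using u w by blast
  moreover have "w ** matrix_inv u \<notin> ZW"
  proof
    assume z: "w ** matrix_inv u \<in> ZW"
    have "(w ** matrix_inv u) ** u = u ** (w ** matrix_inv u)" using z u by (auto simp: group_centre_def)
    hence "w = u ** (w ** matrix_inv u)" using u by simp
    hence "matrix_inv u ** w = w ** matrix_inv u" using u by (metis W_assoc2)
    thus False using z n by simp
  qed
  ultimately show False using gen e by blast
qed

text \<open>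
  The symbol of an operator that maps \<open>M\<^sup>T\<close> into \<open>(q - \<zeta>) M\<^sup>T\<close> vanishes on the quadric \<open>q = 0\<close>: balanced
  polynomials separate the points of a generic orbit modulo the centre of \<open>W\<close>.
\<close>

lemma symbol_vanishes:
  assumes h: "sym d h (\<lambda>w. ev (f w))"
    and M: "\<And>h'. h' \<in> HT \<Longrightarrow> \<exists>h''\<in>HT. ap (h * h') one1 = ap (Qop \<zeta> * h'') one1"
    and fz: "\<And>u y. u \<in> W \<Longrightarrow> y \<in> ZW \<Longrightarrow> f (u ** y) = f u"
    and v: "v \<in> reg" "\<forall>g\<in>W - ZW. \<forall>k. g *v v \<noteq> k *s v" and p: "p \<noteq> 0" "pairing p v = 0" and u: "u \<in> W"
  shows "ev (f u) (v, p) = 0"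
proof -
  let ?z = "(v, p)"
  \<comment> \<open>The sum is the symbol of \<open>h\<close> applied to a normally ordered
    monomial. By \<open>M\<close> this function is a multiple of \<open>q - \<zeta>\<close>, so its
    symbol vanishes on the quadric.\<close>
  have mono: "(\<Sum>w\<in>W. ev (f w) ?z * mev (act w ?z) m) = 0" if m: "xdeg m = ydeg m" for m
  proof -
    let ?r = "Poly_Mapping.single m 1 :: 'a mpoly"
    have "iota * NF (\<lambda>w. if w = mat 1 then ?r else 0) \<in> HT" by (rule NF_HT) (use m in \<open>auto simp: bal_def\<close>)
    hence "iota * rt (nfT ?r) \<in> HT" by (simp only: NF_delta)
    from M[OF this] obtain h'' where h'': "h'' \<in> HT" "ap (h * (iota * rt (nfT ?r))) one1 = ap (Qop \<zeta> * h'') one1" by blast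
    obtain \<psi> where \<psi>: "h'' = iota * NF \<psi>" using h''(1) HT_NF by blast
    have r: "ylt (Suc (ydeg m)) ?r" by (simp add: ylt_def)
    have rc: "ycomp (ydeg m) ?r = ?r" by simp
    have "fsym (ydeg m) (ap (iota * rt (nfT ?r)) one1) (ev ?r)"
      using fsym_nfT[OF r] unfolding rc by (simp add: fsym_def ap_iota)
    from fsym_apply[OF h this]
    have "fsym (d + ydeg m) (ap (Qop \<zeta> * h'') one1) (\<lambda>z. \<Sum>w\<in>W. ev (f w) z * ev ?r (act w z))" using h''(2) by simp
    hence "fsym (d + ydeg m) (\<lambda>z. (qf z - \<zeta>) * ap (rt (nfT (\<Sum>w\<in>W. \<psi> w))) one1 z) (\<lambda>z. \<Sum>w\<in>W. ev (f w) z * ev ?r (act w z))"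
      by (simp add: fsym_def \<psi> ap_iota ap_Qop ap_NF_one)
    from fsym_Q_nfT[OF this, of ?z] show ?thesis using v p by (simp add: qf_def)
  qed
  have test: "(\<Sum>w\<in>W. ev (f w) ?z * ev r (act w ?z)) = 0" if "bal r" for r
  proof -
    have "(\<Sum>w\<in>W. ev (f w) ?z * ev r (act w ?z)) = (\<Sum>m\<in>Poly_Mapping.keys r. Poly_Mapping.lookup r m * (\<Sum>w\<in>W. ev (f w) ?z * mev (act w ?z) m))"
      unfolding ev_def[of r] mlift_def sum_distrib_left by (subst sum.swap) (simp add: mult_ac)
    also have "\<dots> = 0" using that mono by (intro sum.neutral) (simp add: bal_def)
    finally show ?thesis .
  qed
  \<comment> \<open>The points of the orbit outside the class of \<open>u\<close> modulo the centre;
    a balanced polynomial can vanish at all of them and be 1 at \<open>u\<close>.\<close>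
  define A where "A = (\<lambda>w. act w ?z) ` {w \<in> W. matrix_inv u ** w \<notin> ZW}"
  have "\<exists>i j. fst b $ i * snd b $ j \<noteq> fst (act u ?z) $ i * snd (act u ?z) $ j" if "b \<in> A" for b
    using that orbit_separated[OF v(2) p(1) u] unfolding A_def by blast
  moreover have "finite A" using fin by (simp add: A_def)
  ultimately obtain r where r: "bal r" "ev r (act u ?z) = 1" "\<forall>b\<in>A. ev r b = 0"
    using separating_bal_poly[of A "act u ?z"] by blast
  have "0 = (\<Sum>w\<in>W. ev (f w) ?z * ev r (act w ?z))" using test[OF r(1)] by simp
  also have "\<dots> = (\<Sum>w\<in>W. ev (f (u ** w)) ?z * ev r (act (u ** w) ?z))"
    by (rule sum_W_left[OF u, symmetric])
  \<comment> \<open>On the coset of the centre both \<open>r\<close> and the coefficient are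
    constant, so the sum is a nonzero multiple of the value sought.\<close>
  also have "\<dots> = (\<Sum>w\<in>W. if w \<in> ZW then ev (f u) ?z else 0)"
  proof (rule sum.cong)
    fix w assume w: "w \<in> W"
    show "ev (f (u ** w)) ?z * ev r (act (u ** w) ?z) = (if w \<in> ZW then ev (f u) ?z else 0)"
    proof (cases "w \<in> ZW")
      case True
      have "ev r (act (u ** w) ?z) = ev r (act w (act u ?z))" using u w by (simp add: act_act)
      thus ?thesis using True r act_centre[OF True r(1)] fz[OF u True] by simp
    next
      case False
      hence "act (u ** w) ?z \<in> A" unfolding A_def using u w by auto
      thus ?thesis using False r by simp
    qed
  qed simp
  also have "\<dots> = (\<Sum>w\<in>W \<inter> ZW. ev (f u) ?z)" by (rule sum.inter_restrict[OF fin, symmetric])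
  also have "W \<inter> ZW = ZW" using ZW_W by blast
  finally show ?thesis using ZW_card by simp
qed

text \<open>The symbol is divisible by \<open>qhat\<close>. Subtracting the corresponding multiple
  of \<open>Qop \<zeta>\<close> lowers the degree and keeps both hypotheses, because the subtracted
  operator sends the module into multiples of \<open>Qop \<zeta>\<close> and the quotient is chosen
  constant on cosets of the centre.\<close>

lemma HT_divide:
  assumes "h \<in> HT" "\<And>y. y \<in> ZW \<Longrightarrow> h * Wop y = h"
    "\<And>h'. h' \<in> HT \<Longrightarrow> \<exists>h''\<in>HT. ap (h * h') one1 = ap (Qop \<zeta> * h'') one1"
  shows "\<exists>k\<in>HT. h = Qop \<zeta> * k"
proof -
  obtain \<phi> where \<phi>: "h = iota * NF \<phi>" "\<forall>w\<in>W. bal (\<phi> w)" using HT_NF assms(1) by blast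
  obtain N where N: "\<forall>w\<in>W. ylt N (\<phi> w)" using ylt_all_ex by blast
  show ?thesis using assms \<phi> N
  proof (induction N arbitrary: h \<phi>)
    case 0
    have "\<phi> w = 0" if "w \<in> W" for w using "0.prems"(6) ylt_zero that by blast
    hence "NF \<phi> = 0" unfolding NF_def by (intro sum.neutral) simp
    hence "h = Qop \<zeta> * 0" using "0.prems"(4) by simp
    thus ?case using HT_zero by blast
  next
    case (Suc d)
    define f where "f w = ycomp d (\<phi> w)" for w
    have sh: "sym d h (\<lambda>w. ev (f w))" unfolding f_def Suc.prems(4) sym_iota by (rule sym_NF) (use Suc.prems in blast)
    have \<phi>z: "\<phi> (u ** y) = \<phi> u" if "u \<in> W" "y \<in> ZW" for u y
    proof -
      have yW: "y \<in> W" using that ZW_W by blast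
      have "iota * NF (\<lambda>w. \<phi> (w ** matrix_inv y)) = iota * NF \<phi>"
        using Suc.prems(2)[OF that(2)] NF_Wop[OF yW, of \<phi>] by (simp add: Suc.prems(4) mult.assoc)
      from NF_unique[OF this, of "u ** y"] show ?thesis using that yW by (simp add: W_mult)
    qed
    have fz: "f (u ** y) = f u" if "u \<in> W" "y \<in> ZW" for u y using \<phi>z[OF that] by (simp add: f_def)
    obtain \<V> where V: "finite \<V>" "\<forall>V\<in>\<V>. vec.subspace V \<and> V \<noteq> (UNIV :: (complex^'a) set)"
      "\<forall>v. (\<forall>V\<in>\<V>. v \<notin> V) \<longrightarrow> v \<in> reg \<and> (\<forall>g\<in>W - ZW. \<forall>k. g *v v \<noteq> k *s v)" using generic_avoid by blast
    have div: "\<exists>g. f u = qhat * g" if "u \<in> W" for u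
    proof (rule quadric_division[OF card V(1)])
      fix v p :: "complex^'a" assume "\<forall>V\<in>\<V>. v \<notin> V" "p \<noteq> 0" "pairing p v = 0"
      thus "ev (f u) (v, p) = 0" using symbol_vanishes[OF sh Suc.prems(3) fz _ _ _ _ that] V(3) by blast
    qed (use V in blast)
    have deg: "bcomp d d (f u) = f u" if "u \<in> W" for u
      by (rule pcomp_id) (use Suc.prems(5) that in \<open>auto simp: f_def keys_pcomp bal_def\<close>)
    \<comment> \<open>Quotients are restricted to bidegree one less, which makes them balanced and
      gives the product the right degree. With the successor on the left, \<open>d = 0\<close>
      forces the quotient to be zero.\<close>
    define P where "P = (\<lambda>f g. f = qhat * g \<and> bal g \<and> (\<forall>m\<in>Poly_Mapping.keys g. Suc (ydeg m) = d))"
    have ex: "\<exists>g. P (f u) g" if "u \<in> W" for u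
    proof -
      obtain g where g: "f u = qhat * g" using div[OF \<open>u \<in> W\<close>] by blast
      show ?thesis
      proof (cases d)
        case 0
        have "f u = 0" using bcomp_qhat_0[of 0 g] deg[OF that] g 0 by simp
        thus ?thesis by (intro exI[of _ 0]) (simp add: P_def bal_simps)
      next
        case (Suc e)
        have "f u = qhat * bcomp e e g" using bcomp_qhat[of e e g] deg[OF that] g Suc by simp
        thus ?thesis by (intro exI[of _ "bcomp e e g"]) (auto simp: P_def bal_def keys_pcomp Suc)
      qed
    qed
    \<comment> \<open>The choice depends on the polynomial \<open>f w\<close> alone, so
      \<open>k\<close> inherits from \<open>f\<close> the invariance under the centre.\<close>
    define k where "k = (\<lambda>w. SOME g. P (f w) g)"
    have k: "P (f u) (k u)" if "u \<in> W" for u unfolding k_def by (rule someI_ex[OF ex[OF that]])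
    define K where "K = iota * NF k"
    have K: "K \<in> HT" unfolding K_def by (rule NF_HT) (use k in \<open>auto simp: P_def\<close>)
    have kz: "k (u ** y) = k u" if "u \<in> W" "y \<in> ZW" for u y using fz[OF that] by (simp add: k_def)
    have KW: "K * Wop y = K" if "y \<in> ZW" for y
    proof -
      have "NF (\<lambda>w. k (w ** matrix_inv y)) = NF k"
        unfolding NF_def by (rule sum.cong) (use that kz[OF _ Zg.W_minv[OF that]] in auto)
      thus ?thesis unfolding K_def using NF_Wop[OF ZW_W[OF that], of k] by (simp add: mult.assoc)
    qed
    have symQK: "sym d (Qop \<zeta> * K) (\<lambda>w. ev (f w))"
    proof (cases d)
      case 0
      have "k u = 0" if "u \<in> W" for u using k[OF that] 0 by (auto simp: P_def)
      hence "K = 0" unfolding K_def NF_def by simp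
      moreover have "f u = 0" if "u \<in> W" for u using k[OF that] \<open>\<And>u. u \<in> W \<Longrightarrow> k u = 0\<close>[OF that] by (simp add: P_def)
      ultimately have "sym d (Qop \<zeta> * K) (\<lambda>w. ev (f w)) = sym d 0 (\<lambda>w z. 0)"
        unfolding sym_def by simp
      thus ?thesis unfolding sym_def by (auto simp: coeffs_def homp_zero intro!: exI[of _ "\<lambda>w x. 0"])
    next
      case (Suc e)
      have yk: "ydeg m = e" if "u \<in> W" "m \<in> Poly_Mapping.keys (k u)" for u m
        using k[OF that(1)] that(2) Suc by (simp add: P_def)
      have "ylt (Suc e) (k u)" if "u \<in> W" for u using yk[OF that] by (auto simp: ylt_def)
      from sym_NF[OF this] have "sym e K (\<lambda>w z. ev (ycomp e (k w)) z)" unfolding K_def sym_iota .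
      from sym_Q[OF this, of \<zeta>] have "sym d (Qop \<zeta> * K) (\<lambda>w z. qf z * ev (ycomp e (k w)) z)" unfolding Suc .
      thus ?thesis
      proof (rule sym_cong)
        fix w z assume w: "w \<in> W"
        have "ycomp e (k w) = k w" by (rule pcomp_id) (use yk[OF w] in auto)
        moreover have "f w = qhat * k w" using k[OF w] by (simp add: P_def)
        ultimately show "qf z * ev (ycomp e (k w)) z = ev (f w) z" by (simp add: ev_qhat')
      qed
    qed
    define h1 where "h1 = h - Qop \<zeta> * K"
    have h1: "h1 \<in> HT" unfolding h1_def by (intro HT_diff HT_mult Qop_HT K Suc.prems)
    have low: "lowop d h1"
    proof -
      obtain t t' where "coeffs h t" "\<forall>w\<in>W. \<forall>v\<in>reg. homp d (\<lambda>p. ev (f w) (v, p)) \<and> lowp d (\<lambda>p. t w (v, p) - ev (f w) (v, p))"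
        "coeffs (Qop \<zeta> * K) t'" "\<forall>w\<in>W. \<forall>v\<in>reg. homp d (\<lambda>p. ev (f w) (v, p)) \<and> lowp d (\<lambda>p. t' w (v, p) - ev (f w) (v, p))"
        using sh symQK unfolding sym_def by blast
      note t = this
      show ?thesis unfolding lowop_def h1_def
      proof (intro exI[of _ "\<lambda>w x. t w x - t' w x"] conjI ballI coeffs_diff t)
        fix w v assume wv: "w \<in> W" "v \<in> reg"
        have "lowp d (\<lambda>p. t w (v, p) - ev (f w) (v, p))" "lowp d (\<lambda>p. t' w (v, p) - ev (f w) (v, p))" using t wv by auto
        from lowp_diff[OF this] show "lowp d (\<lambda>p. t w (v, p) - t' w (v, p))" by simp
      qed
    qed
    obtain \<phi>1 where \<phi>1: "h1 = iota * NF \<phi>1" "\<forall>w\<in>W. bal (\<phi>1 w)" using HT_NF h1 by blast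
    have y1: "\<forall>w\<in>W. ylt d (\<phi>1 w)" using NF_ylt low unfolding \<phi>1(1) lowop_iota by blast
    have "\<exists>k\<in>HT. h1 = Qop \<zeta> * k"
    proof (rule Suc.IH[OF h1 _ _ \<phi>1 y1])
      fix y assume "y \<in> ZW"
      thus "h1 * Wop y = h1" using Suc.prems(2) KW by (simp add: h1_def left_diff_distrib mult.assoc)
    next
      fix h' assume h': "h' \<in> HT"
      then obtain h'' where h'': "h'' \<in> HT" "ap (h * h') one1 = ap (Qop \<zeta> * h'') one1" using Suc.prems(3) by blast
      have "ap (h1 * h') one1 = ap (Qop \<zeta> * (h'' - K * h')) one1"
      proof -
        have "ap (h1 * h') one1 = (\<lambda>x. ap (h * h') one1 x - ap (Qop \<zeta> * (K * h')) one1 x)"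
          by (simp add: h1_def left_diff_distrib)
        also have "\<dots> = ap (Qop \<zeta> * h'' - Qop \<zeta> * (K * h')) one1" unfolding h''(2) by (simp only: ap_simps)
        finally show ?thesis by (simp only: right_diff_distrib)
      qed
      thus "\<exists>h''\<in>HT. ap (h1 * h') one1 = ap (Qop \<zeta> * h'') one1" using HT_diff HT_mult h'' K h' by blast
    qed
    then obtain k1 where "k1 \<in> HT" "h1 = Qop \<zeta> * k1" by blast
    thus ?case using K by (intro bexI[of _ "k1 + K"]) (auto simp: h1_def distrib_left HT_add algebra_simps)
  qed
qed

section \<open>The centre modulo the Euler element\<close>

definition aH :: "'a lop" where "aH = iota * aa"
definition eH :: "'a lop" where "eH = iota * ee"
text \<open>\<open>BB\<close> and \<open>ZT\<close> are the operator versions of the corner algebra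
  and of the torus-invariant centre; \<open>centre_iso\<close> makes the identification.\<close>

definition BB :: "'a lop set" where "BB = {aH * h * aH | h. h \<in> HT}"
definition ZT :: "'a lop set" where "ZT = {z \<in> HT. \<forall>h\<in>HH. z * h = h * z}"

lemma aH_HT: "aH \<in> HT" and eH_HT: "eH \<in> HT"
  by (simp_all add: aH_def eH_def aa_HT ee_HT)

lemma iota_swap: "b * iota = iota * b \<Longrightarrow> (iota * a) * (iota * b) = iota * (a * b)" if "a * iota = iota * a" for a b :: "'a lop"
proof -
  have "(iota * a) * (iota * b) = iota * (a * iota) * b" by (simp add: mult.assoc)
  also have "\<dots> = (iota * iota) * (a * b)" unfolding that by (simp only: mult.assoc)
  finally show ?thesis by (simp only: iota_idem)
qed

lemma aH_eH: "aH * aH = aH" "aH * eH = eH" "eH * aH = eH" "eH * eH = eH"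
  by (simp_all add: aH_def eH_def iota_swap aa_iota ee_iota aa_idem ee_aa)

lemma aH_eH_left: "aH * (aH * x) = aH * x" "aH * (eH * x) = eH * x" "eH * (aH * x) = eH * x" "eH * (eH * x) = eH * x"
  by (simp_all add: aH_eH flip: mult.assoc)

lemma BB_HT: "b \<in> BB \<Longrightarrow> b \<in> HT"
  by (auto simp: BB_def intro!: HT_mult aH_HT)

lemma BB_aH: "b \<in> BB \<Longrightarrow> aH * b = b" "b \<in> BB \<Longrightarrow> b * aH = b"
  by (auto simp: BB_def mult.assoc aH_eH aH_eH_left)

lemma BB_iff: "b \<in> BB \<longleftrightarrow> b \<in> HT \<and> aH * b * aH = b"
proof
  assume b: "b \<in> BB"
  thus "b \<in> HT \<and> aH * b * aH = b" by (simp add: BB_HT BB_aH)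
next
  assume "b \<in> HT \<and> aH * b * aH = b"
  thus "b \<in> BB" unfolding BB_def by (intro CollectI exI[of _ b]) simp
qed

lemma BB_mult: "a \<in> BB \<Longrightarrow> b \<in> BB \<Longrightarrow> a * b \<in> BB"
proof -
  assume a: "a \<in> BB" and b: "b \<in> BB"
  have "aH * (a * b) * aH = (aH * a) * (b * aH)" by (simp only: mult.assoc)
  also have "\<dots> = a * b" by (simp only: BB_aH[OF a] BB_aH[OF b])
  finally show ?thesis using a b by (simp add: BB_iff HT_mult)
qed

lemma BB_add: "a \<in> BB \<Longrightarrow> b \<in> BB \<Longrightarrow> a + b \<in> BB" and BB_diff: "a \<in> BB \<Longrightarrow> b \<in> BB \<Longrightarrow> a - b \<in> BB"
  by (simp_all add: BB_iff HT_add HT_diff distrib_left distrib_right left_diff_distrib right_diff_distrib)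

lemma eH_BB: "eH \<in> BB"
  by (simp add: BB_iff eH_HT mult.assoc aH_eH)

lemma ZT_aH: "z \<in> ZT \<Longrightarrow> aH * z \<in> BB"
proof -
  assume z: "z \<in> ZT"
  have "aH * (aH * z) * aH = aH * (z * aH)" by (simp add: mult.assoc aH_eH_left)
  also have "z * aH = aH * z" using z aH_HT by (simp add: ZT_def HT_HH)
  finally show ?thesis using z aH_HT by (simp add: BB_iff HT_mult ZT_def aH_eH_left)
qed

lemma winv_ee_commute: "winv \<psi> \<Longrightarrow> ap ee (\<lambda>z. \<psi> z * F z) = (\<lambda>z. \<psi> z * ap ee F z)"
proof
  fix z assume \<psi>: "winv \<psi>"
  have "\<psi> (act w z) = \<psi> z" if "w \<in> W" for w using \<psi> that unfolding winv_def by blast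
  thus "ap ee (\<lambda>z. \<psi> z * F z) z = \<psi> z * ap ee F z" by (simp add: ee_def Wop_def sum_distrib_left)
qed

text \<open>The function \<open>e F\<close> is invariant, hence passes through \<open>h\<close> and
  through the outer \<open>e\<close> as a factor; what is left is \<open>e h 1\<close>.\<close>

lemma spherical:
  assumes h: "h \<in> HH" shows "ee * h * ee = mulop (ap (ee * h) one1) * ee"
proof (rule lop_eqI)
  fix F z
  let ?\<psi> = "ap ee F"
  have "ap h ?\<psi> = (\<lambda>z. ?\<psi> z * ap h one1 z)"
  proof
    fix z
    obtain g where g: "coeffs h g" using HH_coeffs h by blast
    show "ap h ?\<psi> z = ?\<psi> z * ap h one1 z"
      using coeffs_winv[OF g ee_winv, of z F one1] HH_off_reg[OF h, of z] by (cases "fst z \<in> reg") simp_all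
  qed
  thus "ap (ee * h * ee) F z = ap (mulop (ap (ee * h) one1) * ee) F z"
    by (simp add: winv_ee_commute[OF ee_winv])
qed

lemma tau_ee: "tau k * ee = ee * tau k"
  unfolding ee_def sum_distrib_left sum_distrib_right
  by (intro sum.cong refl) (rule commute_mult[symmetric], simp_all add: scal_commute[of "tau k"] tau_Wop)

text \<open>The constant 1 is fixed by the torus, so the function \<open>e h 1\<close> inherits
  invariance from \<open>h\<close>. The second claim identifies the central element by its effect on
  \<open>e\<close>.\<close>

lemma spherical_ZT:
  assumes h: "h \<in> HT"
  defines "z \<equiv> iota * mulop (ap (ee * h) one1)"
  shows "z \<in> ZT" "eH * h * eH = z * eH"
proof -
  let ?\<Phi> = "ap (ee * h) one1"
  have hH: "h \<in> HH" using h by (rule HT_HH)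
  note sp = spherical_in_HH[OF hH]
  have zHH: "z \<in> HH" using sp by (simp add: z_def)
  have "tau k * z = z * tau k" if k: "k \<noteq> 0" for k
  proof -
    have "tau k * (ee * h) = ee * h * tau k" using h k tau_ee[of k] by (simp add: HT_def mult.assoc[symmetric]) (simp add: HT_def mult.assoc)
    hence "ap (tau k * (ee * h)) one1 = ap (ee * h * tau k) one1" by simp
    hence "ap (tau k) ?\<Phi> = ?\<Phi>" by (simp add: tau_def split_beta)
    hence inv: "?\<Phi> (k *s fst x, inverse k *s snd x) = ?\<Phi> x" for x by (simp add: tau_def split_beta fun_eq_iff)
    have "tau k * mulop ?\<Phi> = mulop ?\<Phi> * tau k"
      using inv by (intro lop_eqI) (simp add: tau_def split_beta)
    thus ?thesis unfolding z_def using tau_iota[OF k] by (metis mult.assoc)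
  qed
  moreover have "z * h' = h' * z" if h': "h' \<in> HH" for h'
  proof -
    have "z * h' = iota * (h' * mulop ?\<Phi>)" unfolding z_def HH_winv_commute[OF h' sp(1)] by (simp add: mult.assoc)
    also have "\<dots> = h' * iota * mulop ?\<Phi>" using h' by (simp flip: mult.assoc)
    finally show ?thesis by (simp add: z_def mult.assoc)
  qed
  ultimately show "z \<in> ZT" using zHH by (simp add: ZT_def HT_def)
  have "eH * h * eH = iota * ee * (h * iota) * ee" by (simp add: eH_def mult.assoc)
  also have "\<dots> = iota * (ee * h * ee)" using hH by (simp add: mult.assoc)
  also have "\<dots> = iota * (mulop ?\<Phi> * ee)" by (simp only: spherical[OF hH])
  also have "\<dots> = (iota * iota) * (mulop ?\<Phi> * ee)" by simp
  also have "\<dots> = z * eH" by (simp only: z_def eH_def mult.assoc) (simp only: iota_mulop mult.assoc[symmetric])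
  finally show "eH * h * eH = z * eH" .
qed

lemma ap_aH_one: "h \<in> HH \<Longrightarrow> ap (h * aH) one1 = ap h one1" "h \<in> HH \<Longrightarrow> ap (h * eH) one1 = ap h one1"
proof -
  assume h: "h \<in> HH"
  have "h * aH = h * aa" "h * eH = h * ee" using h by (simp_all add: aH_def eH_def flip: mult.assoc)
  thus "ap (h * aH) one1 = ap h one1" "ap (h * eH) one1 = ap h one1" by (simp_all add: aa_one ee_one)
qed

theorem central_surj:
  assumes h: "h \<in> BB" and c: "\<And>b. b \<in> BB \<Longrightarrow> \<exists>d\<in>BB. h * b - b * h = Qop \<zeta> * d"
  shows "\<exists>z\<in>ZT. \<exists>d\<in>BB. h - aH * z = Qop \<zeta> * d"
proof -
  have hT: "h \<in> HT" using h by (rule BB_HT)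
  define z where "z = iota * mulop (ap (ee * h) one1)"
  have z: "z \<in> ZT" "eH * h * eH = z * eH" using spherical_ZT[OF hT] by (simp_all add: z_def)
  have zc: "z * b = b * z" if "b \<in> HT" for b using z that HT_HH by (auto simp: ZT_def)
  define h0 where "h0 = h - aH * z"
  have h0: "h0 \<in> BB" unfolding h0_def by (intro BB_diff h ZT_aH z)
  have comm: "h0 * b - b * h0 = h * b - b * h" if b: "b \<in> BB" for b
  proof -
    have "aH * z * b = b * (aH * z)"
    proof -
      have "aH * z * b = z * aH * b" by (simp only: zc[OF aH_HT])
      also have "\<dots> = z * (aH * b)" by (simp only: mult.assoc)
      also have "\<dots> = b * z" using BB_aH[OF b] zc[OF BB_HT[OF b]] by simp
      also have "\<dots> = b * aH * z" using BB_aH[OF b] by simp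
      finally show ?thesis by (simp add: mult.assoc)
    qed
    thus ?thesis by (simp add: h0_def algebra_simps)
  qed
  \<comment> \<open>This is what \<open>z\<close> was chosen for: \<open>a\<close> is absorbed by
    \<open>e\<close>, so the compression of \<open>a z\<close> agrees with that of
    \<open>h\<close>.\<close>
  have e0: "eH * h0 * eH = 0"
  proof -
    have "eH * (aH * z) * eH = eH * (z * eH)" by (simp add: mult.assoc aH_eH_left)
    also have "\<dots> = z * eH" using zc[OF eH_HT] by (simp add: aH_eH_left)
    finally show ?thesis using z(2) by (simp add: h0_def left_diff_distrib right_diff_distrib)
  qed
  obtain d1 where d1: "d1 \<in> BB" "h0 * eH - eH * h0 = Qop \<zeta> * d1" using c[OF eH_BB] comm[OF eH_BB] by auto
  \<comment> \<open>Multiplying the commutator with \<open>e\<close> by \<open>e\<close> on the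
    right kills its second term because of \<open>e0\<close>.\<close>
  have h0e: "h0 * eH = Qop \<zeta> * (d1 * eH)"
  proof -
    have "Qop \<zeta> * (d1 * eH) = (h0 * eH - eH * h0) * eH" by (simp add: d1 flip: mult.assoc)
    also have "\<dots> = h0 * eH" using e0 by (simp add: left_diff_distrib mult.assoc aH_eH)
    finally show ?thesis by simp
  qed
  have "\<exists>k\<in>HT. h0 = Qop \<zeta> * k"
  proof (rule HT_divide[OF BB_HT[OF h0]])
    fix y assume y: "y \<in> ZW"
    have "aH * Wop y = aH" using aa_Wop[OF y] by (simp add: aH_def mult.assoc)
    hence "h0 * aH * Wop y = h0 * aH" by (simp add: mult.assoc)
    thus "h0 * Wop y = h0" using BB_aH[OF h0] by simp
  next
    fix h' assume h': "h' \<in> HT"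
    define b where "b = aH * h' * aH"
    have b: "b \<in> BB" using h' by (auto simp: b_def BB_def)
    obtain d2 where d2: "d2 \<in> BB" "h0 * b - b * h0 = Qop \<zeta> * d2" using c[OF b] comm[OF b] by auto
    have "ap (h0 * h') one1 = ap (h0 * h' * aH) one1"
      using ap_aH_one(1)[of "h0 * h'"] HH_mult HT_HH BB_HT[OF h0] h' by simp
    also have "h0 * h' * aH = h0 * b" using BB_aH[OF h0] by (simp add: b_def flip: mult.assoc)
    also have "h0 * b = b * h0 + Qop \<zeta> * d2" using d2(2) by (simp add: algebra_simps)
    \<comment> \<open>The constant 1 is fixed by \<open>e\<close>, so \<open>e\<close> may be
      inserted to the right of \<open>h0\<close>, where \<open>h0e\<close> applies.\<close>
    also have "ap (b * h0 + Qop \<zeta> * d2) one1 = ap (b * h0 * eH + Qop \<zeta> * d2) one1"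
      using ap_aH_one(2)[of "b * h0"] HH_mult HT_HH BB_HT[OF h0] BB_HT[OF b] by (simp only: ap_simps(3))
    also have "b * h0 * eH = Qop \<zeta> * (b * (d1 * eH))"
      using Qop_central[OF HT_HH[OF BB_HT[OF b]], of \<zeta>] by (simp add: h0e mult.assoc) (simp flip: mult.assoc)
    also have "Qop \<zeta> * (b * (d1 * eH)) + Qop \<zeta> * d2 = Qop \<zeta> * (b * (d1 * eH) + d2)" by (simp add: distrib_left)
    finally have "ap (h0 * h') one1 = ap (Qop \<zeta> * (b * (d1 * eH) + d2)) one1" .
    moreover have "b * (d1 * eH) + d2 \<in> HT" using b d1 d2 eH_BB by (intro BB_HT BB_add BB_mult)
    ultimately show "\<exists>h''\<in>HT. ap (h0 * h') one1 = ap (Qop \<zeta> * h'') one1" by blast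
  qed
  then obtain k where k: "k \<in> HT" "h0 = Qop \<zeta> * k" by blast
  \<comment> \<open>The quotient from \<open>HT_divide\<close> need not lie in the corner.
    Compressing by \<open>a\<close> on both sides puts it there, since \<open>Qop \<zeta>\<close> is
    central.\<close>
  have "h0 = aH * h0 * aH" using BB_aH[OF h0] by simp
  also have "\<dots> = (aH * Qop \<zeta>) * k * aH" by (simp add: k mult.assoc)
  also have "\<dots> = Qop \<zeta> * (aH * k * aH)" using Qop_central[OF HT_HH[OF aH_HT], of \<zeta>] by (simp add: mult.assoc)
  finally have "h0 = Qop \<zeta> * (aH * k * aH)" .
  moreover have "aH * k * aH \<in> BB" using k by (auto simp: BB_def)
  ultimately show ?thesis using z(1) unfolding h0_def by blast
qed

lemma ZT_diff: "a \<in> ZT \<Longrightarrow> b \<in> ZT \<Longrightarrow> a - b \<in> ZT"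
  by (simp add: ZT_def HT_diff left_diff_distrib right_diff_distrib)

lemma ZT_mult: "a \<in> ZT \<Longrightarrow> b \<in> ZT \<Longrightarrow> a * b \<in> ZT"
proof -
  assume a: "a \<in> ZT" and b: "b \<in> ZT"
  have "a * b * h = h * (a * b)" if "h \<in> HH" for h
    using a b that by (intro commute_mult) (simp_all add: ZT_def)
  thus ?thesis using a b by (simp add: ZT_def HT_mult)
qed

lemma Qop_ZT: "Qop \<zeta> \<in> ZT"
  by (simp add: ZT_def Qop_HT Qop_central)

text \<open>Commutation with linear functions leaves only the coefficient at the identity, so
  \<open>z\<close> is multiplication by the function \<open>z 1\<close>. That function is also
  \<open>z e 1\<close>, which is zero.\<close>

lemma ZT_eH_zero:
  assumes z: "z \<in> ZT" "z * eH = 0" shows "z = 0"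
proof -
  have zT: "z \<in> HT" and zH: "z \<in> HH" using z HT_HH by (auto simp: ZT_def)
  obtain g where g: "coeffs z g" using HH_coeffs zH by blast
  have off: "g w x = 0" if x: "fst x \<in> reg" and w: "w \<in> W" "w \<noteq> mat 1" for w x
  proof -
    let ?d = "\<lambda>u. of_bool (u = act w x)"
    have "matrix_inv w *v fst x \<noteq> fst x"
    proof
      assume "matrix_inv w *v fst x = fst x"
      hence "w *v fst x = fst x" using W_vec1[OF w(1), of "fst x"] by simp
      thus False using x w by (auto simp: reg_def)
    qed
    then obtain y where y: "pairing y (matrix_inv w *v fst x) \<noteq> pairing y (fst x)" using pairing_ext2 by blast
    have "iota * xop y \<in> HH" using HH_rt[of "of_h_dual y"] by simp
    hence "z * (iota * xop y) = iota * xop y * z" using z by (simp add: ZT_def)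
    hence c: "z * xop y = iota * xop y * z" using zH by (simp flip: mult.assoc)
    have xd: "ap (xop y) ?d = (\<lambda>u. pairing y (matrix_inv w *v fst x) * ?d u)"
      by (auto simp: xop_def fun_eq_iff act_def split_beta)
    have "pairing y (matrix_inv w *v fst x) * ap z ?d x = ap z (ap (xop y) ?d) x" unfolding xd ap_scale ..
    also have "\<dots> = ap (iota * xop y * z) ?d x" by (simp flip: c)
    also have "\<dots> = pairing y (fst x) * ap z ?d x" using x by (simp add: ap_iota xop_def split_beta)
    finally have "ap z ?d x = 0" using y by simp
    thus ?thesis using coeffs_unique[OF g x w(1)] by simp
  qed
  have "ap z one1 = (\<lambda>x. 0)" using ap_aH_one(2)[OF zH] z(2) by simp
  hence sum: "(\<Sum>w\<in>W. g w x) = 0" if "fst x \<in> reg" for x using coeffsD[OF g that, of one1] by simp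
  have "g (mat 1) x = 0" if x: "fst x \<in> reg" for x
  proof -
    have "(\<Sum>w\<in>W. g w x) = (\<Sum>w\<in>W. of_bool (w = mat 1) * g w x)" by (rule sum.cong) (use off[OF x] in auto)
    thus ?thesis using sum[OF x] fin by simp
  qed
  hence all: "g w x = 0" if "fst x \<in> reg" "w \<in> W" for w x using off that by metis
  show ?thesis
  proof (rule lop_eqI)
    fix f x show "ap z f x = ap 0 f x"
      using coeffsD[OF g, of x f] all[of x] HH_off_reg[OF zH, of x f] by (cases "fst x \<in> reg") simp_all
  qed
qed

text \<open>Compression by \<open>e\<close> turns \<open>a z\<close> into \<open>z e\<close>, and
  \<open>d\<close> into \<open>y e\<close> with \<open>y\<close> central. Then \<open>z\<close> and
  \<open>Qop \<zeta> * y\<close> agree on \<open>e\<close>, and \<open>ZT_eH_zero\<close> removes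
  the \<open>e\<close>.\<close>

theorem central_inj:
  assumes z: "z \<in> ZT" and d: "d \<in> BB" and eq: "aH * z = Qop \<zeta> * d"
  shows "\<exists>z'\<in>ZT. z = Qop \<zeta> * z'"
proof -
  have dT: "d \<in> HT" using d by (rule BB_HT)
  define y where "y = iota * mulop (ap (ee * d) one1)"
  have y: "y \<in> ZT" "eH * d * eH = y * eH" using spherical_ZT[OF dT] by (simp_all add: y_def)
  have "eH * (aH * z) * eH = eH * (z * eH)" by (simp add: mult.assoc aH_eH_left)
  also have "z * eH = eH * z" using z eH_HT by (simp add: ZT_def HT_HH)
  also have "eH * (eH * z) = z * eH" using z eH_HT by (simp add: ZT_def HT_HH aH_eH_left)
  finally have 1: "eH * (aH * z) * eH = z * eH" .
  have "eH * (Qop \<zeta> * d) * eH = (eH * Qop \<zeta>) * d * eH" by (simp add: mult.assoc)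
  also have "\<dots> = Qop \<zeta> * (eH * d * eH)" using Qop_central[OF HT_HH[OF eH_HT], of \<zeta>] by (simp add: mult.assoc)
  finally have "z * eH = Qop \<zeta> * y * eH" using 1 eq y(2) by (simp add: mult.assoc)
  hence "(z - Qop \<zeta> * y) * eH = 0" by (simp add: left_diff_distrib)
  with ZT_eH_zero[of "z - Qop \<zeta> * y"] have "z - Qop \<zeta> * y = 0" using z y Qop_ZT by (simp add: ZT_diff ZT_mult)
  thus ?thesis using y by auto
qed

end

section \<open>The subalgebra generated by the \<open>x\<^sub>i y\<^sub>j\<close> and \<open>W\<close>\<close>

context cherednik_irreducible
begin

text \<open>The operator version of the subalgebra generated by the \<open>x y\<close> products and
  \<open>W\<close>, given inductively so that elements can be lifted to any subalgebra containing
  the generators.\<close>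

inductive_set GLA :: "'a lop set" where
  xy: "iota * (xop (axis i 1) * dun (axis j 1)) \<in> GLA"
| grp: "w \<in> W \<Longrightarrow> iota * Wop w \<in> GLA"
| add: "\<lbrakk>a \<in> GLA; b \<in> GLA\<rbrakk> \<Longrightarrow> a + b \<in> GLA"
| mult: "\<lbrakk>a \<in> GLA; b \<in> GLA\<rbrakk> \<Longrightarrow> a * b \<in> GLA"
| scal: "a \<in> GLA \<Longrightarrow> scal k * a \<in> GLA"

lemma GLA_HH: "g \<in> GLA \<Longrightarrow> g \<in> HH"
proof (induction rule: GLA.induct)
  case (xy i j)
  show ?case using HH_rt[of "gen (X i) * gen (Y j)"] by simp
qed (auto intro: HH_Wop HH_add HH_mult HH_scal)

lemma GLA_iota: "iota \<in> GLA"
  using GLA.grp[OF W_one] by simp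

lemma GLA_zero: "0 \<in> GLA"
  using GLA.scal[OF GLA_iota, of 0] by (simp add: scalar_hom_0[OF scal_hom])

lemma GLA_sum: "(\<And>i. i \<in> A \<Longrightarrow> T i \<in> GLA) \<Longrightarrow> (\<Sum>i\<in>A. T i) \<in> GLA"
  by (induction A rule: infinite_finite_induct) (auto intro: GLA.add simp: GLA_zero)

text \<open>
  A balanced word \<open>x g y\<close> has its outer letters far apart.  The elements \<open>s\<close> which may be placed between
  \<open>x\<^sub>i\<close> and \<open>y\<^sub>j\<close> form a left ideal, because \<open>x\<^sub>i x\<^sub>k y\<^sub>l s y\<^sub>j\<close> is \<open>x\<^sub>k y\<^sub>l x\<^sub>i s y\<^sub>j\<close> up to terms \<open>x\<^sub>k w s y\<^sub>j\<close>.
\<close>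

definition sandwich :: "'a lop set" where
  "sandwich = {s \<in> GLA. \<forall>i j. iota * (xop (axis i 1) * (s * dun (axis j 1))) \<in> GLA}"

lemma xop_iota: "xop x * iota = iota * xop x"
  by (simp add: xop_def iota_mulop)

lemma sandwich_xop:
  assumes "s \<in> sandwich" shows "iota * (xop x * (s * dun (axis j 1))) \<in> GLA"
proof -
  have "xop x = (\<Sum>i\<in>UNIV. scal (x $ i) * xop (axis i 1))"
    using rt_of_h_dual[of x] unfolding of_h_dual_def by simp
  hence "iota * (xop x * (s * dun (axis j 1))) = (\<Sum>i\<in>UNIV. scal (x $ i) * (iota * (xop (axis i 1) * (s * dun (axis j 1)))))"
    by (simp add: sum_distrib_left sum_distrib_right scal_commute[of iota] flip: mult.assoc)
  thus ?thesis using assms by (auto simp: sandwich_def intro!: GLA_sum GLA.scal)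
qed

lemma sandwich_Wop:
  assumes s: "s \<in> sandwich" and w: "w \<in> W"
  shows "iota * (xop x * (Wop w * (s * dun (axis j 1)))) \<in> GLA"
proof -
  have "xop x * Wop w = Wop w * xop (dual_act (matrix_inv w) x)"
    using Wop_xop[OF w, of "dual_act (matrix_inv w) x"] w by (simp add: dual_act_mult W_minv)
  hence "iota * (xop x * (Wop w * (s * dun (axis j 1)))) = iota * (Wop w * (xop (dual_act (matrix_inv w) x) * (s * dun (axis j 1))))"
    by (simp flip: mult.assoc)
  also have "\<dots> = (iota * Wop w) * (iota * (xop (dual_act (matrix_inv w) x) * (s * dun (axis j 1))))"
    using iota_Wop[OF w] by (simp only: mult.assoc[symmetric]) (simp only: mult.assoc iota_left)
  finally show ?thesis using sandwich_xop[OF s] GLA.grp[OF w] GLA.mult by metis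
qed

lemma GLA_sandwich:
  assumes "g \<in> GLA" "s \<in> sandwich" shows "g * s \<in> sandwich"
  using assms
proof (induction arbitrary: s rule: GLA.induct)
  case (xy k l)
  have sG: "s \<in> GLA" and sH: "iota * s = s" using xy GLA_HH HH_iota by (auto simp: sandwich_def)
  have "iota * (xop (axis i 1) * (iota * (xop (axis k 1) * dun (axis l 1)) * s * dun (axis j 1))) \<in> GLA" for i j
  proof -
    let ?xi = "xop (axis i 1)" and ?xk = "xop (axis k 1)" and ?dl = "dun (axis l 1)" and ?dj = "dun (axis j 1)"
    let ?K = "\<Sum>t\<in>SS. scal (kap t (axis i 1) (axis l 1)) * Wop t"
    \<comment> \<open>Reordering brings \<open>x_i\<close> next to \<open>s y_j\<close>, where the
      hypothesis on \<open>s\<close> applies; each reflection left over is carried past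
      \<open>x_k\<close> by \<open>sandwich_Wop\<close>.\<close>
    have rel: "iota * (?xi * ?dl) = iota * (?dl * ?xi + ?K)"
      using dun_xop[of "axis l 1" "axis i 1"] by (simp add: algebra_simps)
    have "iota * (?xi * (iota * (?xk * ?dl) * s * ?dj)) = iota * (?xi * iota) * (?xk * ?dl * s * ?dj)" by (simp only: mult.assoc)
    also have "\<dots> = iota * (?xi * ?xk) * (?dl * s * ?dj)" unfolding xop_iota by (simp only: mult.assoc iota_left)
    also have "?xi * ?xk = ?xk * ?xi" by (simp add: xop_def mulop_commute)
    also have "iota * (?xk * ?xi) * (?dl * s * ?dj) = ?xk * (iota * (?xi * ?dl) * (s * ?dj))"
      using xop_iota[of "axis k 1"] by (simp only: mult.assoc[symmetric])
    also have "\<dots> = ?xk * (iota * (?dl * ?xi) * (s * ?dj)) + ?xk * (iota * ?K * (s * ?dj))"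
      unfolding rel by (simp only: distrib_left distrib_right)
    also have "?xk * (iota * (?dl * ?xi) * (s * ?dj)) = (iota * (?xk * ?dl)) * (iota * (?xi * (s * ?dj)))"
    proof -
      have "(iota * (?xk * ?dl)) * (iota * (?xi * (s * ?dj))) = iota * (?xk * (?dl * iota)) * (?xi * (s * ?dj))" by (simp only: mult.assoc)
      also have "\<dots> = iota * (?xk * iota) * (?dl * (?xi * (s * ?dj)))" unfolding iota_dun by (simp only: mult.assoc)
      also have "\<dots> = iota * ?xk * (?dl * (?xi * (s * ?dj)))" unfolding xop_iota by (simp only: mult.assoc iota_left)
      also have "\<dots> = ?xk * iota * (?dl * (?xi * (s * ?dj)))" unfolding xop_iota ..
      finally show ?thesis by (simp only: mult.assoc)
    qed
    also have "?xk * (iota * ?K * (s * ?dj)) = (\<Sum>t\<in>SS. scal (kap t (axis i 1) (axis l 1)) * (iota * (?xk * (Wop t * (s * ?dj)))))"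
    proof -
      have "?xk * (iota * ?K * (s * ?dj)) = iota * ?xk * (?K * (s * ?dj))"
        using xop_iota[of "axis k 1"] by (simp only: mult.assoc[symmetric])
      also have "\<dots> = (\<Sum>t\<in>SS. iota * ?xk * scal (kap t (axis i 1) (axis l 1)) * (Wop t * (s * ?dj)))"
        by (simp only: sum_distrib_left sum_distrib_right mult.assoc)
      also have "\<dots> = (\<Sum>t\<in>SS. scal (kap t (axis i 1) (axis l 1)) * (iota * (?xk * (Wop t * (s * ?dj)))))"
        unfolding scal_commute[of "iota * ?xk"] by (simp only: mult.assoc)
      finally show ?thesis .
    qed
    finally have eq: "iota * (?xi * (iota * (?xk * ?dl) * s * ?dj)) = iota * (?xk * ?dl) * (iota * (?xi * (s * ?dj))) +
      (\<Sum>t\<in>SS. scal (kap t (axis i 1) (axis l 1)) * (iota * (?xk * (Wop t * (s * ?dj)))))" .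
    show ?thesis unfolding eq
    proof (rule GLA.add)
      show "iota * (?xk * ?dl) * (iota * (?xi * (s * ?dj))) \<in> GLA"
        by (rule GLA.mult[OF GLA.xy]) (use xy in \<open>simp add: sandwich_def\<close>)
      show "(\<Sum>t\<in>SS. scal (kap t (axis i 1) (axis l 1)) * (iota * (?xk * (Wop t * (s * ?dj))))) \<in> GLA"
        by (intro GLA_sum GLA.scal sandwich_Wop[OF xy] SS_W)
    qed
  qed
  thus ?case using sG by (auto simp: sandwich_def intro: GLA.mult GLA.xy)
next
  case (grp w)
  have "iota * (xop (axis i 1) * (iota * Wop w * s * dun (axis j 1))) \<in> GLA" for i j
  proof -
    have "iota * (xop (axis i 1) * (iota * Wop w * s * dun (axis j 1))) = iota * (xop (axis i 1) * iota) * (Wop w * (s * dun (axis j 1)))"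
      by (simp only: mult.assoc)
    also have "\<dots> = iota * (xop (axis i 1) * (Wop w * (s * dun (axis j 1))))" unfolding xop_iota by (simp only: mult.assoc iota_left)
    finally show ?thesis using sandwich_Wop grp by simp
  qed
  thus ?case using grp by (auto simp: sandwich_def intro: GLA.mult GLA.grp)
next
  case (add a b)
  hence "a * s \<in> sandwich" "b * s \<in> sandwich" by auto
  thus ?case by (auto simp: sandwich_def distrib_left distrib_right intro: GLA.add)
next
  case (mult a b)
  thus ?case by (simp add: mult.assoc)
next
  case (scal a k)
  hence s: "a * s \<in> sandwich" by auto
  have "iota * (xop x * (scal k * a * s * dun y)) = scal k * (iota * (xop x * (a * s * dun y)))" for x y
    using scal_commute[of "iota * xop x" k] by (simp only: mult.assoc[symmetric])
  thus ?case using s by (auto simp: sandwich_def mult.assoc intro: GLA.scal)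
qed

lemma iota_sandwich: "iota \<in> sandwich"
proof -
  have "iota * (xop x * (iota * dun y)) = iota * (xop x * dun y)" for x y
  proof -
    have "iota * (xop x * (iota * dun y)) = iota * (xop x * iota) * dun y" by (simp only: mult.assoc)
    thus ?thesis unfolding xop_iota by (simp only: mult.assoc iota_left)
  qed
  thus ?thesis by (simp add: sandwich_def GLA_iota GLA.xy)
qed

text \<open>Removing the first \<open>x\<close> and the last \<open>y\<close> leaves a shorter
  balanced word, which is in the subalgebra by induction. As \<open>sandwich\<close> contains the
  unit and is stable under left multiplication, the outer letters may be put back.\<close>

lemma GLA_balanced_word:
  "\<lbrakk>length xs = length ys; \<forall>x\<in>set xs. isX x; \<forall>y\<in>set ys. \<not> isX y\<rbrakk> \<Longrightarrow> iota * rt (lw xs * lw ys) \<in> GLA"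
proof (induction xs arbitrary: ys)
  case Nil
  thus ?case by (simp add: GLA_iota)
next
  case (Cons x xs)
  then obtain ys' y where ys: "ys = ys' @ [y]" by (cases ys rule: rev_cases) auto
  obtain i where i: "x = X i" using Cons.prems by (cases x) auto
  obtain j where j: "y = Y j" using Cons.prems ys by (cases y) auto
  have g: "iota * rt (lw xs * lw ys') \<in> GLA" using Cons ys by simp
  have "iota * rt (lw xs * lw ys') * iota \<in> sandwich" by (rule GLA_sandwich[OF g iota_sandwich])
  hence "iota * rt (lw xs * lw ys') \<in> sandwich" by (simp only: mult.assoc iota_rt iota_left)
  hence s: "iota * (xop (axis i 1) * (iota * rt (lw xs * lw ys') * dun (axis j 1))) \<in> GLA" by (simp add: sandwich_def)
  have "iota * (xop (axis i 1) * (iota * rt (lw xs * lw ys') * dun (axis j 1))) = iota * (xop (axis i 1) * iota) * (rt (lw xs * lw ys') * dun (axis j 1))"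
    by (simp only: mult.assoc)
  also have "\<dots> = iota * (xop (axis i 1) * (rt (lw xs * lw ys') * dun (axis j 1)))" unfolding xop_iota by (simp only: mult.assoc iota_left)
  also have "\<dots> = iota * rt (lw (x # xs) * lw ys)" by (simp add: ys i j mult.assoc)
  finally show ?case using s by simp
qed

lemma HT_GLA: "h \<in> HT \<Longrightarrow> h \<in> GLA"
proof -
  assume "h \<in> HT"
  then obtain \<phi> where \<phi>: "h = iota * NF \<phi>" "\<forall>w\<in>W. bal (\<phi> w)" using HT_NF by blast
  have nf: "iota * rt (nfT f) \<in> GLA" if f: "bal f" for f
  proof -
    have "iota * rt (nfT f) = (\<Sum>m\<in>Poly_Mapping.keys f. scal (Poly_Mapping.lookup f m) * (iota * rt (lw (xlist m) * lw (ylist m))))"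
      unfolding nfT_def mlift_def by (simp add: sum_distrib_left scal_commute[of iota] flip: mult.assoc)
    moreover have "iota * rt (lw (xlist m) * lw (ylist m)) \<in> GLA" if m: "m \<in> Poly_Mapping.keys f" for m
    proof (rule GLA_balanced_word)
      have "length (xlist m) = xdeg m" "length (ylist m) = ydeg m"
        by (simp_all add: xdeg_def ydeg_def flip: size_mset)
      thus "length (xlist m) = length (ylist m)" using f m by (simp add: bal_def)
      show "\<forall>x\<in>set (xlist m). isX x" "\<forall>y\<in>set (ylist m). \<not> isX y"
        by (simp_all add: set_mset_mset[symmetric] del: set_mset_mset)
    qed
    ultimately show ?thesis by (auto intro!: GLA_sum GLA.scal)
  qed
  have "h = (\<Sum>w\<in>W. (iota * rt (nfT (\<phi> w))) * (iota * Wop w))"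
  proof -
    have "(iota * a) * (iota * b) = iota * (a * b)" if "a * iota = iota * a" for a b :: "'a lop"
    proof -
      have "(iota * a) * (iota * b) = iota * (a * iota) * b" by (simp only: mult.assoc)
      thus ?thesis unfolding that by (simp only: mult.assoc iota_left)
    qed
    thus ?thesis unfolding \<phi>(1) NF_def sum_distrib_left by (intro sum.cong) (simp_all add: iota_rt)
  qed
  moreover have "(\<Sum>w\<in>W. (iota * rt (nfT (\<phi> w))) * (iota * Wop w)) \<in> GLA"
    by (rule GLA_sum, rule GLA.mult[OF nf GLA.grp]) (use \<phi>(2) in auto)
  ultimately show ?thesis by simp
qed

section \<open>Comparison with the algebra of operators\<close>

abbreviation "R \<equiv> cherednik W \<alpha> \<alpha>' 0 c"
abbreviation "cls \<equiv> cherednik_class W \<alpha> \<alpha>' 0 c"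

lemma R_eq: "R = alg_quot (smash W) CI"
  by (simp add: cherednik_def CI_def)

lemma cls_eq: "cls f = CI +>\<^bsub>smash W\<^esub> f"
  by (simp add: cherednik_class_def CI_def)

sublocale R: calg R
  unfolding R_eq by (rule S.quot_calg[OF CI_ideal])

lemma R_carrier: "carrier R = cls ` carrier (smash W)"
  by (auto simp: R_eq cls_eq[abs_def] S.quot_carrier[OF CI_ideal])

lemma cls_mem: "f \<in> carrier (smash W) \<Longrightarrow> g \<in> cls f \<longleftrightarrow> g \<in> carrier (smash W) \<and> rho g = rho f"
  using rho_kernel[of "g \<ominus>\<^bsub>smash W\<^esub> f"]
  by (auto simp: cls_eq S.coset_mem[OF CI_ideal] rho_minus)

text \<open>Any representative serves, since congruent elements have the same operator; by
  \<open>rb_inj\<close> no information is lost.\<close>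

definition rb :: "'a smash_elt set \<Rightarrow> 'a lop" where "rb x = rho (SOME f. f \<in> x)"

lemma rb_cls: "f \<in> carrier (smash W) \<Longrightarrow> rb (cls f) = rho f"
proof -
  assume f: "f \<in> carrier (smash W)"
  hence "f \<in> cls f" by (simp add: cls_mem)
  hence "(SOME g. g \<in> cls f) \<in> cls f" by (rule someI[of "\<lambda>g. g \<in> cls f"])
  thus ?thesis using f by (simp add: rb_def cls_mem)
qed

lemma R_cases:
  assumes "x \<in> carrier R" obtains f where "f \<in> carrier (smash W)" "x = cls f"
  using assms by (auto simp: R_carrier)

lemma rb_inj: "x \<in> carrier R \<Longrightarrow> y \<in> carrier R \<Longrightarrow> rb x = rb y \<Longrightarrow> x = y"
  by (elim R_cases) (auto simp: rb_cls set_eq_iff cls_mem)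

lemma rb_HH: "rb x \<in> HH" if "x \<in> carrier R"
  using that by (elim R_cases) (auto simp: rb_cls HH_def)

lemma rb_surj:
  assumes "h \<in> HH" obtains x where "x \<in> carrier R" "rb x = h"
proof -
  obtain f where "f \<in> carrier (smash W)" "h = rho f" using assms by (auto simp: HH_def)
  thus thesis using that[of "cls f"] by (simp add: R_carrier rb_cls)
qed

lemma rb_hom:
  "x \<in> carrier R \<Longrightarrow> y \<in> carrier R \<Longrightarrow> rb (x \<otimes>\<^bsub>R\<^esub> y) = rb x * rb y"
  "x \<in> carrier R \<Longrightarrow> y \<in> carrier R \<Longrightarrow> rb (x \<oplus>\<^bsub>R\<^esub> y) = rb x + rb y"
  "x \<in> carrier R \<Longrightarrow> rb (k \<odot>\<^bsub>R\<^esub> x) = scal k * rb x"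
  "rb \<one>\<^bsub>R\<^esub> = iota" "rb \<zero>\<^bsub>R\<^esub> = 0"
  "x \<in> carrier R \<Longrightarrow> y \<in> carrier R \<Longrightarrow> rb (x \<ominus>\<^bsub>R\<^esub> y) = rb x - rb y"
proof -
  have m: "f \<in> carrier (smash W) \<Longrightarrow> g \<in> carrier (smash W) \<Longrightarrow> rb (cls f \<otimes>\<^bsub>R\<^esub> cls g) = rho f * rho g"
    and a: "f \<in> carrier (smash W) \<Longrightarrow> g \<in> carrier (smash W) \<Longrightarrow> rb (cls f \<oplus>\<^bsub>R\<^esub> cls g) = rho f + rho g"
    and s: "f \<in> carrier (smash W) \<Longrightarrow> rb (k \<odot>\<^bsub>R\<^esub> cls f) = scal k * rho f"
    and d: "f \<in> carrier (smash W) \<Longrightarrow> g \<in> carrier (smash W) \<Longrightarrow> rb (cls f \<ominus>\<^bsub>R\<^esub> cls g) = rho f - rho g" for f g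
    unfolding R_eq
    by (simp_all add: cls_eq S.quot_mult[OF CI_ideal] S.quot_add[OF CI_ideal] S.quot_smult[OF CI_ideal] S.quot_minus[OF CI_ideal]
        S.minus_closed)
      (simp_all add: rb_cls S.minus_closed rho_mult rho_add rho_smult rho_minus flip: cls_eq)
  show "x \<in> carrier R \<Longrightarrow> y \<in> carrier R \<Longrightarrow> rb (x \<otimes>\<^bsub>R\<^esub> y) = rb x * rb y"
    by (elim R_cases) (simp add: m rb_cls)
  have ad: "rb (x \<oplus>\<^bsub>R\<^esub> y) = rb x + rb y" if "x \<in> carrier R" "y \<in> carrier R" for x y
    using that by (elim R_cases) (simp add: a rb_cls)
  thus "x \<in> carrier R \<Longrightarrow> y \<in> carrier R \<Longrightarrow> rb (x \<oplus>\<^bsub>R\<^esub> y) = rb x + rb y" .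
  show "x \<in> carrier R \<Longrightarrow> rb (k \<odot>\<^bsub>R\<^esub> x) = scal k * rb x"
    by (elim R_cases) (simp add: s rb_cls)
  show "x \<in> carrier R \<Longrightarrow> y \<in> carrier R \<Longrightarrow> rb (x \<ominus>\<^bsub>R\<^esub> y) = rb x - rb y"
    by (elim R_cases) (simp add: d rb_cls)
  have "\<one>\<^bsub>R\<^esub> = cls \<one>\<^bsub>smash W\<^esub>" by (simp add: R_eq cls_eq S.quot_one[OF CI_ideal])
  thus "rb \<one>\<^bsub>R\<^esub> = iota" by (simp add: rb_cls rho_one)
  have "rb (\<zero>\<^bsub>R\<^esub> \<oplus>\<^bsub>R\<^esub> \<zero>\<^bsub>R\<^esub>) = rb \<zero>\<^bsub>R\<^esub> + rb \<zero>\<^bsub>R\<^esub>"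
    by (rule ad) simp_all
  thus "rb \<zero>\<^bsub>R\<^esub> = 0" by simp
qed

lemma torus_mult: "torus_act k (torus_act l a) = torus_act (k * l) (a :: 'a tensor)"
proof (induction a rule: tensor_induct)
  case (gen g)
  have "const q * (const p * a) = const (p * q) * a" for p q and a :: "'a tensor"
    by (simp only: const_simps(4) const_commute[of "const q" p] flip: mult.assoc)
  thus ?case by (cases g) (simp_all add: torus_hom inverse_mult_distrib del: const_simps(4))
qed (simp_all add: torus_hom)

lemma torus_one: "torus_act 1 a = (a :: 'a tensor)"
proof (induction a rule: tensor_induct)
  case (gen g)
  show ?case by (cases g) (simp_all add: torus_hom)
qed (simp_all add: torus_hom)

text \<open>Stability of the coset as a set is compared with commutation: moving
  \<open>tau k\<close> past \<open>rho\<close> applies the torus to a representative, and operators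
  separate cosets.\<close>

lemma torus_invariants_iff: "x \<in> carrier R \<Longrightarrow> x \<in> torus_invariants W \<alpha> \<alpha>' 0 c \<longleftrightarrow> rb x \<in> HT"
proof -
  assume x: "x \<in> carrier R"
  then obtain f where f: "f \<in> carrier (smash W)" "x = cls f" by (rule R_cases)
  let ?t = "\<lambda>k f w. torus_act k (f w)"
  have tc: "?t k g \<in> carrier (smash W)" if "g \<in> carrier (smash W)" for k g
    using that by (simp add: smash_carrier torus_hom)
  have "(?t k ` x = x) \<longleftrightarrow> tau k * rho f = rho f * tau k" if k: "k \<noteq> 0" for k
  proof
    assume "?t k ` x = x"
    hence "?t k f \<in> x" using f by (auto simp: cls_mem)
    hence "rho (?t k f) = rho f" using f by (simp add: cls_mem)
    thus "tau k * rho f = rho f * tau k" using tau_rho[OF k, of f] by simp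
  next
    assume c: "tau k * rho f = rho f * tau k"
    have sub: "?t l g \<in> x" if l: "l \<noteq> 0" "tau l * rho f = rho f * tau l" and g: "g \<in> x" for l g
    proof -
      have g': "g \<in> carrier (smash W)" "rho g = rho f" using g f by (auto simp: cls_mem)
      have "rho (?t l g) * tau l = rho f * tau l" using tau_rho[OF l(1), of g] g' l(2) by simp
      hence "rho (?t l g) = rho f" using l(1) by (simp add: tau_cancel)
      thus ?thesis using f g' tc by (simp add: cls_mem)
    qed
    \<comment> \<open>Commutation is transferred to the inverse torus element, which supplies
      preimages and hence the inclusion of the coset in its image.\<close>
    have "rho f * tau (inverse k) = tau (inverse k) * (tau k * rho f) * tau (inverse k)"
      using k by (simp add: tau_mult flip: mult.assoc)
    also have "\<dots> = tau (inverse k) * rho f" unfolding c using k by (simp add: tau_mult mult.assoc)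
    finally have c': "tau (inverse k) * rho f = rho f * tau (inverse k)" by simp
    show "?t k ` x = x"
    proof
      show "?t k ` x \<subseteq> x" using sub[OF k c] by blast
      show "x \<subseteq> ?t k ` x"
      proof
        fix g assume g: "g \<in> x"
        have "g = ?t k (?t (inverse k) g)" using k by (simp add: torus_mult torus_one)
        moreover have "?t (inverse k) g \<in> x" using sub[OF _ c' g] k by simp
        ultimately show "g \<in> ?t k ` x" by (rule image_eqI)
      qed
    qed
  qed
  thus ?thesis using x f by (simp add: torus_invariants_def HT_def rb_cls) (simp add: HH_def)
qed

definition G :: "'a smash_elt set set" where
  "G = carrier (cherednik_gl W \<alpha> \<alpha>' 0 c)"

text \<open>The generators are invariant, which gives one inclusion. Conversely an invariant
  operator is in \<open>GLA\<close>, so every subalgebra containing the generators has an element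
  with that operator, and faithfulness identifies it.\<close>

lemma G_iff: "x \<in> G \<longleftrightarrow> x \<in> carrier R \<and> rb x \<in> HT"
proof -
  let ?gens = "cls ` ({of_tensor (gen (X i) * gen (Y j)) | i j. True} \<union> {group_sum {w} (\<lambda>_. 1) | w. w \<in> W})"
  have Gdef: "G = gen_subalgebra R ?gens" by (simp add: G_def cherednik_gl_def)
  have r1: "rb (cls (of_tensor (gen (X i) * gen (Y j)))) = iota * (xop (axis i 1) * dun (axis j 1))" for i j
    by (simp add: rb_cls rho_def)
  have r2: "rb (cls (group_sum {w} (\<lambda>_. 1))) = iota * Wop w" if "w \<in> W" for w
    using that by (simp add: rb_cls rho_def rho'_group_sum)
  let ?A = "{x \<in> carrier R. rb x \<in> HT}"
  have xyT: "iota * (xop (axis i 1) * dun (axis j 1)) \<in> HT" for i j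
  proof -
    have "tau k * (iota * rt (gen (X i) * gen (Y j))) = iota * rt (gen (X i) * gen (Y j)) * tau k" if k: "k \<noteq> 0" for k
    proof -
      have "torus_act k (gen (X i) * gen (Y j)) = const k * (gen (X i) * const (inverse k)) * gen (Y j)"
        by (simp add: torus_hom mult.assoc)
      also have "\<dots> = const (k * inverse k) * (gen (X i) * gen (Y j))"
        unfolding const_commute[of "gen (X i)"] by (simp only: const_simps mult.assoc)
      finally have "torus_act k (gen (X i) * gen (Y j)) = gen (X i) * gen (Y j)" using k by simp
      hence "tau k * rt (gen (X i) * gen (Y j)) = rt (gen (X i) * gen (Y j)) * tau k" using tau_rt[OF k, of "gen (X i) * gen (Y j)"] by simp
      hence "iota * (tau k * rt (gen (X i) * gen (Y j))) = iota * (rt (gen (X i) * gen (Y j)) * tau k)" by simp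
      thus ?thesis using tau_iota[OF k] by (simp only: mult.assoc[symmetric])
    qed
    thus ?thesis using HH_rt[of "gen (X i) * gen (Y j)"] by (simp add: HT_def)
  qed
  have "subring ?A R"
  proof (rule R.subringI)
    show "?A \<subseteq> carrier R" by blast
    show "\<one>\<^bsub>R\<^esub> \<in> ?A" by (simp add: rb_hom HT_one)
    fix x y assume xy: "x \<in> ?A" "y \<in> ?A"
    thus "x \<otimes>\<^bsub>R\<^esub> y \<in> ?A" "x \<oplus>\<^bsub>R\<^esub> y \<in> ?A" by (simp_all add: rb_hom HT_mult HT_add)
    have "\<ominus>\<^bsub>R\<^esub> x = \<zero>\<^bsub>R\<^esub> \<ominus>\<^bsub>R\<^esub> x" using xy by (simp add: a_minus_def)
    thus "\<ominus>\<^bsub>R\<^esub> x \<in> ?A" using xy HT_diff[OF HT_zero, of "rb x"] by (simp add: rb_hom)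
  qed
  moreover have "\<forall>k. \<forall>b\<in>?A. k \<odot>\<^bsub>R\<^esub> b \<in> ?A" by (simp add: rb_hom HT_scal)
  moreover have "?gens \<subseteq> ?A"
    using r1 r2 xyT HT_Wop by (auto simp: R_carrier intro!: imageI)
  ultimately have sub: "G \<subseteq> ?A" unfolding Gdef gen_subalgebra_def by blast
  have sup: "x \<in> B" if x: "x \<in> ?A" and B: "subring B R" "\<forall>k. \<forall>b\<in>B. k \<odot>\<^bsub>R\<^esub> b \<in> B" "?gens \<subseteq> B" for x B
  proof -
    have BR: "B \<subseteq> carrier R" using B(1) by (rule subringE)
    have "\<exists>b\<in>B. rb b = h" if "h \<in> GLA" for h
      using that
    proof (induction rule: GLA.induct)
      case (xy i j)
      have "cls (of_tensor (gen (X i) * gen (Y j))) \<in> B" using B(3) by blast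
      thus ?case using r1 by blast
    next
      case (grp w)
      hence "cls (group_sum {w} (\<lambda>_. 1)) \<in> B" using B(3) by blast
      thus ?case using r2[OF grp] by blast
    next
      case (add a b)
      then obtain x y where xy: "x \<in> B" "y \<in> B" "rb x = a" "rb y = b" by blast
      hence "x \<in> carrier R" "y \<in> carrier R" using BR by auto
      with xy show ?case using subringE(7)[OF B(1)] BR by (intro bexI[of _ "x \<oplus>\<^bsub>R\<^esub> y"]) (auto simp: rb_hom)
    next
      case (mult a b)
      then obtain x y where xy: "x \<in> B" "y \<in> B" "rb x = a" "rb y = b" by blast
      hence "x \<in> carrier R" "y \<in> carrier R" using BR by auto
      with xy show ?case using subringE(6)[OF B(1)] BR by (intro bexI[of _ "x \<otimes>\<^bsub>R\<^esub> y"]) (auto simp: rb_hom)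
    next
      case (scal a k)
      then obtain x where x: "x \<in> B" "rb x = a" by blast
      hence "x \<in> carrier R" using BR by auto
      with x show ?case using B(2) BR by (intro bexI[of _ "k \<odot>\<^bsub>R\<^esub> x"]) (auto simp: rb_hom)
    qed
    then obtain b where "b \<in> B" "rb b = rb x" using x HT_GLA by blast
    thus ?thesis using rb_inj[of b x] x BR by auto
  qed
  show ?thesis
  proof
    assume "x \<in> carrier R \<and> rb x \<in> HT"
    thus "x \<in> G" unfolding Gdef gen_subalgebra_def using sup by blast
  qed (use sub in blast)
qed

abbreviation "ac \<equiv> centre_idempotent W \<alpha> \<alpha>' 0 c"
abbreviation "eu \<equiv> euler W \<alpha> \<alpha>' lam 0 c"

lemma ac: "ac \<in> carrier R" "rb ac = aH"
proof -
  have s: "group_sum ZW (\<lambda>_. 1 / of_nat (card ZW)) \<in> carrier (smash W)" using ZW_W by blast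
  show "ac \<in> carrier R" unfolding centre_idempotent_def R_carrier using s by blast
  have "ZW \<subseteq> W" using ZW_W by blast
  thus "rb ac = aH" unfolding centre_idempotent_def using s by (simp add: rb_cls rho_def rho'_group_sum aH_def aa_def)
qed

lemma eu: "eu \<in> carrier R" "rb eu = iota * mulop qf"
proof -
  have SW: "SS \<subseteq> W" using SS_W by blast
  have s: "group_sum SS (\<lambda>s. 2 * c s / (1 - lam s)) \<in> carrier (smash W)" using SW by blast
  hence m: "of_tensor (\<Sum>i\<in>UNIV. gen (X i) * gen (Y i)) \<ominus>\<^bsub>smash W\<^esub> group_sum SS (\<lambda>s. 2 * c s / (1 - lam s)) \<in> carrier (smash W)"
    by (intro S.minus_closed) auto
  show "eu \<in> carrier R" unfolding euler_def R_carrier using m by blast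
  have "rb eu = rho (of_tensor (\<Sum>i\<in>UNIV. gen (X i) * gen (Y i))) - rho (group_sum SS (\<lambda>s. 2 * c s / (1 - lam s)))"
    unfolding euler_def using m s by (simp add: rb_cls rho_minus)
  also have "\<dots> = iota * ((\<Sum>i\<in>UNIV. xop (axis i 1) * dun (axis i 1)) - (\<Sum>s\<in>SS. scal (kk s) * Wop s))"
    by (simp add: rho_def rho'_group_sum[OF SW] kk_def right_diff_distrib)
  finally show "rb eu = iota * mulop qf" by (simp only: euler_op)
qed

text \<open>Everything is transported along the injective map \<open>rb\<close>. The two conditions
  of \<open>centre_quotient_iso\<close> then become \<open>central_surj\<close> and
  \<open>central_inj\<close>.\<close>

theorem centre_iso:
  fixes \<zeta> :: complex
  defines "A \<equiv> quot_alg W \<alpha> \<alpha>' lam 0 c \<zeta>" and "Z \<equiv> centre_invariants W \<alpha> \<alpha>' 0 c"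
  shows "alg_isomorphic (A\<lparr>carrier := alg_centre A\<rparr>)
    (alg_quot Z (Idl\<^bsub>Z\<^esub> {eu \<ominus>\<^bsub>Z\<^esub> (\<zeta> \<odot>\<^bsub>Z\<^esub> \<one>\<^bsub>Z\<^esub>)}))"
proof -
  define Bc where "Bc = {ac \<otimes>\<^bsub>R\<^esub> x \<otimes>\<^bsub>R\<^esub> ac | x. x \<in> G}"
  define Zc where "Zc = alg_centre R \<inter> torus_invariants W \<alpha> \<alpha>' 0 c"
  define B where "B = corner (cherednik_gl W \<alpha> \<alpha>' 0 c) ac"
  have B: "B = R\<lparr>carrier := Bc, one := ac\<rparr>"
    unfolding B_def corner_def Bc_def G_def by (simp add: cherednik_gl_def)
  have Z: "Z = R\<lparr>carrier := Zc, one := \<one>\<^bsub>R\<^esub>\<rparr>"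
    by (simp add: Z_def centre_invariants_def Zc_def)
  have Bc: "x \<in> Bc \<longleftrightarrow> x \<in> carrier R \<and> rb x \<in> BB" for x
  proof
    assume "x \<in> Bc"
    thus "x \<in> carrier R \<and> rb x \<in> BB" by (auto simp: Bc_def G_iff ac rb_hom BB_def)
  next
    assume x: "x \<in> carrier R \<and> rb x \<in> BB"
    have "ac \<otimes>\<^bsub>R\<^esub> x \<otimes>\<^bsub>R\<^esub> ac = x"
      by (rule rb_inj) (use x BB_iff in \<open>auto simp: ac rb_hom\<close>)
    thus "x \<in> Bc" unfolding Bc_def using x BB_HT by (auto simp: G_iff intro!: exI[of _ x])
  qed
  have Zc: "x \<in> Zc \<longleftrightarrow> x \<in> carrier R \<and> rb x \<in> ZT" for x
  proof -
    have "x \<in> alg_centre R \<longleftrightarrow> x \<in> carrier R \<and> (\<forall>h\<in>HH. rb x * h = h * rb x)"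
    proof
      assume x: "x \<in> alg_centre R"
      have "rb x * h = h * rb x" if h: "h \<in> HH" for h
      proof -
        obtain y where y: "y \<in> carrier R" "rb y = h" by (rule rb_surj[OF h])
        have "x \<in> carrier R" "x \<otimes>\<^bsub>R\<^esub> y = y \<otimes>\<^bsub>R\<^esub> x" using x y by (simp_all add: alg_centre_def)
        thus ?thesis using rb_hom(1)[of x y] rb_hom(1)[of y x] y by simp
      qed
      thus "x \<in> carrier R \<and> (\<forall>h\<in>HH. rb x * h = h * rb x)" using x by (simp add: alg_centre_def)
    next
      assume x: "x \<in> carrier R \<and> (\<forall>h\<in>HH. rb x * h = h * rb x)"
      have "x \<otimes>\<^bsub>R\<^esub> y = y \<otimes>\<^bsub>R\<^esub> x" if "y \<in> carrier R" for y
        by (rule rb_inj) (use x that rb_HH in \<open>auto simp: rb_hom\<close>)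
      thus "x \<in> alg_centre R" using x by (simp add: alg_centre_def)
    qed
    thus ?thesis using torus_invariants_iff[of x] by (auto simp: Zc_def ZT_def)
  qed
  have ZT_HH: "z \<in> HH" if "z \<in> ZT" for z
    using that HT_HH by (simp add: ZT_def)
  have neg: "rb (\<ominus>\<^bsub>R\<^esub> x) = - rb x" if "x \<in> carrier R" for x
  proof -
    have "\<ominus>\<^bsub>R\<^esub> x = \<zero>\<^bsub>R\<^esub> \<ominus>\<^bsub>R\<^esub> x" using that by (simp add: a_minus_def)
    thus ?thesis using that by (simp add: rb_hom)
  qed
  have BB0: "0 \<in> BB" "aH \<in> BB" "\<And>k b. b \<in> BB \<Longrightarrow> scal k * b \<in> BB" "\<And>b. b \<in> BB \<Longrightarrow> - b \<in> BB"
  proof -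
    show "0 \<in> BB" "aH \<in> BB" by (simp_all add: BB_iff HT_zero aH_HT aH_eH)
    show "scal k * b \<in> BB" if b: "b \<in> BB" for k b
    proof -
      have "aH * (scal k * b) * aH = scal k * (aH * b * aH)" using scal_commute[of aH k] by (simp only: mult.assoc[symmetric])
      thus ?thesis using b by (simp add: BB_iff HT_scal)
    qed
    show "- b \<in> BB" if "b \<in> BB" for b using BB_diff[OF \<open>0 \<in> BB\<close> that] by simp
  qed
  have ZT0: "0 \<in> ZT" "iota \<in> ZT" "\<And>a b. a \<in> ZT \<Longrightarrow> b \<in> ZT \<Longrightarrow> a + b \<in> ZT" "\<And>k b. b \<in> ZT \<Longrightarrow> scal k * b \<in> ZT" "\<And>b. b \<in> ZT \<Longrightarrow> - b \<in> ZT"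
  proof -
    show "0 \<in> ZT" "iota \<in> ZT" by (simp_all add: ZT_def HT_zero HT_one)
    show "a + b \<in> ZT" if "a \<in> ZT" "b \<in> ZT" for a b using that by (simp add: ZT_def HT_add distrib_left distrib_right)
    show "scal k * b \<in> ZT" if b: "b \<in> ZT" for k b
    proof -
      have "scal k * b * h = h * (scal k * b)" if "h \<in> HH" for h
        using b that scal_commute[of h k] by (simp add: ZT_def mult.assoc) (simp flip: mult.assoc)
      thus ?thesis using b by (simp add: ZT_def HT_scal)
    qed
    show "- b \<in> ZT" if "b \<in> ZT" for b using ZT_diff[OF \<open>0 \<in> ZT\<close> that] by simp
  qed
  have un: "ac \<otimes>\<^bsub>R\<^esub> x = x" "x \<otimes>\<^bsub>R\<^esub> ac = x" if "x \<in> carrier R" "rb x \<in> BB" for x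
    using that by (intro rb_inj; simp add: ac rb_hom BB_aH)+
  have Bca: "calg B" and Bminus: "\<And>x y. x \<in> Bc \<Longrightarrow> y \<in> Bc \<Longrightarrow> x \<ominus>\<^bsub>B\<^esub> y = x \<ominus>\<^bsub>R\<^esub> y"
    unfolding B
  proof (rule R.restrict_calg, goal_cases)
    fix x y assume "x \<in> Bc" "y \<in> Bc"
    thus "x \<ominus>\<^bsub>R\<lparr>carrier := Bc, one := ac\<rparr>\<^esub> y = x \<ominus>\<^bsub>R\<^esub> y"
      by (rule R.restrict_calg(3)[rotated -2])
        (auto simp: Bc rb_hom ac neg BB0 BB_add BB_mult un)
  qed (auto simp: Bc rb_hom ac neg BB0 BB_add BB_mult un)
  have Zca: "calg Z" and Zminus: "\<And>x y. x \<in> Zc \<Longrightarrow> y \<in> Zc \<Longrightarrow> x \<ominus>\<^bsub>Z\<^esub> y = x \<ominus>\<^bsub>R\<^esub> y"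
    unfolding Z
  proof (rule R.restrict_calg, goal_cases)
    fix x y assume "x \<in> Zc" "y \<in> Zc"
    thus "x \<ominus>\<^bsub>R\<lparr>carrier := Zc, one := \<one>\<^bsub>R\<^esub>\<rparr>\<^esub> y = x \<ominus>\<^bsub>R\<^esub> y"
      by (rule R.restrict_calg(3)[rotated -2]) (auto simp: Zc rb_hom neg ZT0 ZT_mult)
  qed (auto simp: Zc rb_hom neg ZT0 ZT_mult)
  have Bsimps: "carrier B = Bc" "mult B = mult R" "add B = add R" "smult B = smult R" "one B = ac" by (simp_all add: B)
  have Zsimps: "carrier Z = Zc" "mult Z = mult R" "add Z = add R" "smult Z = smult R" "one Z = \<one>\<^bsub>R\<^esub>" by (simp_all add: Z)
  define u where "u = eu \<ominus>\<^bsub>Z\<^esub> (\<zeta> \<odot>\<^bsub>Z\<^esub> \<one>\<^bsub>Z\<^esub>)"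
  have q1: "iota * mulop qf \<in> ZT"
    using ZT0(3)[OF Qop_ZT[of 0] ZT0(1)] by (simp add: Qop_eq scalar_hom_0[OF scal_hom])
  have euZ: "eu \<in> Zc" "\<zeta> \<odot>\<^bsub>R\<^esub> \<one>\<^bsub>R\<^esub> \<in> Zc" by (simp_all add: Zc eu q1 rb_hom ZT0)
  have u: "u \<in> Zc" "rb u = Qop \<zeta>"
  proof -
    have "u = eu \<ominus>\<^bsub>R\<^esub> (\<zeta> \<odot>\<^bsub>R\<^esub> \<one>\<^bsub>R\<^esub>)" unfolding u_def using euZ by (simp add: Zminus Zsimps)
    moreover from this show "rb u = Qop \<zeta>" by (simp add: rb_hom eu Qop_eq)
    ultimately show "u \<in> Zc" using Qop_ZT eu by (simp add: Zc)
  qed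
  \<comment> \<open>On \<open>Zc\<close>, multiplication by the idempotent is multiplicative and
    sends the unit to the unit of the corner.\<close>
  define j where "j z = ac \<otimes>\<^bsub>R\<^esub> z" for z
  have jB: "j z \<in> Bc" "rb (j z) = aH * rb z" if "z \<in> Zc" for z
    using that ZT_aH by (auto simp: j_def Zc Bc ac rb_hom)
  have comm: "b * z = z * b" if "z \<in> ZT" "b \<in> BB" for z b using that BB_HT HT_HH by (auto simp: ZT_def)
  have zaH: "z * aH = aH * z" if "z \<in> ZT" for z using comm[OF that BB0(2)] by simp
  have iso: "alg_isomorphic ((alg_quot B (Idl\<^bsub>B\<^esub> {j u}))\<lparr>carrier := alg_centre (alg_quot B (Idl\<^bsub>B\<^esub> {j u}))\<rparr>) (alg_quot Z (Idl\<^bsub>Z\<^esub> {u}))"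
  proof (rule centre_quotient_iso[OF Bca Zca])
    show "j \<in> ring_hom Z B"
    proof (rule ring_hom_memI)
      fix x y assume x: "x \<in> carrier Z" and y: "y \<in> carrier Z"
      show "j x \<in> carrier B" using x jB by (simp add: Bsimps Zsimps)
      have xy: "x \<in> carrier R" "y \<in> carrier R" "rb x \<in> ZT" "rb y \<in> ZT" using x y by (simp_all add: Zsimps Zc)
      show "j (x \<oplus>\<^bsub>Z\<^esub> y) = j x \<oplus>\<^bsub>B\<^esub> j y" using xy by (simp add: j_def Bsimps Zsimps R.r_distr ac)
      have "rb (j (x \<otimes>\<^bsub>R\<^esub> y)) = rb (j x \<otimes>\<^bsub>R\<^esub> j y)"
      proof -
        have "aH * rb x * (aH * rb y) = aH * (rb x * aH) * rb y" by (simp only: mult.assoc)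
        also have "\<dots> = aH * (rb x * rb y)" using zaH[OF xy(3)] by (simp add: mult.assoc aH_eH_left)
        finally show ?thesis using xy by (simp add: j_def ac rb_hom)
      qed
      thus "j (x \<otimes>\<^bsub>Z\<^esub> y) = j x \<otimes>\<^bsub>B\<^esub> j y" using xy by (simp only: Bsimps Zsimps) (rule rb_inj, simp_all add: j_def ac)
    qed (simp add: j_def Bsimps Zsimps ac)
    show "j (k \<odot>\<^bsub>Z\<^esub> z) = k \<odot>\<^bsub>B\<^esub> j z" if "z \<in> carrier Z" for k z
      using that by (simp add: j_def Bsimps Zsimps Zc ac R.smult_right)
    show "b \<otimes>\<^bsub>B\<^esub> j z = j z \<otimes>\<^bsub>B\<^esub> b" if "z \<in> carrier Z" "b \<in> carrier B" for z b
    proof -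
      have zb: "z \<in> carrier R" "rb z \<in> ZT" "b \<in> carrier R" "rb b \<in> BB" using that by (simp_all add: Bsimps Zsimps Zc Bc)
      have "rb b * (aH * rb z) = rb b * rb z" using BB_aH[OF zb(4)] by (simp flip: mult.assoc)
      also have "\<dots> = aH * rb z * rb b"
        using BB_aH[OF zb(4)] comm[OF zb(2,4)] zaH[OF zb(2)] by (simp add: mult.assoc) (metis mult.assoc)
      finally show ?thesis unfolding Bsimps by (intro rb_inj) (simp_all add: j_def ac zb rb_hom)
    qed
    show "u \<in> carrier Z" using u by (simp add: Zsimps)
    show "z \<otimes>\<^bsub>Z\<^esub> u = u \<otimes>\<^bsub>Z\<^esub> z" if "z \<in> carrier Z" for z
      using that u unfolding Zsimps by (intro rb_inj) (auto simp: Zc rb_hom Qop_central HT_HH ZT_def)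
    have juop: "rb (j u \<otimes>\<^bsub>R\<^esub> d) = Qop \<zeta> * rb d" if "d \<in> Bc" for d
    proof -
      have "rb (j u \<otimes>\<^bsub>R\<^esub> d) = aH * Qop \<zeta> * rb d" using that u jB[OF u(1)] by (simp add: Bc rb_hom)
      also have "aH * Qop \<zeta> = Qop \<zeta> * aH" using zaH[OF Qop_ZT] by simp
      finally show ?thesis using that BB_aH[of "rb d"] by (simp add: Bc mult.assoc)
    qed
    show "\<exists>z\<in>carrier Z. \<exists>d\<in>carrier B. b \<ominus>\<^bsub>B\<^esub> j z = j u \<otimes>\<^bsub>B\<^esub> d"
      if b: "b \<in> carrier B" and h: "\<And>b'. b' \<in> carrier B \<Longrightarrow> \<exists>d\<in>carrier B. b \<otimes>\<^bsub>B\<^esub> b' \<ominus>\<^bsub>B\<^esub> b' \<otimes>\<^bsub>B\<^esub> b = j u \<otimes>\<^bsub>B\<^esub> d" for b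
    proof -
      have b': "b \<in> carrier R" "rb b \<in> BB" using b by (simp_all add: Bsimps Bc)
      have "\<exists>d\<in>BB. rb b * g - g * rb b = Qop \<zeta> * d" if g: "g \<in> BB" for g
      proof -
        obtain b2 where b2: "b2 \<in> carrier R" "rb b2 = g" by (rule rb_surj[OF HT_HH[OF BB_HT[OF g]]])
        have "b2 \<in> Bc" using b2 g by (simp add: Bc)
        with h[of b2] obtain d where d: "d \<in> Bc" "b \<otimes>\<^bsub>R\<^esub> b2 \<ominus>\<^bsub>B\<^esub> b2 \<otimes>\<^bsub>R\<^esub> b = j u \<otimes>\<^bsub>R\<^esub> d" by (auto simp: Bsimps)
        have "b \<otimes>\<^bsub>R\<^esub> b2 \<in> Bc" "b2 \<otimes>\<^bsub>R\<^esub> b \<in> Bc" using b' b2 g by (simp_all add: Bc rb_hom BB_mult)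
        hence "rb (b \<otimes>\<^bsub>R\<^esub> b2 \<ominus>\<^bsub>R\<^esub> b2 \<otimes>\<^bsub>R\<^esub> b) = rb (j u \<otimes>\<^bsub>R\<^esub> d)" using d(2) by (simp add: Bminus)
        hence "rb b * g - g * rb b = Qop \<zeta> * rb d" using b' b2 by (simp add: rb_hom juop[OF d(1)])
        thus ?thesis using d(1) by (auto simp: Bc)
      qed
      from central_surj[OF b'(2) this] obtain z d where zd: "z \<in> ZT" "d \<in> BB" "rb b - aH * z = Qop \<zeta> * d" by blast
      obtain z' where z': "z' \<in> carrier R" "rb z' = z" by (rule rb_surj[OF ZT_HH[OF zd(1)]])
      obtain d' where d': "d' \<in> carrier R" "rb d' = d" by (rule rb_surj[OF HT_HH[OF BB_HT[OF zd(2)]]])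
      have mem: "z' \<in> Zc" "d' \<in> Bc" using z' d' zd by (simp_all add: Zc Bc)
      have "b \<ominus>\<^bsub>R\<^esub> j z' = j u \<otimes>\<^bsub>R\<^esub> d'"
        by (rule rb_inj) (use b' jB[OF mem(1)] jB[OF u(1)] mem zd z' d' juop[OF mem(2)] in \<open>auto simp: Bc rb_hom\<close>)
      hence "b \<ominus>\<^bsub>B\<^esub> j z' = j u \<otimes>\<^bsub>B\<^esub> d'" using b jB[OF mem(1)] by (simp add: Bminus Bsimps)
      thus ?thesis using mem by (auto simp: Bsimps Zsimps)
    qed
    show "\<exists>z'\<in>carrier Z. z = u \<otimes>\<^bsub>Z\<^esub> z'" if z: "z \<in> carrier Z" and d: "d \<in> carrier B" and eq: "j z = j u \<otimes>\<^bsub>B\<^esub> d" for z d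
    proof -
      have z': "z \<in> Zc" "z \<in> carrier R" "rb z \<in> ZT" and d': "d \<in> Bc" "rb d \<in> BB" using z d by (simp_all add: Bsimps Zsimps Zc Bc)
      have "aH * rb z = Qop \<zeta> * rb d" using eq jB(2)[OF z'(1)] juop[OF d'(1)] by (simp add: Bsimps)
      from central_inj[OF z'(3) d'(2) this] obtain y where y: "y \<in> ZT" "rb z = Qop \<zeta> * y" by blast
      obtain y' where y': "y' \<in> carrier R" "rb y' = y" by (rule rb_surj[OF ZT_HH[OF y(1)]])
      have "z = u \<otimes>\<^bsub>R\<^esub> y'" by (rule rb_inj) (use z' y y' u in \<open>auto simp: rb_hom Zc\<close>)
      thus ?thesis using y' y by (auto simp: Zsimps Zc)
    qed
  qed
  \<comment> \<open>The generator used to define the quotient of the corner is the image of the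
    generator on the central side, so both quotients have the required shape.\<close>
  have "(ac \<otimes>\<^bsub>B\<^esub> eu) \<ominus>\<^bsub>B\<^esub> (\<zeta> \<odot>\<^bsub>B\<^esub> ac) = j u"
  proof -
    have m: "ac \<otimes>\<^bsub>R\<^esub> eu \<in> Bc" "\<zeta> \<odot>\<^bsub>R\<^esub> ac \<in> Bc"
      using jB(1)[OF euZ(1)] by (simp_all add: j_def Bc ac rb_hom BB0)
    have "aH * iota = aH" using aH_HT HT_HH by simp
    hence "aH * (scal \<zeta> * iota) = scal \<zeta> * aH" using scal_commute[of aH \<zeta>] by (simp add: mult.assoc flip: mult.assoc[of aH "scal \<zeta>"])
    hence "(ac \<otimes>\<^bsub>R\<^esub> eu) \<ominus>\<^bsub>R\<^esub> (\<zeta> \<odot>\<^bsub>R\<^esub> ac) = j u"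
      using u by (intro rb_inj) (auto simp: j_def ac eu rb_hom Zc Qop_eq right_diff_distrib)
    thus ?thesis using m by (simp add: Bsimps Bminus)
  qed
  hence "A = alg_quot B (Idl\<^bsub>B\<^esub> {j u})" unfolding A_def quot_alg_def Let_def B_def[symmetric] by simp
  thus ?thesis using iso unfolding u_def by simp
qed

end

theorem corollary8p14:
  fixes W :: "(complex^'n::finite^'n) set"
    and \<alpha> \<alpha>' :: "complex^'n^'n \<Rightarrow> complex^'n"
    and lam c :: "complex^'n^'n \<Rightarrow> complex"
    and \<zeta> :: complex
  assumes "complex_reflection_group W"
    and "irreducible_rep W"
    and "CARD('n) > 1"
    and "reflection_data W \<alpha> \<alpha>' lam"
    and "conj_invariant W c"
  defines "A \<equiv> quot_alg W \<alpha> \<alpha>' lam 0 c \<zeta>"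
    and "Z \<equiv> centre_invariants W \<alpha> \<alpha>' 0 c"
  shows "alg_isomorphic
           (A\<lparr>carrier := alg_centre A\<rparr>)
           (alg_quot Z (Idl\<^bsub>Z\<^esub> {euler W \<alpha> \<alpha>' lam 0 c \<ominus>\<^bsub>Z\<^esub> (\<zeta> \<odot>\<^bsub>Z\<^esub> \<one>\<^bsub>Z\<^esub>)}))"
proof -
  interpret subgroup W GL using assms(1) by (simp add: complex_reflection_group_def)
  interpret cherednik_irreducible W \<alpha> \<alpha>' lam c
    using assms(1-5) by unfold_locales (simp_all add: complex_reflection_group_def)
  show ?thesis unfolding A_def Z_def by (rule centre_iso)
qed

end
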